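(* For each monoid $M$ and natural number $n$, $$\tau_n\left(\|\mathrm{ner}\,M\|,\|\star\|\right)=\begin{cases}M & n=1\\ \star & n\neq 1,\end{cases}$$ where $\star$ on the right denotes the terminal (one-element) monoid.
   Context: Cubical sets. $[1]=\{0<1\}$; posets and monoids are regarded as categories (a monoid as a category with one object). $\square$ is the subcategory of the category $\mathbf{Cat}$ of small categories with objects the product posets $[1]^n$ ($n\geq 0$) and morphisms all composites of cofaces $[1]^{n-1}\to[1]^n$ (inserting a constant $0$ or $1$ in one coordinate), codegeneracies $[1]^{n+1}\to[1]^n$ (projections omitting one coordinate) and coordinate permutations. Cubical sets are presheaves of sets on $\square$, forming $\hat\square$; $\square[1]^n$ is the presheaf represented by $[1]^n$. The cubical nerve $\mathrm{ner}\,M$ has $(\mathrm{ner}\,M)_n=\mathbf{Cat}([1]^n,M)$; it has a unique vertex, denoted $\star$. Streams. A circulation on a space $X$ assigns to each open $U\subset X$ a preorder $\leqslant_U$ on $U$ such that, for each collection $\mathcal{O}$ of open subsets, the preorder on $\bigcup\mathcal{O}$ is the one with smallest graph containing the graphs of all $\leqslant_U$, $U\in\mathcal{O}$. A stream is a space with a circulation; a stream map $f:X\to Y$ is a continuous function with $f(x)\leqslant_U f(y)$ whenever $U\subset Y$ is open and $x\leqslant_{f^{-1}U}y$. $\mathbf{DiTop}$ is the (complete, cocomplete) category of weak Hausdorff k-streams (k-stream: colimit of compact Hausdorff streams in all streams; weak Hausdorff: the underlying space is). $\vec{\mathbb{I}}^n$ is $[0,1]^n$ with the unique circulation whose value on the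 whole cube is the coordinatewise order; $\vec{\mathbb{I}}=\vec{\mathbb{I}}^1$. Directed realization $\|-\|:\hat\square\to\mathbf{DiTop}$ is the cocontinuous functor with $\|\square[1]^n\|=\vec{\mathbb{I}}^n$ (with the evident action on cofaces, codegeneracies, permutations). $\|\star\|$ denotes the point of $\|\mathrm{ner}\,M\|$ given by the unique vertex. Directed homotopy monoids. $\vec{\mathbb{S}}^n$ is the quotient stream $\vec{\mathbb{I}}^n/\partial\mathbb{I}^n$ in $\mathbf{DiTop}$ and $\infty\in\vec{\mathbb{S}}^n$ is the quotiented point (for $n=0$, where $\partial\mathbb{I}^0=\varnothing$, the quotiented point $\infty$ is adjoined). For a stream $X$ and $x\in X$, $\tau_n(X,x)$ is the set of stream maps $\vec{\mathbb{S}}^n\to X$ sending $\infty$ to $x$, modulo the equivalence relation generated by $f\sim g$ whenever there is a stream map $\vec{\mathbb{S}}^n\times\vec{\mathbb{I}}\to X$ restricting to $f$ at $0$, to $g$ at $1$, and constant with value $x$ on $\{\infty\}\times\vec{\mathbb{I}}$. For $n\geqslant 1$, $\tau_n(X,x)$ is a monoid under the multiplication induced by the standard co-H multiplication (pinch map, i.e. concatenation of directed cubes in one coordinate) of $\vec{\mathbb{S}}^n$. The equality means a natural identification (of monoids for $n\geq 1$). *)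

theory Defs
  imports "HOL-Analysis.Analysis" "HOL-Algebra.Group" "HOL-Combinatorics.Permutations"
begin

section \<open>Streams\<close>

record 'a prestream =
  topo :: "'a topology"
  circ :: "'a set \<Rightarrow> 'a rel"

abbreviation points :: "'a prestream \<Rightarrow> 'a set" where
  "points X \<equiv> topspace (topo X)"

text \<open>The graphs of the preorders on a family of open sets have a reflexive union, so the smallest
  preorder containing them is the transitive closure of that union. A circulation is only relevant
  on open sets; the value \<^term>\<open>{}\<close> elsewhere makes equality of streams
  coincide with equality of records.\<close>

definition circulation :: "'a topology \<Rightarrow> ('a set \<Rightarrow> 'a rel) \<Rightarrow> bool" where
  "circulation T c \<longleftrightarrow>
     (\<forall>U. openin T U \<longrightarrow> preorder_on U (c U)) \<and>
     (\<forall>U. \<not> openin T U \<longrightarrow> c U = {}) \<and>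
     (\<forall>\<O>. (\<forall>U\<in>\<O>. openin T U) \<longrightarrow> c (\<Union>\<O>) = (\<Union>U\<in>\<O>. c U)\<^sup>+)"

definition stream :: "'a prestream \<Rightarrow> bool" where
  "stream X \<longleftrightarrow> circulation (topo X) (circ X)"

definition stream_map :: "'a prestream \<Rightarrow> 'b prestream \<Rightarrow> ('a \<Rightarrow> 'b) \<Rightarrow> bool" where
  "stream_map X Y f \<longleftrightarrow> continuous_map (topo X) (topo Y) f \<and>
     (\<forall>U. openin (topo Y) U \<longrightarrow>
        (\<forall>(x, y) \<in> circ X {x \<in> points X. f x \<in> U}. (f x, f y) \<in> circ Y U))"


subsection \<open>The category DiTop\<close>

text \<open>It is enough to test with compact Hausdorff spaces on the type \<^typ>\<open>'a set set\<close>: if \<open>f\<close> maps a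
  compact Hausdorff space \<open>K\<close> to \<open>T\<close>, choose one preimage of each point of the image. The closure in
  \<open>K\<close> of the set of these preimages is a compact Hausdorff space with the same image, and its
  cardinality is at most that of \<^typ>\<open>'a set set\<close>.\<close>

definition weak_hausdorff :: "'a topology \<Rightarrow> bool" where
  "weak_hausdorff T \<longleftrightarrow>
     (\<forall>(K :: 'a set set topology) f.
        compact_space K \<and> Hausdorff_space K \<and> continuous_map K T f
          \<longrightarrow> closedin T (f ` topspace K))"

definition compact_hausdorff_stream :: "'a prestream \<Rightarrow> bool" where
  "compact_hausdorff_stream K \<longleftrightarrow> stream K \<and> compact_space (topo K) \<and> Hausdorff_space (topo K)"

text \<open>A stream is a colimit of compact Hausdorff streams iff its topology and its circulation are
  final with respect to all stream maps from compact Hausdorff streams. When the underlying space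
  is weak Hausdorff, these maps factor through compact Hausdorff streams on subsets of the space,
  so that test streams on the type \<^typ>\<open>'a\<close> suffice; \<open>k_stream\<close> is only used in that case.\<close>

definition k_stream :: "'a prestream \<Rightarrow> bool" where
  "k_stream X \<longleftrightarrow> stream X \<and>
     (\<forall>U \<subseteq> points X.
        (\<forall>(K :: 'a prestream) f. compact_hausdorff_stream K \<and> stream_map K X f
            \<longrightarrow> openin (topo K) {a \<in> points K. f a \<in> U})
          \<longrightarrow> openin (topo X) U) \<and>
     (\<forall>U. openin (topo X) U \<longrightarrow>
        circ X U \<subseteq> {(f a, f b) | (K :: 'a prestream) f a b.
            compact_hausdorff_stream K \<and> stream_map K X f \<and>
            (a, b) \<in> circ K {a \<in> points K. f a \<in> U}}\<^sup>+)"

definition ditop :: "'a prestream \<Rightarrow> bool" where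
  "ditop X \<longleftrightarrow> k_stream X \<and> weak_hausdorff (topo X)"

text \<open>The forgetful functor to sets preserves products, so the product lives on the cartesian
  product of the point sets, and the universal property against test objects on the same type
  determines its structure.\<close>

definition is_ditop_product ::
    "'a prestream \<Rightarrow> 'b prestream \<Rightarrow> ('a \<times> 'b) prestream \<Rightarrow> bool" where
  "is_ditop_product X Y P \<longleftrightarrow>
     ditop P \<and> points P = points X \<times> points Y \<and> stream_map P X fst \<and> stream_map P Y snd \<and>
     (\<forall>(Q :: ('a \<times> 'b) prestream) f g.
        ditop Q \<and> stream_map Q X f \<and> stream_map Q Y g \<longrightarrow> stream_map Q P (\<lambda>q. (f q, g q)))"

definition ditop_product ::
    "'a prestream \<Rightarrow> 'b prestream \<Rightarrow> ('a \<times> 'b) prestream" where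
  "ditop_product X Y = (THE P. is_ditop_product X Y P)"

definition sum_stream :: "('i \<Rightarrow> 'a prestream) \<Rightarrow> 'i set \<Rightarrow> ('i \<times> 'a) prestream" where
  "sum_stream X I =
     \<lparr> topo = sum_topology (\<lambda>i. topo (X i)) I,
       circ = (\<lambda>U. if openin (sum_topology (\<lambda>i. topo (X i)) I) U
                   then {((i, x), (i, y)) | i x y. i \<in> I \<and> (x, y) \<in> circ (X i) {x. (i, x) \<in> U}}
                   else {}) \<rparr>"

definition quotient_topology :: "'a topology \<Rightarrow> 'a rel \<Rightarrow> 'a set topology" where
  "quotient_topology T R = topology (\<lambda>\<U>. \<U> \<subseteq> topspace T // R \<and> openin T (\<Union>\<U>))"

definition quotient_stream :: "'a prestream \<Rightarrow> 'a rel \<Rightarrow> 'a set prestream" where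
  "quotient_stream X R =
     \<lparr> topo = quotient_topology (topo X) R,
       circ = (\<lambda>\<U>. if openin (quotient_topology (topo X) R) \<U>
                   then {(R `` {x}, R `` {y}) | x y. (x, y) \<in> circ X (\<Union>\<U>)}\<^sup>+
                   else {}) \<rparr>"

text \<open>Quotients in DiTop: weak Hausdorff k-streams are reflective in k-streams, and the reflection
  divides out the smallest equivalence relation with weak Hausdorff quotient.\<close>

definition ditop_equiv :: "'a prestream \<Rightarrow> 'a rel \<Rightarrow> 'a rel" where
  "ditop_equiv X G =
     \<Inter> {R. equiv (points X) R \<and> G \<subseteq> R \<and> weak_hausdorff (quotient_topology (topo X) R)}"

definition ditop_quotient :: "'a prestream \<Rightarrow> 'a rel \<Rightarrow> 'a set prestream" where
  "ditop_quotient X G = quotient_stream X (ditop_equiv X G)"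


subsection \<open>Directed cubes\<close>

definition icube :: "nat \<Rightarrow> (nat \<Rightarrow> real) set" where
  "icube n = PiE {..<n} (\<lambda>_. {0..1})"

definition icube_topology :: "nat \<Rightarrow> (nat \<Rightarrow> real) topology" where
  "icube_topology n = product_topology (\<lambda>_. top_of_set {0..1}) {..<n}"

definition dcube :: "nat \<Rightarrow> (nat \<Rightarrow> real) prestream" where
  "dcube n =
     \<lparr> topo = icube_topology n,
       circ = (THE c. circulation (icube_topology n) c \<and>
                 c (icube n) = {(x, y). x \<in> icube n \<and> y \<in> icube n \<and> (\<forall>i<n. x i \<le> y i)}) \<rparr>"


section \<open>Cubical sets\<close>

definition vertices :: "nat \<Rightarrow> (nat \<Rightarrow> bool) set" where
  "vertices n = PiE {..<n} (\<lambda>_. UNIV)"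

definition insert_at :: "nat \<Rightarrow> 'a \<Rightarrow> (nat \<Rightarrow> 'a) \<Rightarrow> (nat \<Rightarrow> 'a)" where
  "insert_at i c x = (\<lambda>k. if k < i then x k else if k = i then c else x (k - 1))"

definition omit_at :: "nat \<Rightarrow> (nat \<Rightarrow> 'a) \<Rightarrow> (nat \<Rightarrow> 'a)" where
  "omit_at i x = (\<lambda>k. if k < i then x k else x (Suc k))"

text \<open>\<open>box_arrow m n f F\<close>: the function \<open>f\<close> between vertex sets is a morphism from the \<open>m\<close>-cube to the
  \<open>n\<close>-cube in the box category, and \<open>F\<close> is the induced map of topological cubes.\<close>

inductive box_arrow ::
    "nat \<Rightarrow> nat \<Rightarrow> ((nat \<Rightarrow> bool) \<Rightarrow> (nat \<Rightarrow> bool)) \<Rightarrow> ((nat \<Rightarrow> real) \<Rightarrow> (nat \<Rightarrow> real)) \<Rightarrow> bool" where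
  identity: "box_arrow n n (restrict id (vertices n)) (restrict id (icube n))"
| coface: "i \<le> n \<Longrightarrow>
    box_arrow n (Suc n) (restrict (insert_at i b) (vertices n))
                        (restrict (insert_at i (of_bool b)) (icube n))"
| codegeneracy: "i \<le> n \<Longrightarrow>
    box_arrow (Suc n) n (restrict (omit_at i) (vertices (Suc n)))
                        (restrict (omit_at i) (icube (Suc n)))"
| permutation: "p permutes {..<n} \<Longrightarrow>
    box_arrow n n (restrict (\<lambda>x. x \<circ> p) (vertices n)) (restrict (\<lambda>x. x \<circ> p) (icube n))"
| composite: "box_arrow l m f F \<Longrightarrow> box_arrow m n g G \<Longrightarrow>
    box_arrow l n (compose (vertices l) g f) (compose (icube l) G F)"

record 'c cubical_data =
  cells :: "nat \<Rightarrow> 'c set"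
  act :: "nat \<Rightarrow> nat \<Rightarrow> ((nat \<Rightarrow> bool) \<Rightarrow> (nat \<Rightarrow> bool)) \<Rightarrow> 'c \<Rightarrow> 'c"

definition cubical_set :: "'c cubical_data \<Rightarrow> bool" where
  "cubical_set C \<longleftrightarrow>
     (\<forall>m n f F. box_arrow m n f F \<longrightarrow> act C m n f \<in> cells C n \<rightarrow> cells C m) \<and>
     (\<forall>n. \<forall>c \<in> cells C n. act C n n (restrict id (vertices n)) c = c) \<and>
     (\<forall>l m n f F g G. box_arrow l m f F \<and> box_arrow m n g G \<longrightarrow>
        (\<forall>c \<in> cells C n. act C l n (compose (vertices l) g f) c = act C l m f (act C m n g c)))"

text \<open>Directed realization is the coend of the directed cubes \<^term>\<open>dcube n\<close> over the cells, formed in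
  DiTop.\<close>

definition cell_sum :: "'c cubical_data \<Rightarrow> ((nat \<times> 'c) \<times> (nat \<Rightarrow> real)) prestream" where
  "cell_sum C = sum_stream (\<lambda>(n, c). dcube n) (Sigma UNIV (cells C))"

definition cell_glue :: "'c cubical_data \<Rightarrow> ((nat \<times> 'c) \<times> (nat \<Rightarrow> real)) rel" where
  "cell_glue C = {(((m, act C m n f c), x), ((n, c), F x)) | m n f F c x.
                    box_arrow m n f F \<and> c \<in> cells C n \<and> x \<in> icube m}"

definition realization :: "'c cubical_data \<Rightarrow> ((nat \<times> 'c) \<times> (nat \<Rightarrow> real)) set prestream" where
  "realization C = ditop_quotient (cell_sum C) (cell_glue C)"

definition realization_map ::
    "'c cubical_data \<Rightarrow> 'd cubical_data \<Rightarrow> (nat \<Rightarrow> 'c \<Rightarrow> 'd) \<Rightarrow>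
     ((nat \<times> 'c) \<times> (nat \<Rightarrow> real)) set \<Rightarrow> ((nat \<times> 'd) \<times> (nat \<Rightarrow> real)) set" where
  "realization_map C D g =
     (\<lambda>s \<in> points (realization C).
        ditop_equiv (cell_sum D) (cell_glue D) `` ((\<lambda>((n, c), x). ((n, g n c), x)) ` s))"


subsection \<open>The cubical nerve of a monoid\<close>

definition vertex_pairs :: "nat \<Rightarrow> ((nat \<Rightarrow> bool) \<times> (nat \<Rightarrow> bool)) set" where
  "vertex_pairs n = {(u, v). u \<in> vertices n \<and> v \<in> vertices n \<and> (\<forall>i<n. u i \<le> v i)}"

text \<open>A functor to the one-object category of \<open>M\<close> assigns an element of \<open>M\<close> to each pair
  \<open>u \<le> v\<close> of vertices. Composition in that category is written in diagrammatic order: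
  \<open>a\<close> followed by \<open>b\<close> is \<open>a \<otimes> b\<close>. This matches the order of concatenation in \<open>loop_mult\<close> below;
  reversing exactly one of the two conventions would produce the opposite monoid.\<close>

definition nerve ::
    "('a, 'b) monoid_scheme \<Rightarrow> ((nat \<Rightarrow> bool) \<times> (nat \<Rightarrow> bool) \<Rightarrow> 'a) cubical_data" where
  "nerve M =
     \<lparr> cells = (\<lambda>n. {\<phi> \<in> vertex_pairs n \<rightarrow>\<^sub>E carrier M.
          (\<forall>u \<in> vertices n. \<phi> (u, u) = \<one>\<^bsub>M\<^esub>) \<and>
          (\<forall>u v w. (u, v) \<in> vertex_pairs n \<and> (v, w) \<in> vertex_pairs n \<longrightarrow>
             \<phi> (u, w) = \<phi> (u, v) \<otimes>\<^bsub>M\<^esub> \<phi> (v, w))}),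
       act = (\<lambda>m n f \<phi>. \<lambda>(u, v) \<in> vertex_pairs m. \<phi> (f u, f v)) \<rparr>"

definition nerve_map ::
    "('a \<Rightarrow> 'b) \<Rightarrow> nat \<Rightarrow> ((nat \<Rightarrow> bool) \<times> (nat \<Rightarrow> bool) \<Rightarrow> 'a) \<Rightarrow>
     ((nat \<Rightarrow> bool) \<times> (nat \<Rightarrow> bool) \<Rightarrow> 'b)" where
  "nerve_map h n \<phi> = compose (vertex_pairs n) h \<phi>"

definition nerve_vertex ::
    "('a, 'b) monoid_scheme \<Rightarrow> ((nat \<Rightarrow> bool) \<times> (nat \<Rightarrow> bool) \<Rightarrow> 'a)" where
  "nerve_vertex M = (THE c. c \<in> cells (nerve M) 0)"

text \<open>The only point of \<^term>\<open>icube 0\<close> is \<^term>\<open>\<lambda>_::nat. undefined :: real\<close>.\<close>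

definition nerve_point ::
    "('a, 'b) monoid_scheme \<Rightarrow>
     ((nat \<times> ((nat \<Rightarrow> bool) \<times> (nat \<Rightarrow> bool) \<Rightarrow> 'a)) \<times> (nat \<Rightarrow> real)) set" where
  "nerve_point M =
     ditop_equiv (cell_sum (nerve M)) (cell_glue (nerve M)) `` {((0, nerve_vertex M), \<lambda>_. undefined)}"

lemma box_arrow_vertices:
  assumes "box_arrow m n f F"
  shows "f \<in> vertices m \<rightarrow>\<^sub>E vertices n"
    and "(u, v) \<in> vertex_pairs m \<Longrightarrow> (f u, f v) \<in> vertex_pairs n"
proof -
  have "f \<in> vertices m \<rightarrow>\<^sub>E vertices n \<and>
        (\<forall>u v. (u, v) \<in> vertex_pairs m \<longrightarrow> (f u, f v) \<in> vertex_pairs n)"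
    using assms
  proof (induction rule: box_arrow.induct)
    case (permutation p n)
    have "p i < n \<longleftrightarrow> i < n" for i
      using permutes_in_image[OF permutation, of i] by simp
    then show ?case
      by (auto simp: vertices_def vertex_pairs_def PiE_iff extensional_def)
  next
    case (composite l m f F n g G)
    have "f u \<in> vertices m" if "u \<in> vertices l" for u
      using composite.IH(1) that by blast
    moreover have "g u \<in> vertices n" if "u \<in> vertices m" for u
      using composite.IH(2) that by blast
    ultimately have "compose (vertices l) g f \<in> vertices l \<rightarrow>\<^sub>E vertices n"
      by (auto simp: compose_def)
    moreover have "(compose (vertices l) g f u, compose (vertices l) g f v) \<in> vertex_pairs n"
      if uv: "(u, v) \<in> vertex_pairs l" for u v
    proof -
      have "u \<in> vertices l" "v \<in> vertices l"
        using uv by (simp_all add: vertex_pairs_def)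
      then show ?thesis
        using composite.IH uv by (simp add: compose_eq)
    qed
    ultimately show ?case by blast
  qed (auto simp: vertices_def vertex_pairs_def PiE_iff extensional_def insert_at_def omit_at_def)
  then show "f \<in> vertices m \<rightarrow>\<^sub>E vertices n"
    and "(u, v) \<in> vertex_pairs m \<Longrightarrow> (f u, f v) \<in> vertex_pairs n"
    by auto
qed

lemma cubical_set_nerve: "cubical_set (nerve M)"
proof -
  have vp: "u \<in> vertices n \<and> v \<in> vertices n" if "(u, v) \<in> vertex_pairs n" for u v n
    using that by (auto simp: vertex_pairs_def)
  have tr: "(u, w) \<in> vertex_pairs n"
    if "(u, v) \<in> vertex_pairs n" "(v, w) \<in> vertex_pairs n" for u v w n
    using that by (fastforce simp: vertex_pairs_def)
  have rf: "(u, u) \<in> vertex_pairs n" if "u \<in> vertices n" for u n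
    using that by (auto simp: vertex_pairs_def)
  have 1: "act (nerve M) m n f c \<in> cells (nerve M) m"
    if f: "box_arrow m n f F" and c: "c \<in> cells (nerve M) n" for m n f F c
  proof -
    note fv = box_arrow_vertices[OF f]
    have fu: "f u \<in> vertices n" if "u \<in> vertices m" for u
      using fv(1) that by (auto simp: PiE_iff)
    from c have c1: "\<And>u v. (u, v) \<in> vertex_pairs n \<Longrightarrow> c (u, v) \<in> carrier M"
      and c2: "\<And>u. u \<in> vertices n \<Longrightarrow> c (u, u) = \<one>\<^bsub>M\<^esub>"
      and c3: "\<And>u v w. (u, v) \<in> vertex_pairs n \<Longrightarrow> (v, w) \<in> vertex_pairs n \<Longrightarrow>
             c (u, w) = c (u, v) \<otimes>\<^bsub>M\<^esub> c (v, w)"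
      by (auto simp: nerve_def PiE_iff)
    have "(\<lambda>(u, v) \<in> vertex_pairs m. c (f u, f v)) \<in> vertex_pairs m \<rightarrow>\<^sub>E carrier M"
      using c1 fv(2) by auto
    moreover have "(\<lambda>(u, v) \<in> vertex_pairs m. c (f u, f v)) (u, u) = \<one>\<^bsub>M\<^esub>" if "u \<in> vertices m" for u
      using c2 fu rf that by auto
    moreover have "(\<lambda>(u, v) \<in> vertex_pairs m. c (f u, f v)) (u, w) =
        (\<lambda>(u, v) \<in> vertex_pairs m. c (f u, f v)) (u, v) \<otimes>\<^bsub>M\<^esub>
        (\<lambda>(u, v) \<in> vertex_pairs m. c (f u, f v)) (v, w)"
      if "(u, v) \<in> vertex_pairs m" "(v, w) \<in> vertex_pairs m" for u v w
      using c3 fv(2) tr that by auto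
    ultimately show ?thesis
      by (auto simp: nerve_def)
  qed
  have 2: "act (nerve M) n n (restrict id (vertices n)) c = c" if c: "c \<in> cells (nerve M) n" for n c
  proof -
    have "c \<in> vertex_pairs n \<rightarrow>\<^sub>E carrier M"
      using c by (simp add: nerve_def)
    then have ext: "c p = undefined" if "p \<notin> vertex_pairs n" for p
      using that by (rule PiE_arb)
    show ?thesis
    proof
      fix p :: "(nat \<Rightarrow> bool) \<times> (nat \<Rightarrow> bool)"
      obtain u v where p: "p = (u, v)" by (cases p)
      show "act (nerve M) n n (restrict id (vertices n)) c p = c p"
        using ext[of p] vp[of u v n] unfolding p nerve_def by (cases "(u, v) \<in> vertex_pairs n") simp_all
    qed
  qed
  have 3: "act (nerve M) l n (compose (vertices l) g f) c =
           act (nerve M) l m f (act (nerve M) m n g c)"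
    if f: "box_arrow l m f F" for l m n f F g c
  proof
    fix p :: "(nat \<Rightarrow> bool) \<times> (nat \<Rightarrow> bool)"
    obtain u v where p: "p = (u, v)" by (cases p)
    show "act (nerve M) l n (compose (vertices l) g f) c p =
          act (nerve M) l m f (act (nerve M) m n g c) p"
      using box_arrow_vertices(2)[OF f, of u v] vp[of u v l] unfolding p nerve_def
      by (cases "(u, v) \<in> vertex_pairs l") (simp_all add: compose_eq)
  qed
  show ?thesis
    unfolding cubical_set_def
  proof (intro conjI allI impI ballI funcsetI)
    fix l m n f F g G c
    assume "box_arrow l m f F \<and> box_arrow m n g G"
    then show "act (nerve M) l n (compose (vertices l) g f) c =
               act (nerve M) l m f (act (nerve M) m n g c)"
      by (elim conjE) (rule 3)
  qed (rule 1 2; assumption)+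
qed


section \<open>Directed homotopy monoids\<close>

definition boundary :: "nat \<Rightarrow> (nat \<Rightarrow> real) set" where
  "boundary n = {x \<in> icube n. \<exists>i<n. x i = 0 \<or> x i = 1}"

text \<open>The quotient of the \<open>n\<close>-cube by its boundary is formed as the disjoint union of the cube
  (index \<^term>\<open>True\<close>) and a point \<^term>\<open>dcube 0\<close> (index \<^term>\<open>False\<close>), with the boundary glued to the
  point. For \<open>n = 0\<close> the boundary is empty and the point is adjoined.\<close>

definition pointed_cube :: "nat \<Rightarrow> (bool \<times> (nat \<Rightarrow> real)) prestream" where
  "pointed_cube n = sum_stream (\<lambda>b. if b then dcube n else dcube 0) UNIV"

definition sphere_glue :: "nat \<Rightarrow> (bool \<times> (nat \<Rightarrow> real)) rel" where
  "sphere_glue n = {((True, x), (False, \<lambda>_. undefined)) | x. x \<in> boundary n}"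

type_synonym sphere_point = "(bool \<times> (nat \<Rightarrow> real)) set"

definition dsphere :: "nat \<Rightarrow> sphere_point prestream" where
  "dsphere n = ditop_quotient (pointed_cube n) (sphere_glue n)"

definition to_sphere :: "nat \<Rightarrow> (nat \<Rightarrow> real) \<Rightarrow> sphere_point" where
  "to_sphere n x = ditop_equiv (pointed_cube n) (sphere_glue n) `` {(True, x)}"

definition sphere_infty :: "nat \<Rightarrow> sphere_point" where
  "sphere_infty n = ditop_equiv (pointed_cube n) (sphere_glue n) `` {(False, \<lambda>_. undefined)}"

definition loops :: "nat \<Rightarrow> 'a prestream \<Rightarrow> 'a \<Rightarrow> (sphere_point \<Rightarrow> 'a) set" where
  "loops n X x =
     {f \<in> extensional (points (dsphere n)). stream_map (dsphere n) X f \<and> f (sphere_infty n) = x}"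

definition interval_point :: "real \<Rightarrow> (nat \<Rightarrow> real)" where
  "interval_point t = (\<lambda>i \<in> {..<1}. t)"

definition dihomotopic ::
    "nat \<Rightarrow> 'a prestream \<Rightarrow> 'a \<Rightarrow> (sphere_point \<Rightarrow> 'a) \<Rightarrow> (sphere_point \<Rightarrow> 'a) \<Rightarrow> bool" where
  "dihomotopic n X x f g \<longleftrightarrow>
     (\<exists>H. stream_map (ditop_product (dsphere n) (dcube 1)) X H \<and>
        (\<forall>s \<in> points (dsphere n).
           H (s, interval_point 0) = f s \<and> H (s, interval_point 1) = g s) \<and>
        (\<forall>t \<in> {0..1}. H (sphere_infty n, interval_point t) = x))"

definition dihomotopy_rel :: "nat \<Rightarrow> 'a prestream \<Rightarrow> 'a \<Rightarrow> (sphere_point \<Rightarrow> 'a) rel" where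
  "dihomotopy_rel n X x =
     \<Inter> {R. equiv (loops n X x) R \<and>
          (\<forall>f \<in> loops n X x. \<forall>g \<in> loops n X x. dihomotopic n X x f g \<longrightarrow> (f, g) \<in> R)}"

text \<open>For \<open>n \<ge> 1\<close>, the directed cube of \<open>f\<close> followed by that of \<open>g\<close> in the first coordinate. The
  point chosen by \<open>SOME\<close> is unique, because off \<open>\<infinity>\<close> the projection from the cube is injective.\<close>

definition loop_mult ::
    "nat \<Rightarrow> (sphere_point \<Rightarrow> 'a) \<Rightarrow> (sphere_point \<Rightarrow> 'a) \<Rightarrow> (sphere_point \<Rightarrow> 'a)" where
  "loop_mult n f g =
     (\<lambda>s \<in> points (dsphere n).
        if s = sphere_infty n then f (sphere_infty n)
        else let x = (SOME x. x \<in> icube n \<and> to_sphere n x = s)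
             in if x 0 \<le> 1/2 then f (to_sphere n (x(0 := 2 * x 0)))
                else g (to_sphere n (x(0 := 2 * x 0 - 1))))"

text \<open>For \<open>n = 0\<close> only the carrier and the distinguished element are meaningful. The union in the
  product of two classes has a single member when the multiplication is well defined on classes.\<close>

definition tau :: "nat \<Rightarrow> 'a prestream \<Rightarrow> 'a \<Rightarrow> (sphere_point \<Rightarrow> 'a) set monoid" where
  "tau n X x =
     \<lparr> carrier = loops n X x // dihomotopy_rel n X x,
       mult = (\<lambda>a b. \<Union>f\<in>a. \<Union>g\<in>b. dihomotopy_rel n X x `` {loop_mult n f g}),
       one = dihomotopy_rel n X x `` {\<lambda>s \<in> points (dsphere n). x} \<rparr>"

definition tau_map ::
    "nat \<Rightarrow> 'a prestream \<Rightarrow> 'a \<Rightarrow> 'b prestream \<Rightarrow> 'b \<Rightarrow> ('a \<Rightarrow> 'b) \<Rightarrow>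
     (sphere_point \<Rightarrow> 'a) set \<Rightarrow> (sphere_point \<Rightarrow> 'b) set" where
  "tau_map n X x Y y k =
     (\<lambda>a \<in> carrier (tau n X x). dihomotopy_rel n Y y `` ((\<lambda>f. compose (points (dsphere n)) k f) ` a))"

abbreviation tau_nerve ::
    "nat \<Rightarrow> ('a, 'b) monoid_scheme \<Rightarrow>
     (sphere_point \<Rightarrow> ((nat \<times> ((nat \<Rightarrow> bool) \<times> (nat \<Rightarrow> bool) \<Rightarrow> 'a)) \<times> (nat \<Rightarrow> real)) set) set monoid" where
  "tau_nerve n M \<equiv> tau n (realization (nerve M)) (nerve_point M)"

abbreviation tau_nerve_map ::
    "nat \<Rightarrow> ('a, 'b) monoid_scheme \<Rightarrow> ('c, 'd) monoid_scheme \<Rightarrow> ('a \<Rightarrow> 'c) \<Rightarrow>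
     (sphere_point \<Rightarrow> ((nat \<times> ((nat \<Rightarrow> bool) \<times> (nat \<Rightarrow> bool) \<Rightarrow> 'a)) \<times> (nat \<Rightarrow> real)) set) set \<Rightarrow>
     (sphere_point \<Rightarrow> ((nat \<times> ((nat \<Rightarrow> bool) \<times> (nat \<Rightarrow> bool) \<Rightarrow> 'c)) \<times> (nat \<Rightarrow> real)) set) set" where
  "tau_nerve_map n M N h \<equiv>
     tau_map n (realization (nerve M)) (nerve_point M) (realization (nerve N)) (nerve_point N)
       (realization_map (nerve M) (nerve N) (nerve_map h))"

end

theory Submission
  imports Defs
begin

text \<open>
  The coordinates in which the face carrying a point is not constant are invariant under gluing, so
  the glued space is already Hausdorff and its points are the naive classes of a cell \<open>\<phi>\<close> of the
  nerve with coordinates \<open>x\<close>. Rounding \<open>x\<close> at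
  a threshold \<open>a\<close> gives a vertex, and for \<open>a \<le> b\<close> the value of \<open>\<phi>\<close> on the two vertices obtained from
  \<open>b\<close> and \<open>a\<close> depends on the point only: it is the transport from \<open>b\<close> to \<open>a\<close>. The open set of points
  having no relevant coordinate near \<open>a\<close> admits no transport across \<open>a\<close> along directed paths, and
  such sets cover the realization. By a Lebesgue number argument, a directed cube \<open>f\<close> whose final
  corner is sent to \<open>\<star>\<close> therefore has a unique lift \<open>L\<close>: the value \<open>L p\<close> in \<open>M\<close> is the transport
  across the threshold \<open>1/2\<close> along any directed path from \<open>p\<close> to the final corner.

  Stretching coordinates so that those below \<open>1/2\<close> become \<open>0\<close> is directed homotopic to the identity,
  and the stretched point lies on the face below the vertex rounded at \<open>1/2\<close>. The cone over that
  face, whose edge at the rounded vertex is labelled \<open>L p\<close>, contracts the stretched \<open>f\<close> to \<open>\<star>\<close>. If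
  \<open>n \<ge> 2\<close>, then \<open>L\<close> is trivial on the boundary and the contraction is relative to it. If \<open>n = 1\<close>, the
  diagonal of the contraction deforms \<open>f\<close> to the edge labelled by the holonomy \<open>L 0\<close>, which is
  invariant because homotopies lift, and multiplicative because lifts restrict to subintervals. If
  \<open>n = 0\<close>, a directed path inside one cell leads from any point to \<open>\<star>\<close>.
\<close>

text \<open>A monoid need have neither inverses nor cancellation, and this shapes every
  construction. A rounded vertex can only be compared with a larger one, so labels accumulate
  towards one end of the cube: a lift is normalized at the final corner, and two sequences of steps
  are compared by pushing both towards that corner instead of going around a closed path. For the
  same reason the auxiliary thresholds \<open>a\<close> lie below \<open>1/2\<close>: lowering the
  threshold enlarges the rounded vertex, so the comparison from \<open>1/2\<close> to
  \<open>a\<close> is an edge in the forward direction.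

  The function \<open>L\<close> jumps when a coordinate crosses \<open>1/2\<close>. The contraction
  is continuous nevertheless: near each point \<open>L\<close> is the transport from
  \<open>1/2\<close> to some \<open>a\<close> times a constant, and the stretched point lies on a
  face on which the cone with the jumping label agrees with a cone over a larger, locally constant
  vertex with a constant label.

  Nothing may depend on the cell that represents a point. Functions on points are therefore given by
  coordinate formulas that commute with arrows; rounding does so because the constants 0 and 1 round
  to themselves.\<close>

section \<open>Preorders of a circulation and stream maps\<close>

lemma trancl_image_into:
  assumes "(a, b) \<in> r\<^sup>+" "\<And>x y. (x, y) \<in> r \<Longrightarrow> (f x, f y) \<in> s" "trans s"
  shows "(f a, f b) \<in> s"
  using assms(1) by (induction rule: trancl_induct) (use assms(2,3) in \<open>auto dest: transD\<close>)

lemma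
  assumes "stream X" "openin (topo X) U"
  shows circ_subset: "circ X U \<subseteq> U \<times> U"
    and circ_refl: "x \<in> U \<Longrightarrow> (x, x) \<in> circ X U"
    and circ_trans: "trans (circ X U)"
  using assms by (auto simp: stream_def circulation_def preorder_on_def refl_on_def)

lemma circ_not_open: "stream X \<Longrightarrow> \<not> openin (topo X) U \<Longrightarrow> circ X U = {}"
  by (auto simp: stream_def circulation_def)

lemma circ_Union:
  "stream X \<Longrightarrow> (\<And>U. U \<in> \<O> \<Longrightarrow> openin (topo X) U) \<Longrightarrow> circ X (\<Union>\<O>) = (\<Union>U\<in>\<O>. circ X U)\<^sup>+"
  by (auto simp: stream_def circulation_def)

text \<open>The union axiom for the family of \<open>U\<close> and \<open>V\<close>, whose union is
  \<open>V\<close>, contains monotonicity.\<close>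

lemma circ_mono:
  assumes "stream X" "openin (topo X) U" "openin (topo X) V" "U \<subseteq> V"
  shows "circ X U \<subseteq> circ X V"
proof -
  have "\<Union>{U, V} = V"
    using assms(4) by auto
  then have "circ X V = (\<Union>W\<in>{U, V}. circ X W)\<^sup>+"
    using circ_Union[of X "{U, V}"] assms by auto
  then show ?thesis
    by auto
qed

lemma stream_mapD:
  assumes "stream_map X Y f" "openin (topo Y) U" "(x, y) \<in> circ X {x \<in> points X. f x \<in> U}"
  shows "(f x, f y) \<in> circ Y U"
  using assms unfolding stream_map_def by blast

lemma stream_map_compose:
  assumes "stream_map X Y f" "stream_map Y Z g"
  shows "stream_map X Z (\<lambda>x. g (f x))"
  unfolding stream_map_def
proof (intro conjI allI impI)
  have cf: "continuous_map (topo X) (topo Y) f" and cg: "continuous_map (topo Y) (topo Z) g"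
    using assms by (auto simp: stream_map_def)
  show "continuous_map (topo X) (topo Z) (\<lambda>x. g (f x))"
    using continuous_map_compose[OF cf cg] by (simp add: o_def)
  fix U assume U: "openin (topo Z) U"
  let ?V = "{y \<in> points Y. g y \<in> U}"
  have V: "openin (topo Y) ?V"
    using cg U by (rule openin_continuous_map_preimage)
  have eq: "{x \<in> points X. g (f x) \<in> U} = {x \<in> points X. f x \<in> ?V}"
    using continuous_map_image_subset_topspace[OF cf] by auto
  show "\<forall>(x, y)\<in>circ X {x \<in> points X. g (f x) \<in> U}. (g (f x), g (f y)) \<in> circ Z U"
    unfolding eq using stream_mapD[OF assms(1) V] stream_mapD[OF assms(2) U] by blast
qed

lemma stream_map_id: "stream X \<Longrightarrow> stream_map X X (\<lambda>x. x)"
proof -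
  have "{x \<in> points X. x \<in> U} = U" if "openin (topo X) U" for U
    using openin_subset[OF that] by auto
  then show ?thesis
    by (auto simp: stream_map_def)
qed

lemma stream_map_const:
  assumes "stream X" "stream Y" "y \<in> points Y"
  shows "stream_map X Y (\<lambda>_. y)"
  unfolding stream_map_def
proof (intro conjI allI impI)
  show "continuous_map (topo X) (topo Y) (\<lambda>_. y)"
    using assms(3) by simp
  fix U assume U: "openin (topo Y) U"
  show "\<forall>(a, b)\<in>circ X {a \<in> points X. y \<in> U}. (y, y) \<in> circ Y U"
  proof (cases "y \<in> U")
    case True
    then show ?thesis using circ_refl[OF assms(2) U] by auto
  next
    case False
    have "openin (topo X) {}" by simp
    then have "circ X {} \<subseteq> {} \<times> {}" by (rule circ_subset[OF assms(1)])
    then show ?thesis using False by auto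
  qed
qed

text \<open>That \<open>X\<close> is a stream ensures that related elements are points of
  \<open>X\<close>, which is where the two maps agree.\<close>

lemma stream_map_cong:
  assumes "stream_map X Y f" "\<And>x. x \<in> points X \<Longrightarrow> f x = g x" "stream X"
  shows "stream_map X Y g"
  unfolding stream_map_def
proof (intro conjI allI impI)
  show "continuous_map (topo X) (topo Y) g"
    using assms(1,2) by (auto simp: stream_map_def intro: continuous_map_eq)
  fix U assume U: "openin (topo Y) U"
  have eq: "{x \<in> points X. g x \<in> U} = {x \<in> points X. f x \<in> U}"
    using assms(2) by auto
  have op: "openin (topo X) {x \<in> points X. f x \<in> U}"
    using assms(1) U by (auto simp: stream_map_def intro: openin_continuous_map_preimage)
  show "\<forall>(x, y)\<in>circ X {x \<in> points X. g x \<in> U}. (g x, g y) \<in> circ Y U"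
    unfolding eq
    using stream_mapD[OF assms(1) U] assms(2) circ_subset[OF assms(3) op] by fastforce
qed

text \<open>The final circulation along \<open>k\<close>. Points outside the image of
  \<open>k\<close> are related to themselves only through the added identity. It serves twice: along
  a quotient projection it is the quotient circulation, and along a pairing it becomes one of the
  circulations whose join is the product circulation.\<close>

lemma pushforward_circulation:
  assumes "stream Q" "continuous_map (topo Q) T k"
  shows "circulation T (\<lambda>U. if openin T U
    then ({(k a, k b) | a b. (a, b) \<in> circ Q {a \<in> points Q. k a \<in> U}} \<union> Id_on U)\<^sup>+ else {})"
    (is "circulation T ?c")
  unfolding circulation_def
proof (intro conjI allI impI)
  let ?P = "\<lambda>U. {a \<in> points Q. k a \<in> U}"
  let ?S = "\<lambda>U. {(k a, k b) | a b. (a, b) \<in> circ Q (?P U)} \<union> Id_on U"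
  have opP: "openin (topo Q) (?P U)" if "openin T U" for U
    using assms(2) that by (rule openin_continuous_map_preimage)
  fix U assume U: "openin T U"
  have sub: "?S U \<subseteq> U \<times> U"
    using circ_subset[OF assms(1) opP[OF U]] by auto
  then have "(?S U)\<^sup>+ \<subseteq> U \<times> U"
    by (rule trancl_subset_Sigma)
  moreover have "refl_on U ((?S U)\<^sup>+)"
    by (auto simp: refl_on_def)
  ultimately show "preorder_on U (?c U)"
    using U by (simp add: preorder_on_def)
next
  let ?P = "\<lambda>U. {a \<in> points Q. k a \<in> U}"
  let ?S = "\<lambda>U. {(k a, k b) | a b. (a, b) \<in> circ Q (?P U)} \<union> Id_on U"
  have opP: "openin (topo Q) (?P U)" if "openin T U" for U
    using assms(2) that by (rule openin_continuous_map_preimage)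
  fix \<O> assume \<O>: "\<forall>U\<in>\<O>. openin T U"
  then have un: "openin T (\<Union>\<O>)" by auto
  have PU: "?P (\<Union>\<O>) = \<Union>(?P ` \<O>)" by auto
  have "circ Q (\<Union>(?P ` \<O>)) = (\<Union>V\<in>?P ` \<O>. circ Q V)\<^sup>+"
    using \<O> opP by (intro circ_Union[OF assms(1)]) auto
  then have circ: "circ Q (?P (\<Union>\<O>)) = (\<Union>U\<in>\<O>. circ Q (?P U))\<^sup>+"
    by (simp only: PU image_image)
  \<comment> \<open>Preimages commute with unions, so the union axiom of \<open>Q\<close> breaks a
    generating pair over the union into a chain of pairs, each over a single member.\<close>
  have "?S (\<Union>\<O>) \<subseteq> (\<Union>U\<in>\<O>. ?c U)\<^sup>+"
  proof
    fix z assume "z \<in> ?S (\<Union>\<O>)"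
    then consider a b where "z = (k a, k b)" "(a, b) \<in> (\<Union>U\<in>\<O>. circ Q (?P U))\<^sup>+"
      | x U where "z = (x, x)" "x \<in> U" "U \<in> \<O>"
      unfolding circ by blast
    then show "z \<in> (\<Union>U\<in>\<O>. ?c U)\<^sup>+"
    proof cases
      case 1
      have "(k a, k b) \<in> (\<Union>U\<in>\<O>. ?c U)\<^sup>+"
      proof (rule trancl_image_into[OF 1(2)])
        fix x y assume "(x, y) \<in> (\<Union>U\<in>\<O>. circ Q (?P U))"
        then obtain U where U: "U \<in> \<O>" "(x, y) \<in> circ Q (?P U)" by blast
        then have "(k x, k y) \<in> ?S U" by blast
        then have "(k x, k y) \<in> (?S U)\<^sup>+" by (rule r_into_trancl)
        then have "(k x, k y) \<in> ?c U" using U \<O> by simp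
        then show "(k x, k y) \<in> (\<Union>U\<in>\<O>. ?c U)\<^sup>+"
          using U(1) by (intro r_into_trancl UN_I)
      qed simp
      then show ?thesis using 1 by simp
    next
      case 2
      then have "(x, x) \<in> ?S U" by blast
      then have "(x, x) \<in> (?S U)\<^sup>+" by (rule r_into_trancl)
      then have "(x, x) \<in> ?c U" using 2 \<O> by simp
      then show ?thesis unfolding 2(1) using 2(3) by (intro r_into_trancl UN_I)
    qed
  qed
  then have "(?S (\<Union>\<O>))\<^sup>+ \<subseteq> ((\<Union>U\<in>\<O>. ?c U)\<^sup>+)\<^sup>+"
    by (rule trancl_mono_subset)
  moreover have "?c U \<subseteq> ?c (\<Union>\<O>)" if "U \<in> \<O>" for U
  proof -
    have "circ Q (?P U) \<subseteq> circ Q (?P (\<Union>\<O>))"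
      using that \<O> opP[of U] opP[OF un] by (intro circ_mono[OF assms(1)]) auto
    then have "?S U \<subseteq> ?S (\<Union>\<O>)" using that by blast
    then have "(?S U)\<^sup>+ \<subseteq> (?S (\<Union>\<O>))\<^sup>+" by (rule trancl_mono_subset)
    then show ?thesis using that \<O> un by simp
  qed
  then have "(\<Union>U\<in>\<O>. ?c U)\<^sup>+ \<subseteq> (?c (\<Union>\<O>))\<^sup>+"
    by (intro trancl_mono_subset UN_least)
  ultimately show "?c (\<Union>\<O>) = (\<Union>U\<in>\<O>. ?c U)\<^sup>+"
    using un by simp
qed auto


subsection \<open>Sums and quotients\<close>

lemma points_sum_stream [simp]: "points (sum_stream X I) = Sigma I (\<lambda>i. points (X i))"
  by (simp add: sum_stream_def o_def)

lemma topo_sum_stream: "topo (sum_stream X I) = sum_topology (\<lambda>i. topo (X i)) I"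
  by (simp add: sum_stream_def)

lemma openin_sum_stream:
  "openin (topo (sum_stream X I)) U \<longleftrightarrow>
    U \<subseteq> Sigma I (\<lambda>i. points (X i)) \<and> (\<forall>i\<in>I. openin (topo (X i)) {x. (i, x) \<in> U})"
  by (simp add: topo_sum_stream openin_sum_topology o_def)

lemma circ_sum_stream:
  "openin (topo (sum_stream X I)) U \<Longrightarrow>
    circ (sum_stream X I) U = {((i, x), (i, y)) | i x y. i \<in> I \<and> (x, y) \<in> circ (X i) {x. (i, x) \<in> U}}"
  by (simp add: sum_stream_def)

text \<open>A chain of related points never leaves its summand, so each axiom reduces to the slices
  of the open set.\<close>

lemma stream_sum_stream:
  assumes "\<And>i. i \<in> I \<Longrightarrow> stream (X i)"
  shows "stream (sum_stream X I)"
  unfolding stream_def circulation_def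
proof (intro conjI allI impI)
  let ?S = "sum_stream X I"
  fix U assume U: "openin (topo ?S) U"
  have op: "openin (topo (X i)) {x. (i, x) \<in> U}" if "i \<in> I" for i
    using U that by (simp add: openin_sum_stream)
  have "U \<subseteq> Sigma I (\<lambda>i. points (X i))"
    using U by (simp add: openin_sum_stream)
  moreover have "trans (circ ?S U)"
    unfolding circ_sum_stream[OF U]
    by (intro transI) (auto dest: transD[OF circ_trans[OF assms op]])
  ultimately show "preorder_on U (circ ?S U)"
    using circ_subset[OF assms op] circ_refl[OF assms op]
    unfolding preorder_on_def refl_on_def circ_sum_stream[OF U] by fastforce
next
  let ?S = "sum_stream X I"
  fix U assume "\<not> openin (topo ?S) U"
  then show "circ ?S U = {}"
    by (simp add: sum_stream_def)
next
  let ?S = "sum_stream X I"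
  fix \<O> assume \<O>: "\<forall>U\<in>\<O>. openin (topo ?S) U"
  then have un: "openin (topo ?S) (\<Union>\<O>)" by auto
  have op: "openin (topo (X i)) {x. (i, x) \<in> U}" if "i \<in> I" "U \<in> \<O>" for i U
    using \<O> that by (simp add: openin_sum_stream)
  have ci: "circ (X i) {x. (i, x) \<in> \<Union>\<O>} = (\<Union>U\<in>\<O>. circ (X i) {x. (i, x) \<in> U})\<^sup>+" if i: "i \<in> I" for i
  proof -
    have eq: "{x. (i, x) \<in> \<Union>\<O>} = \<Union>((\<lambda>U. {x. (i, x) \<in> U}) ` \<O>)" by auto
    have "circ (X i) (\<Union>((\<lambda>U. {x. (i, x) \<in> U}) ` \<O>)) =
        (\<Union>V\<in>(\<lambda>U. {x. (i, x) \<in> U}) ` \<O>. circ (X i) V)\<^sup>+"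
      using op[OF i] by (intro circ_Union[OF assms[OF i]]) auto
    then show ?thesis by (simp only: eq image_image)
  qed
  have uni: "circ ?S U = {((i, x), (i, y)) | i x y. i \<in> I \<and> (x, y) \<in> circ (X i) {x. (i, x) \<in> U}}"
    if "U \<in> \<O>" for U
    using \<O> that by (intro circ_sum_stream) auto
  show "circ ?S (\<Union>\<O>) = (\<Union>U\<in>\<O>. circ ?S U)\<^sup>+"
  proof
    show "circ ?S (\<Union>\<O>) \<subseteq> (\<Union>U\<in>\<O>. circ ?S U)\<^sup>+"
    proof
      fix z assume "z \<in> circ ?S (\<Union>\<O>)"
      then obtain i x y where z: "z = ((i, x), (i, y))" and i: "i \<in> I"
        and xy: "(x, y) \<in> (\<Union>U\<in>\<O>. circ (X i) {x. (i, x) \<in> U})\<^sup>+"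
        unfolding circ_sum_stream[OF un] using ci by auto
      have "((i, x), (i, y)) \<in> (\<Union>U\<in>\<O>. circ ?S U)\<^sup>+"
      proof (rule trancl_image_into[OF xy, where f = "Pair i"])
        fix a b assume "(a, b) \<in> (\<Union>U\<in>\<O>. circ (X i) {x. (i, x) \<in> U})"
        then show "((i, a), (i, b)) \<in> (\<Union>U\<in>\<O>. circ ?S U)\<^sup>+"
          using i by (intro r_into_trancl) (auto simp: uni)
      qed simp
      then show "z \<in> (\<Union>U\<in>\<O>. circ ?S U)\<^sup>+" by (simp add: z)
    qed
  next
    have "circ ?S U \<subseteq> circ ?S (\<Union>\<O>)" if UO: "U \<in> \<O>" for U
    proof
      fix z assume "z \<in> circ ?S U"
      then obtain i x y where z: "z = ((i, x), (i, y))" and i: "i \<in> I"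
        and xy: "(x, y) \<in> circ (X i) {x. (i, x) \<in> U}"
        unfolding uni[OF UO] by auto
      then have "(x, y) \<in> circ (X i) {x. (i, x) \<in> \<Union>\<O>}"
        unfolding ci[OF i] using UO by (intro r_into_trancl) auto
      then show "z \<in> circ ?S (\<Union>\<O>)"
        unfolding circ_sum_stream[OF un] using z i by auto
    qed
    then have sub: "(\<Union>U\<in>\<O>. circ ?S U) \<subseteq> circ ?S (\<Union>\<O>)" by blast
    have "trans (circ ?S (\<Union>\<O>))"
      unfolding circ_sum_stream[OF un] using ci
      by (intro transI) (auto dest: transD[OF trans_trancl])
    then have "(circ ?S (\<Union>\<O>))\<^sup>+ = circ ?S (\<Union>\<O>)" by (rule trancl_id)
    with trancl_mono_subset[OF sub] show "(\<Union>U\<in>\<O>. circ ?S U)\<^sup>+ \<subseteq> circ ?S (\<Union>\<O>)"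
      by simp
  qed
qed

lemma stream_map_inject:
  assumes i: "i \<in> I"
  shows "stream_map (X i) (sum_stream X I) (Pair i)"
  unfolding stream_map_def
proof (intro conjI allI impI)
  show "continuous_map (topo (X i)) (topo (sum_stream X I)) (Pair i)"
    unfolding topo_sum_stream using i by (rule continuous_map_component_injection)
  fix U assume U: "openin (topo (sum_stream X I)) U"
  have "{x \<in> points (X i). (i, x) \<in> U} = {x. (i, x) \<in> U}"
    using U i by (auto simp: openin_sum_stream)
  then show "\<forall>(x, y)\<in>circ (X i) {x \<in> points (X i). (i, x) \<in> U}. ((i, x), (i, y)) \<in> circ (sum_stream X I) U"
    unfolding circ_sum_stream[OF U] using i by auto
qed

lemma stream_map_from_sum:
  assumes "\<And>i. i \<in> I \<Longrightarrow> stream_map (X i) Y (\<lambda>x. f (i, x))"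
  shows "stream_map (sum_stream X I) Y f"
  unfolding stream_map_def
proof (intro conjI allI impI)
  show cont: "continuous_map (topo (sum_stream X I)) (topo Y) f"
    unfolding continuous_map_def
  proof (intro conjI allI impI)
    have cont: "continuous_map (topo (X i)) (topo Y) (\<lambda>x. f (i, x))" if "i \<in> I" for i
      using assms[OF that] by (simp add: stream_map_def)
    show "f \<in> points (sum_stream X I) \<rightarrow> points Y"
      using continuous_map_image_subset_topspace[OF cont] by auto
    fix U assume "openin (topo Y) U"
    then have "openin (topo (X i)) {x \<in> points (X i). f (i, x) \<in> U}" if "i \<in> I" for i
      using cont[OF that] by (rule openin_continuous_map_preimage[rotated])
    then show "openin (topo (sum_stream X I)) {z \<in> points (sum_stream X I). f z \<in> U}"
      by (auto simp: openin_sum_stream cong: conj_cong)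
  qed
  fix U assume U: "openin (topo Y) U"
  let ?V = "{z \<in> points (sum_stream X I). f z \<in> U}"
  have V: "openin (topo (sum_stream X I)) ?V"
    using cont U by (rule openin_continuous_map_preimage)
  have "{x. (i, x) \<in> ?V} = {x \<in> points (X i). f (i, x) \<in> U}" if "i \<in> I" for i
    using that by auto
  then show "\<forall>(x, y)\<in>circ (sum_stream X I) ?V. (f x, f y) \<in> circ Y U"
    unfolding circ_sum_stream[OF V] using stream_mapD[OF assms U] by auto
qed

section \<open>Quotient topologies and quotient streams\<close>

lemma openin_quotient_topology:
  assumes "equiv (topspace T) R"
  shows "openin (quotient_topology T R) \<U> \<longleftrightarrow> \<U> \<subseteq> topspace T // R \<and> openin T (\<Union>\<U>)"
proof -
  have "istopology (\<lambda>\<U>. \<U> \<subseteq> topspace T // R \<and> openin T (\<Union>\<U>))"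
    unfolding istopology_def
  proof (intro conjI allI impI)
    fix S S' assume S: "S \<subseteq> topspace T // R \<and> openin T (\<Union>S)"
      and S': "S' \<subseteq> topspace T // R \<and> openin T (\<Union>S')"
    \<comment> \<open>Distinct classes are disjoint, so a point common to both unions lies in a
      class common to both families.\<close>
    have "\<Union>(S \<inter> S') = \<Union>S \<inter> \<Union>S'"
      using S S' quotient_disj[OF assms] by fast
    then show "openin T (\<Union>(S \<inter> S'))" using S S' by auto
    show "S \<inter> S' \<subseteq> topspace T // R" using S by auto
  next
    fix \<K> assume "\<forall>K\<in>\<K>. K \<subseteq> topspace T // R \<and> openin T (\<Union>K)"
    moreover have "\<Union>(\<Union>\<K>) = \<Union>(Union ` \<K>)" by auto
    ultimately show "\<Union>\<K> \<subseteq> topspace T // R" "openin T (\<Union>(\<Union>\<K>))" by auto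
  qed
  then show ?thesis
    unfolding quotient_topology_def by (simp add: topology_inverse')
qed

lemma topspace_quotient_topology:
  assumes "equiv (topspace T) R"
  shows "topspace (quotient_topology T R) = topspace T // R"
proof
  show "topspace (quotient_topology T R) \<subseteq> topspace T // R"
    using openin_topspace[of "quotient_topology T R"] openin_quotient_topology[OF assms] by blast
  have "openin (quotient_topology T R) (topspace T // R)"
    unfolding openin_quotient_topology[OF assms] Union_quotient[OF assms] by simp
  then show "topspace T // R \<subseteq> topspace (quotient_topology T R)"
    by (rule openin_subset)
qed

lemma Union_subset_quotient:
  assumes "equiv A R" "\<U> \<subseteq> A // R"
  shows "\<Union>\<U> = {x \<in> A. R `` {x} \<in> \<U>}"
proof (intro equalityI subsetI)
  fix x assume "x \<in> \<Union>\<U>"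
  then obtain C where C: "C \<in> \<U>" "x \<in> C" by blast
  then obtain y where y: "y \<in> A" "C = R `` {y}"
    using assms(2) by (auto simp: quotient_def)
  then have "(y, x) \<in> R" using C by auto
  then have "C = R `` {x}" "x \<in> A"
    using y equiv_class_eq[OF assms(1)] assms(1) by (auto simp: equiv_def refl_on_def)
  then show "x \<in> {x \<in> A. R `` {x} \<in> \<U>}" using C by auto
next
  fix x assume "x \<in> {x \<in> A. R `` {x} \<in> \<U>}"
  then show "x \<in> \<Union>\<U>"
    using equiv_class_self[OF assms(1)] by blast
qed

lemma openin_quotient_iff:
  assumes "equiv (topspace T) R"
  shows "openin (quotient_topology T R) \<U> \<longleftrightarrow>
    \<U> \<subseteq> topspace T // R \<and> openin T {x \<in> topspace T. R `` {x} \<in> \<U>}"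
  using openin_quotient_topology[OF assms, of \<U>] Union_subset_quotient[OF assms, of \<U>] by metis

lemma topo_quotient_stream [simp]: "topo (quotient_stream X R) = quotient_topology (topo X) R"
  by (simp add: quotient_stream_def)

lemma circ_quotient_stream:
  assumes "equiv (points X) R" "openin (quotient_topology (topo X) R) \<U>"
  shows "circ (quotient_stream X R) \<U> =
    {(R `` {x}, R `` {y}) | x y. (x, y) \<in> circ X {x \<in> points X. R `` {x} \<in> \<U>}}\<^sup>+"
proof -
  have "\<Union>\<U> = {x \<in> points X. R `` {x} \<in> \<U>}"
    using assms by (intro Union_subset_quotient) (auto simp: openin_quotient_topology)
  then show ?thesis using assms(2) by (simp add: quotient_stream_def)
qed

lemma continuous_map_quotient:
  assumes "equiv (topspace T) R"
  shows "continuous_map T (quotient_topology T R) (\<lambda>x. R `` {x})"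
  unfolding continuous_map_def topspace_quotient_topology[OF assms]
  using openin_quotient_iff[OF assms] by (auto intro: quotientI)

lemma stream_quotient_stream:
  assumes X: "stream X" and R: "equiv (points X) R"
  shows "stream (quotient_stream X R)"
proof -
  let ?T = "quotient_topology (topo X) R"
  let ?k = "\<lambda>x. R `` {x}"
  let ?c = "\<lambda>U. if openin ?T U
    then ({(?k a, ?k b) | a b. (a, b) \<in> circ X {a \<in> points X. ?k a \<in> U}} \<union> Id_on U)\<^sup>+ else {}"
  have "circ (quotient_stream X R) = ?c"
  proof
    fix U
    show "circ (quotient_stream X R) U = ?c U"
    proof (cases "openin ?T U")
      case True
      have op: "openin (topo X) {a \<in> points X. ?k a \<in> U}"
        using True openin_quotient_iff[OF R] by blast
      \<comment> \<open>Every class has a representative, and the circulation of \<open>X\<close> is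
        reflexive there, so the identity added by the pushforward is absorbed.\<close>
      have "Id_on U \<subseteq> {(?k a, ?k b) | a b. (a, b) \<in> circ X {a \<in> points X. ?k a \<in> U}}"
      proof
        fix z assume "z \<in> Id_on U"
        then obtain C where C: "z = (C, C)" "C \<in> U" by auto
        moreover from C obtain x where "x \<in> points X" "C = ?k x"
          using True openin_quotient_iff[OF R] by (auto simp: quotient_def)
        ultimately show "z \<in> {(?k a, ?k b) | a b. (a, b) \<in> circ X {a \<in> points X. ?k a \<in> U}}"
          using circ_refl[OF X op, of x] by blast
      qed
      then show ?thesis
        using True circ_quotient_stream[OF R True] by (simp add: Un_absorb2)
    next
      case False
      then show ?thesis by (simp add: quotient_stream_def)
    qed
  qed
  then show ?thesis
    using pushforward_circulation[OF X continuous_map_quotient[OF R]] by (simp add: stream_def)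
qed

lemma stream_map_quotient:
  assumes X: "stream X" and R: "equiv (points X) R"
  shows "stream_map X (quotient_stream X R) (\<lambda>x. R `` {x})"
  unfolding stream_map_def
proof (intro conjI allI impI)
  show "continuous_map (topo X) (topo (quotient_stream X R)) (\<lambda>x. R `` {x})"
    using continuous_map_quotient[OF R] by simp
  fix U assume "openin (topo (quotient_stream X R)) U"
  then show "\<forall>(x, y)\<in>circ X {x \<in> points X. R `` {x} \<in> U}. (R `` {x}, R `` {y}) \<in> circ (quotient_stream X R) U"
    using circ_quotient_stream[OF R, of U] by (auto intro: r_into_trancl)
qed

lemma stream_map_from_quotient:
  assumes X: "stream X" and R: "equiv (points X) R" and Y: "stream Y"
    and f: "stream_map X Y (\<lambda>x. f (R `` {x}))"
  shows "stream_map (quotient_stream X R) Y f"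
  unfolding stream_map_def
proof (intro conjI allI impI)
  have cf: "continuous_map (topo X) (topo Y) (\<lambda>x. f (R `` {x}))"
    using f by (simp add: stream_map_def)
  show cont: "continuous_map (topo (quotient_stream X R)) (topo Y) f"
    unfolding continuous_map_def
  proof (intro conjI allI impI)
    show "f \<in> points (quotient_stream X R) \<rightarrow> points Y"
      using continuous_map_image_subset_topspace[OF cf]
      by (auto simp: topspace_quotient_topology[OF R] quotient_def)
    fix U assume U: "openin (topo Y) U"
    have "{x \<in> points X. R `` {x} \<in> {C \<in> points X // R. f C \<in> U}} = {x \<in> points X. f (R `` {x}) \<in> U}"
      by (auto intro: quotientI)
    then show "openin (topo (quotient_stream X R)) {C \<in> points (quotient_stream X R). f C \<in> U}"
      using openin_continuous_map_preimage[OF cf U]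
      by (simp add: topspace_quotient_topology[OF R] openin_quotient_iff[OF R])
  qed
  fix U assume U: "openin (topo Y) U"
  let ?V = "{C \<in> points (quotient_stream X R). f C \<in> U}"
  have V: "openin (quotient_topology (topo X) R) ?V"
    using openin_continuous_map_preimage[OF cont U] by simp
  have eq: "{x \<in> points X. R `` {x} \<in> ?V} = {x \<in> points X. f (R `` {x}) \<in> U}"
    by (auto simp: topspace_quotient_topology[OF R] intro: quotientI)
  show "\<forall>(x, y)\<in>circ (quotient_stream X R) ?V. (f x, f y) \<in> circ Y U"
  proof safe
    fix a b assume "(a, b) \<in> circ (quotient_stream X R) ?V"
    then have ab: "(a, b) \<in> {(R `` {x}, R `` {y}) | x y. (x, y) \<in> circ X {x \<in> points X. f (R `` {x}) \<in> U}}\<^sup>+"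
      unfolding circ_quotient_stream[OF R V] eq .
    show "(f a, f b) \<in> circ Y U"
      by (rule trancl_image_into[OF ab]) (use stream_mapD[OF f U] circ_trans[OF Y U] in auto)
  qed
qed

lemma Hausdorff_imp_weak_hausdorff: "Hausdorff_space T \<Longrightarrow> weak_hausdorff T"
  unfolding weak_hausdorff_def compact_space_def
  by (auto intro!: compactin_imp_closedin image_compactin)

text \<open>When the plain equivalence closure of the gluing has a Hausdorff quotient, the
  reflection into weak Hausdorff spaces collapses nothing further: the closure is one of the
  relations intersected in \<open>ditop_equiv\<close> and lies in all the others.\<close>

lemma ditop_equiv_eqI:
  assumes "equiv (points X) E" "G \<subseteq> E" "Hausdorff_space (quotient_topology (topo X) E)"
    and "\<And>R. equiv (points X) R \<Longrightarrow> G \<subseteq> R \<Longrightarrow> E \<subseteq> R"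
  shows "ditop_equiv X G = E"
  unfolding ditop_equiv_def using assms Hausdorff_imp_weak_hausdorff by blast

lemma openin_stream_map_preimage:
  "stream_map X Y f \<Longrightarrow> openin (topo Y) U \<Longrightarrow> openin (topo X) {x \<in> points X. f x \<in> U}"
  by (auto simp: stream_map_def intro: openin_continuous_map_preimage)

subsection \<open>Products of compact Hausdorff streams\<close>

definition product_circ :: "'a prestream \<Rightarrow> 'b prestream \<Rightarrow> (('a \<times> 'b) set \<Rightarrow> ('a \<times> 'b) rel) \<Rightarrow> bool" where
  "product_circ X Y c \<longleftrightarrow> circulation (prod_topology (topo X) (topo Y)) c \<and>
     stream_map \<lparr>topo = prod_topology (topo X) (topo Y), circ = c\<rparr> X fst \<and>
     stream_map \<lparr>topo = prod_topology (topo X) (topo Y), circ = c\<rparr> Y snd"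

text \<open>The product circulation as the join of all circulations on the product topology for
  which both projections are stream maps. Transitivity has to be restored after taking the
  union.\<close>

definition prod_stream :: "'a prestream \<Rightarrow> 'b prestream \<Rightarrow> ('a \<times> 'b) prestream" where
  "prod_stream X Y = \<lparr>topo = prod_topology (topo X) (topo Y),
     circ = (\<lambda>U. (\<Union>c\<in>Collect (product_circ X Y). c U)\<^sup>+)\<rparr>"

text \<open>The pushforward of \<open>Q\<close> along the pairing is one of the circulations joined
  in \<open>prod_stream\<close>, so the pairing is a stream map into the join.\<close>

lemma prod_stream_initial:
  assumes Q: "stream Q" and X: "stream X" and Y: "stream Y"
    and f: "stream_map Q X f" and g: "stream_map Q Y g"
  shows "stream_map Q (prod_stream X Y) (\<lambda>q. (f q, g q))"
proof -
  let ?T = "prod_topology (topo X) (topo Y)"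
  let ?k = "\<lambda>q. (f q, g q)"
  have k: "continuous_map (topo Q) ?T ?k"
    using f g by (simp add: stream_map_def continuous_map_paired)
  let ?S = "\<lambda>U. {(?k a, ?k b) | a b. (a, b) \<in> circ Q {a \<in> points Q. ?k a \<in> U}} \<union> Id_on U"
  let ?c = "\<lambda>U. if openin ?T U then (?S U)\<^sup>+ else {}"
  let ?P = "\<lparr>topo = ?T, circ = ?c\<rparr>"
  have c: "circulation ?T ?c"
    using pushforward_circulation[OF Q k] .
  have proj: "stream_map ?P Z p"
    if Z: "stream Z" and p: "continuous_map ?T (topo Z) p" and pk: "stream_map Q Z (\<lambda>q. p (?k q))" for Z p
    unfolding stream_map_def
  proof (intro conjI allI impI)
    show "continuous_map (topo ?P) (topo Z) p" using p by simp
    fix U assume U: "openin (topo Z) U"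
    let ?V = "{z \<in> points ?P. p z \<in> U}"
    have V: "openin ?T ?V"
      using openin_continuous_map_preimage[OF p U] by simp
    have eq: "{a \<in> points Q. ?k a \<in> ?V} = {a \<in> points Q. p (?k a) \<in> U}"
      using continuous_map_image_subset_topspace[OF k] by auto
    show "\<forall>(x, y)\<in>circ ?P ?V. (p x, p y) \<in> circ Z U"
    proof safe
      fix x1 x2 y1 y2 assume "((x1, x2), (y1, y2)) \<in> circ ?P ?V"
      then have "((x1, x2), (y1, y2)) \<in> (?S ?V)\<^sup>+"
        using V by simp
      then show "(p (x1, x2), p (y1, y2)) \<in> circ Z U"
      proof (rule trancl_image_into)
        show "trans (circ Z U)" by (rule circ_trans[OF Z U])
        fix x y assume "(x, y) \<in> ?S ?V"
        then show "(p x, p y) \<in> circ Z U"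
          unfolding eq using stream_mapD[OF pk U] circ_refl[OF Z U] by auto
      qed
    qed
  qed
  have "product_circ X Y ?c"
    unfolding product_circ_def
    using c proj[OF X continuous_map_fst] proj[OF Y continuous_map_snd] f g by simp
  then have "?c U \<subseteq> (\<Union>c\<in>Collect (product_circ X Y). c U)" for U
    using UN_upper[OF CollectI, of "product_circ X Y" ?c "\<lambda>c. c U"] by simp
  then have sub: "?c U \<subseteq> circ (prod_stream X Y) U" for U
    unfolding prod_stream_def by (simp only: prestream.simps) (meson r_into_trancl' subset_iff)
  show ?thesis
    unfolding stream_map_def
  proof (intro conjI allI impI)
    show "continuous_map (topo Q) (topo (prod_stream X Y)) ?k"
      using k by (simp add: prod_stream_def)
    fix U assume "openin (topo (prod_stream X Y)) U"
    then have U: "openin ?T U" by (simp add: prod_stream_def)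
    show "\<forall>(x, y)\<in>circ Q {x \<in> points Q. ?k x \<in> U}. (?k x, ?k y) \<in> circ (prod_stream X Y) U"
    proof safe
      fix x y assume "(x, y) \<in> circ Q {x \<in> points Q. ?k x \<in> U}"
      then have "(?k x, ?k y) \<in> (?S U)\<^sup>+" by (intro r_into_trancl) blast
      then show "(?k x, ?k y) \<in> circ (prod_stream X Y) U"
        using sub[of U] U by auto
    qed
  qed
qed

lemma topo_prod_stream [simp]: "topo (prod_stream X Y) = prod_topology (topo X) (topo Y)"
  by (simp add: prod_stream_def)

lemma stream_prod_stream:
  assumes X: "stream X" and Y: "stream Y"
  shows "stream (prod_stream X Y)"
  unfolding stream_def circulation_def
proof (intro conjI allI impI)
  let ?T = "prod_topology (topo X) (topo Y)"
  let ?C = "Collect (product_circ X Y)"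
  let ?d = "\<lambda>U. \<Union>c\<in>?C. c U"
  have circ: "circ (prod_stream X Y) = (\<lambda>U. (?d U)\<^sup>+)"
    by (simp add: prod_stream_def)
  have po: "preorder_on U (c U)" if "c \<in> ?C" "openin ?T U" for c U
    using that by (auto simp: product_circ_def circulation_def)
  \<comment> \<open>The circulation consisting of equality relations makes every continuous map a
    stream map. It belongs to the family and supplies reflexivity of the join.\<close>
  have ne: "\<exists>c. c \<in> ?C \<and> (x, x) \<in> c U" if "openin ?T U" "x \<in> U" for U x
  proof -
    let ?c = "\<lambda>U. if openin ?T U then Id_on U else {}"
    have Id: "(Id_on A)\<^sup>+ = Id_on A" for A :: "('a \<times> 'b) set"
      by (rule trancl_id) (auto intro: transI)
    have "(\<Union>U\<in>\<O>. ?c U) = Id_on (\<Union>\<O>)" if "\<forall>U\<in>\<O>. openin ?T U" for \<O>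
      using that by (auto simp: Id_on_def)
    then have "circulation ?T ?c"
      unfolding circulation_def by (auto simp: Id preorder_on_def refl_on_def intro: transI openin_Union)
    moreover have "stream_map \<lparr>topo = ?T, circ = ?c\<rparr> Z p"
      if "stream Z" "continuous_map ?T (topo Z) p" for Z :: "'c prestream" and p
      using that unfolding stream_map_def
      by (auto simp: circ_refl dest: openin_continuous_map_preimage split: if_splits)
    ultimately have "product_circ X Y ?c"
      unfolding product_circ_def using X Y continuous_map_fst continuous_map_snd
      by (auto simp: stream_map_def circ_refl split: if_splits)
    then show ?thesis using that by (intro exI[of _ ?c]) auto
  qed
  {
    fix U assume "openin (topo (prod_stream X Y)) U"
    then have U: "openin ?T U" by simp
    have "?d U \<subseteq> U \<times> U" using po[OF _ U] by (auto simp: preorder_on_def)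
    then have "(?d U)\<^sup>+ \<subseteq> U \<times> U" by (rule trancl_subset_Sigma)
    then show "preorder_on U (circ (prod_stream X Y) U)"
      unfolding preorder_on_def refl_on_def circ using ne[OF U] by (auto intro!: r_into_trancl)
  next
    fix U assume "\<not> openin (topo (prod_stream X Y)) U"
    then have "?d U = {}" by (auto simp: product_circ_def circulation_def)
    then show "circ (prod_stream X Y) U = {}" by (simp only: circ trancl_empty)
  next
    fix \<O> assume "\<forall>U\<in>\<O>. openin (topo (prod_stream X Y)) U"
    then have op: "\<forall>U\<in>\<O>. openin ?T U" by simp
    have un: "c (\<Union>\<O>) = (\<Union>U\<in>\<O>. c U)\<^sup>+" if "c \<in> ?C" for c
      using that op by (auto simp: product_circ_def circulation_def)
    have "(\<Union>U\<in>\<O>. c U)\<^sup>+ \<subseteq> (\<Union>U\<in>\<O>. (?d U)\<^sup>+)\<^sup>+" if "c \<in> ?C" for c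
      using that by (intro trancl_mono_subset) (auto intro!: r_into_trancl)
    then have 1: "?d (\<Union>\<O>) \<subseteq> (\<Union>U\<in>\<O>. (?d U)\<^sup>+)\<^sup>+"
      using un by blast
    have "c U \<subseteq> c (\<Union>\<O>)" if "c \<in> ?C" "U \<in> \<O>" for c U
      unfolding un[OF that(1)] using that by (auto intro!: r_into_trancl)
    then have "?d U \<subseteq> ?d (\<Union>\<O>)" if "U \<in> \<O>" for U using that by blast
    then have "(?d U)\<^sup>+ \<subseteq> (?d (\<Union>\<O>))\<^sup>+" if "U \<in> \<O>" for U
      using that by (intro trancl_mono_subset)
    then have "(\<Union>U\<in>\<O>. (?d U)\<^sup>+) \<subseteq> (?d (\<Union>\<O>))\<^sup>+" by (intro UN_least)
    from trancl_mono_subset[OF this] trancl_mono_subset[OF 1]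
    show "circ (prod_stream X Y) (\<Union>\<O>) = (\<Union>U\<in>\<O>. circ (prod_stream X Y) U)\<^sup>+"
      unfolding circ by simp
  }
qed

lemma stream_map_prod_stream_proj:
  assumes X: "stream X" and Y: "stream Y"
  shows "stream_map (prod_stream X Y) X fst" "stream_map (prod_stream X Y) Y snd"
proof -
  let ?T = "prod_topology (topo X) (topo Y)"
  have *: "stream_map (prod_stream X Y) Z p"
    if Z: "stream Z" and p: "continuous_map ?T (topo Z) p"
      and c: "\<And>c. product_circ X Y c \<Longrightarrow> stream_map \<lparr>topo = ?T, circ = c\<rparr> Z p" for Z :: "'c prestream" and p
    unfolding stream_map_def
  proof (intro conjI allI impI)
    show "continuous_map (topo (prod_stream X Y)) (topo Z) p" using p by simp
    fix U assume U: "openin (topo Z) U"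
    show "\<forall>(x, y)\<in>circ (prod_stream X Y) {x \<in> points (prod_stream X Y). p x \<in> U}. (p x, p y) \<in> circ Z U"
    proof safe
      fix x1 x2 y1 y2
      assume "((x1, x2), (y1, y2)) \<in> circ (prod_stream X Y) {x \<in> points (prod_stream X Y). p x \<in> U}"
      then have "((x1, x2), (y1, y2)) \<in> (\<Union>c\<in>Collect (product_circ X Y). c {x \<in> topspace ?T. p x \<in> U})\<^sup>+"
        unfolding prod_stream_def by simp
      then show "(p (x1, x2), p (y1, y2)) \<in> circ Z U"
      proof (rule trancl_image_into)
        fix x y assume "(x, y) \<in> (\<Union>c\<in>Collect (product_circ X Y). c {x \<in> topspace ?T. p x \<in> U})"
        then obtain d where "product_circ X Y d" "(x, y) \<in> d {x \<in> topspace ?T. p x \<in> U}" by blast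
        then show "(p x, p y) \<in> circ Z U"
          using stream_mapD[OF c U, of d x y] by simp
      qed (rule circ_trans[OF Z U])
    qed
  qed
  show "stream_map (prod_stream X Y) X fst"
    unfolding stream_map_def using *[of X fst] X by (auto simp: product_circ_def stream_map_def continuous_map_fst)
  show "stream_map (prod_stream X Y) Y snd"
    unfolding stream_map_def using *[of Y snd] Y by (auto simp: product_circ_def stream_map_def continuous_map_snd)
qed

text \<open>The identity is itself one of the test maps, which settles both finality conditions of a
  k-stream at once.\<close>

lemma compact_Hausdorff_imp_ditop:
  assumes X: "compact_hausdorff_stream X"
  shows "ditop X"
proof -
  have s: "stream X" and H: "Hausdorff_space (topo X)"
    using X by (auto simp: compact_hausdorff_stream_def)
  have idm: "stream_map X X (\<lambda>x. x)" using s by (rule stream_map_id)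
  have U: "{a \<in> points X. a \<in> U} = U" if "U \<subseteq> points X" for U
    using that by auto
  have "k_stream X"
    unfolding k_stream_def
  proof (intro conjI allI impI s)
    fix U assume sub: "U \<subseteq> points X" and
      "\<forall>(K :: 'a prestream) f. compact_hausdorff_stream K \<and> stream_map K X f \<longrightarrow>
          openin (topo K) {a \<in> points K. f a \<in> U}"
    then have "openin (topo X) {a \<in> points X. a \<in> U}"
      using X idm by fast
    then show "openin (topo X) U" using U[OF sub] by simp
  next
    fix V assume V: "openin (topo X) V"
    show "circ X V \<subseteq> {(f a, f b) | (K :: 'a prestream) f a b.
            compact_hausdorff_stream K \<and> stream_map K X f \<and>
            (a, b) \<in> circ K {a \<in> points K. f a \<in> V}}\<^sup>+"
    proof safe
      fix a b assume "(a, b) \<in> circ X V"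
      then have "(a, b) \<in> circ X {a \<in> points X. a \<in> V}"
        using U[OF openin_subset[OF V]] by simp
      then show "(a, b) \<in> {(f a, f b) | (K :: 'a prestream) f a b.
            compact_hausdorff_stream K \<and> stream_map K X f \<and>
            (a, b) \<in> circ K {a \<in> points K. f a \<in> V}}\<^sup>+"
        using X idm by (intro r_into_trancl CollectI exI[of _ X] exI[of _ "\<lambda>x. x"] exI[of _ a] exI[of _ b]) simp
    qed
  qed
  then show ?thesis
    using Hausdorff_imp_weak_hausdorff[OF H] by (simp add: ditop_def)
qed

text \<open>For compact Hausdorff factors the product topology is again compact Hausdorff, so no
  refinement to a k-topology intervenes. Spheres and the interval are of this kind.\<close>

lemma ditop_product_eq:
  assumes X: "compact_hausdorff_stream X" and Y: "compact_hausdorff_stream Y"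
  shows "ditop_product X Y = prod_stream X Y"
proof -
  have sX: "stream X" and sY: "stream Y"
    using X Y by (auto simp: compact_hausdorff_stream_def)
  note sP = stream_prod_stream[OF sX sY]
  have "compact_hausdorff_stream (prod_stream X Y)"
    using X Y sP unfolding compact_hausdorff_stream_def
    by (auto simp: compact_space_prod_topology Hausdorff_space_prod_topology)
  then have ditop: "ditop (prod_stream X Y)" by (rule compact_Hausdorff_imp_ditop)
  have P: "is_ditop_product X Y (prod_stream X Y)"
    unfolding is_ditop_product_def
    using ditop stream_map_prod_stream_proj[OF sX sY] prod_stream_initial[OF _ sX sY]
    by (auto simp: ditop_def k_stream_def)
  \<comment> \<open>Each product serves as a test object for the other and the induced map is the
    identity. Hence open sets and preorders are compared in both directions.\<close>
  have uniq: "P = P'" if "is_ditop_product X Y P" "is_ditop_product X Y P'" for P P'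
  proof -
    have pts: "points P = points P'" and s: "stream P" "stream P'"
      using that by (auto simp: is_ditop_product_def ditop_def k_stream_def)
    have "stream_map P P' (\<lambda>q. (fst q, snd q))"
      using that unfolding is_ditop_product_def by blast
    then have id1: "stream_map P P' (\<lambda>q. q)" by simp
    have "stream_map P' P (\<lambda>q. (fst q, snd q))"
      using that unfolding is_ditop_product_def by blast
    then have id2: "stream_map P' P (\<lambda>q. q)" by simp
    have le: "openin (topo A) U \<and> circ A U \<subseteq> circ B U"
      if "stream_map A B (\<lambda>q. q)" "points A = points B" "openin (topo B) U" for A B :: "('a \<times> 'b) prestream" and U
    proof -
      have eq: "{x \<in> points A. x \<in> U} = U" using that openin_subset by blast
      then show ?thesis using that unfolding stream_map_def continuous_map_def by fastforce
    qed
    have op: "openin (topo P) U \<longleftrightarrow> openin (topo P') U" for U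
      using le[OF id1 pts] le[OF id2 pts[symmetric]] by blast
    then have "topo P = topo P'" by (simp add: topology_eq)
    moreover have "circ P U = circ P' U" for U
    proof (cases "openin (topo P) U")
      case True
      then show ?thesis using le[OF id1 pts, of U] le[OF id2 pts[symmetric], of U] op by blast
    next
      case False
      then show ?thesis using circ_not_open s op by metis
    qed
    ultimately show "P = P'" by (intro prestream.equality) auto
  qed
  show ?thesis
    unfolding ditop_product_def using P uniq by (intro the_equality) auto
qed

text \<open>A product stream is locally a product, so one can move in one variable at a time.\<close>

lemma stream_map_from_prod_stream:
  assumes X: "stream X" and Y: "stream Y" and Z: "stream Z"
    and cont: "continuous_map (prod_topology (topo X) (topo Y)) (topo Z) h"
    and h1: "\<And>y. y \<in> points Y \<Longrightarrow> stream_map X Z (\<lambda>x. h (x, y))"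
    and h2: "\<And>x. x \<in> points X \<Longrightarrow> stream_map Y Z (\<lambda>y. h (x, y))"
  shows "stream_map (prod_stream X Y) Z h"
  unfolding stream_map_def
proof (intro conjI allI impI)
  let ?P = "prod_stream X Y"
  note sP = stream_prod_stream[OF X Y]
  note proj = stream_map_prod_stream_proj[OF X Y]
  show "continuous_map (topo ?P) (topo Z) h" using cont by simp
  fix U assume U: "openin (topo Z) U"
  let ?V = "{z \<in> points ?P. h z \<in> U}"
  have V: "openin (topo ?P) ?V"
    using openin_continuous_map_preimage[OF cont U] by simp
  \<comment> \<open>Open boxes inside the preimage cover it, so by the union axiom a relation there
    is a chain of relations within single boxes.\<close>
  let ?\<O> = "{A \<times> B | A B. openin (topo X) A \<and> openin (topo Y) B \<and> A \<times> B \<subseteq> ?V}"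
  have "?V = \<Union>?\<O>"
  proof
    show "?V \<subseteq> \<Union>?\<O>"
    proof
      fix z assume z: "z \<in> ?V"
      then obtain x y where xy: "z = (x, y)" by (cases z)
      have "openin (prod_topology (topo X) (topo Y)) ?V" "(x, y) \<in> ?V"
        using V z xy by simp_all
      then obtain A B where "openin (topo X) A" "openin (topo Y) B" "x \<in> A" "y \<in> B" "A \<times> B \<subseteq> ?V"
        unfolding openin_prod_topology_alt by meson
      then show "z \<in> \<Union>?\<O>" unfolding xy by blast
    qed
  qed blast
  moreover have "circ ?P (\<Union>?\<O>) = (\<Union>W\<in>?\<O>. circ ?P W)\<^sup>+"
    by (rule circ_Union[OF sP]) (auto simp: openin_prod_Times_iff)
  ultimately have circ: "circ ?P ?V = (\<Union>W\<in>?\<O>. circ ?P W)\<^sup>+" by simp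
  show "\<forall>(x, y)\<in>circ ?P ?V. (h x, h y) \<in> circ Z U"
  proof safe
    fix x1 y1 x2 y2 assume "((x1, y1), (x2, y2)) \<in> circ ?P ?V"
    then have "((x1, y1), (x2, y2)) \<in> (\<Union>W\<in>?\<O>. circ ?P W)\<^sup>+" unfolding circ .
    then show "(h (x1, y1), h (x2, y2)) \<in> circ Z U"
    proof (rule trancl_image_into)
      show "trans (circ Z U)" by (rule circ_trans[OF Z U])
      fix z w assume "(z, w) \<in> (\<Union>W\<in>?\<O>. circ ?P W)"
      then obtain A B where A: "openin (topo X) A" and B: "openin (topo Y) B" and AB: "A \<times> B \<subseteq> ?V"
        and zw: "(z, w) \<in> circ ?P (A \<times> B)" by blast
      obtain z1 z2 w1 w2 where z: "z = (z1, z2)" and w: "w = (w1, w2)" by (cases z, cases w)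
      have opAB: "openin (topo ?P) (A \<times> B)" using A B by (simp add: openin_prod_Times_iff)
      have pts: "z1 \<in> A" "z2 \<in> B" "w1 \<in> A" "w2 \<in> B"
        using circ_subset[OF sP opAB] zw z w by auto
      have "openin (topo ?P) {p \<in> points ?P. fst p \<in> A}" "openin (topo ?P) {p \<in> points ?P. snd p \<in> B}"
        using openin_continuous_map_preimage[of "topo ?P" "topo X" fst A] openin_continuous_map_preimage[of "topo ?P" "topo Y" snd B]
          proj A B by (simp_all add: stream_map_def)
      moreover have "A \<times> B \<subseteq> points ?P" using openin_subset[OF opAB] .
      ultimately have "circ ?P (A \<times> B) \<subseteq> circ ?P {p \<in> points ?P. fst p \<in> A}"
        and "circ ?P (A \<times> B) \<subseteq> circ ?P {p \<in> points ?P. snd p \<in> B}"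
        using circ_mono[OF sP opAB, of "{p \<in> points ?P. fst p \<in> A}"]
          circ_mono[OF sP opAB, of "{p \<in> points ?P. snd p \<in> B}"] by fastforce+
      then have "(z1, w1) \<in> circ X A" "(z2, w2) \<in> circ Y B"
        using stream_mapD[OF proj(1) A, of z w] stream_mapD[OF proj(2) B, of z w] zw z w by auto
      moreover have "openin (topo X) {x \<in> points X. h (x, z2) \<in> U}" "openin (topo Y) {y \<in> points Y. h (w1, y) \<in> U}"
        using openin_stream_map_preimage[OF h1 U] openin_stream_map_preimage[OF h2 U]
          pts openin_subset[OF A] openin_subset[OF B] by auto
      moreover have "A \<subseteq> {x \<in> points X. h (x, z2) \<in> U}" "B \<subseteq> {y \<in> points Y. h (w1, y) \<in> U}"
        using AB pts openin_subset[OF A] openin_subset[OF B] by auto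
      ultimately have "(z1, w1) \<in> circ X {x \<in> points X. h (x, z2) \<in> U}"
        and "(z2, w2) \<in> circ Y {y \<in> points Y. h (w1, y) \<in> U}"
        using circ_mono[OF X A] circ_mono[OF Y B] by blast+
      \<comment> \<open>The move is split at the corner \<open>(w1, z2)\<close>, which lies in the
        same box and therefore over \<open>U\<close>.\<close>
      then have "(h (z1, z2), h (w1, z2)) \<in> circ Z U" "(h (w1, z2), h (w1, w2)) \<in> circ Z U"
        using stream_mapD[OF h1 U] stream_mapD[OF h2 U] pts openin_subset[OF A] openin_subset[OF B]
        by blast+
      then show "(h z, h w) \<in> circ Z U"
        unfolding z w using circ_trans[OF Z U] by (blast dest: transD)
    qed
  qed
qed

subsection \<open>Directed cubes\<close>

definition near :: "nat \<Rightarrow> real \<Rightarrow> (nat \<Rightarrow> real) \<Rightarrow> (nat \<Rightarrow> real) \<Rightarrow> bool" where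
  "near n r x y \<longleftrightarrow> (\<forall>i<n. \<bar>y i - x i\<bar> < r)"

definition cle :: "nat \<Rightarrow> (nat \<Rightarrow> real) \<Rightarrow> (nat \<Rightarrow> real) \<Rightarrow> bool" where
  "cle n x y \<longleftrightarrow> (\<forall>i<n. x i \<le> y i)"

definition cbetween :: "nat \<Rightarrow> (nat \<Rightarrow> real) \<Rightarrow> (nat \<Rightarrow> real) \<Rightarrow> (nat \<Rightarrow> real) set" where
  "cbetween n x y = {z \<in> icube n. cle n x z \<and> cle n z y}"

text \<open>The explicit candidate for the circulation that \<open>dcube\<close> selects by
  \<open>THE\<close>: an order relation is an elementary move in \<open>V\<close> when its whole
  order interval lies in \<open>V\<close>.\<close>

definition dcirc :: "nat \<Rightarrow> (nat \<Rightarrow> real) set \<Rightarrow> (nat \<Rightarrow> real) rel" where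
  "dcirc n V = {(x, y). x \<in> icube n \<and> y \<in> icube n \<and> cle n x y \<and> cbetween n x y \<subseteq> V}\<^sup>+"

lemma cle_refl [simp]: "cle n x x" by (simp add: cle_def)
lemma cle_trans: "cle n x y \<Longrightarrow> cle n y z \<Longrightarrow> cle n x z" by (fastforce simp: cle_def)
lemma near_refl [simp]: "0 < r \<Longrightarrow> near n r x x" by (simp add: near_def)
lemma near_mono: "near n r x y \<Longrightarrow> r \<le> s \<Longrightarrow> near n s x y" by (fastforce simp: near_def)
lemma near_sym: "near n r x y \<Longrightarrow> near n r y x" by (simp add: near_def abs_minus_commute)
lemma near_trans: "near n r x y \<Longrightarrow> near n s y z \<Longrightarrow> near n (r + s) x z"
  unfolding near_def by (intro allI impI) (smt (verit, best))
lemma near_between: "near n r x y \<Longrightarrow> near n r x z \<Longrightarrow> cle n y w \<Longrightarrow> cle n w z \<Longrightarrow> near n r x w"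
  unfolding near_def cle_def by (intro allI impI) (smt (verit, best))

lemma icube_ext: "x \<in> icube n \<Longrightarrow> y \<in> icube n \<Longrightarrow> (\<And>i. i < n \<Longrightarrow> x i = y i) \<Longrightarrow> x = y"
  unfolding icube_def by (rule PiE_ext) auto

lemma icubeD: "x \<in> icube n \<Longrightarrow> i < n \<Longrightarrow> 0 \<le> x i \<and> x i \<le> 1"
  unfolding icube_def by (auto dest!: PiE_mem)

lemma icube_restrict: "(\<And>i. i < n \<Longrightarrow> 0 \<le> g i \<and> g i \<le> 1) \<Longrightarrow> (\<lambda>i\<in>{..<n}. g i) \<in> icube n"
  by (auto simp: icube_def)

lemma cbetween_refl: "x \<in> icube n \<Longrightarrow> cbetween n x x = {x}"
  unfolding cbetween_def cle_def by (auto intro: icube_ext antisym)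

lemma cbetween_ends: "x \<in> icube n \<Longrightarrow> y \<in> icube n \<Longrightarrow> cle n x y \<Longrightarrow> x \<in> cbetween n x y \<and> y \<in> cbetween n x y"
  by (auto simp: cbetween_def)

lemma topspace_icube [simp]: "topspace (icube_topology n) = icube n"
  by (simp add: icube_topology_def icube_def)

lemma compact_space_icube: "compact_space (icube_topology n)"
  unfolding icube_topology_def compact_space_product_topology
  by (simp add: compact_space_subtopology)

lemma Hausdorff_space_icube: "Hausdorff_space (icube_topology n)"
  unfolding icube_topology_def Hausdorff_space_product_topology
  by (simp add: Hausdorff_space_subtopology)

lemma openin_icube:
  "openin (icube_topology n) V \<longleftrightarrow>
    V \<subseteq> icube n \<and> (\<forall>x\<in>V. \<exists>r>0. \<forall>y\<in>icube n. near n r x y \<longrightarrow> y \<in> V)"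
proof
  assume V: "openin (icube_topology n) V"
  then have sub: "V \<subseteq> icube n" using openin_subset by fastforce
  have "\<exists>r>0. \<forall>y\<in>icube n. near n r x y \<longrightarrow> y \<in> V" if x: "x \<in> V" for x
  proof -
    obtain U where U: "\<forall>i\<in>{..<n}. openin (top_of_set {0..1}) (U i)" "x \<in> PiE {..<n} U" "PiE {..<n} U \<subseteq> V"
      using V x unfolding icube_topology_def openin_product_topology_alt by blast
    have "\<exists>r>0. \<forall>t\<in>{0..1}. \<bar>t - x i\<bar> < r \<longrightarrow> t \<in> U i" if "i < n" for i
    proof -
      obtain T where T: "open T" "U i = {0..1} \<inter> T"
        using U(1) \<open>i < n\<close> by (auto simp: openin_open)
      moreover have "x i \<in> U i" using U(2) that by auto
      ultimately obtain r where "r > 0" "\<And>t. dist t (x i) < r \<Longrightarrow> t \<in> T"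
        by (metis IntD2 open_dist)
      then show ?thesis using T by (auto simp: dist_real_def)
    qed
    then obtain r where r: "\<And>i. i < n \<Longrightarrow> 0 < r i \<and> (\<forall>t\<in>{0..1}. \<bar>t - x i\<bar> < r i \<longrightarrow> t \<in> U i)"
      by metis
    define m where "m = Min (insert 1 (r ` {..<n}))"
    have m: "0 < m" "\<And>i. i < n \<Longrightarrow> m \<le> r i"
      unfolding m_def using r by (auto simp: Min_gr_iff)
    have "y \<in> V" if "y \<in> icube n" "near n m x y" for y
    proof -
      have "y i \<in> U i" if "i < n" for i
        using r[OF that] m(2)[OF that] \<open>near n m x y\<close> icubeD[OF \<open>y \<in> icube n\<close> that] that
        by (auto simp: near_def)
      then have "y \<in> PiE {..<n} U" using \<open>y \<in> icube n\<close> by (auto simp: icube_def PiE_iff)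
      then show ?thesis using U(3) by blast
    qed
    then show ?thesis using m by blast
  qed
  then show "V \<subseteq> icube n \<and> (\<forall>x\<in>V. \<exists>r>0. \<forall>y\<in>icube n. near n r x y \<longrightarrow> y \<in> V)"
    using sub by blast
next
  assume R: "V \<subseteq> icube n \<and> (\<forall>x\<in>V. \<exists>r>0. \<forall>y\<in>icube n. near n r x y \<longrightarrow> y \<in> V)"
  show "openin (icube_topology n) V"
    unfolding icube_topology_def openin_product_topology_alt
  proof
    fix x assume x: "x \<in> V"
    then obtain r where r: "r > 0" "\<forall>y\<in>icube n. near n r x y \<longrightarrow> y \<in> V" using R by blast
    define U where "U = (\<lambda>i. {0..1} \<inter> ball (x i) r)"
    have "x \<in> icube n" using x R by blast
    then have "x \<in> PiE {..<n} U"
      using r by (auto simp: U_def icube_def PiE_iff)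
    moreover have "PiE {..<n} U \<subseteq> V"
    proof
      fix y assume y: "y \<in> PiE {..<n} U"
      then have "y \<in> icube n" by (auto simp: icube_def U_def PiE_iff)
      moreover have "near n r x y"
        using y by (auto simp: near_def U_def PiE_iff dist_real_def abs_minus_commute)
      ultimately show "y \<in> V" using r by blast
    qed
    moreover have "finite {i \<in> {..<n}. U i \<noteq> topspace (top_of_set {0..1})}" by simp
    moreover have "\<forall>i\<in>{..<n}. openin (top_of_set {0..1}) (U i)"
      by (auto simp: U_def openin_open)
    ultimately show "\<exists>U. finite {i \<in> {..<n}. U i \<noteq> topspace (top_of_set {0..1})} \<and>
        (\<forall>i\<in>{..<n}. openin (top_of_set {0..1}) (U i)) \<and> x \<in> PiE {..<n} U \<and> PiE {..<n} U \<subseteq> V"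
      by blast
  qed
qed

lemma openin_icube_near: "openin (icube_topology n) {z \<in> icube n. near n r x z}"
  unfolding openin_icube
proof safe
  fix z assume z: "z \<in> icube n" "near n r x z"
  show "\<exists>s>0. \<forall>y\<in>icube n. near n s z y \<longrightarrow> y \<in> {z \<in> icube n. near n r x z}"
  proof (cases "n = 0")
    case True
    then show ?thesis by (auto simp: near_def intro!: exI[of _ 1])
  next
    case False
    define s where "s = Min ((\<lambda>i. r - \<bar>z i - x i\<bar>) ` {..<n})"
    have ne: "(\<lambda>i. r - \<bar>z i - x i\<bar>) ` {..<n} \<noteq> {}" using False by auto
    have "0 < s" "\<And>i. i < n \<Longrightarrow> s \<le> r - \<bar>z i - x i\<bar>"
      using z Min_gr_iff[OF _ ne] by (auto simp: s_def near_def)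
    then show ?thesis
      unfolding near_def by (intro exI[of _ s]) (smt (verit) mem_Collect_eq)
  qed
qed

lemma openin_icube_not_between: "openin (icube_topology n) (icube n - cbetween n x y)"
  unfolding openin_icube
proof safe
  fix z assume z: "z \<in> icube n" "z \<notin> cbetween n x y"
  then consider i where "i < n" "z i < x i" | i where "i < n" "y i < z i"
    by (force simp: cbetween_def cle_def)
  then show "\<exists>r>0. \<forall>w\<in>icube n. near n r z w \<longrightarrow> w \<in> icube n - cbetween n x y"
  proof cases
    case 1
    then show ?thesis
      by (intro exI[of _ "x i - z i"]) (auto simp: near_def cbetween_def cle_def dest!: spec[of _ i])
  next
    case 2
    then show ?thesis
      by (intro exI[of _ "z i - y i"]) (auto simp: near_def cbetween_def cle_def dest!: spec[of _ i])
  qed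
qed

lemma icube_Lebesgue_number:
  assumes op: "\<And>U. U \<in> \<U> \<Longrightarrow> openin (icube_topology n) U" and cov: "icube n \<subseteq> \<Union>\<U>"
  obtains \<delta> where "\<delta> > 0" "\<And>x. x \<in> icube n \<Longrightarrow> \<exists>U\<in>\<U>. \<forall>y\<in>icube n. near n \<delta> x y \<longrightarrow> y \<in> U"
proof -
  \<comment> \<open>The factor 2 reserves one radius for the distance from the centre and one for
    the Lebesgue number.\<close>
  define ok where "ok = (\<lambda>x r. r > 0 \<and> (\<exists>U\<in>\<U>. \<forall>y\<in>icube n. near n (2 * r) x y \<longrightarrow> y \<in> U))"
  have "\<exists>r. ok x r" if x: "x \<in> icube n" for x
  proof -
    obtain U where U: "U \<in> \<U>" "x \<in> U" using cov x by blast
    then obtain r where "r > 0" "\<forall>y\<in>icube n. near n r x y \<longrightarrow> y \<in> U"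
      using op[of U] unfolding openin_icube by blast
    then show ?thesis using U by (intro exI[of _ "r / 2"]) (auto simp: ok_def)
  qed
  then obtain r where r: "\<And>x. x \<in> icube n \<Longrightarrow> ok x (r x)" by metis
  let ?B = "\<lambda>x. {z \<in> icube n. near n (r x) x z}"
  have "\<exists>F. finite F \<and> F \<subseteq> ?B ` icube n \<and> topspace (icube_topology n) \<subseteq> \<Union>F"
  proof (rule compact_space_icube[of n, unfolded compact_space_alt, THEN spec, THEN mp], intro conjI ballI)
    show "openin (icube_topology n) U" if "U \<in> ?B ` icube n" for U
      using that openin_icube_near by blast
    show "topspace (icube_topology n) \<subseteq> \<Union>(?B ` icube n)"
      using r by (auto simp: ok_def)
  qed
  then obtain F where F: "finite F" "F \<subseteq> ?B ` icube n" "icube n \<subseteq> \<Union>F" by auto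
  obtain S where S: "finite S" "S \<subseteq> icube n" "F = ?B ` S"
    using finite_subset_image[OF F(1,2)] by blast
  define \<delta> where "\<delta> = Min (insert 1 (r ` S))"
  have \<delta>: "0 < \<delta>" "\<And>x. x \<in> S \<Longrightarrow> \<delta> \<le> r x"
    unfolding \<delta>_def using S r by (auto simp: Min_gr_iff ok_def)
  have "\<exists>U\<in>\<U>. \<forall>y\<in>icube n. near n \<delta> x y \<longrightarrow> y \<in> U" if x: "x \<in> icube n" for x
  proof -
    obtain c where c: "c \<in> S" "near n (r c) c x" using x F(3) S(3) by blast
    then obtain U where U: "U \<in> \<U>" "\<forall>y\<in>icube n. near n (2 * r c) c y \<longrightarrow> y \<in> U"
      using r[of c] S(2) unfolding ok_def by blast
    have "near n (2 * r c) c y" if "near n \<delta> x y" for y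
      using near_trans[OF c(2) near_mono[OF that \<delta>(2)[OF c(1)]]] by simp
    then show ?thesis using U by blast
  qed
  then show thesis using that \<delta>(1) by blast
qed

section \<open>The circulation of a cube is determined by its order\<close>

lemma mem_circ_basic:
  "x \<in> icube n \<Longrightarrow> y \<in> icube n \<Longrightarrow> cle n x y \<Longrightarrow> cbetween n x y \<subseteq> V \<Longrightarrow> (x, y) \<in> dcirc n V"
  unfolding dcirc_def by (intro r_into_trancl) simp

text \<open>Affine interpolation in \<open>K\<close> steps. Coordinates of the cube differ by at
  most 1, so \<open>K > 1 / d\<close> makes every step shorter than \<open>d\<close>.\<close>

lemma cbetween_interpolate:
  assumes x: "x \<in> icube n" and y: "y \<in> icube n" and xy: "cle n x y" and d: "0 < d"
  obtains K z where "z 0 = x" "z K = y" "\<And>j. j \<le> K \<Longrightarrow> z j \<in> cbetween n x y"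
    "\<And>j. j < K \<Longrightarrow> cle n (z j) (z (Suc j))" "\<And>j. j < K \<Longrightarrow> near n d (z j) (z (Suc j))"
proof -
  obtain K :: nat where K: "1 / d < real K" using reals_Archimedean2 by blast
  moreover have "0 < 1 / d" using d by simp
  ultimately have K0: "0 < real K" by linarith
  then have Kd: "1 / real K < d" using K d by (simp add: field_simps)
  define z where "z = (\<lambda>j. \<lambda>i\<in>{..<n}. x i + (real j / real K) * (y i - x i))"
  have le: "0 \<le> y i - x i" "y i - x i \<le> 1" if "i < n" for i
    using icubeD[OF x that] icubeD[OF y that] xy that by (auto simp: cle_def)
  have zi: "x i \<le> z j i \<and> z j i \<le> y i" if "j \<le> K" "i < n" for i j
  proof -
    have "0 \<le> real j / real K" "real j / real K \<le> 1" using that K0 by auto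
    then have "0 \<le> (real j / real K) * (y i - x i)" "(real j / real K) * (y i - x i) \<le> y i - x i"
      using le[OF that(2)] mult_right_mono[of "real j / real K" 1 "y i - x i"] by simp_all
    then show ?thesis using that by (simp add: z_def)
  qed
  show thesis
  proof (rule that[of z K])
    show "z 0 = x" by (rule icube_ext[OF _ x]) (use x in \<open>auto simp: z_def intro!: icube_restrict dest: icubeD\<close>)
    show "z K = y" by (rule icube_ext[OF _ y]) (use y K0 in \<open>auto simp: z_def intro!: icube_restrict dest: icubeD\<close>)
    fix j
    { assume j: "j \<le> K"
      have "z j \<in> icube n"
        unfolding z_def using zi[OF j] icubeD[OF x] icubeD[OF y]
        by (intro icube_restrict) (fastforce simp: z_def)
      then show "z j \<in> cbetween n x y" using zi[OF j] by (auto simp: cbetween_def cle_def) }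
    { assume j: "j < K"
      have "z (Suc j) i - z j i = (y i - x i) / real K" if "i < n" for i
        using that K0 by (simp add: z_def field_simps)
      moreover have "0 \<le> (y i - x i) / real K" "(y i - x i) / real K < d" if "i < n" for i
        using le[OF that] K0 Kd divide_right_mono[of "y i - x i" 1 "real K"] by (auto intro: order.strict_trans1)
      ultimately show "cle n (z j) (z (Suc j))" "near n d (z j) (z (Suc j))"
        unfolding cle_def near_def by (smt (verit))+ }
  qed
qed

text \<open>A compactness argument on order intervals: an interval inside \<open>V\<close> is
  subdivided so finely that each step falls into a neighbourhood where the local hypothesis applies,
  and transitivity of \<open>S\<close> joins the steps.\<close>

lemma dcirc_local:
  assumes V: "openin (icube_topology n) V" and xy: "(x, y) \<in> dcirc n V" and S: "trans S"
    and loc: "\<And>x0. x0 \<in> V \<Longrightarrow> \<exists>r>0. \<forall>x\<in>icube n. \<forall>y\<in>icube n.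
        near n r x0 x \<and> near n r x0 y \<and> cle n x y \<longrightarrow> (k x, k y) \<in> S"
  shows "(k x, k y) \<in> S"
  using xy unfolding dcirc_def
proof (rule trancl_image_into)
  show "trans S" by (rule S)
  fix x y assume "(x, y) \<in> {(x, y). x \<in> icube n \<and> y \<in> icube n \<and> cle n x y \<and> cbetween n x y \<subseteq> V}"
  then have x: "x \<in> icube n" and y: "y \<in> icube n" and xy: "cle n x y" and sub: "cbetween n x y \<subseteq> V" by auto
  define ok where "ok = (\<lambda>x0 r. r > 0 \<and> (\<forall>x\<in>icube n. \<forall>y\<in>icube n.
        near n r x0 x \<and> near n r x0 y \<and> cle n x y \<longrightarrow> (k x, k y) \<in> S))"
  \<comment> \<open>The complement of the interval completes the cover of the cube. It cannot be the
    member that contains a step, because \<open>z j\<close> lies in the interval.\<close>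
  let ?\<U> = "insert (icube n - cbetween n x y) {{z \<in> icube n. near n r x0 z} | x0 r. x0 \<in> V \<and> ok x0 r}"
  obtain d where d: "d > 0" "\<And>x. x \<in> icube n \<Longrightarrow> \<exists>U\<in>?\<U>. \<forall>y\<in>icube n. near n d x y \<longrightarrow> y \<in> U"
  proof (rule icube_Lebesgue_number[of ?\<U> n])
    show "openin (icube_topology n) U" if "U \<in> ?\<U>" for U
      using that openin_icube_near openin_icube_not_between by auto
    show "icube n \<subseteq> \<Union>?\<U>"
    proof
      fix w assume w: "w \<in> icube n"
      show "w \<in> \<Union>?\<U>"
      proof (cases "w \<in> cbetween n x y")
        case True
        then have wV: "w \<in> V" using sub by blast
        then obtain r where "ok w r" using loc unfolding ok_def by blast
        then have "w \<in> {z \<in> icube n. near n r w z}" using w by (simp add: ok_def)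
        then show ?thesis using wV \<open>ok w r\<close> by blast
      qed (use w in blast)
    qed
  qed blast
  obtain K z where z: "z 0 = x" "z K = y" "\<And>j. j \<le> K \<Longrightarrow> z j \<in> cbetween n x y"
    "\<And>j. j < K \<Longrightarrow> cle n (z j) (z (Suc j))" "\<And>j. j < K \<Longrightarrow> near n d (z j) (z (Suc j))"
    using cbetween_interpolate[OF x y xy d(1)] by blast
  have step: "(k (z j), k w) \<in> S" if "j \<le> K" "w \<in> icube n" "cle n (z j) w" "near n d (z j) w" for j w
  proof -
    have zj: "z j \<in> cbetween n x y" "z j \<in> icube n" using z(3)[OF that(1)] by (auto simp: cbetween_def)
    obtain U where U: "U \<in> ?\<U>" "\<forall>y\<in>icube n. near n d (z j) y \<longrightarrow> y \<in> U" using d(2)[OF zj(2)] by blast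
    have "z j \<in> U" "w \<in> U" using U(2) zj(2) that d(1) by auto
    then obtain x0 r where "ok x0 r" "near n r x0 (z j)" "near n r x0 w" using U(1) zj(1) by blast
    then show ?thesis using that zj(2) unfolding ok_def by blast
  qed
  have "(k x, k (z j)) \<in> S" if "j \<le> K" for j
    using that
  proof (induction j)
    case 0
    then show ?case using step[of 0 x] z(1) x d(1) by simp
  next
    case (Suc j)
    have "z (Suc j) \<in> icube n" using z(3)[of "Suc j"] Suc.prems by (auto simp: cbetween_def)
    then have "(k (z j), k (z (Suc j))) \<in> S" using step[of j "z (Suc j)"] z(4,5)[of j] Suc.prems by simp
    then show ?case using Suc S by (auto dest: transD)
  qed
  then show "(k x, k y) \<in> S" using z(2) by blast
qed

lemma dcirc_subset: "dcirc n V \<subseteq> {(x, y). x \<in> icube n \<and> y \<in> icube n \<and> cle n x y \<and> x \<in> V \<and> y \<in> V}"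
proof -
  have "(x, y) \<in> {(x, y). x \<in> icube n \<and> y \<in> icube n \<and> cle n x y \<and> x \<in> V \<and> y \<in> V}"
    if "(x, y) \<in> dcirc n V" for x y
    using that unfolding dcirc_def
    by (rule trancl_image_into[where f = "\<lambda>x. x"]) (auto dest: cbetween_ends cle_trans intro: transI)
  then show ?thesis by auto
qed

lemma circulation_dcirc:
  "circulation (icube_topology n) (\<lambda>V. if openin (icube_topology n) V then dcirc n V else {})"
  unfolding circulation_def
proof (intro conjI allI impI)
  fix V assume V: "openin (icube_topology n) V"
  have "(x, x) \<in> dcirc n V" if "x \<in> V" for x
  proof -
    have "x \<in> icube n" using that openin_subset[OF V] by auto
    then show ?thesis using that by (intro mem_circ_basic) (simp_all add: cbetween_refl)
  qed
  then show "preorder_on V (if openin (icube_topology n) V then dcirc n V else {})"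
    using V dcirc_subset[of n V] by (auto simp: preorder_on_def refl_on_def dcirc_def)
next
  fix \<O> assume op: "\<forall>U\<in>\<O>. openin (icube_topology n) U"
  then have un: "openin (icube_topology n) (\<Union>\<O>)" by auto
  have eq: "(\<Union>U\<in>\<O>. if openin (icube_topology n) U then dcirc n U else {}) = (\<Union>U\<in>\<O>. dcirc n U)"
    using op by auto
  have "dcirc n (\<Union>\<O>) = (\<Union>U\<in>\<O>. dcirc n U)\<^sup>+"
  proof (intro equalityI subrelI)
    fix x y assume xy: "(x, y) \<in> dcirc n (\<Union>\<O>)"
    show "(x, y) \<in> (\<Union>U\<in>\<O>. dcirc n U)\<^sup>+"
    proof (rule dcirc_local[OF un xy, where k = "\<lambda>x. x"])
      fix x0 assume "x0 \<in> \<Union>\<O>"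
      then obtain U r where U: "U \<in> \<O>" and r: "r > 0" "\<forall>y\<in>icube n. near n r x0 y \<longrightarrow> y \<in> U"
        using op unfolding openin_icube by (metis UnionE)
      have "(x, y) \<in> (\<Union>U\<in>\<O>. dcirc n U)\<^sup>+"
        if "x \<in> icube n" "y \<in> icube n" "near n r x0 x" "near n r x0 y" "cle n x y" for x y
      proof -
        have "cbetween n x y \<subseteq> U"
          using r(2) near_between[OF that(3,4)] by (auto simp: cbetween_def)
        then have "(x, y) \<in> dcirc n U" using that by (intro mem_circ_basic)
        then show ?thesis using U by blast
      qed
      then show "\<exists>r>0. \<forall>x\<in>icube n. \<forall>y\<in>icube n. near n r x0 x \<and> near n r x0 y \<and> cle n x y \<longrightarrow>
          (x, y) \<in> (\<Union>U\<in>\<O>. dcirc n U)\<^sup>+" using r(1) by blast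
    qed simp
  next
    have mono: "dcirc n U \<subseteq> dcirc n (\<Union>\<O>)" if "U \<in> \<O>" for U
      unfolding dcirc_def using that by (intro trancl_mono_subset) blast
    have "(\<Union>U\<in>\<O>. dcirc n U)\<^sup>+ \<subseteq> (dcirc n (\<Union>\<O>))\<^sup>+"
      using mono by (intro trancl_mono_subset) blast
    then show "(x, y) \<in> dcirc n (\<Union>\<O>)" if "(x, y) \<in> (\<Union>U\<in>\<O>. dcirc n U)\<^sup>+" for x y
      using that by (auto simp: dcirc_def)
  qed
  then show "(if openin (icube_topology n) (\<Union>\<O>) then dcirc n (\<Union>\<O>) else {}) =
      (\<Union>U\<in>\<O>. if openin (icube_topology n) U then dcirc n U else {})\<^sup>+"
    using un by (simp only: eq if_True)
qed auto

text \<open>Small boxes are order convex, which bounds \<open>c V\<close> by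
  \<open>dcirc n V\<close>. Conversely, the cube is covered by \<open>V\<close> and the complement
  of an order interval contained in \<open>V\<close>; a global relation between the ends of that
  interval breaks into pieces over these two sets, and none of the pieces can lie over the
  complement.\<close>

lemma circulation_icube_unique:
  assumes c: "circulation (icube_topology n) c"
    and top: "c (icube n) = {(x, y). x \<in> icube n \<and> y \<in> icube n \<and> (\<forall>i<n. x i \<le> y i)}"
  shows "c = (\<lambda>V. if openin (icube_topology n) V then dcirc n V else {})"
proof
  fix V
  let ?X = "\<lparr>topo = icube_topology n, circ = c\<rparr>"
  have s: "stream ?X" using c by (simp add: stream_def)
  have cle: "c (icube n) = {(x, y). x \<in> icube n \<and> y \<in> icube n \<and> cle n x y}"
    using top by (simp add: cle_def)
  have opI: "openin (icube_topology n) (icube n)"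
    using openin_topspace[of "icube_topology n"] by simp
  show "c V = (if openin (icube_topology n) V then dcirc n V else {})"
  proof (cases "openin (icube_topology n) V")
    case False
    then show ?thesis using circ_not_open[OF s] by simp
  next
    case V: True
    have sub: "c U \<subseteq> {(x, y). x \<in> icube n \<and> y \<in> icube n \<and> cle n x y \<and> x \<in> U \<and> y \<in> U}"
      if U: "openin (icube_topology n) U" for U
      using circ_subset[OF s, of U] circ_mono[OF s, of U "icube n"] opI U openin_subset[OF U] cle by auto
    have "c V \<subseteq> dcirc n V"
    proof -
      let ?\<O> = "{{z \<in> icube n. near n r x0 z} | x0 r. {z \<in> icube n. near n r x0 z} \<subseteq> V}"
      have "\<exists>W\<in>?\<O>. x \<in> W" if x: "x \<in> V" for x
      proof -
        have xi: "x \<in> icube n" using x openin_subset[OF V] by auto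
        obtain r where r: "r > 0" "\<forall>y\<in>icube n. near n r x y \<longrightarrow> y \<in> V"
          using x V unfolding openin_icube by blast
        then have "{z \<in> icube n. near n r x z} \<in> ?\<O>" by blast
        moreover have "x \<in> {z \<in> icube n. near n r x z}" using xi r by simp
        ultimately show ?thesis by blast
      qed
      then have "V = \<Union>?\<O>"
      proof (intro equalityI subsetI)
        fix x assume "x \<in> \<Union>?\<O>"
        then obtain x0 r where "x \<in> {z \<in> icube n. near n r x0 z}" "{z \<in> icube n. near n r x0 z} \<subseteq> V" by blast
        then show "x \<in> V" by (rule subsetD[rotated])
      qed (meson UnionI)
      moreover have "c (\<Union>?\<O>) = (\<Union>W\<in>?\<O>. c W)\<^sup>+"
        using circ_Union[OF s, of ?\<O>] openin_icube_near by auto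
      ultimately have eq: "c V = (\<Union>W\<in>?\<O>. c W)\<^sup>+" by simp
      \<comment> \<open>Two points of a box have their whole order interval in that box.\<close>
      have "c W \<subseteq> {(x, y). x \<in> icube n \<and> y \<in> icube n \<and> cle n x y \<and> cbetween n x y \<subseteq> V}" if WO: "W \<in> ?\<O>" for W
      proof -
        obtain x0 r where W: "W = {z \<in> icube n. near n r x0 z}" "W \<subseteq> V" using WO by blast
        have "openin (icube_topology n) W" using openin_icube_near W by simp
        from sub[OF this] show ?thesis
          using W near_between by (fastforce simp: cbetween_def)
      qed
      then show ?thesis unfolding eq dcirc_def by (intro trancl_mono_subset) blast
    qed
    moreover have "dcirc n V \<subseteq> c V"
    proof -
      have "(x, y) \<in> c V" if x: "x \<in> icube n" and y: "y \<in> icube n" and xy: "cle n x y" and B: "cbetween n x y \<subseteq> V" for x y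
      proof -
        let ?W = "icube n - cbetween n x y"
        have W: "openin (icube_topology n) ?W" by (rule openin_icube_not_between)
        have "\<Union>{V, ?W} = icube n" using B openin_subset[OF V] by auto
        moreover have "c (\<Union>{V, ?W}) = (\<Union>U\<in>{V, ?W}. c U)\<^sup>+"
          using circ_Union[OF s, of "{V, ?W}"] V W by auto
        moreover have "(x, y) \<in> c (icube n)" using cle x y xy by simp
        ultimately have "(x, y) \<in> (c V \<union> c ?W)\<^sup>+" by simp
        \<comment> \<open>A chain that starts at \<open>x\<close> and is still below
          \<open>y\<close> lies in the interval, so its next step cannot belong to
          \<open>c ?W\<close>.\<close>
        have "cle n z y \<longrightarrow> (x, z) \<in> c V \<and> cle n x z" if "(x, z) \<in> (c V \<union> c ?W)\<^sup>+" for z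
          using that
        proof (induction rule: trancl_induct)
          case (base z)
          then show ?case using sub[OF V] sub[OF W] x by (auto simp: cbetween_def)
        next
          case (step z w)
          show ?case
          proof
            assume wy: "cle n w y"
            have zw: "cle n z w" "z \<in> icube n" using step.hyps(2) sub[OF V] sub[OF W] by auto
            then have "cle n z y" using wy cle_trans by blast
            then have IH: "(x, z) \<in> c V" "cle n x z" using step.IH by auto
            then have "z \<in> cbetween n x y" using zw \<open>cle n z y\<close> by (simp add: cbetween_def)
            then have "(z, w) \<in> c V" using step.hyps(2) sub[OF W] by auto
            then show "(x, w) \<in> c V \<and> cle n x w"
              using IH zw circ_trans[OF s, of V] V cle_trans by (auto dest: transD)
          qed
        qed
        then show ?thesis using \<open>(x, y) \<in> (c V \<union> c ?W)\<^sup>+\<close> by auto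
      qed
      then have "{(x, y). x \<in> icube n \<and> y \<in> icube n \<and> cle n x y \<and> cbetween n x y \<subseteq> V} \<subseteq> c V" by blast
      then have "dcirc n V \<subseteq> (c V)\<^sup>+" unfolding dcirc_def by (rule trancl_mono_subset)
      then show ?thesis using circ_trans[OF s, of V] V by (simp add: trancl_id)
    qed
    ultimately show ?thesis using V by simp
  qed
qed

section \<open>Stream maps out of directed cubes\<close>

lemma topo_dcube [simp]: "topo (dcube n) = icube_topology n"
  by (simp add: dcube_def)

lemma circ_dcube_eq: "circ (dcube n) = (\<lambda>V. if openin (icube_topology n) V then dcirc n V else {})"
    (is "_ = ?c")
proof -
  have opI: "openin (icube_topology n) (icube n)"
    using openin_topspace[of "icube_topology n"] by simp
  have "dcirc n (icube n) = {(x, y). x \<in> icube n \<and> y \<in> icube n \<and> (\<forall>i<n. x i \<le> y i)}"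
  proof
    show "dcirc n (icube n) \<subseteq> {(x, y). x \<in> icube n \<and> y \<in> icube n \<and> (\<forall>i<n. x i \<le> y i)}"
      using dcirc_subset[of n "icube n"] by (auto simp: cle_def)
    show "{(x, y). x \<in> icube n \<and> y \<in> icube n \<and> (\<forall>i<n. x i \<le> y i)} \<subseteq> dcirc n (icube n)"
      by (auto intro!: mem_circ_basic simp: cle_def cbetween_def)
  qed
  then have "circulation (icube_topology n) ?c \<and>
      ?c (icube n) = {(x, y). x \<in> icube n \<and> y \<in> icube n \<and> (\<forall>i<n. x i \<le> y i)}"
    using circulation_dcirc[of n] opI by presburger
  then have "(THE c. circulation (icube_topology n) c \<and>
      c (icube n) = {(x, y). x \<in> icube n \<and> y \<in> icube n \<and> (\<forall>i<n. x i \<le> y i)}) = ?c"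
  proof (intro the_equality)
    fix c :: "(nat \<Rightarrow> real) set \<Rightarrow> (nat \<Rightarrow> real) rel"
    assume "circulation (icube_topology n) c \<and>
      c (icube n) = {(x, y). x \<in> icube n \<and> y \<in> icube n \<and> (\<forall>i<n. x i \<le> y i)}"
    then show "c = ?c" by (elim conjE) (rule circulation_icube_unique)
  qed
  then show ?thesis
    unfolding dcube_def by (simp only: prestream.simps)
qed

lemma stream_dcube: "stream (dcube n)"
  unfolding stream_def circ_dcube_eq using circulation_dcirc by simp

lemma circ_dcube: "openin (icube_topology n) V \<Longrightarrow> circ (dcube n) V = dcirc n V"
  by (simp add: circ_dcube_eq)

text \<open>The working criterion for maps out of cubes. Boxes being order convex, only order
  relations between points near a common centre need testing. Continuity is included: applied to a
  pair of equal points, the condition says that the image lies in \<open>U\<close>.\<close>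

lemma stream_map_dcube_iff:
  assumes X: "stream X"
  shows "stream_map (dcube n) X k \<longleftrightarrow> k \<in> icube n \<rightarrow> points X \<and>
    (\<forall>x0\<in>icube n. \<forall>U. openin (topo X) U \<and> k x0 \<in> U \<longrightarrow> (\<exists>r>0. \<forall>x\<in>icube n. \<forall>y\<in>icube n.
       near n r x0 x \<and> near n r x0 y \<and> cle n x y \<longrightarrow> (k x, k y) \<in> circ X U))"
    (is "_ \<longleftrightarrow> ?R")
proof
  assume k: "stream_map (dcube n) X k"
  then have cont: "continuous_map (icube_topology n) (topo X) k" by (simp add: stream_map_def)
  have "\<exists>r>0. \<forall>x\<in>icube n. \<forall>y\<in>icube n.
       near n r x0 x \<and> near n r x0 y \<and> cle n x y \<longrightarrow> (k x, k y) \<in> circ X U"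
    if x0: "x0 \<in> icube n" and U: "openin (topo X) U" "k x0 \<in> U" for x0 U
  proof -
    let ?V = "{x \<in> icube n. k x \<in> U}"
    have V: "openin (icube_topology n) ?V"
      using openin_continuous_map_preimage[OF cont U(1)] by simp
    moreover have "x0 \<in> ?V" using x0 U by simp
    ultimately obtain r where r: "r > 0" "\<forall>y\<in>icube n. near n r x0 y \<longrightarrow> y \<in> ?V"
      unfolding openin_icube by blast
    have "(k x, k y) \<in> circ X U"
      if "x \<in> icube n" "y \<in> icube n" "near n r x0 x" "near n r x0 y" "cle n x y" for x y
    proof -
      have "cbetween n x y \<subseteq> ?V"
        using r(2) near_between[OF that(3,4)] unfolding cbetween_def by blast
      then have "(x, y) \<in> circ (dcube n) {x \<in> points (dcube n). k x \<in> U}"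
        using that V by (simp add: circ_dcube mem_circ_basic)
      then show ?thesis by (rule stream_mapD[OF k U(1)])
    qed
    then show ?thesis using r(1) by blast
  qed
  moreover have "k \<in> icube n \<rightarrow> points X"
    using cont by (simp add: continuous_map_def)
  ultimately show ?R by blast
next
  assume R: ?R
  have cont: "continuous_map (icube_topology n) (topo X) k"
    unfolding continuous_map_def
  proof (intro conjI allI impI)
    show "k \<in> topspace (icube_topology n) \<rightarrow> points X" using R by simp
    fix U assume U: "openin (topo X) U"
    have "\<exists>r>0. \<forall>y\<in>icube n. near n r x y \<longrightarrow> k y \<in> U" if x: "x \<in> icube n" "k x \<in> U" for x
    proof -
      obtain r where r: "r > 0" "\<forall>a\<in>icube n. \<forall>y\<in>icube n.
         near n r x a \<and> near n r x y \<and> cle n a y \<longrightarrow> (k a, k y) \<in> circ X U" using R x U by meson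
      have "k y \<in> U" if "y \<in> icube n" "near n r x y" for y
        using r(2)[rule_format, OF that(1,1)] that circ_subset[OF X U] by auto
      then show ?thesis using r(1) by blast
    qed
    then show "openin (icube_topology n) {x \<in> topspace (icube_topology n). k x \<in> U}"
      unfolding openin_icube by auto
  qed
  show "stream_map (dcube n) X k"
    unfolding stream_map_def
  proof (intro conjI allI impI)
    show "continuous_map (topo (dcube n)) (topo X) k" using cont by simp
    fix U assume U: "openin (topo X) U"
    let ?V = "{x \<in> icube n. k x \<in> U}"
    have V: "openin (icube_topology n) ?V"
      using openin_continuous_map_preimage[OF cont U] by simp
    show "\<forall>(x, y)\<in>circ (dcube n) {x \<in> points (dcube n). k x \<in> U}. (k x, k y) \<in> circ X U"
    proof safe
      fix x y assume "(x, y) \<in> circ (dcube n) {x \<in> points (dcube n). k x \<in> U}"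
      then have "(x, y) \<in> dcirc n ?V" using V by (simp add: circ_dcube)
      then show "(k x, k y) \<in> circ X U"
      proof (rule dcirc_local[OF V])
        show "trans (circ X U)" by (rule circ_trans[OF X U])
        fix x0 assume "x0 \<in> ?V"
        then show "\<exists>r>0. \<forall>x\<in>icube n. \<forall>y\<in>icube n.
            near n r x0 x \<and> near n r x0 y \<and> cle n x y \<longrightarrow> (k x, k y) \<in> circ X U"
          using R U by simp
      qed
    qed
  qed
qed

lemma stream_map_dcube_compose:
  assumes X: "stream X" and k: "stream_map (dcube n) X k"
    and \<alpha>: "\<alpha> \<in> icube m \<rightarrow> icube n"
    and mono: "\<And>x y. x \<in> icube m \<Longrightarrow> y \<in> icube m \<Longrightarrow> cle m x y \<Longrightarrow> cle n (\<alpha> x) (\<alpha> y)"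
    and cont: "\<And>x0 r. x0 \<in> icube m \<Longrightarrow> 0 < r \<Longrightarrow>
      \<exists>s>0. \<forall>x\<in>icube m. near m s x0 x \<longrightarrow> near n r (\<alpha> x0) (\<alpha> x)"
  shows "stream_map (dcube m) X (\<lambda>x. k (\<alpha> x))"
  unfolding stream_map_dcube_iff[OF X]
proof (intro conjI ballI allI impI)
  note k' = k[unfolded stream_map_dcube_iff[OF X]]
  show "(\<lambda>x. k (\<alpha> x)) \<in> icube m \<rightarrow> points X"
    using conjunct1[OF k'] \<alpha> by (simp add: Pi_iff)
  fix x0 U assume x0: "x0 \<in> icube m" and U: "openin (topo X) U \<and> k (\<alpha> x0) \<in> U"
  then obtain r where r: "r > 0" "\<forall>x\<in>icube n. \<forall>y\<in>icube n.
       near n r (\<alpha> x0) x \<and> near n r (\<alpha> x0) y \<and> cle n x y \<longrightarrow> (k x, k y) \<in> circ X U"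
    using conjunct2[OF k', rule_format, OF funcset_mem[OF \<alpha> x0] U] by blast
  obtain s where s: "s > 0" "\<forall>x\<in>icube m. near m s x0 x \<longrightarrow> near n r (\<alpha> x0) (\<alpha> x)"
    using cont[OF x0 r(1)] by blast
  have "(k (\<alpha> x), k (\<alpha> y)) \<in> circ X U"
    if "x \<in> icube m" "y \<in> icube m" "near m s x0 x \<and> near m s x0 y \<and> cle m x y" for x y
    using that s(2) mono[OF that(1,2)] \<alpha> by (intro r(2)[rule_format]) auto
  then show "\<exists>r>0. \<forall>x\<in>icube m. \<forall>y\<in>icube m.
       near m r x0 x \<and> near m r x0 y \<and> cle m x y \<longrightarrow> (k (\<alpha> x), k (\<alpha> y)) \<in> circ X U"
    using s(1) by blast
qed

text \<open>Monotone reparametrizations that do not increase distances. Maps built from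
  \<open>expand\<close> have slope up to 2 and need the version with a modulus of
  continuity.\<close>

lemma stream_map_dcube_compose':
  assumes "stream X" "stream_map (dcube n) X k" "\<alpha> \<in> icube m \<rightarrow> icube n"
    and "\<And>x y. x \<in> icube m \<Longrightarrow> y \<in> icube m \<Longrightarrow> cle m x y \<Longrightarrow> cle n (\<alpha> x) (\<alpha> y)"
    and "\<And>x y r. x \<in> icube m \<Longrightarrow> y \<in> icube m \<Longrightarrow> 0 < r \<Longrightarrow> near m r x y \<Longrightarrow> near n r (\<alpha> x) (\<alpha> y)"
  shows "stream_map (dcube m) X (\<lambda>x. k (\<alpha> x))"
  using assms by (intro stream_map_dcube_compose[of X n k \<alpha> m]) blast+

lemma stream_map_dcube_dcube:
  assumes "\<alpha> \<in> icube m \<rightarrow> icube n"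
    and "\<And>x y. x \<in> icube m \<Longrightarrow> y \<in> icube m \<Longrightarrow> cle m x y \<Longrightarrow> cle n (\<alpha> x) (\<alpha> y)"
    and "\<And>x y r. x \<in> icube m \<Longrightarrow> y \<in> icube m \<Longrightarrow> 0 < r \<Longrightarrow> near m r x y \<Longrightarrow> near n r (\<alpha> x) (\<alpha> y)"
  shows "stream_map (dcube m) (dcube n) \<alpha>"
  using stream_map_dcube_compose'[OF stream_dcube stream_map_id[OF stream_dcube] assms] by simp

lemma icube_upd: "p \<in> icube n \<Longrightarrow> 0 \<le> t \<Longrightarrow> t \<le> 1 \<Longrightarrow> p(n := t) \<in> icube (Suc n)"
  by (auto simp: icube_def PiE_iff extensional_def)

lemma icube_upd_inner: "p \<in> icube n \<Longrightarrow> i < n \<Longrightarrow> 0 \<le> t \<Longrightarrow> t \<le> 1 \<Longrightarrow> p(i := t) \<in> icube n"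
  by (auto simp: icube_def PiE_iff extensional_def)

lemma icube_restrict_lessThan: "q \<in> icube (Suc n) \<Longrightarrow> restrict q {..<n} \<in> icube n"
  by (auto simp: icube_def PiE_iff extensional_def)

lemma icube_0: "icube 0 = {\<lambda>_. undefined}"
  by (simp add: icube_def)

lemma Hausdorff_quotientI:
  assumes R: "equiv (topspace T) R"
    and sep: "\<And>x y. x \<in> topspace T \<Longrightarrow> y \<in> topspace T \<Longrightarrow> (x, y) \<notin> R \<Longrightarrow>
      \<exists>A B. openin T A \<and> openin T B \<and> x \<in> A \<and> y \<in> B \<and> A \<inter> B = {} \<and>
        (\<forall>a b. (a, b) \<in> R \<longrightarrow> (a \<in> A \<longrightarrow> b \<in> A) \<and> (a \<in> B \<longrightarrow> b \<in> B))"
  shows "Hausdorff_space (quotient_topology T R)"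
  unfolding Hausdorff_space_def topspace_quotient_topology[OF R]
proof (intro allI impI, elim conjE)
  fix C D assume CD: "C \<in> topspace T // R" "D \<in> topspace T // R" "C \<noteq> D"
  then obtain x y where xy: "C = R `` {x}" "D = R `` {y}" "x \<in> topspace T" "y \<in> topspace T"
    by (auto simp: quotient_def)
  then have "(x, y) \<notin> R" using CD(3) equiv_class_eq[OF R] by blast
  then obtain A B where AB: "openin T A" "openin T B" "x \<in> A" "y \<in> B" "A \<inter> B = {}"
    "\<And>a b. (a, b) \<in> R \<Longrightarrow> a \<in> A \<Longrightarrow> b \<in> A" "\<And>a b. (a, b) \<in> R \<Longrightarrow> a \<in> B \<Longrightarrow> b \<in> B"
    using sep[OF xy(3,4)] by metis
  have sym: "(b, a) \<in> R" if "(a, b) \<in> R" for a b using R that by (auto simp: equiv_def sym_def)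
  have *: "{z \<in> topspace T. R `` {z} \<in> {E \<in> topspace T // R. E \<subseteq> W}} = W"
    if "openin T W" "\<And>a b. (a, b) \<in> R \<Longrightarrow> a \<in> W \<Longrightarrow> b \<in> W" for W
    using that openin_subset[OF that(1)] equiv_class_self[OF R] by (auto intro: quotientI)
  show "\<exists>U V. openin (quotient_topology T R) U \<and> openin (quotient_topology T R) V \<and> C \<in> U \<and> D \<in> V \<and> disjnt U V"
  proof (intro exI conjI)
    show "openin (quotient_topology T R) {E \<in> topspace T // R. E \<subseteq> A}"
      using *[OF AB(1,6)] AB(1) by (simp add: openin_quotient_iff[OF R])
    show "openin (quotient_topology T R) {E \<in> topspace T // R. E \<subseteq> B}"
      using *[OF AB(2,7)] AB(2) by (simp add: openin_quotient_iff[OF R])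
    show "C \<in> {E \<in> topspace T // R. E \<subseteq> A}" using CD(1) AB(3,6) xy(1) by auto
    show "D \<in> {E \<in> topspace T // R. E \<subseteq> B}" using CD(2) AB(4,7) xy(2) by auto
    have "E \<noteq> {}" if "E \<in> topspace T // R" for E
      using that in_quotient_imp_non_empty[OF R] by blast
    then show "disjnt {E \<in> topspace T // R. E \<subseteq> A} {E \<in> topspace T // R. E \<subseteq> B}"
      using AB(5) by (fastforce simp: disjnt_def)
  qed
qed

subsection \<open>Directed spheres\<close>

definition sphere_base :: "nat \<Rightarrow> (bool \<times> (nat \<Rightarrow> real)) set" where
  "sphere_base n = insert (False, \<lambda>_. undefined) ({True} \<times> boundary n)"

definition sphere_equiv :: "nat \<Rightarrow> (bool \<times> (nat \<Rightarrow> real)) rel" where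
  "sphere_equiv n = Id_on (points (pointed_cube n)) \<union> sphere_base n \<times> sphere_base n"

lemma points_pointed_cube: "points (pointed_cube n) = insert (False, \<lambda>_. undefined) ({True} \<times> icube n)"
  by (auto simp: pointed_cube_def icube_0 split: if_splits)

lemma stream_pointed_cube: "stream (pointed_cube n)"
  unfolding pointed_cube_def by (rule stream_sum_stream) (simp add: stream_dcube)

lemma boundary_subset: "boundary n \<subseteq> icube n" by (auto simp: boundary_def)

lemma sphere_base_subset: "sphere_base n \<subseteq> points (pointed_cube n)"
  using boundary_subset by (auto simp: sphere_base_def points_pointed_cube)

lemma equiv_sphere_equiv: "equiv (points (pointed_cube n)) (sphere_equiv n)"
  using sphere_base_subset[of n]
  by (auto simp: equiv_def refl_on_def sym_def trans_def sphere_equiv_def)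

lemma openin_pointed_cube_True:
  "openin (icube_topology n) V \<Longrightarrow> openin (topo (pointed_cube n)) ({True} \<times> V)"
  using openin_subset[of "icube_topology n" V] by (auto simp: pointed_cube_def openin_sum_stream)

lemma openin_pointed_cube_insert:
  "openin (icube_topology n) V \<Longrightarrow> openin (topo (pointed_cube n)) (insert (False, \<lambda>_. undefined) ({True} \<times> V))"
  using openin_subset[of "icube_topology n" V] openin_topspace[of "icube_topology 0"]
  by (auto simp: pointed_cube_def openin_sum_stream icube_0)

lemma interior_radius:
  assumes "x \<in> icube n" "x \<notin> boundary n"
  obtains d where "d > 0" "\<And>i. i < n \<Longrightarrow> d \<le> x i \<and> x i \<le> 1 - d"
proof
  define d where "d = Min (insert 1 ((\<lambda>i. min (x i) (1 - x i)) ` {..<n}))"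
  have "0 < x i" "x i < 1" if "i < n" for i
    using assms icubeD[OF assms(1) that] that by (auto simp: boundary_def order.strict_iff_order)
  then show "d > 0" by (auto simp: d_def)
  have "d \<le> min (x i) (1 - x i)" if "i < n" for i
    unfolding d_def using that by (intro Min_le) auto
  then show "d \<le> x i \<and> x i \<le> 1 - d" if "i < n" for i using that by fastforce
qed

text \<open>Two interior points are separated by balls that avoid the boundary; an interior point is
  separated from the collapsed class by a ball and a collar of the boundary. All these sets are
  saturated.\<close>

lemma Hausdorff_sphere: "Hausdorff_space (quotient_topology (topo (pointed_cube n)) (sphere_equiv n))"
proof (rule Hausdorff_quotientI[OF equiv_sphere_equiv])
  let ?P = "topo (pointed_cube n)"
  let ?sep = "\<lambda>x y. \<exists>A B. openin ?P A \<and> openin ?P B \<and> x \<in> A \<and> y \<in> B \<and> A \<inter> B = {} \<and>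
        (\<forall>a b. (a, b) \<in> sphere_equiv n \<longrightarrow> (a \<in> A \<longrightarrow> b \<in> A) \<and> (a \<in> B \<longrightarrow> b \<in> B))"
  have interior: "z \<notin> boundary n"
    if "\<And>i. i < n \<Longrightarrow> d \<le> x i \<and> x i \<le> 1 - d" "near n d x z" for x z d
  proof
    assume "z \<in> boundary n"
    then obtain i where "i < n" "z i = 0 \<or> z i = 1" by (auto simp: boundary_def)
    then show False using that(1)[of i] that(2) by (auto simp: near_def dest!: spec[of _ i])
  qed
  have 1: "?sep (True, x) (True, y)"
    if x: "x \<in> icube n" "x \<notin> boundary n" and y: "y \<in> icube n" "y \<notin> boundary n" and ne: "x \<noteq> y" for x y
  proof -
    obtain d where d: "d > 0" "\<And>i. i < n \<Longrightarrow> d \<le> x i \<and> x i \<le> 1 - d" using interior_radius[OF x] by blast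
    obtain e where e: "e > 0" "\<And>i. i < n \<Longrightarrow> e \<le> y i \<and> y i \<le> 1 - e" using interior_radius[OF y] by blast
    obtain i where i: "i < n" "x i \<noteq> y i" using icube_ext[OF x(1) y(1)] ne by blast
    define r where "r = min (\<bar>x i - y i\<bar> / 2) (min d e)"
    have r: "r > 0" "r \<le> d" "r \<le> e" "2 * r \<le> \<bar>x i - y i\<bar>" using d(1) e(1) i by (auto simp: r_def min_def)
    let ?A = "{z \<in> icube n. near n r x z}" and ?B = "{z \<in> icube n. near n r y z}"
    have ints: "z \<notin> boundary n" if "z \<in> ?A \<union> ?B" for z
      using that interior[where x=x and d=d and z=z, OF d(2)] interior[where x=y and d=e and z=z, OF e(2)] near_mono r(2,3) by blast
    have "z \<notin> ?A \<inter> ?B" for z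
    proof
      assume "z \<in> ?A \<inter> ?B"
      then have "\<bar>z i - x i\<bar> < r" "\<bar>z i - y i\<bar> < r" using i by (auto simp: near_def)
      then show False using r(4) by linarith
    qed
    then have disj: "?A \<inter> ?B = {}" by blast
    show ?thesis
    proof (intro exI conjI allI impI)
      show "openin ?P ({True} \<times> ?A)" "openin ?P ({True} \<times> ?B)"
        by (simp_all add: openin_pointed_cube_True openin_icube_near)
      show "({True} \<times> ?A) \<inter> ({True} \<times> ?B) = {}" using disj by blast
    qed (use x y r(1) ints in \<open>auto simp: sphere_equiv_def sphere_base_def\<close>)
  qed
  have 2: "?sep (True, x) y" "?sep y (True, x)"
    if x: "x \<in> icube n" "x \<notin> boundary n" and y: "y \<in> sphere_base n" for x y
  proof -
    obtain d where d: "d > 0" "\<And>i. i < n \<Longrightarrow> d \<le> x i \<and> x i \<le> 1 - d" using interior_radius[OF x] by blast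
    let ?A = "{z \<in> icube n. near n (d / 2) x z}"
    \<comment> \<open>A collar of the boundary of width \<open>d / 2\<close>. All coordinates of
      \<open>x\<close> keep distance \<open>d\<close> from 0 and 1, so the collar misses the ball of
      radius \<open>d / 2\<close> around \<open>x\<close>.\<close>
    let ?B = "{z \<in> icube n. \<exists>i<n. z i < d / 2 \<or> 1 - d / 2 < z i}"
    have "openin (icube_topology n) ?B"
      unfolding openin_icube
    proof safe
      fix z i assume z: "z \<in> icube n" "i < n" "z i < d / 2"
      have "w \<in> ?B" if "w \<in> icube n" "near n (d / 2 - z i) z w" for w
        using that z by (auto simp: near_def abs_less_iff dest!: spec[of _ i])
      then show "\<exists>r>0. \<forall>y\<in>icube n. near n r z y \<longrightarrow> y \<in> ?B"
        using z by (intro exI[of _ "d / 2 - z i"]) auto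
    next
      fix z i assume z: "z \<in> icube n" "i < n" "1 - d / 2 < z i"
      have "w \<in> ?B" if "w \<in> icube n" "near n (z i - (1 - d / 2)) z w" for w
      proof -
        have "1 - d / 2 < w i" using that(2) z(2) by (auto simp: near_def abs_less_iff dest!: spec[of _ i])
        then show ?thesis using that(1) z(2) by blast
      qed
      then show "\<exists>r>0. \<forall>y\<in>icube n. near n r z y \<longrightarrow> y \<in> ?B"
        using z by (intro exI[of _ "z i - (1 - d / 2)"]) auto
    qed
    then have B: "openin ?P (insert (False, \<lambda>_. undefined) ({True} \<times> ?B))"
      by (rule openin_pointed_cube_insert)
    have ints: "z \<notin> boundary n" if "z \<in> ?A" for z
      using that interior[where x=x and d=d and z=z, OF d(2)] near_mono[of n "d / 2" x z d] d(1) by auto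
    have bB: "z \<in> ?B" if "z \<in> boundary n" for z
      using that d(1) by (force simp: boundary_def)
    have "z \<notin> ?A \<inter> ?B" for z
    proof
      assume "z \<in> ?A \<inter> ?B"
      then obtain i where "i < n" "z i < d / 2 \<or> 1 - d / 2 < z i" "\<bar>z i - x i\<bar> < d / 2" by (auto simp: near_def)
      then show False using d(2)[of i] by argo
    qed
    then have disj: "?A \<inter> ?B = {}" by blast
    have A: "openin ?P ({True} \<times> ?A)" by (simp add: openin_pointed_cube_True openin_icube_near)
    have disj': "({True} \<times> ?A) \<inter> insert (False, \<lambda>_. undefined) ({True} \<times> ?B) = {}" using disj by blast
    have sat: "(a \<in> {True} \<times> ?A \<longrightarrow> b \<in> {True} \<times> ?A) \<and>
        (a \<in> insert (False, \<lambda>_. undefined) ({True} \<times> ?B) \<longrightarrow> b \<in> insert (False, \<lambda>_. undefined) ({True} \<times> ?B))"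
      if "(a, b) \<in> sphere_equiv n" for a b
      using that ints bB unfolding sphere_equiv_def sphere_base_def by blast
    have xA: "(True, x) \<in> {True} \<times> ?A" using x d(1) by simp
    have yB: "y \<in> insert (False, \<lambda>_. undefined) ({True} \<times> ?B)" using y bB by (auto simp: sphere_base_def)
    show "?sep (True, x) y" using A B disj' sat xA yB by meson
    have disj'': "insert (False, \<lambda>_. undefined) ({True} \<times> ?B) \<inter> ({True} \<times> ?A) = {}" using disj by blast
    show "?sep y (True, x)" using A B disj'' sat xA yB by meson
  qed
  fix x y assume "x \<in> topspace ?P" "y \<in> topspace ?P" and ne: "(x, y) \<notin> sphere_equiv n"
  then have pts: "x \<in> points (pointed_cube n)" "y \<in> points (pointed_cube n)" by auto
  have cases: "z \<in> sphere_base n \<or> (\<exists>p. z = (True, p) \<and> p \<in> icube n \<and> p \<notin> boundary n)"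
    if "z \<in> points (pointed_cube n)" for z
    using that by (auto simp: points_pointed_cube sphere_base_def)
  have xy: "x \<noteq> y" "x \<notin> sphere_base n \<or> y \<notin> sphere_base n"
    using ne pts by (auto simp: sphere_equiv_def)
  show "?sep x y"
  proof (cases "x \<in> sphere_base n")
    case True
    then obtain q where "y = (True, q)" "q \<in> icube n" "q \<notin> boundary n" using cases[OF pts(2)] xy(2) by blast
    then show ?thesis using 2(2)[of q x] True by simp
  next
    case x: False
    then obtain p where p: "x = (True, p)" "p \<in> icube n" "p \<notin> boundary n" using cases[OF pts(1)] by blast
    show ?thesis
    proof (cases "y \<in> sphere_base n")
      case True
      then show ?thesis using 2(1)[of p y] p by simp
    next
      case False
      then obtain q where "y = (True, q)" "q \<in> icube n" "q \<notin> boundary n" using cases[OF pts(2)] by blast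
      then show ?thesis using 1[of p q] p xy(1) by simp
    qed
  qed
qed

lemma ditop_equiv_sphere: "ditop_equiv (pointed_cube n) (sphere_glue n) = sphere_equiv n"
proof (rule ditop_equiv_eqI[OF equiv_sphere_equiv _ Hausdorff_sphere])
  show "sphere_glue n \<subseteq> sphere_equiv n"
    by (auto simp: sphere_glue_def sphere_equiv_def sphere_base_def)
  fix R assume R: "equiv (points (pointed_cube n)) R" and G: "sphere_glue n \<subseteq> R"
  have "(z, (False, \<lambda>_. undefined)) \<in> R" if "z \<in> sphere_base n" for z
    using that G R by (auto simp: sphere_base_def sphere_glue_def equiv_def refl_on_def points_pointed_cube)
  then have "(z, w) \<in> R" if "z \<in> sphere_base n" "w \<in> sphere_base n" for z w
    using that R by (meson equiv_def symD transD)
  then show "sphere_equiv n \<subseteq> R"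
    using R by (auto simp: sphere_equiv_def equiv_def refl_on_def)
qed

lemma dsphere_eq: "dsphere n = quotient_stream (pointed_cube n) (sphere_equiv n)"
  by (simp add: dsphere_def ditop_quotient_def ditop_equiv_sphere)

lemma stream_dsphere: "stream (dsphere n)"
  unfolding dsphere_eq by (rule stream_quotient_stream[OF stream_pointed_cube equiv_sphere_equiv])

lemma to_sphere_eq_iff:
  assumes "x \<in> icube n" "y \<in> icube n"
  shows "to_sphere n x = to_sphere n y \<longleftrightarrow> x = y \<or> x \<in> boundary n \<and> y \<in> boundary n"
  unfolding to_sphere_def ditop_equiv_sphere
  by (subst eq_equiv_class_iff[OF equiv_sphere_equiv])
     (use assms in \<open>auto simp: points_pointed_cube sphere_equiv_def sphere_base_def\<close>)

lemma to_sphere_eq_infty_iff: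
  assumes "x \<in> icube n"
  shows "to_sphere n x = sphere_infty n \<longleftrightarrow> x \<in> boundary n"
  unfolding to_sphere_def sphere_infty_def ditop_equiv_sphere
  by (subst eq_equiv_class_iff[OF equiv_sphere_equiv])
     (use assms in \<open>auto simp: points_pointed_cube sphere_equiv_def sphere_base_def\<close>)

lemma points_dsphere: "points (dsphere n) = insert (sphere_infty n) (to_sphere n ` icube n)"
  unfolding dsphere_eq topo_quotient_stream topspace_quotient_topology[OF equiv_sphere_equiv]
    sphere_infty_def to_sphere_def ditop_equiv_sphere quotient_def points_pointed_cube by auto

lemma sphere_infty_in [simp]: "sphere_infty n \<in> points (dsphere n)"
  and to_sphere_in [simp]: "p \<in> icube n \<Longrightarrow> to_sphere n p \<in> points (dsphere n)"
  by (auto simp: points_dsphere)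

lemma stream_map_to_sphere: "stream_map (dcube n) (dsphere n) (to_sphere n)"
proof -
  have "stream_map (dcube n) (pointed_cube n) (Pair True)"
    unfolding pointed_cube_def
    using stream_map_inject[of True UNIV "\<lambda>b. if b then dcube n else dcube 0"] by simp
  from stream_map_compose[OF this stream_map_quotient[OF stream_pointed_cube equiv_sphere_equiv]]
  show ?thesis by (simp add: dsphere_eq to_sphere_def[abs_def] ditop_equiv_sphere)
qed

lemma stream_map_from_sphere:
  assumes X: "stream X" and f: "stream_map (dcube n) X (\<lambda>p. f (to_sphere n p))" and b: "f (sphere_infty n) \<in> points X"
  shows "stream_map (dsphere n) X f"
  unfolding dsphere_eq
proof (rule stream_map_from_quotient[OF stream_pointed_cube equiv_sphere_equiv X])
  show "stream_map (pointed_cube n) X (\<lambda>x. f (sphere_equiv n `` {x}))"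
    unfolding pointed_cube_def
  proof (rule stream_map_from_sum)
    fix i :: bool
    show "stream_map (if i then dcube n else dcube 0) X (\<lambda>x. f (sphere_equiv n `` {(i, x)}))"
    proof (cases i)
      case True
      then show ?thesis using f by (simp add: to_sphere_def[abs_def] ditop_equiv_sphere)
    next
      case False
      have "f (sphere_infty n) = f (sphere_equiv n `` {(i, x)})" if "x \<in> points (dcube 0)" for x
        using that False by (simp add: sphere_infty_def ditop_equiv_sphere icube_0)
      from stream_map_cong[OF stream_map_const[OF stream_dcube X b] this stream_dcube]
      show ?thesis using False by simp
    qed
  qed
qed

text \<open>The sphere is the image of a cube together with the point at infinity; that point is
  listed separately because for \<open>n = 0\<close> the cube does not reach it.\<close>

lemma compact_hausdorff_dsphere: "compact_hausdorff_stream (dsphere n)"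
  unfolding compact_hausdorff_stream_def
proof (intro conjI)
  show "stream (dsphere n)" by (rule stream_dsphere)
  show "Hausdorff_space (topo (dsphere n))" by (simp add: dsphere_eq Hausdorff_sphere)
  have "compactin (icube_topology n) (icube n)"
    using compact_space_icube[of n] by (simp add: compact_space_def)
  then have "compactin (topo (dsphere n)) (to_sphere n ` icube n)"
    using stream_map_to_sphere[of n] by (auto simp: stream_map_def intro: image_compactin)
  moreover have "compactin (topo (dsphere n)) {sphere_infty n}"
    by (simp add: compactin_sing)
  ultimately have "compactin (topo (dsphere n)) ({sphere_infty n} \<union> to_sphere n ` icube n)"
    by (intro compactin_Un)
  then show "compact_space (topo (dsphere n))"
    by (simp add: compact_space_def points_dsphere)
qed

lemma compact_hausdorff_dcube: "compact_hausdorff_stream (dcube n)"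
  by (simp add: compact_hausdorff_stream_def stream_dcube compact_space_icube Hausdorff_space_icube)

subsection \<open>Loops as maps on cubes\<close>

text \<open>Inverse to precomposition with \<open>to_sphere\<close>. At infinity the value is given
  explicitly, since a chosen preimage would be arbitrary there and for \<open>n = 0\<close> does not
  exist.\<close>

definition of_cube :: "nat \<Rightarrow> 'a \<Rightarrow> ((nat \<Rightarrow> real) \<Rightarrow> 'a) \<Rightarrow> sphere_point \<Rightarrow> 'a" where
  "of_cube n b k = (\<lambda>s\<in>points (dsphere n).
     if s = sphere_infty n then b else k (SOME p. p \<in> icube n \<and> to_sphere n p = s))"

definition cube_loop :: "nat \<Rightarrow> 'a prestream \<Rightarrow> 'a \<Rightarrow> ((nat \<Rightarrow> real) \<Rightarrow> 'a) \<Rightarrow> bool" where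
  "cube_loop n X b k \<longleftrightarrow> stream_map (dcube n) X k \<and> (\<forall>p\<in>boundary n. k p = b)"

lemma some_to_sphere:
  assumes "p \<in> icube n" "p \<notin> boundary n"
  shows "(SOME q. q \<in> icube n \<and> to_sphere n q = to_sphere n p) = p"
proof (rule some_equality)
  show "q = p" if "q \<in> icube n \<and> to_sphere n q = to_sphere n p" for q
    using that to_sphere_eq_iff assms by blast
qed (use assms in simp)

lemma of_cube_infty [simp]: "of_cube n b k (sphere_infty n) = b"
  by (simp add: of_cube_def)

lemma of_cube_to_sphere:
  assumes "\<And>p. p \<in> boundary n \<Longrightarrow> k p = b" "p \<in> icube n"
  shows "of_cube n b k (to_sphere n p) = k p"
  using assms to_sphere_eq_infty_iff[OF assms(2)] some_to_sphere[OF assms(2)]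
  by (cases "p \<in> boundary n") (auto simp: of_cube_def)

lemma of_cube_eqI:
  assumes "f \<in> extensional (points (dsphere n))" "f (sphere_infty n) = b"
    and "\<And>p. p \<in> icube n \<Longrightarrow> f (to_sphere n p) = k p"
  shows "of_cube n b k = f"
proof (rule extensionalityI[OF _ assms(1)])
  show "of_cube n b k \<in> extensional (points (dsphere n))" by (simp add: of_cube_def)
  have k: "k p = b" if "p \<in> boundary n" for p
    using that assms(2,3) to_sphere_eq_infty_iff boundary_subset by (metis subsetD)
  fix s assume "s \<in> points (dsphere n)"
  then show "of_cube n b k s = f s"
    using assms(2,3) of_cube_to_sphere[of n k b, OF k] by (auto simp: points_dsphere)
qed

lemma of_cube_cong:
  assumes "\<And>p. p \<in> icube n \<Longrightarrow> k p = k' p" "\<And>p. p \<in> boundary n \<Longrightarrow> k p = b"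
  shows "of_cube n b k = of_cube n b k'"
proof (rule of_cube_eqI)
  show "of_cube n b k' \<in> extensional (points (dsphere n))" by (simp add: of_cube_def)
  have "k' p = b" if "p \<in> boundary n" for p using that assms boundary_subset by (metis subsetD)
  then show "of_cube n b k' (to_sphere n p) = k p" if "p \<in> icube n" for p
    using that assms(1) by (simp add: of_cube_to_sphere)
qed simp

lemma of_cube_loops:
  assumes X: "stream X" and b: "b \<in> points X" and k: "cube_loop n X b k"
  shows "of_cube n b k \<in> loops n X b"
  unfolding loops_def mem_Collect_eq
proof (intro conjI)
  show "of_cube n b k \<in> extensional (points (dsphere n))" by (simp add: of_cube_def)
  have "stream_map (dcube n) X k" using k by (simp add: cube_loop_def)
  then have "stream_map (dcube n) X (\<lambda>p. of_cube n b k (to_sphere n p))"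
    by (rule stream_map_cong) (use k in \<open>simp_all add: of_cube_to_sphere cube_loop_def stream_dcube\<close>)
  then show "stream_map (dsphere n) X (of_cube n b k)"
    using b by (intro stream_map_from_sphere[OF X]) simp_all
qed simp

lemma loops_cube:
  assumes f: "f \<in> loops n X b"
  shows "cube_loop n X b (\<lambda>p. f (to_sphere n p))" "of_cube n b (\<lambda>p. f (to_sphere n p)) = f"
proof -
  show "cube_loop n X b (\<lambda>p. f (to_sphere n p))"
    unfolding cube_loop_def
  proof (intro conjI ballI)
    show "stream_map (dcube n) X (\<lambda>p. f (to_sphere n p))"
      using f by (intro stream_map_compose[OF stream_map_to_sphere]) (simp add: loops_def)
    show "f (to_sphere n p) = b" if "p \<in> boundary n" for p
      using that f to_sphere_eq_infty_iff[of p n] subsetD[OF boundary_subset that] by (auto simp: loops_def)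
  qed
  show "of_cube n b (\<lambda>p. f (to_sphere n p)) = f"
    using f by (intro of_cube_eqI) (auto simp: loops_def)
qed

text \<open>A homotopy may be specified on a cube with one more coordinate. Its descent to the
  product of sphere and interval is continuous by compactness, and is a stream map because this can
  be tested in each variable separately.\<close>

lemma dihomotopic_of_cube:
  assumes X: "stream X" and b: "b \<in> points X" and K: "stream_map (dcube (Suc n)) X K"
    and bd: "\<And>p t. p \<in> boundary n \<Longrightarrow> 0 \<le> t \<Longrightarrow> t \<le> 1 \<Longrightarrow> K (p(n := t)) = b"
  shows "dihomotopic n X b (of_cube n b (\<lambda>p. K (p(n := 0)))) (of_cube n b (\<lambda>p. K (p(n := 1))))"
proof -
  let ?S = "dsphere n" and ?I = "dcube 1"
  let ?H = "\<lambda>(s, q). of_cube n b (\<lambda>p. K (p(n := q 0))) s"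
  have q01: "0 \<le> q 0 \<and> q 0 \<le> 1" if "q \<in> icube 1" for q using icubeD[OF that, of 0] by simp
  have HK: "?H (to_sphere n p, q) = K (p(n := q 0))" if "p \<in> icube n" "q \<in> icube 1" for p q
    using that q01 bd by (simp add: of_cube_to_sphere)
  have Hb: "?H (sphere_infty n, q) = b" for q by simp
  have pr: "prod_topology (topo ?S) (topo ?I) = prod_topology (topo ?S) (icube_topology 1)" by simp
  have upd: "continuous_map (prod_topology (icube_topology n) (icube_topology 1)) (icube_topology (Suc n))
      (\<lambda>(p, q). p(n := q 0))"
    unfolding icube_topology_def[of "Suc n"] continuous_map_componentwise
  proof (intro conjI ballI)
    show "(\<lambda>(p, q). p(n := q 0)) ` topspace (prod_topology (icube_topology n) (icube_topology 1)) \<subseteq> extensional {..<Suc n}"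
      by (auto simp: icube_def PiE_iff extensional_def)
    fix i assume "i \<in> {..<Suc n}"
    then consider "i < n" | "i = n" by fastforce
    then show "continuous_map (prod_topology (icube_topology n) (icube_topology 1)) (top_of_set {0..1})
        (\<lambda>x. (case x of (p, q) \<Rightarrow> p(n := q 0)) i)"
    proof cases
      case 1
      have "continuous_map (prod_topology (icube_topology n) (icube_topology 1)) (top_of_set {0..1}) ((\<lambda>p. p i) \<circ> fst)"
        using 1 unfolding icube_topology_def[of n]
        by (intro continuous_map_compose[OF continuous_map_fst] continuous_map_product_projection) simp
      then show ?thesis using 1 by (simp add: o_def case_prod_beta)
    next
      case 2
      have "continuous_map (prod_topology (icube_topology n) (icube_topology 1)) (top_of_set {0..1}) ((\<lambda>p. p 0) \<circ> snd)"
        unfolding icube_topology_def[of 1]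
        by (intro continuous_map_compose[OF continuous_map_snd] continuous_map_product_projection) simp
      then show ?thesis using 2 by (simp add: o_def case_prod_beta)
    qed
  qed
  have "continuous_map (icube_topology (Suc n)) (topo X) K" using K by (simp add: stream_map_def)
  from continuous_map_compose[OF upd this]
  have contK: "continuous_map (prod_topology (icube_topology n) (icube_topology 1)) (topo X) (\<lambda>(p, q). K (p(n := q 0)))"
    by (simp add: o_def case_prod_unfold)
  have ts: "continuous_map (icube_topology n) (topo ?S) (to_sphere n)"
    using stream_map_to_sphere[of n] by (simp add: stream_map_def)
  \<comment> \<open>The map from cube times interval to sphere times interval has compact source and
    Hausdorff target. The preimage of a closed set is thus the image of a compact set, together with
    the line over infinity when \<open>b\<close> lies in that set.\<close>
  have cont: "continuous_map (prod_topology (topo ?S) (topo ?I)) (topo X) ?H"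
    unfolding pr continuous_map_closedin
  proof (intro conjI allI impI)
    have "K (p(n := q 0)) \<in> points X" if "p \<in> icube n" "q \<in> icube 1" for p q
      using continuous_map_image_subset_topspace[OF contK] that by auto
    then show H_in: "?H \<in> topspace (prod_topology (topo ?S) (icube_topology 1)) \<rightarrow> points X"
      using HK b by (auto simp: points_dsphere)
    fix C assume C: "closedin (topo X) C"
    let ?A = "{z \<in> topspace (prod_topology (icube_topology n) (icube_topology 1)). (case z of (p, q) \<Rightarrow> K (p(n := q 0))) \<in> C}"
    let ?g = "\<lambda>(p, q). (to_sphere n p, q)"
    have "compact_space (prod_topology (icube_topology n) (icube_topology 1))"
      by (simp add: compact_space_prod_topology compact_space_icube)
    then have "compactin (prod_topology (icube_topology n) (icube_topology 1)) ?A"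
      using closedin_continuous_map_preimage[OF contK C] by (simp add: closedin_compact_space)
    moreover have "continuous_map (prod_topology (icube_topology n) (icube_topology 1)) (prod_topology (topo ?S) (icube_topology 1)) ?g"
      using ts by (auto simp: continuous_map_prod_top)
    ultimately have c1: "compactin (prod_topology (topo ?S) (icube_topology 1)) (?g ` ?A)"
      by (rule image_compactin)
    have c2: "compactin (prod_topology (topo ?S) (icube_topology 1)) ({sphere_infty n} \<times> icube 1)"
      using compact_space_icube[of 1] by (simp add: compactin_Times compactin_sing compact_space_def)
    have eq: "{z \<in> topspace (prod_topology (topo ?S) (icube_topology 1)). ?H z \<in> C} =
        ?g ` ?A \<union> (if b \<in> C then {sphere_infty n} \<times> icube 1 else {})"
    proof (intro equalityI subsetI)
      fix z assume z: "z \<in> {z \<in> topspace (prod_topology (topo ?S) (icube_topology 1)). ?H z \<in> C}"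
      obtain s q where sq: "z = (s, q)" by (cases z)
      then have q: "q \<in> icube 1" and "s \<in> points ?S" and H: "?H (s, q) \<in> C" using z by auto
      then consider "s = sphere_infty n" | p where "p \<in> icube n" "s = to_sphere n p"
        by (auto simp: points_dsphere)
      then show "z \<in> ?g ` ?A \<union> (if b \<in> C then {sphere_infty n} \<times> icube 1 else {})"
      proof cases
        case 1
        then show ?thesis using H q sq by simp
      next
        case 2
        then have "(p, q) \<in> ?A" using H q HK[of p q] by simp
        then show ?thesis using 2 sq by force
      qed
    next
      fix z assume "z \<in> ?g ` ?A \<union> (if b \<in> C then {sphere_infty n} \<times> icube 1 else {})"
      then consider p q where "z = (to_sphere n p, q)" "p \<in> icube n" "q \<in> icube 1" "K (p(n := q 0)) \<in> C"
        | q where "z = (sphere_infty n, q)" "q \<in> icube 1" "b \<in> C"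
        by (auto split: if_splits)
      then show "z \<in> {z \<in> topspace (prod_topology (topo ?S) (icube_topology 1)). ?H z \<in> C}"
        using HK by cases auto
    qed
    have "Hausdorff_space (prod_topology (topo ?S) (icube_topology 1))"
      using compact_hausdorff_dsphere[of n] Hausdorff_space_icube[of 1]
      by (simp add: compact_hausdorff_stream_def Hausdorff_space_prod_topology)
    then show "closedin (prod_topology (topo ?S) (icube_topology 1))
        {z \<in> topspace (prod_topology (topo ?S) (icube_topology 1)). ?H z \<in> C}"
      unfolding eq using c1 c2 by (auto intro!: closedin_Un intro: compactin_imp_closedin)
  qed
  have H1: "stream_map ?S X (\<lambda>s. ?H (s, q))" if q: "q \<in> points ?I" for q
  proof (rule stream_map_from_sphere[OF X])
    have q1: "q \<in> icube 1" using q by simp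
    have "stream_map (dcube n) X (\<lambda>p. K (p(n := q 0)))"
      using q01[OF q1]
      by (intro stream_map_dcube_compose'[OF X K]) (auto simp: cle_def near_def less_Suc_eq intro: icube_upd)
    then show "stream_map (dcube n) X (\<lambda>p. ?H (to_sphere n p, q))"
      by (rule stream_map_cong) (use HK q1 in \<open>simp_all add: stream_dcube\<close>)
  qed (use b in simp)
  have H2: "stream_map ?I X (\<lambda>q. ?H (s, q))" if s: "s \<in> points ?S" for s
  proof (cases "s = sphere_infty n")
    case True
    then show ?thesis using stream_map_const[OF stream_dcube X b] by simp
  next
    case False
    then obtain p where p: "p \<in> icube n" "s = to_sphere n p" using s by (auto simp: points_dsphere)
    have "stream_map ?I X (\<lambda>q. K (p(n := q 0)))"
      using q01 p(1)
      by (intro stream_map_dcube_compose'[OF X K]) (auto simp: cle_def near_def less_Suc_eq intro: icube_upd)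
    then show ?thesis
      by (rule stream_map_cong) (use HK p in \<open>simp_all add: stream_dcube\<close>)
  qed
  have H: "stream_map (ditop_product ?S ?I) X ?H"
    unfolding ditop_product_eq[OF compact_hausdorff_dsphere compact_hausdorff_dcube]
    using stream_map_from_prod_stream[OF stream_dsphere stream_dcube X cont H1 H2] by blast
  have ip: "interval_point t 0 = t" for t by (simp add: interval_point_def)
  show ?thesis
    unfolding dihomotopic_def
    using H by (intro exI[of _ ?H]) (auto simp: ip)
qed

text \<open>The converse passage uses only the universal property of the product: forgetting and
  extracting the last coordinate are stream maps from the larger cube to sphere and
  interval.\<close>

lemma dihomotopic_cube:
  assumes X: "stream X" and fg: "dihomotopic n X b f g"
  obtains K where "stream_map (dcube (Suc n)) X K"
    "\<And>p. p \<in> icube n \<Longrightarrow> K (p(n := 0)) = f (to_sphere n p)"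
    "\<And>p. p \<in> icube n \<Longrightarrow> K (p(n := 1)) = g (to_sphere n p)"
    "\<And>p t. p \<in> boundary n \<Longrightarrow> 0 \<le> t \<Longrightarrow> t \<le> 1 \<Longrightarrow> K (p(n := t)) = b"
proof -
  let ?S = "dsphere n" and ?I = "dcube 1"
  obtain H where H: "stream_map (prod_stream ?S ?I) X H"
    and H0: "\<And>s. s \<in> points ?S \<Longrightarrow> H (s, interval_point 0) = f s \<and> H (s, interval_point 1) = g s"
    and Hb: "\<And>t. t \<in> {0..1} \<Longrightarrow> H (sphere_infty n, interval_point t) = b"
    using fg unfolding dihomotopic_def ditop_product_eq[OF compact_hausdorff_dsphere compact_hausdorff_dcube]
    by blast
  let ?K = "\<lambda>q. H (to_sphere n (restrict q {..<n}), interval_point (q n))"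
  have "stream_map (dcube (Suc n)) (dcube n) (\<lambda>q. restrict q {..<n})"
    by (rule stream_map_dcube_dcube) (auto simp: cle_def near_def intro: icube_restrict_lessThan)
  then have m1: "stream_map (dcube (Suc n)) ?S (\<lambda>q. to_sphere n (restrict q {..<n}))"
    using stream_map_to_sphere by (rule stream_map_compose)
  have m2: "stream_map (dcube (Suc n)) ?I (\<lambda>q. interval_point (q n))"
  proof (rule stream_map_dcube_dcube)
    show "(\<lambda>q. interval_point (q n)) \<in> icube (Suc n) \<rightarrow> icube 1"
      using icubeD[where n = "Suc n" and i = n] by (auto simp: interval_point_def icube_def)
  qed (auto simp: cle_def near_def interval_point_def)
  have K: "stream_map (dcube (Suc n)) X ?K"
    using prod_stream_initial[OF stream_dcube stream_dsphere stream_dcube m1 m2] H by (rule stream_map_compose)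
  have res: "restrict (p(n := t)) {..<n} = p" if "p \<in> icube n" for p t
    using that by (auto simp: icube_def restrict_def PiE_iff extensional_def fun_eq_iff)
  show thesis
  proof (rule that[OF K])
    fix p t assume p: "p \<in> boundary n" and t: "0 \<le> t" "(t::real) \<le> 1"
    then have "to_sphere n p = sphere_infty n" "p \<in> icube n"
      using to_sphere_eq_infty_iff boundary_subset by blast+
    then show "H (to_sphere n (restrict (p(n := t)) {..<n}), interval_point ((p(n := t)) n)) = b"
      using Hb t by (simp only: res fun_upd_same) simp
  qed (use H0 in \<open>simp_all only: res fun_upd_same to_sphere_in\<close>)
qed

section \<open>The equivalence relation generated by directed homotopies\<close>

lemma equiv_Inter:
  assumes "\<And>R. R \<in> \<R> \<Longrightarrow> equiv A R" "\<R> \<noteq> {}"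
  shows "equiv A (\<Inter>\<R>)"
proof (rule equivI)
  show "\<Inter>\<R> \<subseteq> A \<times> A" using assms by (fastforce simp: equiv_def)
  show "refl_on A (\<Inter>\<R>)" using assms by (auto simp: equiv_def refl_on_def)
  show "sym (\<Inter>\<R>)"
    using assms(1) unfolding equiv_def by (intro symI) (meson InterD InterI symD)
  show "trans (\<Inter>\<R>)"
    using assms(1) unfolding equiv_def by (intro transI) (meson InterD InterI transD)
qed

lemma equiv_dihomotopy_rel: "equiv (loops n X x) (dihomotopy_rel n X x)"
  unfolding dihomotopy_rel_def
proof (rule equiv_Inter)
  have "equiv (loops n X x) (loops n X x \<times> loops n X x)"
    by (rule equivI) (auto simp: refl_on_def sym_def trans_def)
  then show "{R. equiv (loops n X x) R \<and>
      (\<forall>f\<in>loops n X x. \<forall>g\<in>loops n X x. dihomotopic n X x f g \<longrightarrow> (f, g) \<in> R)} \<noteq> {}" by blast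
qed blast

lemma dihomotopic_imp_rel:
  "f \<in> loops n X x \<Longrightarrow> g \<in> loops n X x \<Longrightarrow> dihomotopic n X x f g \<Longrightarrow> (f, g) \<in> dihomotopy_rel n X x"
  unfolding dihomotopy_rel_def by blast

text \<open>The kernel of an invariant is one of the equivalence relations whose intersection is
  \<open>dihomotopy_rel\<close>.\<close>

lemma dihomotopy_rel_invariant:
  assumes inv: "\<And>f g. f \<in> loops n X x \<Longrightarrow> g \<in> loops n X x \<Longrightarrow> dihomotopic n X x f g \<Longrightarrow> F f = F g"
    and fg: "(f, g) \<in> dihomotopy_rel n X x"
  shows "F f = F g"
proof -
  let ?R = "{(f, g). f \<in> loops n X x \<and> g \<in> loops n X x \<and> F f = F g}"
  have "equiv (loops n X x) ?R" by (auto simp: equiv_def refl_on_def sym_def trans_def)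
  then have "dihomotopy_rel n X x \<subseteq> ?R"
    unfolding dihomotopy_rel_def using inv by (intro Inter_lower) auto
  then show ?thesis using fg by blast
qed

subsection \<open>Morphisms of the box category\<close>

text \<open>A morphism of the box category fills each coordinate of the target either with a constant or
  with a coordinate of the source, using each coordinate of the source at most once.\<close>

definition arrow_rep :: "nat \<Rightarrow> nat \<Rightarrow> (nat \<Rightarrow> bool + nat) \<Rightarrow>
    ((nat \<Rightarrow> bool) \<Rightarrow> (nat \<Rightarrow> bool)) \<Rightarrow> ((nat \<Rightarrow> real) \<Rightarrow> (nat \<Rightarrow> real)) \<Rightarrow> bool" where
  "arrow_rep m n \<sigma> f F \<longleftrightarrow>
     (\<forall>i<n. \<forall>j. \<sigma> i = Inr j \<longrightarrow> j < m) \<and>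
     (\<forall>i<n. \<forall>i'<n. \<forall>j. \<sigma> i = Inr j \<and> \<sigma> i' = Inr j \<longrightarrow> i = i') \<and>
     (\<forall>u\<in>vertices m. f u = (\<lambda>i\<in>{..<n}. case \<sigma> i of Inl b \<Rightarrow> b | Inr j \<Rightarrow> u j)) \<and>
     (\<forall>x\<in>icube m. F x = (\<lambda>i\<in>{..<n}. case \<sigma> i of Inl b \<Rightarrow> of_bool b | Inr j \<Rightarrow> x j))"

lemma vertices_undef: "u \<in> vertices n \<Longrightarrow> n \<le> k \<Longrightarrow> u k = undefined"
  by (auto simp: vertices_def PiE_iff extensional_def)

lemma icube_undef: "u \<in> icube n \<Longrightarrow> n \<le> k \<Longrightarrow> u k = undefined"
  by (auto simp: icube_def PiE_iff extensional_def)

lemma vertices_ext: "u \<in> vertices n \<Longrightarrow> v \<in> vertices n \<Longrightarrow> (\<And>i. i < n \<Longrightarrow> u i = v i) \<Longrightarrow> u = v"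
  unfolding vertices_def by (rule PiE_ext) auto

lemma vertices_restrict [simp]: "(\<lambda>i\<in>{..<n}. g i) \<in> vertices n"
  by (auto simp: vertices_def)

lemma box_arrow_rep: "box_arrow m n f F \<Longrightarrow> \<exists>\<sigma>. arrow_rep m n \<sigma> f F"
proof (induction rule: box_arrow.induct)
  case (identity n)
  show ?case
    by (rule exI[of _ Inr])
       (auto simp: arrow_rep_def fun_eq_iff vertices_undef icube_undef)
next
  case (coface i n b)
  \<comment> \<open>Beyond the target dimension \<open>insert_at\<close> reads
    \<open>x (k - 1)\<close>, which lies outside the source cube and is \<open>undefined\<close>, as
    the restricted normal form requires.\<close>
  have i: "k - Suc 0 \<ge> n" if "\<not> k < Suc n" for k using that by simp
  show ?case
    by (rule exI[of _ "\<lambda>k. if k < i then Inr k else if k = i then Inl b else Inr (k - 1)"])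
       (use coface in \<open>auto simp: arrow_rep_def fun_eq_iff insert_at_def vertices_undef[OF _ i] icube_undef[OF _ i]\<close>)
next
  case (codegeneracy i n)
  show ?case
    by (rule exI[of _ "\<lambda>k. if k < i then Inr k else Inr (Suc k)"])
       (use codegeneracy in \<open>auto simp: arrow_rep_def fun_eq_iff omit_at_def vertices_undef icube_undef split: if_splits\<close>)
next
  case (permutation p n)
  have "p k < n \<longleftrightarrow> k < n" for k using permutes_in_image[OF permutation, of k] by simp
  moreover have "p i = p j \<longleftrightarrow> i = j" for i j using permutes_inj[OF permutation] by (auto simp: inj_def)
  moreover have "p k = k" if "n \<le> k" for k using permutation that by (auto simp: permutes_def)
  ultimately show ?case
    by (intro exI[of _ "\<lambda>k. Inr (p k)"])
       (auto simp: arrow_rep_def fun_eq_iff vertices_undef icube_undef not_less)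
next
  case (composite l m f F n g G)
  then obtain \<sigma> \<tau> where s: "arrow_rep l m \<sigma> f F" and t: "arrow_rep m n \<tau> g G" by blast
  \<comment> \<open>Substituting \<open>\<sigma>\<close> into \<open>\<tau>\<close>: a constant of
    either arrow remains a constant, and a source coordinate is traced back through both.\<close>
  let ?\<rho> = "\<lambda>i. case \<tau> i of Inl b \<Rightarrow> Inl b | Inr j \<Rightarrow> \<sigma> j"
  have fv: "f u \<in> vertices m" if "u \<in> vertices l" for u
    using that s by (simp add: arrow_rep_def)
  have Fx: "F x \<in> icube m" if "x \<in> icube l" for x
  proof -
    have "F x = (\<lambda>i\<in>{..<m}. case \<sigma> i of Inl b \<Rightarrow> of_bool b | Inr j \<Rightarrow> x j)"
      using that s by (simp add: arrow_rep_def)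
    also have "\<dots> \<in> icube m"
      using s icubeD[OF that] by (intro icube_restrict) (auto simp: arrow_rep_def split: sum.split)
    finally show ?thesis .
  qed
  have "arrow_rep l n ?\<rho> (compose (vertices l) g f) (compose (icube l) G F)"
    unfolding arrow_rep_def
  proof (intro conjI ballI allI impI)
    fix i j assume "i < n" "?\<rho> i = Inr j"
    then show "j < l" using s t by (auto simp: arrow_rep_def split: sum.splits)
  next
    fix i i' j assume "i < n" "i' < n" "?\<rho> i = Inr j \<and> ?\<rho> i' = Inr j"
    moreover then obtain a a' where a: "\<tau> i = Inr a" "\<sigma> a = Inr j" "\<tau> i' = Inr a'" "\<sigma> a' = Inr j"
      by (auto split: sum.splits)
    moreover have "a < m" "a' < m" using a t \<open>i < n\<close> \<open>i' < n\<close> by (auto simp: arrow_rep_def)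
    ultimately have "a = a'" using s unfolding arrow_rep_def by blast
    then show "i = i'" using a t \<open>i < n\<close> \<open>i' < n\<close> unfolding arrow_rep_def by blast
  next
    fix u assume u: "u \<in> vertices l"
    have "j < m" if "i < n" "\<tau> i = Inr j" for i j using that t by (simp add: arrow_rep_def)
    note less = this
    have nth: "f u j = (case \<sigma> j of Inl b \<Rightarrow> b | Inr j \<Rightarrow> u j)" if "j < m" for j
      using s u that by (simp add: arrow_rep_def)
    have "compose (vertices l) g f u = g (f u)" using u by (simp add: compose_eq)
    also have "\<dots> = (\<lambda>i\<in>{..<n}. case \<tau> i of Inl b \<Rightarrow> b | Inr j \<Rightarrow> f u j)"
      using t fv[OF u] unfolding arrow_rep_def by blast
    also have "\<dots> = (\<lambda>i\<in>{..<n}. case ?\<rho> i of Inl b \<Rightarrow> b | Inr j \<Rightarrow> u j)"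
      by (rule restrict_ext) (use less nth in \<open>auto split: sum.split\<close>)
    finally show "compose (vertices l) g f u = (\<lambda>i\<in>{..<n}. case ?\<rho> i of Inl b \<Rightarrow> b | Inr j \<Rightarrow> u j)" .
  next
    fix u assume u: "u \<in> icube l"
    have "j < m" if "i < n" "\<tau> i = Inr j" for i j using that t by (simp add: arrow_rep_def)
    note less = this
    have nth: "F u j = (case \<sigma> j of Inl b \<Rightarrow> of_bool b | Inr j \<Rightarrow> u j)" if "j < m" for j
      using s u that by (simp add: arrow_rep_def)
    have "compose (icube l) G F u = G (F u)" using u by (simp add: compose_eq)
    also have "\<dots> = (\<lambda>i\<in>{..<n}. case \<tau> i of Inl b \<Rightarrow> of_bool b | Inr j \<Rightarrow> F u j)"
      using t Fx[OF u] unfolding arrow_rep_def by blast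
    also have "\<dots> = (\<lambda>i\<in>{..<n}. case ?\<rho> i of Inl b \<Rightarrow> of_bool b | Inr j \<Rightarrow> u j)"
      by (rule restrict_ext) (use less nth in \<open>auto split: sum.split\<close>)
    finally show "compose (icube l) G F u = (\<lambda>i\<in>{..<n}. case ?\<rho> i of Inl b \<Rightarrow> of_bool b | Inr j \<Rightarrow> u j)" .
  qed
  then show ?case by blast
qed

lemma arrow_rep_vertex: "arrow_rep m n \<sigma> f F \<Longrightarrow> u \<in> vertices m \<Longrightarrow> f u \<in> vertices n"
  by (simp add: arrow_rep_def)

lemma arrow_rep_vertex_nth:
  "arrow_rep m n \<sigma> f F \<Longrightarrow> u \<in> vertices m \<Longrightarrow> i < n \<Longrightarrow> f u i = (case \<sigma> i of Inl b \<Rightarrow> b | Inr j \<Rightarrow> u j)"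
  by (simp add: arrow_rep_def)

lemma arrow_rep_point_nth:
  "arrow_rep m n \<sigma> f F \<Longrightarrow> x \<in> icube m \<Longrightarrow> i < n \<Longrightarrow> F x i = (case \<sigma> i of Inl b \<Rightarrow> of_bool b | Inr j \<Rightarrow> x j)"
  by (simp add: arrow_rep_def)

lemma arrow_rep_less: "arrow_rep m n \<sigma> f F \<Longrightarrow> i < n \<Longrightarrow> \<sigma> i = Inr j \<Longrightarrow> j < m"
  by (simp add: arrow_rep_def)

lemma arrow_rep_inj: "arrow_rep m n \<sigma> f F \<Longrightarrow> i < n \<Longrightarrow> i' < n \<Longrightarrow> \<sigma> i = Inr j \<Longrightarrow> \<sigma> i' = Inr j \<Longrightarrow> i = i'"
  unfolding arrow_rep_def by blast

lemma arrow_rep_icube: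
  assumes r: "arrow_rep m n \<sigma> f F" and x: "x \<in> icube m"
  shows "F x \<in> icube n"
proof -
  have "F x = (\<lambda>i\<in>{..<n}. case \<sigma> i of Inl b \<Rightarrow> of_bool b | Inr j \<Rightarrow> x j)"
    using r x by (simp add: arrow_rep_def)
  also have "\<dots> \<in> icube n"
    using icubeD[OF x] arrow_rep_less[OF r] by (intro icube_restrict) (auto split: sum.split)
  finally show ?thesis .
qed

lemma box_arrow_icube: "box_arrow m n f F \<Longrightarrow> x \<in> icube m \<Longrightarrow> F x \<in> icube n"
  using box_arrow_rep arrow_rep_icube by blast

text \<open>A section on the coordinates that the arrow uses; coordinates projected away take the
  default \<open>d\<close>. The default \<open>lo\<close> keeps a lifted vertex inside an order
  interval, and the default \<open>x\<close> keeps a lifted point close to \<open>x\<close>.\<close>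

definition arrow_section :: "nat \<Rightarrow> nat \<Rightarrow> (nat \<Rightarrow> bool + nat) \<Rightarrow> (nat \<Rightarrow> 'b) \<Rightarrow> (nat \<Rightarrow> 'b) \<Rightarrow> (nat \<Rightarrow> 'b)" where
  "arrow_section m n \<sigma> v d =
     (\<lambda>j\<in>{..<m}. if \<exists>i<n. \<sigma> i = Inr j then v (THE i. i < n \<and> \<sigma> i = Inr j) else d j)"

lemma arrow_section_image:
  assumes r: "arrow_rep m n \<sigma> f F" and i: "i < n" "\<sigma> i = Inr j"
  shows "arrow_section m n \<sigma> v d j = v i"
proof -
  have "(THE i. i < n \<and> \<sigma> i = Inr j) = i"
    using i arrow_rep_inj[OF r] by (intro the_equality) blast+
  then show ?thesis using i arrow_rep_less[OF r i] by (auto simp: arrow_section_def)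
qed

lemma arrow_section_other:
  "j < m \<Longrightarrow> \<not> (\<exists>i<n. \<sigma> i = Inr j) \<Longrightarrow> arrow_section m n \<sigma> v d j = d j"
  unfolding arrow_section_def by (simp only: restrict_apply lessThan_iff if_True if_False)

lemma arrow_section_vertex [simp]: "arrow_section m n \<sigma> v d \<in> vertices m"
  by (simp add: arrow_section_def)

lemma arrow_section_icube:
  assumes r: "arrow_rep m n \<sigma> f F" and v: "v \<in> icube n" and d: "d \<in> icube m"
  shows "arrow_section m n \<sigma> v d \<in> icube m"
proof -
  have "0 \<le> arrow_section m n \<sigma> v d j \<and> arrow_section m n \<sigma> v d j \<le> 1" if "j < m" for j
    using arrow_section_image[OF r] arrow_section_other[OF that] icubeD[OF v] icubeD[OF d that] by metis
  then have "(\<lambda>j\<in>{..<m}. arrow_section m n \<sigma> v d j) \<in> icube m" by (intro icube_restrict)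
  moreover have "(\<lambda>j\<in>{..<m}. arrow_section m n \<sigma> v d j) = arrow_section m n \<sigma> v d"
    by (simp add: arrow_section_def fun_eq_iff)
  ultimately show ?thesis by simp
qed

lemma arrow_section_vertex_eq:
  assumes r: "arrow_rep m n \<sigma> f F" and v: "v \<in> vertices n"
    and c: "\<And>i b. i < n \<Longrightarrow> \<sigma> i = Inl b \<Longrightarrow> v i = b"
  shows "f (arrow_section m n \<sigma> v d) = v"
proof (rule vertices_ext[OF _ v])
  show "f (arrow_section m n \<sigma> v d) \<in> vertices n" using arrow_rep_vertex[OF r] by simp
  show "f (arrow_section m n \<sigma> v d) i = v i" if "i < n" for i
    using that c by (cases "\<sigma> i") (auto simp: arrow_rep_vertex_nth[OF r] arrow_section_image[OF r that])
qed

text \<open>Setting the coordinates in \<open>S\<close> to constants is an endomorphism of the cube, so passing to a face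
  needs no renumbering of coordinates.\<close>

definition setc :: "nat \<Rightarrow> nat set \<Rightarrow> (nat \<Rightarrow> 'b) \<Rightarrow> (nat \<Rightarrow> 'b) \<Rightarrow> (nat \<Rightarrow> 'b)" where
  "setc k S b u = (\<lambda>i\<in>{..<k}. if i \<in> S then b i else u i)"

lemma setc_vertex [simp]: "setc k S b u \<in> vertices k" by (simp add: setc_def)

lemma setc_icube: "x \<in> icube k \<Longrightarrow> setc k S (\<lambda>i. of_bool (b i)) x \<in> icube k"
  unfolding setc_def by (intro icube_restrict) (auto dest: icubeD)

text \<open>Fixing one coordinate is a codegeneracy followed by a coface, and the coordinates in
  \<open>S\<close> are fixed one after another. Indices beyond the dimension change nothing.\<close>

lemma box_arrow_setc:
  "finite S \<Longrightarrow> box_arrow k k (restrict (setc k S b) (vertices k)) (restrict (setc k S (\<lambda>i. of_bool (b i))) (icube k))"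
proof (induction S rule: finite_induct)
  case empty
  have "restrict (setc k {} b) (vertices k) = restrict id (vertices k)"
    by (auto simp: fun_eq_iff setc_def vertices_undef)
  moreover have "restrict (setc k {} (\<lambda>i. of_bool (b i))) (icube k) = restrict id (icube k)"
    by (auto simp: fun_eq_iff setc_def icube_undef)
  ultimately show ?case using box_arrow.identity[of k] by (simp only:)
next
  case (insert j S)
  show ?case
  proof (cases "j < k")
    case False
    then have "setc k (insert j S) b = setc k S b"
      "setc k (insert j S) (\<lambda>i. of_bool (b i) :: real) = setc k S (\<lambda>i. of_bool (b i))"
      by (auto simp: setc_def fun_eq_iff)
    then show ?thesis using insert.IH by (simp only:)
  next
    case True
    then obtain n where n: "k = Suc n" "j \<le> n" by (cases k) auto
    note a1 = box_arrow.composite[OF box_arrow.codegeneracy[OF n(2)] box_arrow.coface[OF n(2), of "b j"]]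
    note a2 = box_arrow.composite[OF insert.IH a1[folded n(1)]]
    have om: "restrict (omit_at j) (vertices k) u = omit_at j u" "omit_at j u \<in> vertices n" if "u \<in> vertices k" for u
      using that n by (auto simp: vertices_def omit_at_def PiE_iff extensional_def)
    have om': "restrict (omit_at j) (icube k) u = omit_at j u" "omit_at j u \<in> icube n" if "u \<in> icube k" for u
      using that n by (auto simp: icube_def omit_at_def PiE_iff extensional_def)
    have v: "compose (vertices k) (compose (vertices k) (restrict (insert_at j (b j)) (vertices n)) (restrict (omit_at j) (vertices k)))
        (restrict (setc k S b) (vertices k)) = restrict (setc k (insert j S) b) (vertices k)"
    proof
      fix u
      show "compose (vertices k) (compose (vertices k) (restrict (insert_at j (b j)) (vertices n)) (restrict (omit_at j) (vertices k)))
        (restrict (setc k S b) (vertices k)) u = restrict (setc k (insert j S) b) (vertices k) u"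
      proof (cases "u \<in> vertices k")
        case True
        then show ?thesis using n om(2)[of "setc k S b u"]
          by (auto simp: compose_eq fun_eq_iff insert_at_def omit_at_def setc_def)
      qed (simp add: compose_def)
    qed
    have x: "compose (icube k) (compose (icube k) (restrict (insert_at j (of_bool (b j))) (icube n)) (restrict (omit_at j) (icube k)))
        (restrict (setc k S (\<lambda>i. of_bool (b i))) (icube k)) = restrict (setc k (insert j S) (\<lambda>i. of_bool (b i))) (icube k)"
    proof
      fix u
      show "compose (icube k) (compose (icube k) (restrict (insert_at j (of_bool (b j))) (icube n)) (restrict (omit_at j) (icube k)))
        (restrict (setc k S (\<lambda>i. of_bool (b i))) (icube k)) u = restrict (setc k (insert j S) (\<lambda>i. of_bool (b i))) (icube k) u"
      proof (cases "u \<in> icube k")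
        case True
        then show ?thesis using n om'(2)[OF setc_icube[of u k S b]] setc_icube[of u k S b]
          by (auto simp: compose_eq fun_eq_iff insert_at_def omit_at_def setc_def)
      qed (simp add: compose_def)
    qed
    show ?thesis using a2 unfolding v x .
  qed
qed

text \<open>The product of an arrow with the identity of the interval, the new coordinate being
  last. Cofaces, codegeneracies and permutations act on positions below it. The cone construction
  needs this to be compatible with gluing.\<close>

lemma box_arrow_suspend:
  "box_arrow m n f F \<Longrightarrow> \<exists>f' F'. box_arrow (Suc m) (Suc n) f' F' \<and>
     (\<forall>u\<in>vertices m. \<forall>b. f' (u(m := b)) = (f u)(n := b)) \<and>
     (\<forall>x\<in>icube m. \<forall>t. 0 \<le> t \<and> t \<le> 1 \<longrightarrow> F' (x(m := t)) = (F x)(n := t))"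
proof (induction rule: box_arrow.induct)
  case (identity n)
  show ?case
  proof (intro exI conjI)
    show "box_arrow (Suc n) (Suc n) (restrict id (vertices (Suc n))) (restrict id (icube (Suc n)))"
      by (rule box_arrow.identity)
    have "u(n := c) \<in> vertices (Suc n)" if "u \<in> vertices n" for u c
      using that by (auto simp: vertices_def PiE_iff extensional_def)
    then show "\<forall>u\<in>vertices n. \<forall>b. restrict id (vertices (Suc n)) (u(n := b)) = (restrict id (vertices n) u)(n := b)"
      by simp
    show "\<forall>x\<in>icube n. \<forall>t. 0 \<le> t \<and> t \<le> 1 \<longrightarrow> restrict id (icube (Suc n)) (x(n := t)) = (restrict id (icube n) x)(n := t)"
      using icube_upd by auto
  qed
next
  case (coface i n b)
  have v: "u(n := c) \<in> vertices (Suc n)" if "u \<in> vertices n" for u c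
    using that by (auto simp: vertices_def PiE_iff extensional_def)
  have 1: "insert_at i d (u(n := c)) = (insert_at i d u)(Suc n := c)" for u d and c :: "'c"
    using coface by (auto simp: insert_at_def fun_eq_iff)
  have "i \<le> Suc n" using coface by simp
  from box_arrow.coface[OF this, of b] show ?case
    by (intro exI conjI ballI allI impI, assumption) (simp_all only: restrict_apply' v icube_upd 1 simp_thms)
next
  case (codegeneracy i n)
  have v: "u(Suc n := c) \<in> vertices (Suc (Suc n))" if "u \<in> vertices (Suc n)" for u c
    using that by (auto simp: vertices_def PiE_iff extensional_def)
  have 1: "omit_at i (u(Suc n := c)) = (omit_at i u)(n := c)" for u and c :: "'c"
    using codegeneracy by (auto simp: omit_at_def fun_eq_iff)
  have "i \<le> Suc n" using codegeneracy by simp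
  from box_arrow.codegeneracy[OF this] show ?case
    by (intro exI conjI ballI allI impI, assumption) (simp_all only: restrict_apply' v icube_upd 1 simp_thms)
next
  case (permutation p n)
  have v: "u(n := c) \<in> vertices (Suc n)" if "u \<in> vertices n" for u c
    using that by (auto simp: vertices_def PiE_iff extensional_def)
  have pn: "p n = n" using permutation by (auto simp: permutes_def)
  have "p k = n \<longleftrightarrow> k = n" for k using pn permutes_inj[OF permutation] by (metis injD)
  then have 1: "(u(n := c)) \<circ> p = (u \<circ> p)(n := c)" for u :: "nat \<Rightarrow> 'c" and c
    using pn by (auto simp: fun_eq_iff)
  have "p permutes {..<Suc n}" using permutation by (rule permutes_subset) auto
  from box_arrow.permutation[OF this] show ?case
    by (intro exI conjI ballI allI impI, assumption) (simp_all only: restrict_apply' v icube_upd 1 simp_thms)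
next
  case (composite l m f F n g G)
  from composite.IH(1) obtain f' F' where f: "box_arrow (Suc l) (Suc m) f' F'"
    "\<forall>u\<in>vertices l. \<forall>b. f' (u(l := b)) = (f u)(m := b)"
    "\<forall>x\<in>icube l. \<forall>t. 0 \<le> t \<and> t \<le> 1 \<longrightarrow> F' (x(l := t)) = (F x)(m := t)" by blast
  from composite.IH(2) obtain g' G' where g: "box_arrow (Suc m) (Suc n) g' G'"
    "\<forall>u\<in>vertices m. \<forall>b. g' (u(m := b)) = (g u)(n := b)"
    "\<forall>x\<in>icube m. \<forall>t. 0 \<le> t \<and> t \<le> 1 \<longrightarrow> G' (x(m := t)) = (G x)(n := t)" by blast
  have v: "u(l := c) \<in> vertices (Suc l)" if "u \<in> vertices l" for u c
    using that by (auto simp: vertices_def PiE_iff extensional_def)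
  have fu: "f u \<in> vertices m" if "u \<in> vertices l" for u
    using that box_arrow_vertices(1)[OF composite.hyps(1)] by blast
  show ?case
    by (intro exI conjI ballI allI impI, rule box_arrow.composite[OF f(1) g(1)])
       (simp_all only: compose_eq v fu icube_upd f(2,3)[rule_format] g(2,3)[rule_format] box_arrow_icube[OF composite.hyps(1)] simp_thms)
qed

subsection \<open>The realization of a nerve is Hausdorff\<close>

lemma vertex_pairsI: "u \<in> vertices k \<Longrightarrow> v \<in> vertices k \<Longrightarrow> (\<And>i. i < k \<Longrightarrow> u i \<Longrightarrow> v i) \<Longrightarrow> (u, v) \<in> vertex_pairs k"
  by (auto simp: vertex_pairs_def)

lemma vertex_pairsD:
  assumes "(u, v) \<in> vertex_pairs k"
  shows "u \<in> vertices k" "v \<in> vertices k" "i < k \<Longrightarrow> u i \<Longrightarrow> v i"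
  using assms by (auto simp: vertex_pairs_def)

lemma vertex_pairs_trans: "(u, v) \<in> vertex_pairs k \<Longrightarrow> (v, w) \<in> vertex_pairs k \<Longrightarrow> (u, w) \<in> vertex_pairs k"
  by (auto simp: vertex_pairs_def)

lemma vertex_pairs_refl: "u \<in> vertices k \<Longrightarrow> (u, u) \<in> vertex_pairs k"
  by (auto simp: vertex_pairs_def)

lemma vertices_upd: "u \<in> vertices k \<Longrightarrow> i < k \<Longrightarrow> u(i := b) \<in> vertices k"
  by (auto simp: vertices_def PiE_iff extensional_def)

text \<open>Larger thresholds give smaller vertices. In the cube, \<open>thr k 1 x\<close> and
  \<open>sthr k 0 x\<close> are the least and the greatest vertex of the smallest face containing
  \<open>x\<close>.\<close>

definition thr :: "nat \<Rightarrow> real \<Rightarrow> (nat \<Rightarrow> real) \<Rightarrow> (nat \<Rightarrow> bool)" where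
  "thr k a x = (\<lambda>i\<in>{..<k}. a \<le> x i)"

definition sthr :: "nat \<Rightarrow> real \<Rightarrow> (nat \<Rightarrow> real) \<Rightarrow> (nat \<Rightarrow> bool)" where
  "sthr k a x = (\<lambda>i\<in>{..<k}. a < x i)"

lemma thr_vertex [simp]: "thr k a x \<in> vertices k" and sthr_vertex [simp]: "sthr k a x \<in> vertices k"
  by (auto simp: thr_def sthr_def)

lemma thr_nth [simp]: "i < k \<Longrightarrow> thr k a x i \<longleftrightarrow> a \<le> x i"
  and sthr_nth [simp]: "i < k \<Longrightarrow> sthr k a x i \<longleftrightarrow> a < x i"
  by (auto simp: thr_def sthr_def)

text \<open>The constants 0 and 1 inserted by an arrow must round to themselves, which requires
  \<open>0 < a\<close> and \<open>a \<le> 1\<close>; for strict rounding the bounds are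
  \<open>0 \<le> a\<close> and \<open>a < 1\<close>.\<close>

lemma arrow_rep_thr:
  assumes r: "arrow_rep m n \<sigma> f F" and x: "x \<in> icube m" and a: "0 < a" "a \<le> 1"
  shows "thr n a (F x) = f (thr m a x)"
proof (rule vertices_ext)
  fix i assume i: "i < n"
  show "thr n a (F x) i = f (thr m a x) i"
    using i a arrow_rep_less[OF r i]
    by (cases "\<sigma> i") (auto simp: arrow_rep_vertex_nth[OF r] arrow_rep_point_nth[OF r x] of_bool_def)
qed (simp_all add: arrow_rep_vertex[OF r])

lemma arrow_rep_sthr:
  assumes r: "arrow_rep m n \<sigma> f F" and x: "x \<in> icube m" and a: "0 \<le> a" "a < 1"
  shows "sthr n a (F x) = f (sthr m a x)"
proof (rule vertices_ext)
  fix i assume i: "i < n"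
  show "sthr n a (F x) i = f (sthr m a x) i"
    using i a arrow_rep_less[OF r i]
    by (cases "\<sigma> i") (auto simp: arrow_rep_vertex_nth[OF r] arrow_rep_point_nth[OF r x] of_bool_def)
qed (simp_all add: arrow_rep_vertex[OF r])

lemma arrow_rep_pairs:
  assumes r: "arrow_rep m n \<sigma> f F" and uv: "(u, v) \<in> vertex_pairs m"
  shows "(f u, f v) \<in> vertex_pairs n"
proof (rule vertex_pairsI)
  note v = vertex_pairsD[OF uv]
  show "f u \<in> vertices n" "f v \<in> vertices n" using arrow_rep_vertex[OF r] v by auto
  fix i assume "i < n" "f u i"
  then show "f v i"
    using v arrow_rep_less[OF r] by (cases "\<sigma> i") (auto simp: arrow_rep_vertex_nth[OF r])
qed

lemma arrow_rep_upd:
  assumes r: "arrow_rep m n \<sigma> f F" and u: "u \<in> vertices m" and i: "i < n" "\<sigma> i = Inr j"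
  shows "f (u(j := b)) = (f u)(i := b)"
proof (rule vertices_ext)
  have j: "j < m" using arrow_rep_less[OF r i] .
  show "f (u(j := b)) \<in> vertices n" "(f u)(i := b) \<in> vertices n"
    using arrow_rep_vertex[OF r] vertices_upd u j i by auto
  fix l assume l: "l < n"
  then show "f (u(j := b)) l = ((f u)(i := b)) l"
    using i arrow_rep_inj[OF r l i(1) _ i(2)]
    by (cases "\<sigma> l") (auto simp: arrow_rep_vertex_nth[OF r vertices_upd[OF u j] l] arrow_rep_vertex_nth[OF r u l])
qed

lemma arrow_rep_upd_other:
  assumes r: "arrow_rep m n \<sigma> f F" and u: "u \<in> vertices m" and j: "j < m" "\<And>i. i < n \<Longrightarrow> \<sigma> i \<noteq> Inr j"
  shows "f (u(j := b)) = f u"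
proof (rule vertices_ext)
  show "f (u(j := b)) \<in> vertices n" "f u \<in> vertices n"
    using arrow_rep_vertex[OF r] vertices_upd u j by auto
  fix l assume l: "l < n"
  then show "f (u(j := b)) l = f u l"
    using j(2)[OF l]
    by (cases "\<sigma> l") (auto simp: arrow_rep_vertex_nth[OF r vertices_upd[OF u j(1)] l] arrow_rep_vertex_nth[OF r u l])
qed

text \<open>Arrows map an order interval of vertices onto the order interval between the images of
  its ends. This surjectivity makes conditions quantified over such an interval, as in
  \<open>ess\<close> and \<open>regular\<close>, invariant under gluing in both directions.\<close>

lemma arrow_rep_interval_lift:
  assumes r: "arrow_rep m n \<sigma> f F"
    and lo: "lo \<in> vertices m" and hi: "hi \<in> vertices m" and lohi: "(lo, hi) \<in> vertex_pairs m"
    and v: "(f lo, v) \<in> vertex_pairs n" "(v, f hi) \<in> vertex_pairs n"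
  shows "f (arrow_section m n \<sigma> v lo) = v"
    and "(lo, arrow_section m n \<sigma> v lo) \<in> vertex_pairs m" "(arrow_section m n \<sigma> v lo, hi) \<in> vertex_pairs m"
proof -
  note v' = vertex_pairsD[OF v(1)] vertex_pairsD[OF v(2)]
  show "f (arrow_section m n \<sigma> v lo) = v"
  proof (rule arrow_section_vertex_eq[OF r])
    fix i b assume i: "i < n" "\<sigma> i = Inl b"
    then have "f lo i = b" "f hi i = b" using arrow_rep_vertex_nth[OF r] lo hi by simp_all
    then show "v i = b" using v' i(1) by blast
  qed (rule v')
  have *: "(lo j \<longrightarrow> arrow_section m n \<sigma> v lo j) \<and> (arrow_section m n \<sigma> v lo j \<longrightarrow> hi j)" if j: "j < m" for j
  proof (cases "\<exists>i<n. \<sigma> i = Inr j")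
    case True
    then obtain i where i: "i < n" "\<sigma> i = Inr j" by blast
    then show ?thesis
      using v'(3)[of i] v'(6)[of i] arrow_rep_vertex_nth[OF r lo i(1)] arrow_rep_vertex_nth[OF r hi i(1)]
      by (simp add: arrow_section_image[OF r i])
  next
    case False
    then have "arrow_section m n \<sigma> v lo j = lo j" using arrow_section_other[OF j] by blast
    then show ?thesis using vertex_pairsD(3)[OF lohi j] by simp
  qed
  then show "(lo, arrow_section m n \<sigma> v lo) \<in> vertex_pairs m" "(arrow_section m n \<sigma> v lo, hi) \<in> vertex_pairs m"
    using lo hi by (auto intro!: vertex_pairsI)
qed

text \<open>The set-level gluing, before any passage to a weak Hausdorff quotient. Being the least
  equivalence containing the generators, it allows invariants to be checked on arrows.\<close>

definition cell_equiv :: "'c cubical_data \<Rightarrow> ((nat \<times> 'c) \<times> (nat \<Rightarrow> real)) rel" where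
  "cell_equiv C = \<Inter>{R. equiv (points (cell_sum C)) R \<and> cell_glue C \<subseteq> R}"

lemma points_cell_sum: "((k, c), x) \<in> points (cell_sum C) \<longleftrightarrow> c \<in> cells C k \<and> x \<in> icube k"
  by (auto simp: cell_sum_def)

lemma stream_cell_sum: "stream (cell_sum C)"
  unfolding cell_sum_def by (rule stream_sum_stream) (auto simp: stream_dcube)

lemma openin_cell_sum:
  "openin (topo (cell_sum C)) U \<longleftrightarrow> U \<subseteq> points (cell_sum C) \<and>
     (\<forall>k. \<forall>c\<in>cells C k. openin (icube_topology k) {x. ((k, c), x) \<in> U})"
  unfolding cell_sum_def openin_sum_stream points_sum_stream by auto

lemma cell_glue_subset:
  assumes "cubical_set C"
  shows "cell_glue C \<subseteq> points (cell_sum C) \<times> points (cell_sum C)"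
proof
  fix p assume "p \<in> cell_glue C"
  then obtain m n f F c x where *: "p = (((m, act C m n f c), x), ((n, c), F x))"
    "box_arrow m n f F" "c \<in> cells C n" "x \<in> icube m"
    unfolding cell_glue_def by blast
  moreover have "act C m n f c \<in> cells C m"
    using assms *(2,3) unfolding cubical_set_def by blast
  ultimately show "p \<in> points (cell_sum C) \<times> points (cell_sum C)"
    using box_arrow_icube[OF *(2)] by (simp add: points_cell_sum)
qed

lemma equiv_cell_equiv:
  assumes "cubical_set C"
  shows "equiv (points (cell_sum C)) (cell_equiv C)"
  unfolding cell_equiv_def
proof (rule equiv_Inter)
  let ?A = "points (cell_sum C)"
  have "equiv ?A (?A \<times> ?A)" by (rule equivI) (auto simp: refl_on_def sym_def trans_def)
  then show "{R. equiv ?A R \<and> cell_glue C \<subseteq> R} \<noteq> {}" using cell_glue_subset[OF assms] by blast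
qed blast

lemma cell_equiv_glue:
  "box_arrow m n f F \<Longrightarrow> c \<in> cells C n \<Longrightarrow> x \<in> icube m \<Longrightarrow> (((m, act C m n f c), x), ((n, c), F x)) \<in> cell_equiv C"
  unfolding cell_equiv_def cell_glue_def by blast

text \<open>The kernel of \<open>Q\<close> is an equivalence relation that contains the generators
  of the gluing.\<close>

lemma cell_equiv_invariant:
  assumes zw: "(z, w) \<in> cell_equiv C" and C: "cubical_set C"
    and Q: "\<And>m n f F c x. box_arrow m n f F \<Longrightarrow> c \<in> cells C n \<Longrightarrow> x \<in> icube m \<Longrightarrow>
      Q ((m, act C m n f c), x) = Q ((n, c), F x)"
  shows "Q z = Q w"
proof -
  let ?A = "points (cell_sum C)"
  let ?R = "{(z, w). z \<in> ?A \<and> w \<in> ?A \<and> Q z = Q w}"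
  have "equiv ?A ?R" by (rule equivI) (auto simp: refl_on_def sym_def trans_def)
  moreover have "cell_glue C \<subseteq> ?R"
  proof
    fix p assume p: "p \<in> cell_glue C"
    then obtain m n f F c x where *: "p = (((m, act C m n f c), x), ((n, c), F x))"
      "box_arrow m n f F" "c \<in> cells C n" "x \<in> icube m"
      unfolding cell_glue_def by blast
    show "p \<in> ?R" using subsetD[OF cell_glue_subset[OF C] p] Q[OF *(2-4)] unfolding *(1) by simp
  qed
  ultimately show ?thesis using zw unfolding cell_equiv_def by blast
qed

type_synonym 'a cell_point = "(nat \<times> ((nat \<Rightarrow> bool) \<times> (nat \<Rightarrow> bool) \<Rightarrow> 'a)) \<times> (nat \<Rightarrow> real)"

locale nerve_space = monoid M for M :: "'a monoid" (structure)
begin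

section \<open>Cells of the nerve and essential coordinates\<close>

lemma nerve_cellD:
  assumes "\<phi> \<in> cells (nerve M) k"
  shows nerve_closed: "(u, v) \<in> vertex_pairs k \<Longrightarrow> \<phi> (u, v) \<in> carrier M"
    and nerve_refl: "u \<in> vertices k \<Longrightarrow> \<phi> (u, u) = \<one>"
    and nerve_comp: "(u, v) \<in> vertex_pairs k \<Longrightarrow> (v, w) \<in> vertex_pairs k \<Longrightarrow> \<phi> (u, w) = \<phi> (u, v) \<otimes> \<phi> (v, w)"
    and nerve_undef: "z \<notin> vertex_pairs k \<Longrightarrow> \<phi> z = undefined"
  using assms by (auto simp: nerve_def PiE_iff, cases z, auto simp: extensional_def)

lemma nerve_cellI:
  assumes "\<And>u v. (u, v) \<in> vertex_pairs k \<Longrightarrow> \<phi> (u, v) \<in> carrier M"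
    and "\<And>u. u \<in> vertices k \<Longrightarrow> \<phi> (u, u) = \<one>"
    and "\<And>u v w. (u, v) \<in> vertex_pairs k \<Longrightarrow> (v, w) \<in> vertex_pairs k \<Longrightarrow> \<phi> (u, w) = \<phi> (u, v) \<otimes> \<phi> (v, w)"
    and "\<And>z. z \<notin> vertex_pairs k \<Longrightarrow> \<phi> z = undefined"
  shows "\<phi> \<in> cells (nerve M) k"
  using assms unfolding nerve_def by (auto simp: PiE_iff extensional_def)

lemma act_nerve: "(u, v) \<in> vertex_pairs m \<Longrightarrow> act (nerve M) m n f \<phi> (u, v) = \<phi> (f u, f v)"
  by (simp add: nerve_def)

lemma act_nerve_undef: "z \<notin> vertex_pairs m \<Longrightarrow> act (nerve M) m n f \<phi> z = undefined"
  by (cases z) (simp add: nerve_def)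

lemma act_cells: "box_arrow m n f F \<Longrightarrow> \<phi> \<in> cells (nerve M) n \<Longrightarrow> act (nerve M) m n f \<phi> \<in> cells (nerve M) m"
  using cubical_set_nerve[of M] unfolding cubical_set_def by blast

text \<open>The coordinates of a point in which the face carrying it is not constant.\<close>

definition ess :: "nat \<Rightarrow> ((nat \<Rightarrow> bool) \<times> (nat \<Rightarrow> bool) \<Rightarrow> 'a) \<Rightarrow> (nat \<Rightarrow> real) \<Rightarrow> real set" where
  "ess k \<phi> x = {x i | i. i < k \<and> 0 < x i \<and> x i < 1 \<and>
     (\<exists>v. (thr k 1 x, v) \<in> vertex_pairs k \<and> (v, sthr k 0 x) \<in> vertex_pairs k \<and> \<phi> (v(i := False), v(i := True)) \<noteq> \<one>)}"

text \<open>A source coordinate that the arrow projects away carries only identities in the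
  pulled-back cell and is not essential. A target coordinate that the arrow fills with a constant
  sits at 0 or 1 and is excluded by the strict bounds.\<close>

lemma ess_natural:
  assumes ba: "box_arrow m n f F" and \<phi>: "\<phi> \<in> cells (nerve M) n" and x: "x \<in> icube m"
  shows "ess m (act (nerve M) m n f \<phi>) x = ess n \<phi> (F x)"
proof -
  obtain \<sigma> where r: "arrow_rep m n \<sigma> f F" using box_arrow_rep[OF ba] by blast
  have th: "thr n 1 (F x) = f (thr m 1 x)" and st: "sthr n 0 (F x) = f (sthr m 0 x)"
    using arrow_rep_thr[OF r x] arrow_rep_sthr[OF r x] by simp_all
  have lohi: "(thr m 1 x, sthr m 0 x) \<in> vertex_pairs m" by (rule vertex_pairsI) auto
  show ?thesis
  proof
    show "ess m (act (nerve M) m n f \<phi>) x \<subseteq> ess n \<phi> (F x)"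
    proof
      fix e assume "e \<in> ess m (act (nerve M) m n f \<phi>) x"
      then obtain j v where j: "e = x j" "j < m" "0 < x j" "x j < 1"
        and v: "(thr m 1 x, v) \<in> vertex_pairs m" "(v, sthr m 0 x) \<in> vertex_pairs m"
        and ne: "act (nerve M) m n f \<phi> (v(j := False), v(j := True)) \<noteq> \<one>"
        unfolding ess_def by blast
      have vv: "v \<in> vertices m" using vertex_pairsD[OF v(1)] by simp
      have "(v(j := False), v(j := True)) \<in> vertex_pairs m"
        using vv j(2) by (auto intro!: vertex_pairsI vertices_upd)
      then have ne': "\<phi> (f (v(j := False)), f (v(j := True))) \<noteq> \<one>" using ne by (simp add: act_nerve)
      have "\<exists>i<n. \<sigma> i = Inr j"
      proof (rule ccontr)
        assume "\<not> (\<exists>i<n. \<sigma> i = Inr j)"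
        then have "f (v(j := False)) = f v" "f (v(j := True)) = f v"
          using arrow_rep_upd_other[OF r vv j(2)] by auto
        then show False using ne' nerve_refl[OF \<phi> arrow_rep_vertex[OF r vv]] by simp
      qed
      then obtain i where i: "i < n" "\<sigma> i = Inr j" by blast
      have "\<phi> ((f v)(i := False), (f v)(i := True)) \<noteq> \<one>" using ne' arrow_rep_upd[OF r vv i] by simp
      moreover have "F x i = x j" using arrow_rep_point_nth[OF r x i(1)] i by simp
      ultimately show "e \<in> ess n \<phi> (F x)"
        unfolding ess_def th st using j i arrow_rep_pairs[OF r v(1)] arrow_rep_pairs[OF r v(2)]
        by (intro CollectI exI[of _ i] conjI exI[of _ "f v"]) simp_all
    qed
    show "ess n \<phi> (F x) \<subseteq> ess m (act (nerve M) m n f \<phi>) x"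
    proof
      fix e assume "e \<in> ess n \<phi> (F x)"
      then obtain i v where i: "e = F x i" "i < n" "0 < F x i" "F x i < 1"
        and v: "(f (thr m 1 x), v) \<in> vertex_pairs n" "(v, f (sthr m 0 x)) \<in> vertex_pairs n"
        and ne: "\<phi> (v(i := False), v(i := True)) \<noteq> \<one>"
        unfolding ess_def th st by blast
      obtain j where j: "\<sigma> i = Inr j"
        using i(3,4) arrow_rep_point_nth[OF r x i(2)] by (cases "\<sigma> i") (auto simp: of_bool_def split: if_splits)
      have jm: "j < m" using arrow_rep_less[OF r i(2) j] .
      have Fx: "F x i = x j" using arrow_rep_point_nth[OF r x i(2)] j by simp
      let ?w = "arrow_section m n \<sigma> v (thr m 1 x)"
      note lift = arrow_rep_interval_lift[OF r thr_vertex sthr_vertex lohi v]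
      have "act (nerve M) m n f \<phi> (?w(j := False), ?w(j := True)) = \<phi> (f (?w(j := False)), f (?w(j := True)))"
        using jm by (intro act_nerve vertex_pairsI vertices_upd) auto
      also have "\<dots> = \<phi> (v(i := False), v(i := True))"
        using arrow_rep_upd[OF r arrow_section_vertex i(2) j] lift(1) by simp
      finally have "act (nerve M) m n f \<phi> (?w(j := False), ?w(j := True)) \<noteq> \<one>" using ne by simp
      then show "e \<in> ess m (act (nerve M) m n f \<phi>) x"
        unfolding ess_def using i Fx jm lift by auto
    qed
  qed
qed

lemma ess_invariant:
  assumes "(((k, \<phi>), x), ((l, \<psi>), y)) \<in> cell_equiv (nerve M)"
  shows "ess k \<phi> x = ess l \<psi> y"
  using cell_equiv_invariant[OF assms cubical_set_nerve, of "\<lambda>((k, \<phi>), x). ess k \<phi> x"] ess_natural by simp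

lemma finite_ess: "finite (ess k \<phi> x)"
proof -
  have "ess k \<phi> x \<subseteq> x ` {..<k}" by (auto simp: ess_def)
  then show ?thesis using finite_subset by blast
qed

lemma ess_bounds: "e \<in> ess k \<phi> x \<Longrightarrow> 0 < e \<and> e < 1" by (auto simp: ess_def)

text \<open>If direction \<open>i\<close> carries only identities on the smallest face containing
  \<open>y\<close>, then the restriction of the cell to that face does not depend on coordinate
  \<open>i\<close>. Restricting with and without fixing \<open>i\<close> produces the same cell,
  through which both points are glued.\<close>

lemma cell_equiv_move_to_face:
  assumes \<phi>: "\<phi> \<in> cells (nerve M) k" and y: "y \<in> icube k" and i: "i < k" "0 < y i" "y i < 1"
    and free: "\<And>v. (thr k 1 y, v) \<in> vertex_pairs k \<Longrightarrow> (v, sthr k 0 y) \<in> vertex_pairs k \<Longrightarrow>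
      \<phi> (v(i := False), v(i := True)) = \<one>"
  shows "(((k, \<phi>), y), ((k, \<phi>), y(i := of_bool c))) \<in> cell_equiv (nerve M)"
proof -
  define S where "S = {j. j < k \<and> (y j = 0 \<or> y j = 1)}"
  define b where "b = (\<lambda>j. y j = 1)"
  define A where "A = setc k S b"
  define A' where "A' = setc k (insert i S) (b(i := c))"
  have iS: "i \<notin> S" using i by (auto simp: S_def)
  have fin: "finite S" "finite (insert i S)" by (auto simp: S_def)
  have A'A: "A' u = (A u)(i := c)" for u
    using i(1) iS by (auto simp: A_def A'_def setc_def fun_eq_iff)
  have int: "(thr k 1 y, A u) \<in> vertex_pairs k" "(A u, sthr k 0 y) \<in> vertex_pairs k" for u
  proof -
    have "1 \<le> y j \<longleftrightarrow> y j = 1" "0 < y j \<longleftrightarrow> y j \<noteq> 0" if "j < k" for j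
      using icubeD[OF y that] by auto
    then show "(thr k 1 y, A u) \<in> vertex_pairs k" "(A u, sthr k 0 y) \<in> vertex_pairs k"
      unfolding A_def by (auto intro!: vertex_pairsI simp: setc_def S_def b_def split: if_splits)
  qed
  have eq: "\<phi> (p, q) = \<phi> (p(i := c), q(i := c))"
    if pq: "(p, q) \<in> vertex_pairs k" and fp: "\<phi> (p(i := False), p(i := True)) = \<one>"
      and fq: "\<phi> (q(i := False), q(i := True)) = \<one>" for p q
  proof -
    note v = vertex_pairsD[OF pq]
    have up: "\<phi> (p, p(i := True)) = \<one>" "\<phi> (q, q(i := True)) = \<one>" "\<phi> (p(i := False), p) = \<one>" "\<phi> (q(i := False), q) = \<one>"
      using fp fq nerve_refl[OF \<phi> v(1)] nerve_refl[OF \<phi> v(2)]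
      by (cases "p i"; cases "q i"; simp add: fun_upd_idem)+
    show ?thesis
    proof (cases c)
      case True
      have pairs: "(p, p(i := True)) \<in> vertex_pairs k" "(q, q(i := True)) \<in> vertex_pairs k"
        "(p(i := True), q(i := True)) \<in> vertex_pairs k"
        using v i(1) by (auto intro!: vertex_pairsI vertices_upd)
      have "\<phi> (p, q(i := True)) = \<phi> (p, q)"
        using nerve_comp[OF \<phi> pq pairs(2)] up nerve_closed[OF \<phi> pq] by simp
      moreover have "\<phi> (p, q(i := True)) = \<phi> (p(i := True), q(i := True))"
        using nerve_comp[OF \<phi> pairs(1,3)] up nerve_closed[OF \<phi> pairs(3)] by simp
      ultimately show ?thesis using True by simp
    next
      case False
      have pairs: "(p(i := False), p) \<in> vertex_pairs k" "(q(i := False), q) \<in> vertex_pairs k"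
        "(p(i := False), q(i := False)) \<in> vertex_pairs k"
        using v i(1) by (auto intro!: vertex_pairsI vertices_upd split: if_splits)
      have "\<phi> (p(i := False), q) = \<phi> (p, q)"
        using nerve_comp[OF \<phi> pairs(1) pq] up nerve_closed[OF \<phi> pq] by simp
      moreover have "\<phi> (p(i := False), q) = \<phi> (p(i := False), q(i := False))"
        using nerve_comp[OF \<phi> pairs(3,2)] up nerve_closed[OF \<phi> pairs(3)] by simp
      ultimately show ?thesis using False by simp
    qed
  qed
  have cell: "act (nerve M) k k (restrict A (vertices k)) \<phi> = act (nerve M) k k (restrict A' (vertices k)) \<phi>"
  proof
    fix z :: "(nat \<Rightarrow> bool) \<times> (nat \<Rightarrow> bool)"
    obtain u v where z: "z = (u, v)" by (cases z)
    show "act (nerve M) k k (restrict A (vertices k)) \<phi> z = act (nerve M) k k (restrict A' (vertices k)) \<phi> z"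
    proof (cases "z \<in> vertex_pairs k")
      case True
      note uv = True[unfolded z]
      have "(A u, A v) \<in> vertex_pairs k"
        using vertex_pairsD[OF uv] unfolding A_def by (auto intro!: vertex_pairsI simp: setc_def split: if_splits)
      from eq[OF this free[OF int] free[OF int]] show ?thesis
        using uv vertex_pairsD[OF uv] by (simp add: z act_nerve A'A)
    qed (simp add: act_nerve_undef)
  qed
  \<comment> \<open>\<open>A\<close> leaves \<open>y\<close> in place while \<open>A'\<close> moves
    its coordinate \<open>i\<close>, although both pull \<open>\<phi>\<close> back to the same
    cell.\<close>
  have Ay: "restrict (setc k S (\<lambda>i. of_bool (b i))) (icube k) y = y"
    using y icube_undef[OF y] by (auto simp: setc_def S_def b_def fun_eq_iff)
  have A'y: "restrict (setc k (insert i S) (\<lambda>j. of_bool ((b(i := c)) j))) (icube k) y = y(i := of_bool c)"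
    using y icube_undef[OF y] i(1) by (auto simp: setc_def S_def b_def fun_eq_iff)
  note g = cell_equiv_glue[OF box_arrow_setc[OF fin(1), of k b] \<phi> y, unfolded Ay, folded A_def]
  note g' = cell_equiv_glue[OF box_arrow_setc[OF fin(2), of k "b(i := c)"] \<phi> y, unfolded A'y, folded A'_def]
  note E = equiv_cell_equiv[OF cubical_set_nerve, of M]
  from g have "(((k, \<phi>), y), ((k, act (nerve M) k k (restrict A' (vertices k)) \<phi>), y)) \<in> cell_equiv (nerve M)"
    unfolding cell using E by (meson equiv_def symD)
  with g' show ?thesis
    using E by (meson equiv_def transD)
qed

lemma cell_equiv_move_one:
  assumes \<phi>: "\<phi> \<in> cells (nerve M) k" and y: "y \<in> icube k" and i: "i < k" "0 < y i" "y i < 1" "y i \<notin> ess k \<phi> y"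
    and t: "0 \<le> t" "t \<le> 1"
  shows "(((k, \<phi>), y), ((k, \<phi>), y(i := t))) \<in> cell_equiv (nerve M)"
proof -
  note E = equiv_cell_equiv[OF cubical_set_nerve, of M]
  have free: "\<phi> (v(i := False), v(i := True)) = \<one>"
    if "(thr k 1 y, v) \<in> vertex_pairs k" "(v, sthr k 0 y) \<in> vertex_pairs k" for v
    using i that unfolding ess_def by blast
  note move = cell_equiv_move_to_face[OF \<phi> y i(1-3) free]
  consider "t = of_bool False" | "t = of_bool True" | "0 < t" "t < 1" using t by force
  then show ?thesis
  proof cases
    case 3
    let ?y = "y(i := t)"
    have y': "?y \<in> icube k" using icube_upd_inner[OF y i(1) t] .
    have th: "thr k 1 ?y = thr k 1 y" "sthr k 0 ?y = sthr k 0 y"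
      using i 3 by (auto intro!: vertices_ext[of _ k] split: if_splits)
    \<comment> \<open>Both points are interior in direction \<open>i\<close> of the same smallest
      face, so both can be moved to its side at 0.\<close>
    have "(((k, \<phi>), ?y), ((k, \<phi>), ?y(i := of_bool False))) \<in> cell_equiv (nerve M)"
      using 3 free th by (intro cell_equiv_move_to_face[OF \<phi> y' i(1)]) auto
    moreover have "(((k, \<phi>), y), ((k, \<phi>), y(i := of_bool False))) \<in> cell_equiv (nerve M)" by (rule move)
    ultimately show ?thesis using E by (simp add: equiv_def) (meson symD transD)
  qed (use move in \<open>simp_all only:\<close>)
qed

text \<open>Coordinates are changed one at a time. The essential set is invariant under gluing, so a
  coordinate value inessential at the start remains so at every intermediate point.\<close>

lemma cell_equiv_move:
  assumes \<phi>: "\<phi> \<in> cells (nerve M) k" and y: "y \<in> icube k" and y': "y' \<in> icube k"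
    and mv: "\<And>i. i < k \<Longrightarrow> y' i = y i \<or> 0 < y i \<and> y i < 1 \<and> y i \<notin> ess k \<phi> y"
  shows "(((k, \<phi>), y), ((k, \<phi>), y')) \<in> cell_equiv (nerve M)"
proof -
  note E = equiv_cell_equiv[OF cubical_set_nerve, of M]
  define z where "z = (\<lambda>j i. if i < j then y' i else y i)"
  have zi: "z j \<in> icube k" for j
    using y y' by (auto simp: z_def icube_def PiE_iff extensional_def)
  have "(((k, \<phi>), y), ((k, \<phi>), z j)) \<in> cell_equiv (nerve M)" if "j \<le> k" for j
    using that
  proof (induction j)
    case 0
    have "z 0 = y" by (simp add: z_def)
    then show ?case using E \<phi> y by (simp add: equiv_def refl_on_def points_cell_sum)
  next
    case (Suc j)
    then have IH: "(((k, \<phi>), y), ((k, \<phi>), z j)) \<in> cell_equiv (nerve M)" and j: "j < k" by auto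
    have zS: "z (Suc j) = (z j)(j := y' j)" by (auto simp: z_def fun_eq_iff)
    have zj: "z j j = y j" by (simp add: z_def)
    have "(((k, \<phi>), z j), ((k, \<phi>), z (Suc j))) \<in> cell_equiv (nerve M)"
    proof (cases "y' j = y j")
      case True
      then have "z (Suc j) = z j" unfolding zS using zj by (simp add: fun_upd_idem)
      then show ?thesis using E \<phi> zi by (simp add: equiv_def refl_on_def points_cell_sum)
    next
      case False
      then have "0 < z j j" "z j j < 1" "z j j \<notin> ess k \<phi> (z j)"
        using mv[OF j] ess_invariant[OF IH] zj by auto
      then show ?thesis
        unfolding zS using cell_equiv_move_one[OF \<phi> zi j] icubeD[OF y' j] by blast
    qed
    then show ?case using IH E by (meson equiv_def transD)
  qed
  moreover have "z k = y'"
    by (rule icube_ext[OF zi y']) (simp add: z_def)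
  ultimately show ?thesis by (metis order_refl)
qed

text \<open>The point of cell \<open>\<phi>\<close> with coordinates \<open>x\<close> lies within \<open>r\<close> of the class of \<open>z0\<close>, as measured in
  that cell. For small \<open>r\<close> this does not depend on the cell.\<close>

definition close_to :: "'a cell_point \<Rightarrow> real \<Rightarrow>
    'a cell_point \<Rightarrow> bool" where
  "close_to z0 r = (\<lambda>((k, \<phi>), x). \<exists>y\<in>icube k. (z0, ((k, \<phi>), y)) \<in> cell_equiv (nerve M) \<and> near k r x y)"

text \<open>A witness in the source is pushed forward, since arrows do not increase distances. A
  witness in the target is lifted by a section; where the arrow is constant the witness may deviate
  from the constant, but only by less than \<open>r\<close>, hence in an inessential coordinate that
  can be moved back.\<close>

lemma close_to_natural:
  assumes ba: "box_arrow m n f F" and \<phi>: "\<phi> \<in> cells (nerve M) n" and x: "x \<in> icube m"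
    and r: "0 < r" "r < 1" "\<And>e. e \<in> ess k0 \<phi>0 x0 \<Longrightarrow> r \<le> e \<and> r \<le> 1 - e"
  shows "close_to ((k0, \<phi>0), x0) r ((m, act (nerve M) m n f \<phi>), x) = close_to ((k0, \<phi>0), x0) r ((n, \<phi>), F x)"
proof -
  let ?z0 = "((k0, \<phi>0), x0)"
  note E = equiv_cell_equiv[OF cubical_set_nerve, of M]
  obtain \<sigma> where rep: "arrow_rep m n \<sigma> f F" using box_arrow_rep[OF ba] by blast
  show ?thesis
  proof
    assume "close_to ?z0 r ((m, act (nerve M) m n f \<phi>), x)"
    then obtain y where y: "y \<in> icube m" "(?z0, ((m, act (nerve M) m n f \<phi>), y)) \<in> cell_equiv (nerve M)" "near m r x y"
      by (auto simp: close_to_def)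
    have "(?z0, ((n, \<phi>), F y)) \<in> cell_equiv (nerve M)"
      using y cell_equiv_glue[OF ba \<phi> y(1)] E by (meson equiv_def transD)
    moreover have "near n r (F x) (F y)"
      unfolding near_def
    proof (intro allI impI)
      fix i assume i: "i < n"
      show "\<bar>F y i - F x i\<bar> < r"
        using y(3) r(1) arrow_rep_less[OF rep i]
        by (cases "\<sigma> i") (auto simp: arrow_rep_point_nth[OF rep x i] arrow_rep_point_nth[OF rep y(1) i] near_def)
    qed
    ultimately show "close_to ?z0 r ((n, \<phi>), F x)"
      using arrow_rep_icube[OF rep y(1)] by (auto simp: close_to_def)
  next
    assume "close_to ?z0 r ((n, \<phi>), F x)"
    then obtain z where z: "z \<in> icube n" "(?z0, ((n, \<phi>), z)) \<in> cell_equiv (nerve M)" "near n r (F x) z"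
      by (auto simp: close_to_def)
    \<comment> \<open>The default \<open>x\<close> leaves the coordinates projected away unchanged,
      so the lifted witness stays near \<open>x\<close>.\<close>
    let ?y = "arrow_section m n \<sigma> z x"
    have y: "?y \<in> icube m" using arrow_section_icube[OF rep z(1) x] .
    have "(((n, \<phi>), z), ((n, \<phi>), F ?y)) \<in> cell_equiv (nerve M)"
    proof (rule cell_equiv_move[OF \<phi> z(1) arrow_rep_icube[OF rep y]])
      fix i assume i: "i < n"
      show "F ?y i = z i \<or> 0 < z i \<and> z i < 1 \<and> z i \<notin> ess n \<phi> z"
      proof (cases "\<sigma> i")
        case (Inr j)
        then show ?thesis using arrow_section_image[OF rep i Inr, of z x] arrow_rep_point_nth[OF rep y i] by simp
      next
        case (Inl b)
        then have Fi: "F ?y i = of_bool b" "F x i = of_bool b"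
          using arrow_rep_point_nth[OF rep y i] arrow_rep_point_nth[OF rep x i] by simp_all
        have d: "\<bar>z i - of_bool b\<bar> < r" using z(3) i unfolding near_def Fi(2)[symmetric] by blast
        have "z i \<notin> ess n \<phi> z" if "0 < z i" "z i < 1"
        proof
          assume "z i \<in> ess n \<phi> z"
          then have "r \<le> z i \<and> r \<le> 1 - z i" using r(3) ess_invariant[OF z(2)] by simp
          then show False using d by (cases b) auto
        qed
        moreover have "z i = of_bool b \<or> 0 < z i \<and> z i < 1"
          using d icubeD[OF z(1) i] r(2) by (cases b) auto
        ultimately show ?thesis using Fi by auto
      qed
    qed
    then have "(?z0, ((n, \<phi>), F ?y)) \<in> cell_equiv (nerve M)" using z(2) E by (meson equiv_def transD)
    then have "(?z0, ((m, act (nerve M) m n f \<phi>), ?y)) \<in> cell_equiv (nerve M)"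
      using cell_equiv_glue[OF ba \<phi> y] E by (meson equiv_def symD transD)
    moreover have "near m r x ?y"
      unfolding near_def
    proof (intro allI impI)
      fix j assume j: "j < m"
      show "\<bar>?y j - x j\<bar> < r"
      proof (cases "\<exists>i<n. \<sigma> i = Inr j")
        case True
        then obtain i where i: "i < n" "\<sigma> i = Inr j" by blast
        then have "F x i = x j" "?y j = z i"
          using arrow_rep_point_nth[OF rep x i(1)] arrow_section_image[OF rep i] by simp_all
        then show ?thesis using z(3) i(1) by (auto simp: near_def)
      next
        case False
        then have "?y j = x j" using arrow_section_other[OF j] by blast
        then show ?thesis using r(1) by simp
      qed
    qed
    ultimately show "close_to ?z0 r ((m, act (nerve M) m n f \<phi>), x)"
      using y by (auto simp: close_to_def)
  qed
qed

lemma close_to_self: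
  assumes "((k, \<phi>), x) \<in> points (cell_sum (nerve M))" "0 < r"
  shows "close_to ((k, \<phi>), x) r ((k, \<phi>), x)"
  using assms equiv_cell_equiv[OF cubical_set_nerve, of M]
  by (auto simp: close_to_def points_cell_sum equiv_def refl_on_def intro!: bexI[of _ x])

lemma close_to_mono: "close_to z0 r z \<Longrightarrow> r \<le> s \<Longrightarrow> close_to z0 s z"
  by (auto simp: close_to_def split: prod.splits intro: near_mono)

lemma Hausdorff_cell_equiv:
  "Hausdorff_space (quotient_topology (topo (cell_sum (nerve M))) (cell_equiv (nerve M)))"
proof (rule Hausdorff_quotientI[OF equiv_cell_equiv[OF cubical_set_nerve]])
  let ?C = "nerve M"
  note E = equiv_cell_equiv[OF cubical_set_nerve, of M]
  fix z0 z1 assume z: "z0 \<in> points (cell_sum ?C)" "z1 \<in> points (cell_sum ?C)" and ne: "(z0, z1) \<notin> cell_equiv ?C"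
  obtain k0 \<phi>0 x0 where z0: "z0 = ((k0, \<phi>0), x0)" by (metis surj_pair)
  obtain k1 \<phi>1 x1 where z1: "z1 = ((k1, \<phi>1), x1)" by (metis surj_pair)
  have \<phi>1: "\<phi>1 \<in> cells ?C k1" and x1: "x1 \<in> icube k1" using z(2) by (auto simp: z1 points_cell_sum)
  let ?E = "ess k0 \<phi>0 x0"
  \<comment> \<open>Below these bounds, essential coordinates of \<open>z0\<close> stay away from 0
    and 1, interior coordinates of \<open>x1\<close> stay interior, and an essential value closer
    than the radius to a coordinate of \<open>x1\<close> equals it. The value \<open>1 / 2\<close>
    keeps 0 and 1 apart.\<close>
  define R where "R = {1 / 2} \<union> (\<lambda>e. min e (1 - e)) ` ?E \<union> (\<lambda>i. min (x1 i) (1 - x1 i)) ` {i. i < k1 \<and> 0 < x1 i \<and> x1 i < 1}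
    \<union> (\<lambda>(e, i). \<bar>e - x1 i\<bar>) ` {(e, i). e \<in> ?E \<and> i < k1 \<and> e \<noteq> x1 i}"
  have "finite {(e, i). e \<in> ?E \<and> i < k1 \<and> e \<noteq> x1 i}"
    by (rule finite_subset[of _ "?E \<times> {..<k1}"]) (auto simp: finite_ess)
  then have fin: "finite R" "R \<noteq> {}" by (auto simp: R_def finite_ess)
  define r where "r = Min R"
  have "\<And>s. s \<in> R \<Longrightarrow> 0 < s" by (auto simp: R_def dest: ess_bounds)
  then have r0: "0 < r" using fin by (simp add: r_def)
  have rR: "r \<le> s" if "s \<in> R" for s using that fin by (simp add: r_def)
  have r1: "r \<le> 1 / 2" by (rule rR) (simp add: R_def)
  have rE: "r \<le> e \<and> r \<le> 1 - e" if "e \<in> ?E" for e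
    using rR[of "min e (1 - e)"] that by (auto simp: R_def)
  have rx: "r \<le> x1 i \<and> r \<le> 1 - x1 i" if "i < k1" "0 < x1 i" "x1 i < 1" for i
    using rR[of "min (x1 i) (1 - x1 i)"] that by (auto simp: R_def)
  have rEx: "r \<le> \<bar>e - x1 i\<bar>" if "e \<in> ?E" "i < k1" "e \<noteq> x1 i" for e i
    by (rule rR) (use that in \<open>auto simp: R_def image_iff\<close>)
  have not_close: "\<not> close_to z0 r z1"
  proof
    assume "close_to z0 r z1"
    then obtain y where y: "y \<in> icube k1" "(z0, ((k1, \<phi>1), y)) \<in> cell_equiv ?C" "near k1 r x1 y"
      by (auto simp: close_to_def z1)
    have ey: "ess k1 \<phi>1 y = ?E" using ess_invariant[OF y(2)[unfolded z0]] by simp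
    \<comment> \<open>By the choice of \<open>r\<close>, every coordinate in which \<open>y\<close>
      and \<open>x1\<close> differ is interior and inessential. So closeness would already identify
      the two points.\<close>
    have "(((k1, \<phi>1), y), ((k1, \<phi>1), x1)) \<in> cell_equiv ?C"
    proof (rule cell_equiv_move[OF \<phi>1 y(1) x1])
      fix i assume i: "i < k1"
      have d: "\<bar>y i - x1 i\<bar> < r" using y(3) i by (simp add: near_def)
      show "x1 i = y i \<or> 0 < y i \<and> y i < 1 \<and> y i \<notin> ess k1 \<phi>1 y"
      proof (rule disjCI)
        assume a: "\<not> (0 < y i \<and> y i < 1 \<and> y i \<notin> ess k1 \<phi>1 y)"
        consider "x1 i = 0" | "x1 i = 1" | "0 < x1 i" "x1 i < 1" using icubeD[OF x1 i] by force
        then show "x1 i = y i"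
        proof cases
          case 1
          then show ?thesis using a d r1 rE[of "y i"] icubeD[OF y(1) i] ey by force
        next
          case 2
          then show ?thesis using a d r1 rE[of "y i"] icubeD[OF y(1) i] ey by force
        next
          case 3
          then show ?thesis using a d rx[OF i 3] rEx[of "y i" i] i ey by force
        qed
      qed
    qed
    then show False using ne y(2) E unfolding z1 by (meson equiv_def transD)
  qed
  let ?A = "{w \<in> points (cell_sum ?C). close_to z0 (r / 2) w}"
  \<comment> \<open>The freedom in \<open>s\<close> makes this set open: shrinking \<open>s\<close>
    slightly absorbs a small displacement. The strict bound by \<open>r / 2\<close> keeps it
    disjoint from \<open>?A\<close>.\<close>
  let ?B = "{w \<in> points (cell_sum ?C). \<exists>s. r / 2 < s \<and> s \<le> r \<and> \<not> close_to z0 s w}"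
  have sat: "close_to z0 s w = close_to z0 s w'" if "(w, w') \<in> cell_equiv ?C" "0 < s" "s \<le> r" for s w w'
    using that(1) cubical_set_nerve
  proof (rule cell_equiv_invariant)
    fix m n f F c x assume "box_arrow m n f F" "c \<in> cells ?C n" "x \<in> icube m"
    then show "close_to z0 s ((m, act ?C m n f c), x) = close_to z0 s ((n, c), F x)"
      unfolding z0 using that r1 rE by (intro close_to_natural) force+
  qed
  have A: "openin (topo (cell_sum ?C)) ?A"
    unfolding openin_cell_sum
  proof (intro conjI allI ballI)
    fix k c assume c: "c \<in> cells ?C k"
    let ?Y = "{y \<in> icube k. (z0, ((k, c), y)) \<in> cell_equiv ?C}"
    have "{x. ((k, c), x) \<in> ?A} = (\<Union>y\<in>?Y. {x \<in> icube k. near k (r / 2) y x})"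
    proof (rule Set.set_eqI)
      fix x
      have "((k, c), x) \<in> ?A \<longleftrightarrow> x \<in> icube k \<and> (\<exists>y\<in>?Y. near k (r / 2) x y)"
        using c by (auto simp: close_to_def points_cell_sum)
      also have "\<dots> \<longleftrightarrow> x \<in> icube k \<and> (\<exists>y\<in>?Y. near k (r / 2) y x)"
        using near_sym by meson
      finally show "x \<in> {x. ((k, c), x) \<in> ?A} \<longleftrightarrow> x \<in> (\<Union>y\<in>?Y. {x \<in> icube k. near k (r / 2) y x})" by simp
    qed
    then show "openin (icube_topology k) {x. ((k, c), x) \<in> ?A}"
      using openin_icube_near by auto
  qed auto
  have B: "openin (topo (cell_sum ?C)) ?B"
    unfolding openin_cell_sum
  proof (intro conjI allI ballI)
    fix k c assume c: "c \<in> cells ?C k"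
    show "openin (icube_topology k) {x. ((k, c), x) \<in> ?B}"
      unfolding openin_icube
    proof (intro conjI ballI)
      show "{x. ((k, c), x) \<in> ?B} \<subseteq> icube k" by (auto simp: points_cell_sum)
      fix x assume "x \<in> {x. ((k, c), x) \<in> ?B}"
      then obtain s where s: "r / 2 < s" "s \<le> r" "\<not> close_to z0 s ((k, c), x)" by auto
      define t where "t = (r / 2 + s) / 2"
      have t: "r / 2 < t" "t < s" "t \<le> r" using s by (auto simp: t_def field_simps)
      have "((k, c), w) \<in> ?B" if w: "w \<in> icube k" "near k (s - t) x w" for w
      proof -
        have "\<not> close_to z0 t ((k, c), w)"
        proof
          assume "close_to z0 t ((k, c), w)"
          then obtain y where y: "y \<in> icube k" "(z0, ((k, c), y)) \<in> cell_equiv ?C" "near k t w y"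
            by (auto simp: close_to_def)
          have "near k s x y" using near_trans[OF w(2) y(3)] by simp
          then show False using s(3) y by (auto simp: close_to_def)
        qed
        then show ?thesis using t w(1) c by (auto simp: points_cell_sum)
      qed
      then show "\<exists>d>0. \<forall>w\<in>icube k. near k d x w \<longrightarrow> w \<in> {x. ((k, c), x) \<in> ?B}"
        using t(2) by (intro exI[of _ "s - t"]) auto
    qed
  qed auto
  have disj: "?A \<inter> ?B = {}" using close_to_mono by fastforce
  have z0A: "z0 \<in> ?A" using z(1) close_to_self[of k0 \<phi>0 x0 "r / 2"] r0 by (simp add: z0)
  have z1B: "z1 \<in> ?B" using z(2) not_close r0 by (auto intro!: exI[of _ r])
  have AB: "(a \<in> ?A \<longrightarrow> b \<in> ?A) \<and> (a \<in> ?B \<longrightarrow> b \<in> ?B)" if ab: "(a, b) \<in> cell_equiv ?C" for a b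
  proof -
    have b: "b \<in> points (cell_sum ?C)" using ab E by (auto simp: equiv_def)
    have "close_to z0 (r / 2) a = close_to z0 (r / 2) b" using sat[OF ab, of "r / 2"] r0 by simp
    moreover have "close_to z0 s a = close_to z0 s b" if "r / 2 < s" "s \<le> r" for s
      using sat[OF ab, of s] r0 that by simp
    ultimately show ?thesis using b by auto
  qed
  show "\<exists>A B. openin (topo (cell_sum ?C)) A \<and> openin (topo (cell_sum ?C)) B \<and> z0 \<in> A \<and> z1 \<in> B \<and> A \<inter> B = {} \<and>
        (\<forall>a b. (a, b) \<in> cell_equiv ?C \<longrightarrow> (a \<in> A \<longrightarrow> b \<in> A) \<and> (a \<in> B \<longrightarrow> b \<in> B))"
    by (rule exI[of _ ?A], rule exI[of _ ?B], intro conjI allI impI)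
       (rule A B disj z0A z1B AB[THEN conjunct1, THEN mp] AB[THEN conjunct2, THEN mp]; assumption?)+
qed

lemma ditop_equiv_nerve: "ditop_equiv (cell_sum (nerve M)) (cell_glue (nerve M)) = cell_equiv (nerve M)"
proof (rule ditop_equiv_eqI[OF equiv_cell_equiv[OF cubical_set_nerve] _ Hausdorff_cell_equiv])
  show "cell_glue (nerve M) \<subseteq> cell_equiv (nerve M)" unfolding cell_equiv_def by blast
  show "cell_equiv (nerve M) \<subseteq> R" if "equiv (points (cell_sum (nerve M))) R" "cell_glue (nerve M) \<subseteq> R" for R
    unfolding cell_equiv_def using that by blast
qed

end

subsection \<open>Transport across thresholds\<close>

context nerve_space
begin

abbreviation X :: "'a cell_point set prestream" where
  "X \<equiv> realization (nerve M)"

definition pt :: "nat \<Rightarrow> ((nat \<Rightarrow> bool) \<times> (nat \<Rightarrow> bool) \<Rightarrow> 'a) \<Rightarrow> (nat \<Rightarrow> real) \<Rightarrow>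
    'a cell_point set" where
  "pt k \<phi> x = cell_equiv (nerve M) `` {((k, \<phi>), x)}"

lemma X_eq: "X = quotient_stream (cell_sum (nerve M)) (cell_equiv (nerve M))"
  by (simp add: realization_def ditop_quotient_def ditop_equiv_nerve)

lemma equiv_nerve: "equiv (points (cell_sum (nerve M))) (cell_equiv (nerve M))"
  by (rule equiv_cell_equiv[OF cubical_set_nerve])

lemma stream_X: "stream X"
  unfolding X_eq by (rule stream_quotient_stream[OF stream_cell_sum equiv_nerve])

lemma points_X: "points X = {pt k \<phi> x | k \<phi> x. \<phi> \<in> cells (nerve M) k \<and> x \<in> icube k}"
proof -
  have "points X = points (cell_sum (nerve M)) // cell_equiv (nerve M)"
    by (simp add: X_eq topspace_quotient_topology[OF equiv_nerve])
  also have "\<dots> = {pt k \<phi> x | k \<phi> x. \<phi> \<in> cells (nerve M) k \<and> x \<in> icube k}"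
  proof
    show "points (cell_sum (nerve M)) // cell_equiv (nerve M) \<subseteq> {pt k \<phi> x | k \<phi> x. \<phi> \<in> cells (nerve M) k \<and> x \<in> icube k}"
    proof
      fix C assume "C \<in> points (cell_sum (nerve M)) // cell_equiv (nerve M)"
      then obtain z where z: "z \<in> points (cell_sum (nerve M))" "C = cell_equiv (nerve M) `` {z}" by (auto elim: quotientE)
      obtain k \<phi> x where "z = ((k, \<phi>), x)" by (metis surj_pair)
      then show "C \<in> {pt k \<phi> x | k \<phi> x. \<phi> \<in> cells (nerve M) k \<and> x \<in> icube k}"
        using z unfolding pt_def by (auto simp: points_cell_sum)
    qed
  qed (auto simp: pt_def points_cell_sum intro!: quotientI)
  finally show ?thesis .
qed

lemma pt_in_X: "\<phi> \<in> cells (nerve M) k \<Longrightarrow> x \<in> icube k \<Longrightarrow> pt k \<phi> x \<in> points X"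
  unfolding points_X by blast

lemma X_cases:
  assumes "C \<in> points X"
  obtains k \<phi> x where "C = pt k \<phi> x" "\<phi> \<in> cells (nerve M) k" "x \<in> icube k"
  using assms unfolding points_X by blast

lemma pt_glue:
  "box_arrow m n f F \<Longrightarrow> \<phi> \<in> cells (nerve M) n \<Longrightarrow> x \<in> icube m \<Longrightarrow> pt m (act (nerve M) m n f \<phi>) x = pt n \<phi> (F x)"
  unfolding pt_def by (rule equiv_class_eq[OF equiv_nerve cell_equiv_glue])

section \<open>Functions on points and the circulation of the realization\<close>

definition natural :: "('a cell_point \<Rightarrow> 'c) \<Rightarrow> bool" where
  "natural Q \<longleftrightarrow> (\<forall>m n f F \<phi> x. box_arrow m n f F \<longrightarrow> \<phi> \<in> cells (nerve M) n \<longrightarrow> x \<in> icube m \<longrightarrow>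
     Q ((m, act (nerve M) m n f \<phi>), x) = Q ((n, \<phi>), F x))"

definition on_pts :: "('a cell_point \<Rightarrow> 'c) \<Rightarrow>
    'a cell_point set \<Rightarrow> 'c" where
  "on_pts Q C = Q (SOME z. z \<in> C)"

lemma on_pts_pt:
  assumes Q: "natural Q" and "\<phi> \<in> cells (nerve M) k" "x \<in> icube k"
  shows "on_pts Q (pt k \<phi> x) = Q ((k, \<phi>), x)"
proof -
  have "((k, \<phi>), x) \<in> pt k \<phi> x"
    unfolding pt_def using assms by (intro equiv_class_self[OF equiv_nerve]) (simp add: points_cell_sum)
  then have "(SOME z. z \<in> pt k \<phi> x) \<in> pt k \<phi> x" by (rule someI)
  then have "(((k, \<phi>), x), (SOME z. z \<in> pt k \<phi> x)) \<in> cell_equiv (nerve M)" by (simp add: pt_def)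
  then show ?thesis
    unfolding on_pts_def using cell_equiv_invariant[OF _ cubical_set_nerve, of _ _ M Q] Q unfolding natural_def by metis
qed

lemma stream_map_pt:
  assumes "\<phi> \<in> cells (nerve M) k"
  shows "stream_map (dcube k) X (pt k \<phi>)"
proof -
  have "stream_map (dcube k) (cell_sum (nerve M)) (Pair (k, \<phi>))"
    unfolding cell_sum_def
    using stream_map_inject[of "(k, \<phi>)" "Sigma UNIV (cells (nerve M))" "\<lambda>(n, c). dcube n"] assms by simp
  from stream_map_compose[OF this stream_map_quotient[OF stream_cell_sum equiv_nerve]]
  show ?thesis by (simp add: X_eq pt_def[abs_def])
qed

lemma openin_X:
  "openin (topo X) U \<longleftrightarrow> U \<subseteq> points X \<and>
     (\<forall>k. \<forall>\<phi>\<in>cells (nerve M) k. openin (icube_topology k) {x \<in> icube k. pt k \<phi> x \<in> U})"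
proof -
  let ?S = "cell_sum (nerve M)"
  have "openin (topo X) U \<longleftrightarrow> U \<subseteq> points X \<and> openin (topo ?S) {z \<in> points ?S. cell_equiv (nerve M) `` {z} \<in> U}"
    by (simp add: X_eq openin_quotient_iff[OF equiv_nerve] topspace_quotient_topology[OF equiv_nerve])
  also have "\<dots> \<longleftrightarrow> U \<subseteq> points X \<and>
     (\<forall>k. \<forall>\<phi>\<in>cells (nerve M) k. openin (icube_topology k) {x \<in> icube k. pt k \<phi> x \<in> U})"
  proof -
    have "{x. ((k, \<phi>), x) \<in> {z \<in> points ?S. cell_equiv (nerve M) `` {z} \<in> U}} = {x \<in> icube k. pt k \<phi> x \<in> U}"
      if "\<phi> \<in> cells (nerve M) k" for k \<phi>
      using that by (auto simp: points_cell_sum pt_def)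
    then show ?thesis by (simp add: openin_cell_sum)
  qed
  finally show ?thesis .
qed

lemma openin_pt_preimage:
  "openin (topo X) U \<Longrightarrow> \<phi> \<in> cells (nerve M) k \<Longrightarrow> openin (icube_topology k) {x \<in> icube k. pt k \<phi> x \<in> U}"
  by (simp add: openin_X)

definition moves :: "'a cell_point set set \<Rightarrow>
    'a cell_point set rel" where
  "moves U = {(pt k \<phi> x, pt k \<phi> y) | k \<phi> x y. \<phi> \<in> cells (nerve M) k \<and> x \<in> icube k \<and> y \<in> icube k \<and> cle k x y \<and>
     (\<forall>z\<in>cbetween k x y. pt k \<phi> z \<in> U)}"

text \<open>The transitive closures from the cubes and the quotient merge into a single one,
  generated by order moves inside one cell whose interval stays in \<open>U\<close>.\<close>

lemma circ_X:
  assumes U: "openin (topo X) U"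
  shows "circ X U = (moves U)\<^sup>+"
proof
  let ?S = "cell_sum (nerve M)"
  let ?V = "{z \<in> points ?S. cell_equiv (nerve M) `` {z} \<in> U}"
  have UQ: "openin (quotient_topology (topo ?S) (cell_equiv (nerve M))) U" using U by (simp add: X_eq)
  have V: "openin (topo ?S) ?V" using UQ by (simp add: openin_quotient_iff[OF equiv_nerve])
  show "circ X U \<subseteq> (moves U)\<^sup>+"
  proof (intro subrelI)
    fix C D assume "(C, D) \<in> circ X U"
    then have "(C, D) \<in> {(cell_equiv (nerve M) `` {z}, cell_equiv (nerve M) `` {w}) | z w. (z, w) \<in> circ ?S ?V}\<^sup>+"
      unfolding X_eq circ_quotient_stream[OF equiv_nerve UQ] .
    then show "(C, D) \<in> (moves U)\<^sup>+"
    proof (rule trancl_image_into[where f = "\<lambda>x. x"])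
      fix C D assume "(C, D) \<in> {(cell_equiv (nerve M) `` {z}, cell_equiv (nerve M) `` {w}) | z w. (z, w) \<in> circ ?S ?V}"
      then obtain z w where zw: "C = cell_equiv (nerve M) `` {z}" "D = cell_equiv (nerve M) `` {w}" "(z, w) \<in> circ ?S ?V" by blast
      have "\<exists>k \<phi> x y. z = ((k, \<phi>), x) \<and> w = ((k, \<phi>), y) \<and> \<phi> \<in> cells (nerve M) k \<and> (x, y) \<in> circ (dcube k) {x. ((k, \<phi>), x) \<in> ?V}"
        using zw(3) circ_sum_stream[OF V[unfolded cell_sum_def]] unfolding cell_sum_def by auto
      then obtain k \<phi> x y where *: "z = ((k, \<phi>), x)" "w = ((k, \<phi>), y)" "\<phi> \<in> cells (nerve M) k"
        "(x, y) \<in> circ (dcube k) {x. ((k, \<phi>), x) \<in> ?V}" by blast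
      have eq: "{x. ((k, \<phi>), x) \<in> ?V} = {x \<in> icube k. pt k \<phi> x \<in> U}"
        using *(3) by (auto simp: points_cell_sum pt_def)
      have "(x, y) \<in> dcirc k {x \<in> icube k. pt k \<phi> x \<in> U}"
        using *(4) circ_dcube[OF openin_pt_preimage[OF U *(3)]] unfolding eq by simp
      then have "(pt k \<phi> x, pt k \<phi> y) \<in> (moves U)\<^sup>+"
        unfolding dcirc_def
      proof (rule trancl_image_into)
        fix a b assume "(a, b) \<in> {(a, b). a \<in> icube k \<and> b \<in> icube k \<and> cle k a b \<and> cbetween k a b \<subseteq> {x \<in> icube k. pt k \<phi> x \<in> U}}"
        then show "(pt k \<phi> a, pt k \<phi> b) \<in> (moves U)\<^sup>+"
          using *(3) unfolding moves_def
          by (intro r_into_trancl CollectI exI[of _ k] exI[of _ \<phi>] exI[of _ a] exI[of _ b]) auto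
      qed simp
      then show "(C, D) \<in> (moves U)\<^sup>+" using zw * by (simp add: pt_def)
    qed simp
  qed
  show "(moves U)\<^sup>+ \<subseteq> circ X U"
  proof -
    have "moves U \<subseteq> circ X U"
    proof
      fix p assume "p \<in> moves U"
      then obtain k \<phi> x y where *: "p = (pt k \<phi> x, pt k \<phi> y)" "\<phi> \<in> cells (nerve M) k" "x \<in> icube k" "y \<in> icube k" "cle k x y"
        "\<forall>z\<in>cbetween k x y. pt k \<phi> z \<in> U" unfolding moves_def by blast
      have "(x, y) \<in> dcirc k {x \<in> icube k. pt k \<phi> x \<in> U}"
        using * by (intro mem_circ_basic) (auto simp: cbetween_def)
      then have "(x, y) \<in> circ (dcube k) {x \<in> points (dcube k). pt k \<phi> x \<in> U}"
        using circ_dcube[OF openin_pt_preimage[OF U *(2)]] by simp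
      then show "p \<in> circ X U" unfolding *(1) by (rule stream_mapD[OF stream_map_pt[OF *(2)] U])
    qed
    then have "(moves U)\<^sup>+ \<subseteq> (circ X U)\<^sup>+" by (rule trancl_mono_subset)
    then show ?thesis using circ_trans[OF stream_X U] by (simp add: trancl_id)
  qed
qed

section \<open>Comparison of thresholds and regular sets\<close>

lemma thr_antimono: "a \<le> b \<Longrightarrow> (thr k b x, thr k a x) \<in> vertex_pairs k"
  by (auto intro!: vertex_pairsI)

lemma thr_mono: "cle k x y \<Longrightarrow> (thr k a x, thr k a y) \<in> vertex_pairs k"
  by (auto intro!: vertex_pairsI simp: cle_def intro: order_trans)

definition transport :: "real \<Rightarrow> real \<Rightarrow> 'a cell_point set \<Rightarrow> 'a" where
  "transport b a = on_pts (\<lambda>((k, \<phi>), x). \<phi> (thr k b x, thr k a x))"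

lemma transport_pt:
  assumes "0 < a" "a \<le> b" "b \<le> 1" "\<phi> \<in> cells (nerve M) k" "x \<in> icube k"
  shows "transport b a (pt k \<phi> x) = \<phi> (thr k b x, thr k a x)"
proof -
  have "natural (\<lambda>((k, \<phi>), x). \<phi> (thr k b x, thr k a x))" (is "natural ?Q")
    unfolding natural_def
  proof (intro allI impI)
    fix m n f F \<phi> x assume ba: "box_arrow m n f F" and x: "x \<in> icube m"
    obtain \<sigma> where r: "arrow_rep m n \<sigma> f F" using box_arrow_rep[OF ba] by blast
    show "?Q ((m, act (nerve M) m n f \<phi>), x) = ?Q ((n, \<phi>), F x)"
      using assms by (simp add: act_nerve[OF thr_antimono] arrow_rep_thr[OF r x])
  qed
  from on_pts_pt[OF this assms(4,5)] show ?thesis by (simp add: transport_def)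
qed

lemma transport_closed:
  assumes "0 < a" "a \<le> b" "b \<le> 1" "C \<in> points X"
  shows "transport b a C \<in> carrier M"
proof -
  obtain k \<phi> x where C: "C = pt k \<phi> x" "\<phi> \<in> cells (nerve M) k" "x \<in> icube k" using X_cases[OF assms(4)] .
  then show ?thesis using assms nerve_closed[OF C(2) thr_antimono] by (simp add: transport_pt)
qed

text \<open>Points none of whose coordinates within \<open>e\<close> of the threshold \<open>a\<close> matter: no transport across
  that threshold takes place in this set.\<close>

definition regular :: "real \<Rightarrow> real \<Rightarrow> 'a cell_point set set" where
  "regular a e = {C \<in> points X. on_pts (\<lambda>((k, \<phi>), x). \<forall>v w. (sthr k (a + e) x, v) \<in> vertex_pairs k \<longrightarrow>
     (v, w) \<in> vertex_pairs k \<longrightarrow> (w, thr k (a - e) x) \<in> vertex_pairs k \<longrightarrow> \<phi> (v, w) = \<one>) C}"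

text \<open>The window around \<open>a\<close> must avoid 0, so that rounding commutes with arrows,
  and must stay below \<open>1 / 2\<close>, so that transport from \<open>1 / 2\<close> to
  \<open>a\<close> is available.\<close>

definition level :: "real \<Rightarrow> real \<Rightarrow> bool" where
  "level a e \<longleftrightarrow> 0 < e \<and> 0 < a - e \<and> a + e < 1 / 2"

lemma levelD: "level a e \<Longrightarrow> 0 < e \<and> 0 < a \<and> e < a \<and> a < 1 / 2 \<and> a + e < 1 / 2"
  by (auto simp: level_def)

lemma pt_in_regular:
  assumes "level a e" "\<phi> \<in> cells (nerve M) k" "x \<in> icube k"
  shows "pt k \<phi> x \<in> regular a e \<longleftrightarrow> (\<forall>v w. (sthr k (a + e) x, v) \<in> vertex_pairs k \<longrightarrow>
     (v, w) \<in> vertex_pairs k \<longrightarrow> (w, thr k (a - e) x) \<in> vertex_pairs k \<longrightarrow> \<phi> (v, w) = \<one>)"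
proof -
  have "natural (\<lambda>((k, \<phi>), x). \<forall>v w. (sthr k (a + e) x, v) \<in> vertex_pairs k \<longrightarrow>
     (v, w) \<in> vertex_pairs k \<longrightarrow> (w, thr k (a - e) x) \<in> vertex_pairs k \<longrightarrow> \<phi> (v, w) = \<one>)" (is "natural ?Q")
    unfolding natural_def
  proof (intro allI impI)
    fix m n f F \<phi> x assume ba: "box_arrow m n f F" and x: "x \<in> icube m"
    obtain \<sigma> where r: "arrow_rep m n \<sigma> f F" using box_arrow_rep[OF ba] by blast
    let ?lo = "sthr m (a + e) x" and ?hi = "thr m (a - e) x"
    have th: "thr n (a - e) (F x) = f ?hi" and st: "sthr n (a + e) (F x) = f ?lo"
      using arrow_rep_thr[OF r x] arrow_rep_sthr[OF r x] levelD[OF assms(1)] by simp_all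
    have lohi: "(?lo, ?hi) \<in> vertex_pairs m"
      using levelD[OF assms(1)] by (intro vertex_pairsI) auto
    have "(\<forall>v w. (?lo, v) \<in> vertex_pairs m \<longrightarrow> (v, w) \<in> vertex_pairs m \<longrightarrow> (w, ?hi) \<in> vertex_pairs m \<longrightarrow>
        act (nerve M) m n f \<phi> (v, w) = \<one>) \<longleftrightarrow>
      (\<forall>v w. (f ?lo, v) \<in> vertex_pairs n \<longrightarrow> (v, w) \<in> vertex_pairs n \<longrightarrow> (w, f ?hi) \<in> vertex_pairs n \<longrightarrow> \<phi> (v, w) = \<one>)"
      (is "?L \<longleftrightarrow> ?R")
    proof
      assume L: ?L
      show ?R
      proof (intro allI impI)
        fix v w assume vw: "(f ?lo, v) \<in> vertex_pairs n" "(v, w) \<in> vertex_pairs n" "(w, f ?hi) \<in> vertex_pairs n"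
        \<comment> \<open>\<open>w\<close> is lifted first and \<open>v\<close> then below that
          lift, which keeps the lifted pair comparable.\<close>
        note lw = arrow_rep_interval_lift[OF r sthr_vertex thr_vertex lohi vertex_pairs_trans[OF vw(1,2)] vw(3)]
        let ?w = "arrow_section m n \<sigma> w ?lo"
        have "(v, f ?w) \<in> vertex_pairs n" using vw(2) lw(1) by simp
        note lv = arrow_rep_interval_lift[OF r sthr_vertex arrow_section_vertex lw(2) vw(1) this]
        show "\<phi> (v, w) = \<one>"
          using L[rule_format, OF lv(2,3) lw(3)] act_nerve[OF lv(3)] lv(1) lw(1) by simp
      qed
    next
      assume R: ?R
      show ?L
        using R arrow_rep_pairs[OF r] by (simp add: act_nerve)
    qed
    then show "?Q ((m, act (nerve M) m n f \<phi>), x) = ?Q ((n, \<phi>), F x)"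
      by (simp add: th st)
  qed
  from on_pts_pt[OF this assms(2,3)] show ?thesis
    using pt_in_X[OF assms(2,3)] by (simp add: regular_def)
qed

text \<open>The strict rounding at \<open>a + e\<close> and the weak one at \<open>a - e\<close> are
  chosen so that a small displacement can only shrink the interval between them. Coordinates above
  \<open>a + e\<close> stay above it, and coordinates below \<open>a - e\<close> stay below
  it.\<close>

lemma openin_regular:
  assumes l: "level a e"
  shows "openin (topo X) (regular a e)"
  unfolding openin_X
proof (intro conjI allI ballI)
  fix k \<phi> assume \<phi>: "\<phi> \<in> cells (nerve M) k"
  show "openin (icube_topology k) {x \<in> icube k. pt k \<phi> x \<in> regular a e}"
    unfolding openin_icube
  proof (intro conjI ballI)
    fix x assume "x \<in> {x \<in> icube k. pt k \<phi> x \<in> regular a e}"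
    then have x: "x \<in> icube k" "\<forall>v w. (sthr k (a + e) x, v) \<in> vertex_pairs k \<longrightarrow>
     (v, w) \<in> vertex_pairs k \<longrightarrow> (w, thr k (a - e) x) \<in> vertex_pairs k \<longrightarrow> \<phi> (v, w) = \<one>"
      using pt_in_regular[OF l \<phi>] by auto
    define R where "R = {1} \<union> (\<lambda>i. x i - (a + e)) ` {i. i < k \<and> a + e < x i} \<union> (\<lambda>i. (a - e) - x i) ` {i. i < k \<and> x i < a - e}"
    have fin: "finite R" "R \<noteq> {}" by (auto simp: R_def)
    define r where "r = Min R"
    have "\<And>s. s \<in> R \<Longrightarrow> 0 < s" by (auto simp: R_def)
    then have r0: "0 < r" using fin by (simp add: r_def)
    have r1: "r \<le> x i - (a + e)" if "i < k" "a + e < x i" for i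
      unfolding r_def using fin that by (intro Min_le) (auto simp: R_def)
    have r2: "r \<le> (a - e) - x i" if "i < k" "x i < a - e" for i
      unfolding r_def using fin that by (intro Min_le) (auto simp: R_def)
    have "y \<in> {x \<in> icube k. pt k \<phi> x \<in> regular a e}" if y: "y \<in> icube k" "near k r x y" for y
    proof -
      have yi: "\<bar>y i - x i\<bar> < r" if "i < k" for i using y(2) that by (simp add: near_def)
      have s: "(sthr k (a + e) x, sthr k (a + e) y) \<in> vertex_pairs k"
        by (rule vertex_pairsI) (use r1 yi in \<open>fastforce simp: abs_less_iff\<close>)+
      have t: "(thr k (a - e) y, thr k (a - e) x) \<in> vertex_pairs k"
      proof (rule vertex_pairsI)
        fix i assume i: "i < k" "thr k (a - e) y i"
        show "thr k (a - e) x i"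
        proof (rule ccontr)
          assume "\<not> thr k (a - e) x i"
          then show False using r2[OF i(1)] yi[OF i(1)] i by (auto simp: abs_less_iff)
        qed
      qed simp_all
      show ?thesis
        using x(2) y(1) vertex_pairs_trans[OF s] vertex_pairs_trans[OF _ t] by (simp add: pt_in_regular[OF l \<phi>])
    qed
    then show "\<exists>r>0. \<forall>y\<in>icube k. near k r x y \<longrightarrow> y \<in> {x \<in> icube k. pt k \<phi> x \<in> regular a e}"
      using r0 by blast
  qed auto
qed (auto simp: regular_def)

text \<open>A point has finitely many coordinates in a given cell, so some \<open>a\<close> in the
  range avoids them all. With a sufficiently small window the two roundings coincide and the
  interval contains one vertex only.\<close>

lemma exists_regular:
  assumes "C \<in> points X"
  obtains a e where "level a e" "C \<in> regular a e"
proof -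
  obtain k \<phi> x where C: "C = pt k \<phi> x" "\<phi> \<in> cells (nerve M) k" "x \<in> icube k" using X_cases[OF assms] .
  have "infinite ({0<..<1/2} - x ` {..<k})"
    by (rule Diff_infinite_finite) (simp_all add: infinite_Ioo)
  then have "{0<..<1/2} - x ` {..<k} \<noteq> {}" by (metis finite.emptyI)
  then obtain a where "a \<in> {0<..<1/2} - x ` {..<k}" by blast
  then have a: "0 < a" "a < 1 / 2" "a \<notin> x ` {..<k}" by simp_all
  define R where "R = {a / 2, (1 / 2 - a) / 2} \<union> (\<lambda>i. \<bar>x i - a\<bar> / 2) ` {..<k}"
  have fin: "finite R" "R \<noteq> {}" by (auto simp: R_def)
  define e where "e = Min R"
  have "\<And>s. s \<in> R \<Longrightarrow> 0 < s" using a by (auto simp: R_def)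
  then have e0: "0 < e" using fin by (simp add: e_def)
  have eR: "e \<le> s" if "s \<in> R" for s using fin that by (simp add: e_def)
  have "e \<le> a / 2" "e \<le> (1 / 2 - a) / 2" by (rule eR, simp add: R_def)+
  then have l: "level a e" using e0 a by (auto simp: level_def)
  have ex: "e < \<bar>x i - a\<bar>" if "i < k" for i
  proof -
    have "e \<le> \<bar>x i - a\<bar> / 2" using that by (intro eR) (auto simp: R_def)
    moreover have "x i \<noteq> a" using a(3) that by auto
    then have "\<bar>x i - a\<bar> / 2 < \<bar>x i - a\<bar>" by simp
    ultimately show ?thesis by (rule order.strict_trans1)
  qed
  have "thr k (a - e) x = sthr k (a + e) x"
  proof (rule vertices_ext)
    fix i assume i: "i < k"
    show "thr k (a - e) x i = sthr k (a + e) x i" using ex[OF i] i e0 by (auto simp: abs_if split: if_splits)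
  qed simp_all
  then have "C \<in> regular a e"
    unfolding C(1) pt_in_regular[OF l C(2,3)]
  proof (intro allI impI)
    fix v w assume *: "thr k (a - e) x = sthr k (a + e) x" "(sthr k (a + e) x, v) \<in> vertex_pairs k" "(v, w) \<in> vertex_pairs k" "(w, thr k (a - e) x) \<in> vertex_pairs k"
    have "v = w"
    proof (rule vertices_ext)
      show "v \<in> vertices k" "w \<in> vertices k" using vertex_pairsD[OF *(3)] by auto
      fix i assume i: "i < k"
      show "v i = w i"
        using vertex_pairsD(3)[OF *(2) i] vertex_pairsD(3)[OF *(3) i] vertex_pairsD(3)[OF *(4) i] unfolding *(1) by blast
    qed
    then show "\<phi> (v, w) = \<one>" using nerve_refl[OF C(2)] vertex_pairsD[OF *(3)] by simp
  qed
  then show thesis using that l by blast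
qed

text \<open>The move is cut into pieces that change coordinates by less than \<open>e\<close>. The
  roundings at \<open>a\<close> of both ends of a piece then lie in the interval controlled by
  regularity at its starting point.\<close>

lemma regular_step:
  assumes l: "level a e" and \<phi>: "\<phi> \<in> cells (nerve M) k" and x: "x \<in> icube k" and y: "y \<in> icube k" and xy: "cle k x y"
    and sub: "\<And>z. z \<in> cbetween k x y \<Longrightarrow> pt k \<phi> z \<in> regular a e"
  shows "\<phi> (thr k a x, thr k a y) = \<one>"
proof -
  note lv = levelD[OF l]
  have e0: "0 < e" using lv by simp
  obtain K z where z: "z 0 = x" "z K = y" "\<And>j. j \<le> K \<Longrightarrow> z j \<in> cbetween k x y"
    "\<And>j. j < K \<Longrightarrow> cle k (z j) (z (Suc j))" "\<And>j. j < K \<Longrightarrow> near k e (z j) (z (Suc j))"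
    by (rule cbetween_interpolate[OF x y xy e0]) blast
  have "\<phi> (thr k a x, thr k a (z j)) = \<one>" if "j \<le> K" for j
    using that
  proof (induction j)
    case 0
    then show ?case using nerve_refl[OF \<phi>] by (simp add: z(1))
  next
    case (Suc j)
    then have j: "j < K" "j \<le> K" by auto
    have zj: "z j \<in> icube k" "cle k x (z j)" using z(3)[OF j(2)] by (auto simp: cbetween_def)
    have "\<phi> (thr k a (z j), thr k a (z (Suc j))) = \<one>"
    proof (rule pt_in_regular[OF l \<phi> zj(1), THEN iffD1, OF sub[OF z(3)[OF j(2)]], rule_format])
      show "(sthr k (a + e) (z j), thr k a (z j)) \<in> vertex_pairs k"
        using lv by (intro vertex_pairsI) auto
      show "(thr k a (z j), thr k a (z (Suc j))) \<in> vertex_pairs k" using thr_mono[OF z(4)[OF j(1)]] .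
      show "(thr k a (z (Suc j)), thr k (a - e) (z j)) \<in> vertex_pairs k"
        using z(5)[OF j(1)] by (intro vertex_pairsI) (auto simp: near_def abs_less_iff)
    qed
    then show ?case
      using nerve_comp[OF \<phi> thr_mono[OF zj(2)] thr_mono[OF z(4)[OF j(1)]], of a] Suc by simp
  qed
  then show ?thesis using z(2) by blast
qed

text \<open>A finite path of order moves in \<open>U\<close>, recorded with its label at every
  threshold simultaneously. Keeping the label as a function of the threshold is what permits
  comparing thresholds along one path.\<close>

inductive chain for U where
  nil: "C \<in> U \<Longrightarrow> chain U C (\<lambda>_. \<one>) C"
| step: "\<phi> \<in> cells (nerve M) k \<Longrightarrow> x \<in> icube k \<Longrightarrow> y \<in> icube k \<Longrightarrow> cle k x y \<Longrightarrow>
    (\<And>z. z \<in> cbetween k x y \<Longrightarrow> pt k \<phi> z \<in> U) \<Longrightarrow> chain U (pt k \<phi> y) \<mu> C \<Longrightarrow>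
    chain U (pt k \<phi> x) (\<lambda>a. \<phi> (thr k a x, thr k a y) \<otimes> \<mu> a) C"

lemma chain_closed: "chain U C \<mu> D \<Longrightarrow> \<mu> a \<in> carrier M"
  by (induction rule: chain.induct) (auto intro: nerve_closed thr_mono)

lemma chain_mono: "chain U C \<mu> D \<Longrightarrow> U \<subseteq> V \<Longrightarrow> chain V C \<mu> D"
  by (induction rule: chain.induct) (auto intro: chain.intros)

lemma chain_append: "chain U C \<mu> D \<Longrightarrow> chain U D \<nu> E \<Longrightarrow> chain U C (\<lambda>a. \<mu> a \<otimes> \<nu> a) E"
proof (induction rule: chain.induct)
  case (nil C)
  have "(\<lambda>a. \<one> \<otimes> \<nu> a) = \<nu>" using chain_closed[OF nil(2)] by simp
  then show ?case using nil by simp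
next
  case (step \<phi> k x y \<mu> D)
  have "(\<lambda>a. \<phi> (thr k a x, thr k a y) \<otimes> \<mu> a \<otimes> \<nu> a) = (\<lambda>a. \<phi> (thr k a x, thr k a y) \<otimes> (\<mu> a \<otimes> \<nu> a))"
    using nerve_closed[OF step.hyps(1) thr_mono[OF step.hyps(4)]] chain_closed[OF step.hyps(6)] chain_closed[OF step.prems]
    by (auto simp: m_assoc)
  then show ?case using chain.step[OF step.hyps(1-5) step.IH[OF step.prems]] by simp
qed

text \<open>For a single move both composites equal \<open>\<phi> (thr k b x, thr k a y)\<close>:
  threshold first and movement second, or the other way round. These squares are pasted along the
  chain.\<close>

lemma chain_transport:
  assumes "chain U C \<mu> D" "U \<subseteq> points X" "0 < a" "a \<le> b" "b \<le> 1"
  shows "transport b a C \<otimes> \<mu> a = \<mu> b \<otimes> transport b a D"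
  using assms(1)
proof (induction rule: chain.induct)
  case (nil C)
  then show ?case using assms transport_closed[of a b C] by auto
next
  case (step \<phi> k x y \<mu> D)
  note \<phi> = step.hyps(1) and xy = step.hyps(4)
  have D: "transport b a D \<in> carrier M"
    using step.hyps(6) by (induction rule: chain.induct) (use assms transport_closed in auto)
  note cl = nerve_closed[OF \<phi> thr_mono[OF xy]] nerve_closed[OF \<phi> thr_antimono] chain_closed[OF step.hyps(6)]
  have "\<phi> (thr k b x, thr k a x) \<otimes> \<phi> (thr k a x, thr k a y) = \<phi> (thr k b x, thr k b y) \<otimes> \<phi> (thr k b y, thr k a y)"
    using nerve_comp[OF \<phi> thr_antimono[OF assms(4)] thr_mono[OF xy]]
      nerve_comp[OF \<phi> thr_mono[OF xy] thr_antimono[OF assms(4)]] by metis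
  then have "transport b a (pt k \<phi> x) \<otimes> (\<phi> (thr k a x, thr k a y) \<otimes> \<mu> a) =
      \<phi> (thr k b x, thr k b y) \<otimes> \<phi> (thr k b y, thr k a y) \<otimes> \<mu> a"
    using assms cl step.hyps by (simp add: transport_pt m_assoc[symmetric])
  also have "\<dots> = \<phi> (thr k b x, thr k b y) \<otimes> (transport b a (pt k \<phi> y) \<otimes> \<mu> a)"
    using assms cl step.hyps by (simp add: transport_pt m_assoc)
  also have "\<dots> = \<phi> (thr k b x, thr k b y) \<otimes> \<mu> b \<otimes> transport b a D"
    using cl D unfolding step.IH by (simp add: m_assoc)
  finally show ?case .
qed

lemma chain_regular:
  assumes "chain (regular a e) C \<mu> D" "level a e"
  shows "\<mu> a = \<one>"
  using assms(1)
proof (induction rule: chain.induct)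
  case (step \<phi> k x y \<mu> C)
  show ?case using regular_step[OF assms(2) step.hyps(1-5)] step.IH by simp
qed simp

lemma circ_chain:
  assumes U: "openin (topo X) U" and CD: "(C, D) \<in> circ X U"
  obtains \<mu> where "chain U C \<mu> D"
proof -
  have D: "D \<in> U" using circ_subset[OF stream_X U] CD by blast
  have step: "\<exists>\<mu>. chain U C \<mu> D" if "(C, C') \<in> moves U" "chain U C' \<nu> D" for C C' \<nu>
    using that unfolding moves_def by (blast intro: chain.step)
  have "(C, D) \<in> (moves U)\<^sup>+" using CD unfolding circ_X[OF U] .
  then have "\<exists>\<mu>. chain U C \<mu> D"
  proof (induction rule: converse_trancl_induct)
    case (base C)
    then show ?case using step chain.nil[of D U, OF D] by blast
  next
    case (step C C')
    then show ?case using \<open>\<And>C C' \<nu>. (C, C') \<in> moves U \<Longrightarrow> chain U C' \<nu> D \<Longrightarrow> \<exists>\<mu>. chain U C \<mu> D\<close> by blast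
  qed
  then show thesis using that by blast
qed

lemma chain_ends: "chain U C \<mu> D \<Longrightarrow> C \<in> U \<and> D \<in> U"
proof (induction rule: chain.induct)
  case (step \<phi> k x y \<mu> D)
  then show ?case using cbetween_ends[OF step.hyps(2,3,4)] by blast
qed simp

end

subsection \<open>Transport to the final corner of a cube\<close>

definition ctop :: "nat \<Rightarrow> (nat \<Rightarrow> real)" where
  "ctop n = (\<lambda>i\<in>{..<n}. 1)"

lemma ctop_icube [simp]: "ctop n \<in> icube n"
  unfolding ctop_def by (rule icube_restrict) simp

context nerve_space
begin

abbreviation star where "star \<equiv> nerve_point M"

lemma vertices_0: "vertices 0 = {\<lambda>_. undefined}"
  by (simp add: vertices_def)

lemma nerve_cell_0: "\<phi> \<in> cells (nerve M) 0 \<longleftrightarrow> \<phi> = (\<lambda>z\<in>{(\<lambda>_. undefined, \<lambda>_. undefined)}. \<one>)"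
proof -
  have vp: "vertex_pairs 0 = {(\<lambda>_. undefined, \<lambda>_. undefined)}"
    by (auto simp: vertex_pairs_def vertices_0)
  show ?thesis
  proof
    assume \<phi>: "\<phi> \<in> cells (nerve M) 0"
    show "\<phi> = (\<lambda>z\<in>{(\<lambda>_. undefined, \<lambda>_. undefined)}. \<one>)"
    proof
      fix z :: "(nat \<Rightarrow> bool) \<times> (nat \<Rightarrow> bool)"
      show "\<phi> z = (\<lambda>z\<in>{(\<lambda>_. undefined, \<lambda>_. undefined)}. \<one>) z"
        using nerve_refl[OF \<phi>, of "\<lambda>_. undefined"] nerve_undef[OF \<phi>, of z]
        by (cases "z = (\<lambda>_. undefined, \<lambda>_. undefined)") (simp_all add: vp vertices_0)
    qed
  qed (auto intro!: nerve_cellI simp: vp vertices_0)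
qed

lemma nerve_vertex_cell: "nerve_vertex M \<in> cells (nerve M) 0"
  unfolding nerve_vertex_def nerve_cell_0 by simp

lemma cell_0_eq: "\<phi> \<in> cells (nerve M) 0 \<Longrightarrow> \<phi> = nerve_vertex M"
  using nerve_vertex_cell by (simp add: nerve_cell_0)

lemma star_eq: "star = pt 0 (nerve_vertex M) (\<lambda>_. undefined)"
  by (simp add: nerve_point_def pt_def ditop_equiv_nerve)

lemma undefined_icube_0 [simp]: "(\<lambda>_. undefined) \<in> icube 0"
  by (simp add: icube_0)

lemma star_in_X [simp]: "star \<in> points X"
  unfolding star_eq by (rule pt_in_X[OF nerve_vertex_cell]) simp

lemma transport_star: "0 < a \<Longrightarrow> a \<le> b \<Longrightarrow> b \<le> 1 \<Longrightarrow> transport b a star = \<one>"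
proof -
  assume ab: "0 < a" "a \<le> b" "b \<le> 1"
  have "thr 0 b (\<lambda>_. undefined) = thr 0 a (\<lambda>_. undefined)" by (rule vertices_ext[of _ 0]) auto
  then show "transport b a star = \<one>"
    unfolding star_eq using ab nerve_refl[OF nerve_vertex_cell] by (simp add: transport_pt nerve_vertex_cell)
qed

lemma regular_subset: "regular a e \<subseteq> points X"
  by (auto simp: regular_def)

lemma stream_map_chain:
  assumes f: "stream_map (dcube n) X f" and p: "p \<in> icube n" and q: "q \<in> icube n" and pq: "cle n p q"
    and U: "openin (topo X) U" and sub: "\<And>z. z \<in> cbetween n p q \<Longrightarrow> f z \<in> U"
  obtains s where "chain U (f p) s (f q)"
proof -
  have V: "openin (icube_topology n) {x \<in> icube n. f x \<in> U}"
    using openin_stream_map_preimage[OF f U] by simp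
  have "(p, q) \<in> dcirc n {x \<in> icube n. f x \<in> U}"
    using p q pq sub by (intro mem_circ_basic) (auto simp: cbetween_def)
  then have "(p, q) \<in> circ (dcube n) {x \<in> points (dcube n). f x \<in> U}"
    using V by (simp add: circ_dcube)
  then have "(f p, f q) \<in> circ X U" by (rule stream_mapD[OF f U])
  then show thesis using circ_chain[OF U] that by blast
qed

text \<open>The final value of \<open>L\<close> is left free, so that restrictions to subintervals
  qualify. Only one chain is asked for on each step, which makes the notion easy to transfer along
  reparametrizations and homomorphisms.\<close>

definition lift_steps where
  "lift_steps n f L \<longleftrightarrow> (\<exists>d>0. \<forall>p\<in>icube n. \<forall>q\<in>icube n. cle n p q \<and> near n d p q \<longrightarrow>
     (\<exists>a e s. level a e \<and> (\<forall>z\<in>cbetween n p q. f z \<in> regular a e) \<and> chain (regular a e) (f p) s (f q) \<and>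
        L p = s (1 / 2) \<otimes> L q))"

text \<open>Hence \<open>L p\<close> is the transport across the threshold \<open>1/2\<close> from \<open>f p\<close> to the final corner.\<close>

definition is_lift where
  "is_lift n f L \<longleftrightarrow> L (ctop n) = \<one> \<and> lift_steps n f L"

text \<open>The transports \<open>\<mu>\<close> of a sequence of small steps from \<open>p\<close> to the final corner. Replacing a step
  inside \<open>regular a e\<close> does not change the transport across \<open>a\<close>, hence not the ones across larger
  thresholds, because the final corner is sent to \<open>star\<close>, where transport between thresholds is
  trivial.\<close>

inductive lab for f n d where
  top: "lab f n d (ctop n) (\<lambda>_. \<one>)"
| step: "p \<in> icube n \<Longrightarrow> q \<in> icube n \<Longrightarrow> cle n p q \<Longrightarrow> near n d p q \<Longrightarrow> level a e \<Longrightarrow>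
    (\<And>z. z \<in> cbetween n p q \<Longrightarrow> f z \<in> regular a e) \<Longrightarrow> chain (regular a e) (f p) s (f q) \<Longrightarrow>
    lab f n d q \<nu> \<Longrightarrow> lab f n d p (\<lambda>b. s b \<otimes> \<nu> b)"

text \<open>All coordinates move by \<open>d / 2\<close>, cut off at 1. The step stays strictly
  shorter than \<open>d\<close>, and every point within \<open>d / 2\<close> of \<open>p\<close>
  still lies below the advanced point.\<close>

definition advance :: "nat \<Rightarrow> real \<Rightarrow> (nat \<Rightarrow> real) \<Rightarrow> (nat \<Rightarrow> real)" where
  "advance n d p = (\<lambda>i\<in>{..<n}. min 1 (p i + d / 2))"

lemma advance_props:
  assumes "p \<in> icube n" "0 < d"
  shows "advance n d p \<in> icube n" "cle n p (advance n d p)" "near n d p (advance n d p)"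
proof -
  show "advance n d p \<in> icube n"
    unfolding advance_def using icubeD[OF assms(1)] assms(2) by (intro icube_restrict) (auto simp: min_def)
  show "cle n p (advance n d p)" "near n d p (advance n d p)"
    using icubeD[OF assms(1)] assms(2) by (auto simp: cle_def near_def advance_def min_def)
qed

lemma advance_mono:
  assumes "p \<in> icube n" "q \<in> icube n" "cle n p q" "near n r p q" "0 < r"
  shows "cle n (advance n d p) (advance n d q)" "near n r (advance n d p) (advance n d q)"
  using assms by (auto simp: cle_def near_def advance_def min_def)

lemma advance_ctop: "0 < d \<Longrightarrow> advance n d (ctop n) = ctop n"
  by (auto simp: advance_def ctop_def fun_eq_iff)

text \<open>Induction on the number of canonical steps that lead from a point to the final corner.\<close>

lemma advance_induct:
  assumes d: "0 < d" and p: "p \<in> icube n"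
    and top: "P (ctop n)" and step: "\<And>p. p \<in> icube n \<Longrightarrow> P (advance n d p) \<Longrightarrow> P p"
  shows "P p"
proof -
  have main: "\<forall>p\<in>icube n. (\<forall>i<n. 1 - real k * (d / 2) \<le> p i) \<longrightarrow> P p" for k
  proof (induction k)
    case 0
    have "p = ctop n" if "p \<in> icube n" "\<forall>i<n. 1 \<le> p i" for p
    proof (rule icube_ext[OF that(1)])
      show "p i = ctop n i" if "i < n" for i
        using that \<open>\<forall>i<n. 1 \<le> p i\<close> icubeD[OF \<open>p \<in> icube n\<close> that] by (auto simp: ctop_def intro: antisym)
    qed simp
    then show ?case using top by auto
  next
    case (Suc k)
    show ?case
    proof (intro ballI impI)
      fix p assume p: "p \<in> icube n" "\<forall>i<n. 1 - real (Suc k) * (d / 2) \<le> p i"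
      have "1 - real k * (d / 2) \<le> advance n d p i" if "i < n" for i
      proof -
        have "1 - real (Suc k) * (d / 2) \<le> p i" using p(2) that by blast
        then have "1 - real k * (d / 2) \<le> p i + d / 2" by (simp add: algebra_simps add_divide_distrib)
        moreover have "1 - real k * (d / 2) \<le> 1" using d by simp
        ultimately show ?thesis using that by (simp add: advance_def)
      qed
      then have "P (advance n d p)" using Suc advance_props(1)[OF p(1) d] by blast
      then show "P p" using step p(1) by blast
    qed
  qed
  obtain k :: nat where "2 / d < real k" using reals_Archimedean2 by blast
  then have "1 \<le> real k * (d / 2)" using d by (simp add: field_simps)
  then have "\<forall>i<n. 1 - real k * (d / 2) \<le> p i" using icubeD[OF p] by force
  then show "P p" using main p by blast
qed

section \<open>Independence of the label from the sequence of steps\<close>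

context
  fixes f :: "(nat \<Rightarrow> real) \<Rightarrow> 'a cell_point set" and n :: nat
  assumes f: "stream_map (dcube n) X f" and ftop: "f (ctop n) = star"
begin

lemma f_in_X: "p \<in> icube n \<Longrightarrow> f p \<in> points X"
  using f by (auto simp: stream_map_def continuous_map_def)

lemma lab_icube: "lab f n d p \<mu> \<Longrightarrow> p \<in> icube n"
  by (induction rule: lab.induct) auto

lemma lab_closed: "lab f n d p \<mu> \<Longrightarrow> \<mu> b \<in> carrier M"
  by (induction rule: lab.induct) (auto intro: chain_closed)

text \<open>The label at the larger threshold is expressed by the one at the smaller threshold;
  without inverses this is the direction available. At the final corner both are trivial, and
  \<open>chain_transport\<close> propagates the relation backwards along the sequence.\<close>

lemma lab_transport:
  "lab f n d p \<mu> \<Longrightarrow> 0 < a \<Longrightarrow> a \<le> b \<Longrightarrow> b \<le> 1 \<Longrightarrow> \<mu> b = transport b a (f p) \<otimes> \<mu> a"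
proof (induction rule: lab.induct)
  case top
  then show ?case by (simp add: ftop transport_star)
next
  case (step p q a' e s \<nu>)
  have IH: "\<nu> b = transport b a (f q) \<otimes> \<nu> a" using step by blast
  have cl: "s a \<in> carrier M" "s b \<in> carrier M" "\<nu> a \<in> carrier M"
    "transport b a (f p) \<in> carrier M" "transport b a (f q) \<in> carrier M"
    using step chain_closed lab_closed transport_closed f_in_X by blast+
  have ct: "transport b a (f p) \<otimes> s a = s b \<otimes> transport b a (f q)"
    using chain_transport[OF step.hyps(7) regular_subset] step.prems by blast
  have "s b \<otimes> \<nu> b = (s b \<otimes> transport b a (f q)) \<otimes> \<nu> a" unfolding IH using cl by (simp add: m_assoc)
  also have "\<dots> = transport b a (f p) \<otimes> (s a \<otimes> \<nu> a)" unfolding ct[symmetric] using cl by (simp add: m_assoc)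
  finally show ?case .
qed

text \<open>The right-hand side does not mention \<open>s\<close>: at threshold \<open>a\<close> the
  step contributes nothing, and the value at \<open>1 / 2\<close> is recovered from threshold
  \<open>a\<close>. Any two chains with these ends in the same regular set are thus
  interchangeable.\<close>

lemma lab_swap:
  assumes l: "level a e" and s: "chain (regular a e) (f p) s (f q)" and \<nu>: "lab f n d q \<nu>"
  shows "s (1 / 2) \<otimes> \<nu> (1 / 2) = transport (1 / 2) a (f p) \<otimes> \<nu> a"
proof -
  note la = levelD[OF l]
  have fp: "f p \<in> points X" using chain_ends[OF s] regular_subset by blast
  have cl: "s (1 / 2) \<in> carrier M" "\<nu> a \<in> carrier M" "transport (1 / 2) a (f p) \<in> carrier M" "transport (1 / 2) a (f q) \<in> carrier M"
    using chain_closed[OF s] lab_closed[OF \<nu>] transport_closed fp f_in_X[OF lab_icube[OF \<nu>]] la by auto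
  have "transport (1 / 2) a (f p) \<otimes> s a = s (1 / 2) \<otimes> transport (1 / 2) a (f q)"
    using chain_transport[OF s regular_subset] la by simp
  then have "transport (1 / 2) a (f p) = s (1 / 2) \<otimes> transport (1 / 2) a (f q)"
    using chain_regular[OF s l] cl by simp
  moreover have "\<nu> (1 / 2) = transport (1 / 2) a (f q) \<otimes> \<nu> a"
    using lab_transport[OF \<nu>] la by simp
  ultimately show ?thesis using cl by (simp add: m_assoc)
qed

text \<open>A sequence starting at the corner stays there, but its chains need not be constant. They
  are neutral because transport between thresholds at \<open>star\<close> is trivial.\<close>

lemma lab_top: "lab f n d p \<mu> \<Longrightarrow> p = ctop n \<Longrightarrow> \<mu> (1 / 2) = \<one>"
proof (induction rule: lab.induct)
  case (step p q a e s \<nu>)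
  note la = levelD[OF step.hyps(5)]
  have "q = ctop n"
  proof (rule icube_ext[OF step.hyps(2)])
    show "q i = ctop n i" if "i < n" for i
      using that step.hyps(3) step.prems icubeD[OF step.hyps(2) that] by (auto simp: cle_def ctop_def intro!: antisym)
  qed simp
  then have 1: "\<nu> (1 / 2) = \<one>" using step.IH by blast
  have "\<nu> (1 / 2) = transport (1 / 2) a (f q) \<otimes> \<nu> a" using lab_transport[OF step.hyps(8)] la by simp
  moreover have "transport (1 / 2) a (f q) = \<one>" "transport (1 / 2) a (f p) = \<one>"
    using \<open>q = ctop n\<close> step.prems la by (simp_all add: ftop transport_star)
  ultimately have "\<nu> a = \<one>" "transport (1 / 2) a (f p) = \<one>" using 1 lab_closed[OF step.hyps(8), of a] by simp_all
  then show ?case using lab_swap[OF step.hyps(5,7,8)] by simp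
qed simp

text \<open>The radius \<open>2 * d\<close> allows for two consecutive steps, so a single regular
  set contains the whole square formed by a step and the advances of its ends.\<close>

definition meshed :: "real \<Rightarrow> bool" where
  "meshed d \<longleftrightarrow> 0 < d \<and> (\<forall>p\<in>icube n. \<exists>a e. level a e \<and> (\<forall>q\<in>icube n. near n (2 * d) p q \<longrightarrow> f q \<in> regular a e))"

lemma exists_meshed: obtains d where "meshed d"
proof -
  let ?\<U> = "{{x \<in> icube n. f x \<in> regular a e} | a e. level a e}"
  obtain d where d: "d > 0" "\<And>x. x \<in> icube n \<Longrightarrow> \<exists>U\<in>?\<U>. \<forall>y\<in>icube n. near n d x y \<longrightarrow> y \<in> U"
  proof (rule icube_Lebesgue_number[of ?\<U> n])
    fix U assume "U \<in> ?\<U>"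
    then show "openin (icube_topology n) U"
      using openin_stream_map_preimage[OF f openin_regular] by auto
  next
    show "icube n \<subseteq> \<Union>?\<U>"
    proof
      fix x assume x: "x \<in> icube n"
      obtain a e where "level a e" "f x \<in> regular a e" using exists_regular[OF f_in_X[OF x]] .
      then show "x \<in> \<Union>?\<U>" using x by blast
    qed
  qed blast
  have "meshed (d / 2)"
    unfolding meshed_def using d by fastforce
  then show thesis by (rule that)
qed

lemma meshed_pos: "meshed d \<Longrightarrow> 0 < d" by (simp add: meshed_def)

lemma meshed_between:
  assumes d: "meshed d" and pq: "p \<in> icube n" "q \<in> icube n" "cle n p q" "near n d p q"
  obtains a e where "level a e" "\<And>z. z \<in> cbetween n p q \<Longrightarrow> f z \<in> regular a e"
proof -
  note d0 = meshed_pos[OF d]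
  obtain a e where l: "level a e" and big: "\<And>q. q \<in> icube n \<Longrightarrow> near n (2 * d) p q \<Longrightarrow> f q \<in> regular a e"
    using d pq(1) unfolding meshed_def by blast
  have "f z \<in> regular a e" if z: "z \<in> cbetween n p q" for z
  proof (rule big)
    show "z \<in> icube n" using z by (simp add: cbetween_def)
    have "near n d p z"
      by (rule near_between[OF near_refl[OF d0] pq(4)]) (use z in \<open>auto simp: cbetween_def\<close>)
    then show "near n (2 * d) p z" using near_mono d0 by fastforce
  qed
  then show thesis by (rule that[OF l])
qed

lemma lab_stepI:
  assumes d: "meshed d" and p: "p \<in> icube n" and q: "q \<in> icube n" and pq: "cle n p q" "near n d p q" and \<nu>: "lab f n d q \<nu>"
  obtains \<mu> where "lab f n d p \<mu>"
proof (rule meshed_between[OF d p q pq])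
  fix a e assume ae: "level a e" and sub: "\<And>z. z \<in> cbetween n p q \<Longrightarrow> f z \<in> regular a e"
  obtain s where "chain (regular a e) (f p) s (f q)"
    using stream_map_chain[OF f p q pq(1) openin_regular[OF ae] sub] .
  then show thesis using lab.step[OF p q pq ae sub _ \<nu>] that by blast
qed

lemma lab_exists:
  assumes d: "meshed d" and p: "p \<in> icube n"
  obtains \<mu> where "lab f n d p \<mu>"
proof -
  have d0: "0 < d" using d by (simp add: meshed_def)
  have "\<exists>\<mu>. lab f n d p \<mu>"
  proof (rule advance_induct[OF d0 p])
    show "\<exists>\<mu>. lab f n d (ctop n) \<mu>" using lab.top by blast
    fix p assume p: "p \<in> icube n" and "\<exists>\<mu>. lab f n d (advance n d p) \<mu>"
    then obtain \<mu> where "lab f n d (advance n d p) \<mu>" by blast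
    then show "\<exists>\<mu>. lab f n d p \<mu>"
      using lab_stepI[OF d p advance_props[OF p d0]] by blast
  qed
  then show thesis using that by blast
qed

text \<open>Sequences of steps are compared by moving them sideways towards the final corner.\<close>

lemma lab_ladder:
  assumes d: "meshed d" and \<mu>: "lab f n d p \<mu>"
  shows "\<exists>\<nu>. lab f n d (advance n d p) \<nu> \<and>
    (\<forall>a e s. level a e \<longrightarrow> (\<forall>z\<in>cbetween n p (advance n d p). f z \<in> regular a e) \<longrightarrow>
       chain (regular a e) (f p) s (f (advance n d p)) \<longrightarrow> \<mu> (1 / 2) = s (1 / 2) \<otimes> \<nu> (1 / 2))"
  using \<mu>
proof (induction rule: lab.induct)
  case top
  have d0: "0 < d" using d by (simp add: meshed_def)
  have "s (1 / 2) \<otimes> \<one> = \<one>" if l: "level a e" and s: "chain (regular a e) (f (ctop n)) s (f (ctop n))" for a e s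
    using lab_swap[OF l s lab.top[of f n d]] levelD[OF l] by (simp add: ftop transport_star)
  then show ?case
    unfolding advance_ctop[OF d0] using lab.top[of f n d] by (intro exI[of _ "\<lambda>_. \<one>"]) auto
next
  case (step p q a1 e1 s1 \<mu>1)
  note p = step.hyps(1) and q = step.hyps(2) and pq = step.hyps(3,4) and l1 = step.hyps(5)
    and sub1 = step.hyps(6) and s1 = step.hyps(7) and \<mu>1 = step.hyps(8)
  have d0: "0 < d" using d by (simp add: meshed_def)
  let ?p = "advance n d p" and ?q = "advance n d q"
  note ap = advance_props[OF p d0] and aq = advance_props[OF q d0]
  from step.IH obtain \<nu>1 where \<nu>1: "lab f n d ?q \<nu>1"
    "\<And>a e s. level a e \<Longrightarrow> (\<forall>z\<in>cbetween n q ?q. f z \<in> regular a e) \<Longrightarrow>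
       chain (regular a e) (f q) s (f ?q) \<Longrightarrow> \<mu>1 (1 / 2) = s (1 / 2) \<otimes> \<nu>1 (1 / 2)" by blast
  \<comment> \<open>One regular set for the square with corners \<open>p\<close>, \<open>q\<close>,
    \<open>?p\<close> and \<open>?q\<close>.\<close>
  obtain a e where l: "level a e" and big: "\<And>q. q \<in> icube n \<Longrightarrow> near n (2 * d) p q \<Longrightarrow> f q \<in> regular a e"
    using d p unfolding meshed_def by blast
  have pqq: "near n (2 * d) p ?q" using near_trans[OF pq(2) aq(3)] by simp
  have np: "near n (2 * d) p p" "near n (2 * d) p q" "near n (2 * d) p ?p"
    using d0 near_mono[OF pq(2)] near_mono[OF ap(3)] by auto
  have in_big: "f z \<in> regular a e" if "z \<in> cbetween n u v" "near n (2 * d) p u" "near n (2 * d) p v" for z u v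
    using that near_between[of n "2 * d" p u v z] by (intro big) (auto simp: cbetween_def)
  have op: "openin (topo X) (regular a e \<inter> regular b e')" if "level b e'" for b e'
    using openin_regular[OF l] openin_regular[OF that] by auto
  \<comment> \<open>A chain in both regular sets: it can replace \<open>s1\<close>, and it can also
    be continued inside the regular set of the square.\<close>
  obtain s1' where s1': "chain (regular a e \<inter> regular a1 e1) (f p) s1' (f q)"
    using stream_map_chain[OF f p q pq(1) op[OF l1]] sub1 in_big[OF _ np(1,2)] by blast
  obtain s' where s': "chain (regular a e) (f q) s' (f ?q)"
    using stream_map_chain[OF f q aq(1,2) openin_regular[OF l]] in_big[OF _ np(2) pqq] by blast
  note mono = advance_mono[OF p q pq d0, of d]
  have sub'': "f z \<in> regular a e" if "z \<in> cbetween n ?p ?q" for z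
    using in_big[OF that np(3) pqq] .
  obtain s'' where s'': "chain (regular a e) (f ?p) s'' (f ?q)"
    using stream_map_chain[OF f ap(1) aq(1) mono(1) openin_regular[OF l] sub''] .
  note \<nu> = lab.step[OF ap(1) aq(1) mono l sub'' s'' \<nu>1(1)]
  have cl: "s (1 / 2) \<in> carrier M" if "chain U C s D" for U C s D using chain_closed[OF that] .
  have c1: "\<nu>1 (1 / 2) \<in> carrier M" using lab_closed[OF \<nu>1(1)] .
  \<comment> \<open>Along \<open>p\<close>, \<open>q\<close>, \<open>?q\<close>: the chain
    \<open>s1\<close> is replaced by \<open>s1'\<close>, the induction hypothesis passes from
    \<open>q\<close> to \<open>?q\<close>, and the composite of \<open>s1'\<close> and
    \<open>s'\<close> is evaluated at threshold \<open>a\<close>.\<close>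
  have "s1 (1 / 2) \<otimes> \<mu>1 (1 / 2) = transport (1 / 2) a1 (f p) \<otimes> \<mu>1 a1" by (rule lab_swap[OF l1 s1 \<mu>1])
  also have "\<dots> = s1' (1 / 2) \<otimes> \<mu>1 (1 / 2)"
    using lab_swap[OF l1 chain_mono[OF s1'] \<mu>1] by simp
  also have "\<dots> = s1' (1 / 2) \<otimes> (s' (1 / 2) \<otimes> \<nu>1 (1 / 2))"
    using \<nu>1(2)[OF l _ s'] in_big[OF _ np(2) pqq] by simp
  also have "s1' (1 / 2) \<otimes> (s' (1 / 2) \<otimes> \<nu>1 (1 / 2)) = (s1' (1 / 2) \<otimes> s' (1 / 2)) \<otimes> \<nu>1 (1 / 2)"
    using cl[OF s1'] cl[OF s'] c1 by (simp add: m_assoc)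
  also have "\<dots> = transport (1 / 2) a (f p) \<otimes> \<nu>1 a"
    using lab_swap[OF l chain_append[OF chain_mono[OF s1', of "regular a e"] s'] \<nu>1(1)] by simp
  finally have \<mu>v: "s1 (1 / 2) \<otimes> \<mu>1 (1 / 2) = transport (1 / 2) a (f p) \<otimes> \<nu>1 a" .
  show ?case
  proof (intro exI conjI allI impI)
    show "lab f n d ?p (\<lambda>b. s'' b \<otimes> \<nu>1 b)" by (rule \<nu>)
    fix a0 e0 s assume l0: "level a0 e0" and sub0: "\<forall>z\<in>cbetween n p ?p. f z \<in> regular a0 e0"
      and s: "chain (regular a0 e0) (f p) s (f ?p)"
    \<comment> \<open>Along the other two sides \<open>p\<close>, \<open>?p\<close>,
      \<open>?q\<close> the same evaluation at threshold \<open>a\<close> gives the same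
      value.\<close>
    obtain s0 where s0: "chain (regular a e \<inter> regular a0 e0) (f p) s0 (f ?p)"
      using stream_map_chain[OF f p ap(1,2) op[OF l0]] sub0 in_big[OF _ np(1,3)] by blast
    have "s (1 / 2) \<otimes> (s'' (1 / 2) \<otimes> \<nu>1 (1 / 2)) = s0 (1 / 2) \<otimes> (s'' (1 / 2) \<otimes> \<nu>1 (1 / 2))"
      using lab_swap[OF l0 s \<nu>] lab_swap[OF l0 chain_mono[OF s0] \<nu>] by simp
    also have "\<dots> = (s0 (1 / 2) \<otimes> s'' (1 / 2)) \<otimes> \<nu>1 (1 / 2)"
      using cl[OF s0] cl[OF s''] c1 by (simp add: m_assoc)
    also have "\<dots> = transport (1 / 2) a (f p) \<otimes> \<nu>1 a"
      using lab_swap[OF l chain_append[OF chain_mono[OF s0, of "regular a e"] s''] \<nu>1(1)] by simp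
    finally show "s1 (1 / 2) \<otimes> \<mu>1 (1 / 2) = s (1 / 2) \<otimes> (s'' (1 / 2) \<otimes> \<nu>1 (1 / 2))" using \<mu>v by simp
  qed
qed

text \<open>Both labels are pushed to the advanced point through \<open>lab_ladder\<close> with one
  common chain \<open>s\<close>, and agreement there is the induction hypothesis.\<close>

lemma lab_unique:
  assumes d: "meshed d" and p: "p \<in> icube n"
  shows "\<forall>\<mu> \<mu>'. lab f n d p \<mu> \<longrightarrow> lab f n d p \<mu>' \<longrightarrow> \<mu> (1 / 2) = \<mu>' (1 / 2)"
proof -
  have d0: "0 < d" using d by (simp add: meshed_def)
  show ?thesis
  proof (rule advance_induct[OF d0 p])
    show "\<forall>\<mu> \<mu>'. lab f n d (ctop n) \<mu> \<longrightarrow> lab f n d (ctop n) \<mu>' \<longrightarrow> \<mu> (1 / 2) = \<mu>' (1 / 2)"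
      using lab_top by metis
    fix p assume p: "p \<in> icube n" and IH: "\<forall>\<mu> \<mu>'. lab f n d (advance n d p) \<mu> \<longrightarrow>
      lab f n d (advance n d p) \<mu>' \<longrightarrow> \<mu> (1 / 2) = \<mu>' (1 / 2)"
    note ap = advance_props[OF p d0]
    obtain a e where l: "level a e" and sub: "\<And>z. z \<in> cbetween n p (advance n d p) \<Longrightarrow> f z \<in> regular a e"
      by (rule meshed_between[OF d p ap]) blast
    obtain s where s: "chain (regular a e) (f p) s (f (advance n d p))"
      using stream_map_chain[OF f p ap(1,2) openin_regular[OF l] sub] .
    show "\<forall>\<mu> \<mu>'. lab f n d p \<mu> \<longrightarrow> lab f n d p \<mu>' \<longrightarrow> \<mu> (1 / 2) = \<mu>' (1 / 2)"
    proof (intro allI impI)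
      fix \<mu> \<mu>' assume m: "lab f n d p \<mu>" "lab f n d p \<mu>'"
      obtain \<nu> where \<nu>: "lab f n d (advance n d p) \<nu>" "\<mu> (1 / 2) = s (1 / 2) \<otimes> \<nu> (1 / 2)"
        using lab_ladder[OF d m(1)] l sub s by blast
      obtain \<nu>' where \<nu>': "lab f n d (advance n d p) \<nu>'" "\<mu>' (1 / 2) = s (1 / 2) \<otimes> \<nu>' (1 / 2)"
        using lab_ladder[OF d m(2)] l sub s by blast
      show "\<mu> (1 / 2) = \<mu>' (1 / 2)" using IH \<nu> \<nu>' by metis
    qed
  qed
qed

text \<open>The local formula is the substitute for continuity of \<open>L\<close>: near
  \<open>p0\<close> all jumps are accounted for by the transport from \<open>1 / 2\<close> to
  \<open>a\<close>. The last conclusion, valid for every chain on a short step, is what comparison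
  with other lifts requires.\<close>

lemma lift_exists:
  obtains L where "is_lift n f L" "\<And>p. p \<in> icube n \<Longrightarrow> L p \<in> carrier M"
    "\<And>p0. p0 \<in> icube n \<Longrightarrow> \<exists>a e c r. level a e \<and> c \<in> carrier M \<and> 0 < r \<and>
      (\<forall>p\<in>icube n. near n r p0 p \<longrightarrow> f p \<in> regular a e \<and> L p = transport (1 / 2) a (f p) \<otimes> c)"
    "\<exists>d>0. \<forall>p\<in>icube n. \<forall>q\<in>icube n. cle n p q \<longrightarrow> near n d p q \<longrightarrow> (\<forall>a e s. level a e \<longrightarrow>
      (\<forall>z\<in>cbetween n p q. f z \<in> regular a e) \<longrightarrow> chain (regular a e) (f p) s (f q) \<longrightarrow> L p = s (1 / 2) \<otimes> L q)"
proof -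
  obtain d where d: "meshed d" using exists_meshed .
  have d0: "0 < d" using d by (simp add: meshed_def)
  \<comment> \<open>The sequence is chosen arbitrarily; \<open>lab_unique\<close> fixes its label at
    threshold \<open>1 / 2\<close>, which is the value taken.\<close>
  define L where "L = (\<lambda>p. (SOME \<mu>. lab f n d p \<mu>) (1 / 2))"
  have Lv: "L p = \<mu> (1 / 2)" if "lab f n d p \<mu>" for p \<mu>
    unfolding L_def using lab_unique[OF d lab_icube[OF that]] someI[of "lab f n d p", OF that] that by blast
  have Ltop: "L (ctop n) = \<one>" using Lv[OF lab.top] by simp
  have Lcl: "L p \<in> carrier M" if p: "p \<in> icube n" for p
  proof -
    obtain \<mu> where \<mu>: "lab f n d p \<mu>" using lab_exists[OF d p] .
    show ?thesis using Lv[OF \<mu>] lab_closed[OF \<mu>] by simp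
  qed
  have A: "L p = s (1 / 2) \<otimes> L q"
    if "p \<in> icube n" "q \<in> icube n" "cle n p q" "near n d p q" "level a e"
      "\<And>z. z \<in> cbetween n p q \<Longrightarrow> f z \<in> regular a e" "chain (regular a e) (f p) s (f q)" for p q a e s
  proof -
    obtain \<nu> where \<nu>: "lab f n d q \<nu>" using lab_exists[OF d \<open>q \<in> icube n\<close>] .
    have "lab f n d p (\<lambda>b. s b \<otimes> \<nu> b)"
      by (rule lab.step[where q = q and a = a and e = e]) (fact that \<nu>)+
    then show ?thesis using Lv Lv[OF \<nu>] by simp
  qed
  have "is_lift n f L"
    unfolding is_lift_def lift_steps_def
  proof (rule conjI[OF Ltop], rule exI[of _ d], intro conjI ballI impI)
    fix p q assume p: "p \<in> icube n" and q: "q \<in> icube n" and pq: "cle n p q \<and> near n d p q"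
    obtain a e where ae: "level a e" "\<And>z. z \<in> cbetween n p q \<Longrightarrow> f z \<in> regular a e"
      using pq by (elim conjE) (rule meshed_between[OF d p q], blast+)
    obtain s where s: "chain (regular a e) (f p) s (f q)"
      using stream_map_chain[OF f p q _ openin_regular[OF ae(1)] ae(2)] pq by blast
    have "L p = s (1 / 2) \<otimes> L q" by (rule A[OF p q _ _ ae s]) (use pq in auto)
    then show "\<exists>a e s. level a e \<and> (\<forall>z\<in>cbetween n p q. f z \<in> regular a e) \<and>
        chain (regular a e) (f p) s (f q) \<and> L p = s (1 / 2) \<otimes> L q" using ae s by blast
  qed (rule d0)
  moreover have "\<exists>a e c r. level a e \<and> c \<in> carrier M \<and> 0 < r \<and>
      (\<forall>p\<in>icube n. near n r p0 p \<longrightarrow> f p \<in> regular a e \<and> L p = transport (1 / 2) a (f p) \<otimes> c)"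
    if p0: "p0 \<in> icube n" for p0
  proof -
    obtain a e where l: "level a e" and big: "\<And>q. q \<in> icube n \<Longrightarrow> near n (2 * d) p0 q \<Longrightarrow> f q \<in> regular a e"
      using d p0 unfolding meshed_def by blast
    \<comment> \<open>One target for all points within \<open>d / 2\<close> of \<open>p0\<close>.
      The constant in the local formula is the label of this target at threshold
      \<open>a\<close>.\<close>
    let ?q = "advance n d p0"
    note aq = advance_props[OF p0 d0]
    obtain \<nu> where \<nu>: "lab f n d ?q \<nu>" using lab_exists[OF d aq(1)] .
    have "f p \<in> regular a e \<and> L p = transport (1 / 2) a (f p) \<otimes> \<nu> a" if p: "p \<in> icube n" "near n (d / 2) p0 p" for p
    proof -
      have n0: "near n d p0 p" using near_mono[OF p(2)] d0 by simp
      have "p i \<le> ?q i \<and> \<bar>?q i - p i\<bar> < d" if "i < n" for i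
      proof -
        have "\<bar>p i - p0 i\<bar> < d / 2" using p(2) that unfolding near_def by blast
        then have "p i < p0 i + d / 2" "p0 i < p i + d / 2" by linarith+
        then show ?thesis using icubeD[OF p(1) that] d0 that by (auto simp: advance_def min_def)
      qed
      then have pq: "cle n p ?q" "near n d p ?q" unfolding cle_def near_def by blast+
      have sub: "f z \<in> regular a e" if "z \<in> cbetween n p ?q" for z
      proof (rule big)
        show "z \<in> icube n" using that by (simp add: cbetween_def)
        have "near n d p0 z" by (rule near_between[OF n0 aq(3)]) (use that in \<open>auto simp: cbetween_def\<close>)
        then show "near n (2 * d) p0 z" using near_mono d0 by fastforce
      qed
      obtain s where s: "chain (regular a e) (f p) s (f ?q)"
        using stream_map_chain[OF f p(1) aq(1) pq(1) openin_regular[OF l] sub] .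
      have "L p = s (1 / 2) \<otimes> \<nu> (1 / 2)" using Lv[OF lab.step[OF p(1) aq(1) pq l sub s \<nu>]] by simp
      then show ?thesis using lab_swap[OF l s \<nu>] chain_ends[OF s] by simp
    qed
    then show ?thesis using l lab_closed[OF \<nu>] d0 by (intro exI[of _ a] exI[of _ e] exI[of _ "\<nu> a"] exI[of _ "d / 2"]) auto
  qed
  moreover have "\<exists>d>0. \<forall>p\<in>icube n. \<forall>q\<in>icube n. cle n p q \<longrightarrow> near n d p q \<longrightarrow> (\<forall>a e s. level a e \<longrightarrow>
      (\<forall>z\<in>cbetween n p q. f z \<in> regular a e) \<longrightarrow> chain (regular a e) (f p) s (f q) \<longrightarrow> L p = s (1 / 2) \<otimes> L q)"
    by (rule exI[of _ d], intro conjI ballI allI impI d0) (rule A, assumption+, blast, assumption)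
  ultimately show thesis using that Lcl by blast
qed

end

end

subsection \<open>Homotopies defined cell by cell\<close>

lemma icube_eq_upd: "q \<in> icube (Suc n) \<Longrightarrow> q = (restrict q {..<n})(n := q n)"
  by (auto simp: fun_eq_iff icube_undef)

context nerve_space
begin

text \<open>The map \<open>G\<close> may change with \<open>x0\<close>. For the contraction, a cone
  over one fixed vertex with one fixed label represents the homotopy only near
  \<open>x0\<close>.\<close>

definition local_homotopy where
  "local_homotopy N \<Theta> \<longleftrightarrow> openin (topo X) N \<and>
     (\<forall>k \<phi> x0. \<phi> \<in> cells (nerve M) k \<longrightarrow> x0 \<in> icube k \<longrightarrow> pt k \<phi> x0 \<in> N \<longrightarrow>
       (\<exists>r>0. \<exists>G. stream_map (dcube (Suc k)) X G \<and>
          (\<forall>x\<in>icube k. near k r x0 x \<longrightarrow> (\<forall>s. 0 \<le> s \<and> s \<le> 1 \<longrightarrow> \<Theta> (pt k \<phi> x) s = G (x(k := s))))))"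

lemma local_homotopyD:
  assumes "local_homotopy N \<Theta>" "\<phi> \<in> cells (nerve M) k" "x0 \<in> icube k" "pt k \<phi> x0 \<in> N"
  obtains r G where "0 < r" "stream_map (dcube (Suc k)) X G"
    "\<And>x s. x \<in> icube k \<Longrightarrow> near k r x0 x \<Longrightarrow> 0 \<le> s \<Longrightarrow> s \<le> 1 \<Longrightarrow> \<Theta> (pt k \<phi> x) s = G (x(k := s))"
  using assms unfolding local_homotopy_def by meson

lemma near_upd: "near (Suc k) r (x(k := s)) (y(k := t)) \<longleftrightarrow> near k r x y \<and> \<bar>t - s\<bar> < r"
  by (auto simp: near_def less_Suc_eq)

lemma cle_upd: "cle (Suc k) (x(k := s)) (y(k := t)) \<longleftrightarrow> cle k x y \<and> s \<le> t"
  by (auto simp: cle_def less_Suc_eq)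

lemma cle_restrict [simp]: "cle n (restrict p {..<n}) (restrict q {..<n}) = cle n p q"
  by (simp add: cle_def)

lemma cbetween_last:
  assumes x: "x \<in> icube k" and z: "z \<in> cbetween (Suc k) (x(k := s)) (x(k := t))"
  shows "z = x(k := z k)" "s \<le> z k" "z k \<le> t" "0 \<le> z k" "z k \<le> 1"
proof -
  have zi: "z \<in> icube (Suc k)" and c: "cle (Suc k) (x(k := s)) z" "cle (Suc k) z (x(k := t))"
    using z by (auto simp: cbetween_def)
  show "z = x(k := z k)"
  proof
    fix i
    show "z i = (x(k := z k)) i"
    proof (cases "i < k")
      case True
      have "(x(k := s)) i \<le> z i" "z i \<le> (x(k := t)) i"
        using c True unfolding cle_def by (meson less_Suc_eq)+
      then show ?thesis using True by simp
    next
      case False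
      then show ?thesis using icube_undef[OF x, of i] icube_undef[OF zi, of i] by (cases "i = k") auto
    qed
  qed
  show "s \<le> z k" "z k \<le> t" using c by (auto simp: cle_def dest!: spec[of _ k])
  show "0 \<le> z k" "z k \<le> 1" using icubeD[OF zi, of k] by simp_all
qed

text \<open>A tube lemma combined with monotonicity in each variable: the point moves at fixed time,
  and then time advances at the fixed final point.\<close>

lemma local_homotopy_circ:
  assumes \<Theta>: "local_homotopy N \<Theta>" and C0: "C0 \<in> N" and s0: "0 \<le> s0" "s0 \<le> 1"
    and U: "openin (topo X) U" "\<Theta> C0 s0 \<in> U"
  obtains W r where "openin (topo X) W" "C0 \<in> W" "0 < r"
    "\<And>C D s t. (C, D) \<in> circ X W \<Longrightarrow> 0 \<le> s \<Longrightarrow> s \<le> t \<Longrightarrow> t \<le> 1 \<Longrightarrow> \<bar>s - s0\<bar> < r \<Longrightarrow> \<bar>t - s0\<bar> < r \<Longrightarrow>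
       (\<Theta> C s, \<Theta> D t) \<in> circ X U"
proof -
  have N: "openin (topo X) N" using \<Theta> by (simp add: local_homotopy_def)
  then have NX: "N \<subseteq> points X" by (rule openin_subset)
  have preG: "openin (icube_topology (Suc k)) {q \<in> icube (Suc k). G q \<in> U}" if "stream_map (dcube (Suc k)) X G" for k G
    using openin_stream_map_preimage[OF that U(1)] by simp
  obtain r where r: "0 < r" and rU: "\<And>s. 0 \<le> s \<Longrightarrow> s \<le> 1 \<Longrightarrow> \<bar>s - s0\<bar> \<le> r \<Longrightarrow> \<Theta> C0 s \<in> U"
  proof -
    obtain k \<phi> x0 where C: "C0 = pt k \<phi> x0" "\<phi> \<in> cells (nerve M) k" "x0 \<in> icube k" using X_cases NX C0 by blast
    obtain r1 G where G: "0 < r1" "stream_map (dcube (Suc k)) X G"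
      "\<And>x s. x \<in> icube k \<Longrightarrow> near k r1 x0 x \<Longrightarrow> 0 \<le> s \<Longrightarrow> s \<le> 1 \<Longrightarrow> \<Theta> (pt k \<phi> x) s = G (x(k := s))"
      using local_homotopyD[OF \<Theta> C(2,3)] C0 C(1) by blast
    have "x0(k := s0) \<in> {q \<in> icube (Suc k). G q \<in> U}"
      using U(2) G(3)[OF C(3) near_refl[OF G(1)] s0] icube_upd[OF C(3) s0] C(1) by simp
    then obtain r where r: "0 < r" "\<And>y. y \<in> icube (Suc k) \<Longrightarrow> near (Suc k) r (x0(k := s0)) y \<Longrightarrow> G y \<in> U"
      using preG[OF G(2)] unfolding openin_icube by blast
    have "\<Theta> C0 s \<in> U" if "0 \<le> s" "s \<le> 1" "\<bar>s - s0\<bar> \<le> r / 2" for s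
      using r(2)[of "x0(k := s)"] r(1) that G(3)[OF C(3) near_refl[OF G(1)] that(1,2)] icube_upd[OF C(3) that(1,2)] C(1)
      by (simp add: near_upd)
    then show thesis using that[of "r / 2"] r(1) by simp
  qed
  \<comment> \<open>The points whose track over the closed time interval stays in \<open>U\<close>.
    Compactness of that interval makes \<open>W\<close> open, by a Lebesgue number for the vertical
    segment over a point.\<close>
  define W where "W = {C \<in> N. \<forall>s. 0 \<le> s \<and> s \<le> 1 \<and> \<bar>s - s0\<bar> \<le> r \<longrightarrow> \<Theta> C s \<in> U}"
  have C0W: "C0 \<in> W" using C0 rU by (simp add: W_def)
  have W: "openin (topo X) W"
    unfolding openin_X
  proof (intro conjI allI ballI)
    show "W \<subseteq> points X" using NX by (auto simp: W_def)
    fix k \<phi> assume \<phi>: "\<phi> \<in> cells (nerve M) k"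
    show "openin (icube_topology k) {x \<in> icube k. pt k \<phi> x \<in> W}"
      unfolding openin_icube
    proof (intro conjI ballI)
      fix x1 assume "x1 \<in> {x \<in> icube k. pt k \<phi> x \<in> W}"
      then have x1: "x1 \<in> icube k" "pt k \<phi> x1 \<in> N"
        and x1U: "\<And>s. 0 \<le> s \<Longrightarrow> s \<le> 1 \<Longrightarrow> \<bar>s - s0\<bar> \<le> r \<Longrightarrow> \<Theta> (pt k \<phi> x1) s \<in> U" by (auto simp: W_def)
      obtain r1 G where G: "0 < r1" "stream_map (dcube (Suc k)) X G"
        "\<And>x s. x \<in> icube k \<Longrightarrow> near k r1 x1 x \<Longrightarrow> 0 \<le> s \<Longrightarrow> s \<le> 1 \<Longrightarrow> \<Theta> (pt k \<phi> x) s = G (x(k := s))"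
        using local_homotopyD[OF \<Theta> \<phi> x1] by blast
      obtain r2 where r2: "0 < r2" "\<And>y. y \<in> icube k \<Longrightarrow> near k r2 x1 y \<Longrightarrow> pt k \<phi> y \<in> N"
        using openin_pt_preimage[OF N \<phi>] x1 unfolding openin_icube by blast
      define lo hi where "lo = max 0 (s0 - r)" and "hi = min 1 (s0 + r)"
      let ?V = "{q \<in> icube (Suc k). G q \<in> U}" and ?B = "cbetween (Suc k) (x1(k := lo)) (x1(k := hi))"
      have BV: "?B \<subseteq> ?V"
      proof
        fix z assume z: "z \<in> ?B"
        note zl = cbetween_last[OF x1(1) z]
        have "\<bar>z k - s0\<bar> \<le> r" using zl by (auto simp: lo_def hi_def abs_le_iff)
        then have "G (x1(k := z k)) \<in> U" using x1U[OF zl(4,5)] G(3)[OF x1(1) near_refl[OF G(1)] zl(4,5)] by simp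
        then show "z \<in> ?V" using zl(1) z by (simp add: cbetween_def)
      qed
      obtain d where d: "0 < d" "\<And>x. x \<in> icube (Suc k) \<Longrightarrow> \<exists>A\<in>{?V, icube (Suc k) - ?B}. \<forall>y\<in>icube (Suc k). near (Suc k) d x y \<longrightarrow> y \<in> A"
      proof (rule icube_Lebesgue_number[of "{?V, icube (Suc k) - ?B}" "Suc k"])
        show "openin (icube_topology (Suc k)) A" if "A \<in> {?V, icube (Suc k) - ?B}" for A
          using that preG[OF G(2)] openin_icube_not_between by blast
        show "icube (Suc k) \<subseteq> \<Union>{?V, icube (Suc k) - ?B}" using BV by blast
      qed blast
      have "pt k \<phi> x \<in> W" if x: "x \<in> icube k" "near k (min d (min r1 r2)) x1 x" for x
      proof -
        have nr: "near k d x1 x" "near k r1 x1 x" "near k r2 x1 x" using near_mono[OF x(2)] by auto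
        have "\<Theta> (pt k \<phi> x) s \<in> U" if s: "0 \<le> s" "s \<le> 1" "\<bar>s - s0\<bar> \<le> r" for s
        proof -
          have xs: "x1(k := s) \<in> icube (Suc k)" using icube_upd[OF x1(1) s(1,2)] .
          moreover have "lo \<le> s" "s \<le> hi" using s by (auto simp: lo_def hi_def abs_le_iff)
          ultimately have "x1(k := s) \<in> ?B" by (auto simp: cbetween_def cle_upd)
          moreover have "near (Suc k) d (x1(k := s)) (x1(k := s))" using d(1) by simp
          ultimately have V: "\<forall>y\<in>icube (Suc k). near (Suc k) d (x1(k := s)) y \<longrightarrow> y \<in> ?V"
            using d(2)[OF xs] xs by blast
          have "x(k := s) \<in> ?V"
            using V icube_upd[OF x(1) s(1,2)] nr(1) d(1) by (simp add: near_upd)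
          then show ?thesis using G(3)[OF x(1) nr(2) s(1,2)] by simp
        qed
        then show ?thesis using r2(2)[OF x(1) nr(3)] by (simp add: W_def)
      qed
      then show "\<exists>r>0. \<forall>y\<in>icube k. near k r x1 y \<longrightarrow> y \<in> {x \<in> icube k. pt k \<phi> x \<in> W}"
        using d(1) G(1) r2(1) by (intro exI[of _ "min d (min r1 r2)"]) auto
    qed auto
  qed
  have "(\<Theta> C s, \<Theta> D t) \<in> circ X U"
    if CD: "(C, D) \<in> circ X W" and st: "0 \<le> s" "s \<le> t" "t \<le> 1" "\<bar>s - s0\<bar> < r" "\<bar>t - s0\<bar> < r" for C D s t
  proof -
    have s1: "s \<le> 1" using st by simp
    have "(C, D) \<in> (moves W)\<^sup>+" using CD circ_X[OF W] by simp
    then have 1: "(\<Theta> C s, \<Theta> D s) \<in> circ X U"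
    proof (rule trancl_image_into[where f = "\<lambda>C. \<Theta> C s"])
      show "trans (circ X U)" by (rule circ_trans[OF stream_X U(1)])
      fix C D assume "(C, D) \<in> moves W"
      then obtain k \<phi> x y where *: "C = pt k \<phi> x" "D = pt k \<phi> y" "\<phi> \<in> cells (nerve M) k" "x \<in> icube k" "y \<in> icube k"
        "cle k x y" "\<forall>z\<in>cbetween k x y. pt k \<phi> z \<in> W" unfolding moves_def by blast
      have xy: "(x, y) \<in> dcirc k {x \<in> icube k. pt k \<phi> x \<in> W}"
        using * by (intro mem_circ_basic) (auto simp: cbetween_def)
      show "(\<Theta> C s, \<Theta> D s) \<in> circ X U"
        unfolding *(1,2)
      proof (rule dcirc_local[OF openin_pt_preimage[OF W *(3)] xy circ_trans[OF stream_X U(1)]])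
        fix x0 assume "x0 \<in> {x \<in> icube k. pt k \<phi> x \<in> W}"
        then have x0: "x0 \<in> icube k" "pt k \<phi> x0 \<in> N" "pt k \<phi> x0 \<in> W" by (auto simp: W_def)
        obtain r1 G where G: "0 < r1" "stream_map (dcube (Suc k)) X G"
          "\<And>x s. x \<in> icube k \<Longrightarrow> near k r1 x0 x \<Longrightarrow> 0 \<le> s \<Longrightarrow> s \<le> 1 \<Longrightarrow> \<Theta> (pt k \<phi> x) s = G (x(k := s))"
          using local_homotopyD[OF \<Theta> *(3) x0(1,2)] by blast
        have "G (x0(k := s)) \<in> U"
          using x0(3) G(3)[OF x0(1) near_refl[OF G(1)] st(1) s1] st s1 by (auto simp: W_def)
        then obtain r2 where r2: "0 < r2" "\<And>x y. x \<in> icube (Suc k) \<Longrightarrow> y \<in> icube (Suc k) \<Longrightarrow>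
            near (Suc k) r2 (x0(k := s)) x \<Longrightarrow> near (Suc k) r2 (x0(k := s)) y \<Longrightarrow> cle (Suc k) x y \<Longrightarrow> (G x, G y) \<in> circ X U"
          using G(2) icube_upd[OF x0(1) st(1) s1] U(1) unfolding stream_map_dcube_iff[OF stream_X] by meson
        have "(\<Theta> (pt k \<phi> x) s, \<Theta> (pt k \<phi> y) s) \<in> circ X U"
          if "x \<in> icube k" "y \<in> icube k" "near k (min r1 r2) x0 x \<and> near k (min r1 r2) x0 y \<and> cle k x y" for x y
        proof -
          have nr: "near k r1 x0 x" "near k r2 x0 x" "near k r1 x0 y" "near k r2 x0 y"
            using that(3) near_mono[of k "min r1 r2"] by auto
          have "(G (x(k := s)), G (y(k := s))) \<in> circ X U"
            using r2(1) nr that icube_upd[OF that(1) st(1) s1] icube_upd[OF that(2) st(1) s1]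
            by (intro r2(2)) (auto simp: near_upd cle_upd)
          then show ?thesis using G(3) nr that st(1) s1 by simp
        qed
        then show "\<exists>r>0. \<forall>x\<in>icube k. \<forall>y\<in>icube k. near k r x0 x \<and> near k r x0 y \<and> cle k x y \<longrightarrow>
            (\<Theta> (pt k \<phi> x) s, \<Theta> (pt k \<phi> y) s) \<in> circ X U"
          using G(1) r2(1) by (intro exI[of _ "min r1 r2"]) auto
      qed
    qed
    \<comment> \<open>Time now advances from \<open>s\<close> to \<open>t\<close> at
      \<open>D\<close>; the whole vertical segment maps into \<open>U\<close> because
      \<open>D\<close> lies in \<open>W\<close>.\<close>
    have D: "D \<in> W" using circ_subset[OF stream_X W] CD by blast
    then have DN: "D \<in> N" by (simp add: W_def)
    then obtain k \<phi> x where x: "D = pt k \<phi> x" "\<phi> \<in> cells (nerve M) k" "x \<in> icube k" using X_cases NX by blast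
    obtain r1 G where G: "0 < r1" "stream_map (dcube (Suc k)) X G"
      "\<And>y s. y \<in> icube k \<Longrightarrow> near k r1 x y \<Longrightarrow> 0 \<le> s \<Longrightarrow> s \<le> 1 \<Longrightarrow> \<Theta> (pt k \<phi> y) s = G (y(k := s))"
      using local_homotopyD[OF \<Theta> x(2,3)] DN x(1) by blast
    note Gx = G(3)[OF x(3) near_refl[OF G(1)]]
    have "cbetween (Suc k) (x(k := s)) (x(k := t)) \<subseteq> {q \<in> icube (Suc k). G q \<in> U}"
    proof
      fix z assume z: "z \<in> cbetween (Suc k) (x(k := s)) (x(k := t))"
      note zl = cbetween_last[OF x(3) z]
      have "\<bar>z k - s0\<bar> \<le> r" using zl st by (auto simp: abs_le_iff abs_less_iff)
      then have "\<Theta> D (z k) \<in> U" using D zl by (simp add: W_def)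
      then have "G (x(k := z k)) \<in> U" using Gx[OF zl(4,5)] x(1) by simp
      then show "z \<in> {q \<in> icube (Suc k). G q \<in> U}" using zl(1) z by (simp add: cbetween_def)
    qed
    then have "(x(k := s), x(k := t)) \<in> dcirc (Suc k) {q \<in> icube (Suc k). G q \<in> U}"
      using icube_upd[OF x(3)] st by (intro mem_circ_basic) (auto simp: cle_upd)
    then have "(x(k := s), x(k := t)) \<in> circ (dcube (Suc k)) {q \<in> points (dcube (Suc k)). G q \<in> U}"
      using circ_dcube[OF preG[OF G(2)]] by simp
    from stream_mapD[OF G(2) U(1) this] have "(\<Theta> D s, \<Theta> D t) \<in> circ X U"
      using Gx st s1 x(1) by simp
    with 1 show ?thesis using circ_trans[OF stream_X U(1)] by (blast dest: transD)
  qed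
  then show thesis using that W C0W r by blast
qed

text \<open>Near \<open>p0\<close> the map \<open>f\<close> sends order relations into the
  circulation of the set \<open>W\<close> of \<open>local_homotopy_circ\<close>, which then handles
  the joint motion in point and time.\<close>

lemma stream_map_homotopy:
  assumes f: "stream_map (dcube n) X f"
    and loc: "\<And>p0. p0 \<in> icube n \<Longrightarrow> \<exists>N \<Theta> r. local_homotopy N \<Theta> \<and> f p0 \<in> N \<and> 0 < r \<and>
      (\<forall>p\<in>icube n. near n r p0 p \<longrightarrow> (\<forall>s. 0 \<le> s \<and> s \<le> 1 \<longrightarrow> K (p(n := s)) = \<Theta> (f p) s))"
  shows "stream_map (dcube (Suc n)) X K"
proof -
  have key: "\<exists>r>0. \<forall>x\<in>icube (Suc n). \<forall>y\<in>icube (Suc n).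
       near (Suc n) r q0 x \<and> near (Suc n) r q0 y \<and> cle (Suc n) x y \<longrightarrow> (K x, K y) \<in> circ X U"
    if q0: "q0 \<in> icube (Suc n)" and U: "openin (topo X) U" "K q0 \<in> U" for q0 U
  proof -
    let ?p0 = "restrict q0 {..<n}"
    have p0: "?p0 \<in> icube n" using icube_restrict_lessThan[OF q0] .
    have s0: "0 \<le> q0 n" "q0 n \<le> 1" using icubeD[OF q0, of n] by simp_all
    obtain N \<Theta> r where \<Theta>: "local_homotopy N \<Theta>" "f ?p0 \<in> N" "0 < r"
      "\<And>p s. p \<in> icube n \<Longrightarrow> near n r ?p0 p \<Longrightarrow> 0 \<le> s \<Longrightarrow> s \<le> 1 \<Longrightarrow> K (p(n := s)) = \<Theta> (f p) s"
      using loc[OF p0] by blast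
    have "K q0 = \<Theta> (f ?p0) (q0 n)"
      using \<Theta>(4)[OF p0 near_refl[OF \<Theta>(3)] s0] icube_eq_upd[OF q0] by simp
    then have U': "\<Theta> (f ?p0) (q0 n) \<in> U" using U by simp
    obtain W r1 where W: "openin (topo X) W" "f ?p0 \<in> W" "0 < r1"
      "\<And>C D s t. (C, D) \<in> circ X W \<Longrightarrow> 0 \<le> s \<Longrightarrow> s \<le> t \<Longrightarrow> t \<le> 1 \<Longrightarrow> \<bar>s - q0 n\<bar> < r1 \<Longrightarrow> \<bar>t - q0 n\<bar> < r1 \<Longrightarrow>
        (\<Theta> C s, \<Theta> D t) \<in> circ X U"
      by (rule local_homotopy_circ[OF \<Theta>(1,2) s0 U(1) U']) blast
    obtain r2 where r2: "0 < r2" "\<And>x y. x \<in> icube n \<Longrightarrow> y \<in> icube n \<Longrightarrow> near n r2 ?p0 x \<Longrightarrow> near n r2 ?p0 y \<Longrightarrow>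
        cle n x y \<Longrightarrow> (f x, f y) \<in> circ X W"
      using f p0 W(1,2) unfolding stream_map_dcube_iff[OF stream_X] by meson
    define m where "m = min r (min r1 r2)"
    have m: "0 < m" "m \<le> r" "m \<le> r1" "m \<le> r2" using \<Theta>(3) W(3) r2(1) by (auto simp: m_def)
    have "(K x, K y) \<in> circ X U"
      if x: "x \<in> icube (Suc n)" and y: "y \<in> icube (Suc n)"
        and nr: "near (Suc n) m q0 x" "near (Suc n) m q0 y" "cle (Suc n) x y" for x y
    proof -
      let ?x = "restrict x {..<n}" and ?y = "restrict y {..<n}"
      have xi: "?x \<in> icube n" and yi: "?y \<in> icube n" using icube_restrict_lessThan x y by auto
      have nx: "near n m ?p0 ?x" "\<bar>x n - q0 n\<bar> < m" using nr(1) by (auto simp: near_def)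
      have ny: "near n m ?p0 ?y" "\<bar>y n - q0 n\<bar> < m" using nr(2) by (auto simp: near_def)
      have c: "cle n ?x ?y" "x n \<le> y n" using nr(3) by (auto simp: cle_def)
      have b: "0 \<le> x n" "x n \<le> 1" "0 \<le> y n" "y n \<le> 1" using icubeD[OF x, of n] icubeD[OF y, of n] by simp_all
      have "(f ?x, f ?y) \<in> circ X W"
        using r2(2)[OF xi yi near_mono[OF nx(1) m(4)] near_mono[OF ny(1) m(4)] c(1)] .
      then have "(\<Theta> (f ?x) (x n), \<Theta> (f ?y) (y n)) \<in> circ X U"
        using W(4) b c nx(2) ny(2) m(3) by simp
      moreover have "K x = \<Theta> (f ?x) (x n)"
        using \<Theta>(4)[OF xi near_mono[OF nx(1) m(2)] b(1,2)] icube_eq_upd[OF x] by simp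
      moreover have "K y = \<Theta> (f ?y) (y n)"
        using \<Theta>(4)[OF yi near_mono[OF ny(1) m(2)] b(3,4)] icube_eq_upd[OF y] by simp
      ultimately show ?thesis by simp
    qed
    then show ?thesis using m(1) by blast
  qed
  have "K q \<in> points X" if q: "q \<in> icube (Suc n)" for q
  proof -
    let ?p = "restrict q {..<n}"
    have p: "?p \<in> icube n" using icube_restrict_lessThan[OF q] .
    have s: "0 \<le> q n" "q n \<le> 1" using icubeD[OF q, of n] by simp_all
    obtain N \<Theta> r where \<Theta>: "local_homotopy N \<Theta>" "f ?p \<in> N" "0 < r"
      "\<And>p s. p \<in> icube n \<Longrightarrow> near n r ?p p \<Longrightarrow> 0 \<le> s \<Longrightarrow> s \<le> 1 \<Longrightarrow> K (p(n := s)) = \<Theta> (f p) s"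
      using loc[OF p] by blast
    have "N \<subseteq> points X" using \<Theta>(1) openin_subset by (auto simp: local_homotopy_def)
    then obtain k \<phi> x where x: "f ?p = pt k \<phi> x" "\<phi> \<in> cells (nerve M) k" "x \<in> icube k" using X_cases \<Theta>(2) by blast
    obtain r1 G where G: "0 < r1" "stream_map (dcube (Suc k)) X G"
      "\<And>y s. y \<in> icube k \<Longrightarrow> near k r1 x y \<Longrightarrow> 0 \<le> s \<Longrightarrow> s \<le> 1 \<Longrightarrow> \<Theta> (pt k \<phi> y) s = G (y(k := s))"
      using local_homotopyD[OF \<Theta>(1) x(2,3)] \<Theta>(2) x(1) by metis
    have "K q = G (x(k := q n))"
      using \<Theta>(4)[OF p near_refl[OF \<Theta>(3)] s] G(3)[OF x(3) near_refl[OF G(1)] s] x(1) icube_eq_upd[OF q] by simp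
    moreover have "G (x(k := q n)) \<in> points X"
      using G(2) icube_upd[OF x(3) s] by (auto simp: stream_map_def continuous_map_def)
    ultimately show ?thesis by simp
  qed
  then show ?thesis
    unfolding stream_map_dcube_iff[OF stream_X] using key by blast
qed

text \<open>The parameter \<open>u\<close> runs from the map that sends coordinates up to \<open>1/2\<close> to \<open>0\<close> to the identity.\<close>

definition expand :: "nat \<Rightarrow> real \<Rightarrow> (nat \<Rightarrow> real) \<Rightarrow> (nat \<Rightarrow> real)" where
  "expand k u x = (\<lambda>i\<in>{..<k}. max (max 0 (2 * x i - 1)) (x i + u - 1))"

lemma expand_icube: "x \<in> icube k \<Longrightarrow> 0 \<le> u \<Longrightarrow> u \<le> 1 \<Longrightarrow> expand k u x \<in> icube k"
  unfolding expand_def by (intro icube_restrict) (auto dest: icubeD simp: max_def)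

lemma expand_1: "x \<in> icube k \<Longrightarrow> expand k 1 x = x"
  by (rule icube_ext[OF expand_icube]) (auto dest: icubeD simp: expand_def max_def)

text \<open>The same function is applied to every coordinate, and it fixes 0 and 1; hence it
  commutes with inserting constants and with permuting or omitting coordinates.\<close>

lemma arrow_rep_expand:
  assumes r: "arrow_rep m n \<sigma> f F" and x: "x \<in> icube m" and u: "0 \<le> u" "u \<le> 1"
  shows "F (expand m u x) = expand n u (F x)"
proof (rule icube_ext)
  show "F (expand m u x) \<in> icube n" "expand n u (F x) \<in> icube n"
    using arrow_rep_icube[OF r] expand_icube x u by auto
  fix i assume i: "i < n"
  show "F (expand m u x) i = expand n u (F x) i"
    using i u arrow_rep_less[OF r i] expand_icube[OF x u]
    by (cases "\<sigma> i") (auto simp: arrow_rep_point_nth[OF r _ i] x expand_def of_bool_def max_def)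
qed

definition shrink_to where
  "shrink_to u = on_pts (\<lambda>((k, \<phi>), x). pt k \<phi> (expand k u x))"

lemma shrink_to_pt:
  assumes "\<phi> \<in> cells (nerve M) k" "x \<in> icube k" "0 \<le> u" "u \<le> 1"
  shows "shrink_to u (pt k \<phi> x) = pt k \<phi> (expand k u x)"
proof -
  have "natural (\<lambda>((k, \<phi>), x). pt k \<phi> (expand k u x))"
    unfolding natural_def
  proof (intro allI impI)
    fix m n f F \<phi> x assume ba: "box_arrow m n f F" and \<phi>: "\<phi> \<in> cells (nerve M) n" and x: "x \<in> icube m"
    obtain \<sigma> where r: "arrow_rep m n \<sigma> f F" using box_arrow_rep[OF ba] by blast
    show "(\<lambda>((k, \<phi>), x). pt k \<phi> (expand k u x)) ((m, act (nerve M) m n f \<phi>), x) =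
      (\<lambda>((k, \<phi>), x). pt k \<phi> (expand k u x)) ((n, \<phi>), F x)"
      using pt_glue[OF ba \<phi> expand_icube[OF x]] arrow_rep_expand[OF r x] assms by simp
  qed
  from on_pts_pt[OF this assms(1,2)] show ?thesis by (simp add: shrink_to_def)
qed

lemma stream_map_expand:
  assumes c: "c \<in> cells (nerve M) k"
  shows "stream_map (dcube (Suc k)) X (\<lambda>q. pt k c (expand k (q k) q))"
proof (rule stream_map_dcube_compose[OF stream_X stream_map_pt[OF c]])
  have ex: "expand k (q k) q = expand k (q k) (restrict q {..<k})" for q by (simp add: expand_def fun_eq_iff)
  show "(\<lambda>q. expand k (q k) q) \<in> icube (Suc k) \<rightarrow> icube k"
    using icubeD[where n = "Suc k" and i = k] by (subst ex) (auto intro!: expand_icube icube_restrict_lessThan)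
  show "cle k (expand k (x k) x) (expand k (y k) y)" if "cle (Suc k) x y" for x y
    unfolding cle_def
  proof (intro allI impI)
    fix i assume i: "i < k"
    have "x i \<le> y i" "x k \<le> y k" using that i by (auto simp: cle_def)
    then show "expand k (x k) x i \<le> expand k (y k) y i" using i by (auto simp: expand_def max_def)
  qed
  fix x0 :: "nat \<Rightarrow> real" and r :: real assume r: "0 < r"
  \<comment> \<open>Radius \<open>r / 2\<close> suffices: one branch has slope 2, the other is the
    sum of two moving coordinates.\<close>
  have "near k r (expand k (x0 k) x0) (expand k (x k) x)" if "near (Suc k) (r / 2) x0 x" for x
    unfolding near_def
  proof (intro allI impI)
    fix i assume i: "i < k"
    have "\<bar>x i - x0 i\<bar> < r / 2" "\<bar>x k - x0 k\<bar> < r / 2" using that i unfolding near_def by auto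
    then have "x i < x0 i + r / 2" "x0 i < x i + r / 2" "x k < x0 k + r / 2" "x0 k < x k + r / 2" by linarith+
    then show "\<bar>expand k (x k) x i - expand k (x0 k) x0 i\<bar> < r"
      using i r by (auto simp: expand_def max_def abs_less_iff)
  qed
  then show "\<exists>s>0. \<forall>x\<in>icube (Suc k). near (Suc k) s x0 x \<longrightarrow> near k r (expand k (x0 k) x0) (expand k (x k) x)"
    using r by (intro exI[of _ "r / 2"]) auto
qed

lemma local_homotopy_shrink: "local_homotopy (points X) (\<lambda>C s. shrink_to s C)"
  unfolding local_homotopy_def
proof (intro conjI allI impI)
  fix k \<phi> and x0 :: "nat \<Rightarrow> real" assume \<phi>: "\<phi> \<in> cells (nerve M) k"
  have "shrink_to s (pt k \<phi> x) = pt k \<phi> (expand k ((x(k := s)) k) (x(k := s)))"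
    if "x \<in> icube k" "0 \<le> s" "s \<le> 1" for x s
  proof -
    have "expand k ((x(k := s)) k) (x(k := s)) = expand k s x" by (simp add: expand_def fun_eq_iff)
    then show ?thesis using shrink_to_pt[OF \<phi> that] by simp
  qed
  then show "\<exists>r>0. \<exists>G. stream_map (dcube (Suc k)) X G \<and>
          (\<forall>x\<in>icube k. near k r x0 x \<longrightarrow> (\<forall>s. 0 \<le> s \<and> s \<le> 1 \<longrightarrow> shrink_to s (pt k \<phi> x) = G (x(k := s))))"
    using stream_map_expand[OF \<phi>]
    by (intro exI[of _ 1] conjI exI[of _ "\<lambda>q. pt k \<phi> (expand k (q k) q)"]) auto
qed simp

section \<open>The cone over a face and the contraction\<close>

definition vmeet :: "nat \<Rightarrow> (nat \<Rightarrow> bool) \<Rightarrow> (nat \<Rightarrow> bool) \<Rightarrow> (nat \<Rightarrow> bool)" where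
  "vmeet k v e = (\<lambda>i\<in>{..<k}. v i \<and> e i)"

lemma vmeet_vertex [simp]: "vmeet k v e \<in> vertices k" by (simp add: vmeet_def)

lemma vmeet_pairs:
  "(v, w) \<in> vertex_pairs (Suc k) \<Longrightarrow> (vmeet k v e, vmeet k w e) \<in> vertex_pairs k"
  "(v, w) \<in> vertex_pairs k \<Longrightarrow> (vmeet k v e, vmeet k w e) \<in> vertex_pairs k"
  by (auto simp: vmeet_def vertex_pairs_def)

lemma vmeet_le: "e \<in> vertices k \<Longrightarrow> (vmeet k v e, e) \<in> vertex_pairs k"
  by (auto simp: vmeet_def vertex_pairs_def)

lemma vmeet_restrict [simp]: "vmeet k (restrict v {..<k}) e = vmeet k v e"
  by (auto simp: vmeet_def)

lemma arrow_rep_vmeet: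
  assumes r: "arrow_rep m n \<sigma> f F" and v: "v \<in> vertices m" and e: "e \<in> vertices m"
  shows "f (vmeet m v e) = vmeet n (f v) (f e)"
proof (rule vertices_ext)
  fix i assume i: "i < n"
  show "f (vmeet m v e) i = vmeet n (f v) (f e) i"
    using i arrow_rep_less[OF r i]
    by (cases "\<sigma> i") (auto simp: arrow_rep_vertex_nth[OF r _ i] v e vmeet_def)
qed (simp_all add: arrow_rep_vertex[OF r])

text \<open>The cone over the subcube below the vertex \<open>e\<close> of \<open>\<phi>\<close>; its last coordinate leads to the unique
  vertex, and the edge that starts at \<open>e\<close> is \<open>l\<close>.\<close>

definition cube_cone :: "nat \<Rightarrow> ((nat \<Rightarrow> bool) \<times> (nat \<Rightarrow> bool) \<Rightarrow> 'a) \<Rightarrow> (nat \<Rightarrow> bool) \<Rightarrow> 'a \<Rightarrow>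
    (nat \<Rightarrow> bool) \<times> (nat \<Rightarrow> bool) \<Rightarrow> 'a" where
  "cube_cone k \<phi> e l = (\<lambda>(v, w)\<in>vertex_pairs (Suc k).
     if w k then if v k then \<one> else \<phi> (vmeet k v e, e) \<otimes> l else \<phi> (vmeet k v e, vmeet k w e))"

lemma cube_cone_apply: "(v, w) \<in> vertex_pairs (Suc k) \<Longrightarrow> cube_cone k \<phi> e l (v, w) =
    (if w k then if v k then \<one> else \<phi> (vmeet k v e, e) \<otimes> l else \<phi> (vmeet k v e, vmeet k w e))"
  by (simp add: cube_cone_def)

text \<open>Before the last coordinate is crossed the cone is \<open>\<phi>\<close> pulled back
  along the meet with \<open>e\<close>; crossing it appends the edge to \<open>e\<close> and then
  \<open>l\<close>; afterwards all edges are identities. Functoriality follows from that of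
  \<open>\<phi>\<close> and associativity.\<close>

lemma cube_cone_cell:
  assumes \<phi>: "\<phi> \<in> cells (nerve M) k" and e: "e \<in> vertices k" and l: "l \<in> carrier M"
  shows "cube_cone k \<phi> e l \<in> cells (nerve M) (Suc k)"
proof (rule nerve_cellI)
  fix u v assume uv: "(u, v) \<in> vertex_pairs (Suc k)"
  show "cube_cone k \<phi> e l (u, v) \<in> carrier M"
    unfolding cube_cone_apply[OF uv] using nerve_closed[OF \<phi> vmeet_le[OF e]] nerve_closed[OF \<phi> vmeet_pairs(1)[OF uv]] l by auto
next
  fix u assume u: "u \<in> vertices (Suc k)"
  show "cube_cone k \<phi> e l (u, u) = \<one>"
    unfolding cube_cone_apply[OF vertex_pairs_refl[OF u]] using nerve_refl[OF \<phi>] by simp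
next
  fix u v w assume uv: "(u, v) \<in> vertex_pairs (Suc k)" and vw: "(v, w) \<in> vertex_pairs (Suc k)"
  have k: "u k \<Longrightarrow> v k" "v k \<Longrightarrow> w k" using vertex_pairsD(3)[OF uv, of k] vertex_pairsD(3)[OF vw, of k] by auto
  note p = vmeet_pairs(1)[OF uv, of e] vmeet_pairs(1)[OF vw, of e]
  note c = nerve_closed[OF \<phi> p(1)] nerve_closed[OF \<phi> p(2)] nerve_closed[OF \<phi> vmeet_le[OF e]]
  show "cube_cone k \<phi> e l (u, w) = cube_cone k \<phi> e l (u, v) \<otimes> cube_cone k \<phi> e l (v, w)"
    unfolding cube_cone_apply[OF uv] cube_cone_apply[OF vw] cube_cone_apply[OF vertex_pairs_trans[OF uv vw]]
    using k c l nerve_comp[OF \<phi> p] nerve_comp[OF \<phi> p(1) vmeet_le[OF e]] by (auto simp: m_assoc)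
qed (auto simp: cube_cone_def)

text \<open>Arrows preserve meets of vertices and the suspended arrow keeps the last coordinate, so
  coning commutes with pulling back cells.\<close>

lemma act_cube_cone:
  assumes r: "arrow_rep m n \<sigma> f F" and ba: "box_arrow (Suc m) (Suc n) f' F'"
    and f': "\<And>u b. u \<in> vertices m \<Longrightarrow> f' (u(m := b)) = (f u)(n := b)" and e: "e \<in> vertices m"
  shows "act (nerve M) (Suc m) (Suc n) f' (cube_cone n \<phi> (f e) l) = cube_cone m (act (nerve M) m n f \<phi>) e l"
proof
  fix z :: "(nat \<Rightarrow> bool) \<times> (nat \<Rightarrow> bool)"
  obtain v w where z: "z = (v, w)" by (cases z)
  show "act (nerve M) (Suc m) (Suc n) f' (cube_cone n \<phi> (f e) l) z = cube_cone m (act (nerve M) m n f \<phi>) e l z"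
  proof (cases "(v, w) \<in> vertex_pairs (Suc m)")
    case True
    have fv: "f' u n = u m" "vmeet n (f' u) (f e) = f (vmeet m u e)" if "u \<in> vertices (Suc m)" for u
    proof -
      have u: "u = (restrict u {..<m})(m := u m)"
        using that by (auto simp: fun_eq_iff vertices_undef)
      have eq: "f' u = (f (restrict u {..<m}))(n := u m)" using f'[of "restrict u {..<m}" "u m"] u by simp
      show "f' u n = u m" by (simp add: eq)
      have "vmeet n (f' u) (f e) = vmeet n (f (restrict u {..<m})) (f e)" by (simp add: eq vmeet_def fun_eq_iff)
      also have "\<dots> = f (vmeet m (restrict u {..<m}) e)" by (rule arrow_rep_vmeet[OF r _ e, symmetric]) simp
      finally show "vmeet n (f' u) (f e) = f (vmeet m u e)" by simp
    qed
    note v = vertex_pairsD(1,2)[OF True]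
    show ?thesis
      using True fv[OF v(1)] fv[OF v(2)] box_arrow_vertices(2)[OF ba True]
      by (simp add: z act_nerve cube_cone_apply vmeet_le[OF e] vmeet_pairs)
  next
    case False
    then show ?thesis by (simp add: z act_nerve_undef cube_cone_def)
  qed
qed

text \<open>On the face where coordinates outside \<open>e\<close> vanish, both cones restrict to
  the same cell: the edge to \<open>e'\<close> factors through \<open>e\<close>, and the factor
  \<open>\<phi> (e, e')\<close> is absorbed into the label. This compensates the jump of the label
  when the rounded vertex changes.\<close>

lemma pt_cube_cone_shrink:
  assumes \<phi>: "\<phi> \<in> cells (nerve M) k" and ee: "(e, e') \<in> vertex_pairs k" and l: "l \<in> carrier M"
    and y: "y \<in> icube k" "\<And>i. i < k \<Longrightarrow> \<not> e i \<Longrightarrow> y i = 0" and s: "0 \<le> s" "s \<le> 1"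
  shows "pt (Suc k) (cube_cone k \<phi> e' l) (y(k := s)) = pt (Suc k) (cube_cone k \<phi> e (\<phi> (e, e') \<otimes> l)) (y(k := s))"
proof -
  note ev = vertex_pairsD(1,2)[OF ee]
  note cl = nerve_closed[OF \<phi>]
  define S where "S = {i. i < k \<and> \<not> e i}"
  define A where "A = setc (Suc k) S (\<lambda>_. False)"
  have ba: "box_arrow (Suc k) (Suc k) (restrict A (vertices (Suc k))) (restrict (setc (Suc k) S (\<lambda>_. of_bool False)) (icube (Suc k)))"
    unfolding A_def by (rule box_arrow_setc) (simp add: S_def)
  have Ay: "restrict (setc (Suc k) S (\<lambda>_. of_bool False)) (icube (Suc k)) (y(k := s)) = y(k := s)"
    using icube_upd[OF y(1) s] icube_undef[OF icube_upd[OF y(1) s]] y(2) by (auto simp: setc_def S_def fun_eq_iff)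
  have Am: "A u k = u k" "vmeet k (A u) e' = vmeet k u e" "vmeet k (A u) e = vmeet k u e" for u
    using vertex_pairsD(3)[OF ee] by (auto simp: A_def setc_def S_def vmeet_def fun_eq_iff)
  have c: "cube_cone k \<phi> e' l \<in> cells (nerve M) (Suc k)" "cube_cone k \<phi> e (\<phi> (e, e') \<otimes> l) \<in> cells (nerve M) (Suc k)"
    using cube_cone_cell[OF \<phi>] ev l cl[OF ee] by auto
  have "act (nerve M) (Suc k) (Suc k) (restrict A (vertices (Suc k))) (cube_cone k \<phi> e' l) =
      act (nerve M) (Suc k) (Suc k) (restrict A (vertices (Suc k))) (cube_cone k \<phi> e (\<phi> (e, e') \<otimes> l))"
  proof
    fix z :: "(nat \<Rightarrow> bool) \<times> (nat \<Rightarrow> bool)"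
    obtain v w where z: "z = (v, w)" by (cases z)
    show "act (nerve M) (Suc k) (Suc k) (restrict A (vertices (Suc k))) (cube_cone k \<phi> e' l) z =
      act (nerve M) (Suc k) (Suc k) (restrict A (vertices (Suc k))) (cube_cone k \<phi> e (\<phi> (e, e') \<otimes> l)) z"
    proof (cases "(v, w) \<in> vertex_pairs (Suc k)")
      case True
      have "(A v, A w) \<in> vertex_pairs (Suc k)" using box_arrow_vertices(2)[OF ba True] vertex_pairsD(1,2)[OF True] by simp
      moreover have "\<phi> (vmeet k v e, e') = \<phi> (vmeet k v e, e) \<otimes> \<phi> (e, e')"
        using nerve_comp[OF \<phi> vmeet_le[OF ev(1)] ee] .
      ultimately show ?thesis
        using True vertex_pairsD(1,2)[OF True] cl[OF vmeet_le[OF ev(1)], of v] cl[OF ee] l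
        by (simp add: z act_nerve cube_cone_apply Am m_assoc)
    qed (simp add: z act_nerve_undef)
  qed
  then show ?thesis
    using pt_glue[OF ba c(1) icube_upd[OF y(1) s]] pt_glue[OF ba c(2) icube_upd[OF y(1) s]] Ay by simp
qed

definition contract where
  "contract l s = on_pts (\<lambda>((k, \<phi>), x). pt (Suc k) (cube_cone k \<phi> (thr k (1 / 2) x) l) ((expand k 0 x)(k := s)))"

lemma contract_pt:
  assumes \<phi>: "\<phi> \<in> cells (nerve M) k" and x: "x \<in> icube k" and l: "l \<in> carrier M" and s: "0 \<le> s" "s \<le> 1"
  shows "contract l s (pt k \<phi> x) = pt (Suc k) (cube_cone k \<phi> (thr k (1 / 2) x) l) ((expand k 0 x)(k := s))"
proof -
  have "natural (\<lambda>((k, \<phi>), x). pt (Suc k) (cube_cone k \<phi> (thr k (1 / 2) x) l) ((expand k 0 x)(k := s)))" (is "natural ?Q")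
    unfolding natural_def
  proof (intro allI impI)
    fix m n f F \<phi> x assume ba: "box_arrow m n f F" and \<phi>: "\<phi> \<in> cells (nerve M) n" and x: "x \<in> icube m"
    obtain \<sigma> where r: "arrow_rep m n \<sigma> f F" using box_arrow_rep[OF ba] by blast
    obtain f' F' where f': "box_arrow (Suc m) (Suc n) f' F'"
      "\<forall>u\<in>vertices m. \<forall>b. f' (u(m := b)) = (f u)(n := b)"
      "\<forall>x\<in>icube m. \<forall>t. 0 \<le> t \<and> t \<le> 1 \<longrightarrow> F' (x(m := t)) = (F x)(n := t)"
      using box_arrow_suspend[OF ba] by blast
    let ?e = "thr m (1 / 2) x" and ?y = "expand m 0 x"
    have y: "?y \<in> icube m" using expand_icube[OF x] by simp
    have th: "thr n (1 / 2) (F x) = f ?e" using arrow_rep_thr[OF r x] by simp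
    have "cube_cone n \<phi> (f ?e) l \<in> cells (nerve M) (Suc n)" using cube_cone_cell[OF \<phi> arrow_rep_vertex[OF r thr_vertex] l] .
    from pt_glue[OF f'(1) this icube_upd[OF y s]]
    have "pt (Suc m) (cube_cone m (act (nerve M) m n f \<phi>) ?e l) (?y(m := s)) = pt (Suc n) (cube_cone n \<phi> (f ?e) l) (F' (?y(m := s)))"
      using act_cube_cone[OF r f'(1) _ thr_vertex] f'(2) by simp
    also have "F' (?y(m := s)) = (F ?y)(n := s)" using f'(3) y s by blast
    also have "F ?y = expand n 0 (F x)" using arrow_rep_expand[OF r x] by simp
    finally show "?Q ((m, act (nerve M) m n f \<phi>), x) = ?Q ((n, \<phi>), F x)" by (simp only: prod.case th)
  qed
  from on_pts_pt[OF this \<phi> x] show ?thesis by (simp add: contract_def)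
qed

lemma stream_map_contract_cell:
  assumes c: "c \<in> cells (nerve M) (Suc k)"
  shows "stream_map (dcube (Suc k)) X (\<lambda>q. pt (Suc k) c ((expand k 0 q)(k := q k)))"
proof (rule stream_map_dcube_compose[OF stream_X stream_map_pt[OF c]])
  have ex: "expand k 0 q = expand k 0 (restrict q {..<k})" for q by (simp add: expand_def fun_eq_iff)
  show "(\<lambda>q. (expand k 0 q)(k := q k)) \<in> icube (Suc k) \<rightarrow> icube (Suc k)"
    using icubeD[where n = "Suc k" and i = k] by (subst ex) (auto intro!: icube_upd expand_icube icube_restrict_lessThan)
  show "cle (Suc k) ((expand k 0 x)(k := x k)) ((expand k 0 y)(k := y k))" if "cle (Suc k) x y" for x y
    unfolding cle_upd
  proof
    show "cle k (expand k 0 x) (expand k 0 y)"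
      unfolding cle_def
    proof (intro allI impI)
      fix i assume i: "i < k"
      have "x i \<le> y i" using that i by (auto simp: cle_def)
      then show "expand k 0 x i \<le> expand k 0 y i" using i by (auto simp: expand_def max_def)
    qed
  qed (use that in \<open>simp add: cle_def\<close>)
  fix x0 :: "nat \<Rightarrow> real" and r :: real assume r: "0 < r"
  have "near (Suc k) r ((expand k 0 x0)(k := x0 k)) ((expand k 0 x)(k := x k))" if nr: "near (Suc k) (r / 2) x0 x" for x
    unfolding near_upd
  proof
    show "\<bar>x k - x0 k\<bar> < r" using near_mono[OF nr, of r] r by (simp add: near_def)
    show "near k r (expand k 0 x0) (expand k 0 x)"
      unfolding near_def
    proof (intro allI impI)
      fix i assume i: "i < k"
      have "\<bar>x i - x0 i\<bar> < r / 2" using nr i unfolding near_def by auto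
      then have "x i < x0 i + r / 2" "x0 i < x i + r / 2" by linarith+
      then show "\<bar>expand k 0 x i - expand k 0 x0 i\<bar> < r"
        using i r by (auto simp: expand_def max_def abs_less_iff)
    qed
  qed
  then show "\<exists>s>0. \<forall>x\<in>icube (Suc k). near (Suc k) s x0 x \<longrightarrow>
      near (Suc k) r ((expand k 0 x0)(k := x0 k)) ((expand k 0 x)(k := x k))"
    using r by (intro exI[of _ "r / 2"]) auto
qed

text \<open>All vertices rounded at \<open>1 / 2\<close> near \<open>x0\<close> lie below one vertex
  \<open>?J\<close>. By regularity the label transported from \<open>?J\<close> to threshold
  \<open>a\<close> is constant there, so the varying cones may be replaced by the single cone over
  \<open>?J\<close>.\<close>

lemma local_homotopy_contract:
  assumes l: "level a e" and c: "c \<in> carrier M"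
  shows "local_homotopy (regular a e) (\<lambda>C s. contract (transport (1 / 2) a C \<otimes> c) s C)"
  unfolding local_homotopy_def
proof (intro conjI allI impI openin_regular[OF l])
  note la = levelD[OF l]
  fix k \<phi> x0 assume \<phi>: "\<phi> \<in> cells (nerve M) k" and x0: "x0 \<in> icube k" and reg: "pt k \<phi> x0 \<in> regular a e"
  \<comment> \<open>Half the gap between \<open>a\<close> and \<open>1 / 2\<close>: a displacement
    below \<open>d\<close> keeps \<open>?J\<close> above the rounding at \<open>1 / 2\<close> and
    below the rounding at \<open>a\<close>.\<close>
  define d where "d = (1 / 2 - a) / 2"
  have d: "0 < d" using la by (simp add: d_def)
  let ?J = "thr k (1 / 2 - d) x0" and ?start = "thr k a x0"
  have J0: "(?J, ?start) \<in> vertex_pairs k" using la by (intro thr_antimono) (simp add: d_def field_simps)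
  let ?c = "\<phi> (?J, ?start) \<otimes> c"
  have cc: "?c \<in> carrier M" using nerve_closed[OF \<phi> J0] c by simp
  have "contract (transport (1 / 2) a (pt k \<phi> x) \<otimes> c) s (pt k \<phi> x) = pt (Suc k) (cube_cone k \<phi> ?J ?c) ((expand k 0 (x(k := s)))(k := (x(k := s)) k))"
    if x: "x \<in> icube k" and nr: "near k (min e d) x0 x" and s: "0 \<le> s" "s \<le> 1" for x s
  proof -
    have nri: "x i < x0 i + e" "x0 i < x i + e" "x i < x0 i + d" "x0 i < x i + d" if "i < k" for i
    proof -
      have "\<bar>x i - x0 i\<bar> < e" "\<bar>x i - x0 i\<bar> < d" using nr that by (auto simp: near_def)
      then show "x i < x0 i + e" "x0 i < x i + e" "x i < x0 i + d" "x0 i < x i + d" by linarith+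
    qed
    let ?h = "thr k (1 / 2) x" and ?t = "thr k a x"
    have hJ: "(?h, ?J) \<in> vertex_pairs k" using nri by (intro vertex_pairsI) fastforce+
    have Jt: "(?J, ?t) \<in> vertex_pairs k"
    proof (rule vertex_pairsI)
      fix i assume i: "i < k" "?J i"
      then have "1 / 2 - d \<le> x0 i" by simp
      then have "1 / 2 - 2 * d \<le> x i" using nri[OF i(1)] by linarith
      then show "?t i" using i(1) by (simp add: d_def field_simps)
    qed simp_all
    \<comment> \<open>The join of the roundings at \<open>a\<close> of \<open>x\<close> and
      \<open>x0\<close>. Regularity at \<open>x0\<close> makes both edges into it identities, which
      gives equal labels from \<open>?J\<close>.\<close>
    define z where "z = (\<lambda>i\<in>{..<k}. a \<le> x i \<or> a \<le> x0 i)"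
    have zv: "z \<in> vertices k" by (simp add: z_def)
    have tz: "(?t, z) \<in> vertex_pairs k" "(?start, z) \<in> vertex_pairs k"
      by (auto intro!: vertex_pairsI simp: z_def)
    have zh: "(z, thr k (a - e) x0) \<in> vertex_pairs k"
    proof (rule vertex_pairsI[OF zv thr_vertex])
      fix i assume i: "i < k" "z i"
      then show "thr k (a - e) x0 i" using nri[OF i(1)] la by (auto simp: z_def)
    qed
    have lo: "(sthr k (a + e) x0, ?t) \<in> vertex_pairs k" "(sthr k (a + e) x0, ?start) \<in> vertex_pairs k"
    proof (rule_tac [!] vertex_pairsI)
      fix i assume i: "i < k" "sthr k (a + e) x0 i"
      then show "?t i" "?start i" using nri[OF i(1)] la by auto
    qed simp_all
    note R = reg[unfolded pt_in_regular[OF l \<phi> x0], rule_format]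
    have "\<phi> (?t, z) = \<one>" "\<phi> (?start, z) = \<one>" using R[OF lo(1) tz(1) zh] R[OF lo(2) tz(2) zh] by auto
    then have "\<phi> (?J, ?t) = \<phi> (?J, ?start)"
      using nerve_comp[OF \<phi> Jt tz(1)] nerve_comp[OF \<phi> J0 tz(2)] nerve_closed[OF \<phi> Jt] nerve_closed[OF \<phi> J0] by simp
    then have "transport (1 / 2) a (pt k \<phi> x) \<otimes> c = \<phi> (?h, ?J) \<otimes> ?c"
      using transport_pt[OF _ _ _ \<phi> x, of a "1 / 2"] la nerve_comp[OF \<phi> hJ Jt] nerve_closed[OF \<phi> hJ] nerve_closed[OF \<phi> Jt] c
      by (simp add: m_assoc)
    moreover have "contract (\<phi> (?h, ?J) \<otimes> ?c) s (pt k \<phi> x) =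
        pt (Suc k) (cube_cone k \<phi> ?h (\<phi> (?h, ?J) \<otimes> ?c)) ((expand k 0 x)(k := s))"
      using contract_pt[OF \<phi> x _ s] nerve_closed[OF \<phi> hJ] cc by simp
    moreover have "pt (Suc k) (cube_cone k \<phi> ?J ?c) ((expand k 0 x)(k := s)) =
        pt (Suc k) (cube_cone k \<phi> ?h (\<phi> (?h, ?J) \<otimes> ?c)) ((expand k 0 x)(k := s))"
    proof (rule pt_cube_cone_shrink[OF \<phi> hJ cc _ _ s])
      show "expand k 0 x \<in> icube k" using expand_icube[OF x] by simp
      show "expand k 0 x i = 0" if "i < k" "\<not> ?h i" for i
        using that icubeD[OF x that(1)] by (auto simp: expand_def max_def)
    qed
    moreover have "expand k 0 (x(k := s)) = expand k 0 x" by (simp add: expand_def fun_eq_iff)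
    ultimately show ?thesis by simp
  qed
  then show "\<exists>r>0. \<exists>G. stream_map (dcube (Suc k)) X G \<and>
          (\<forall>x\<in>icube k. near k r x0 x \<longrightarrow> (\<forall>s. 0 \<le> s \<and> s \<le> 1 \<longrightarrow>
             contract (transport (1 / 2) a (pt k \<phi> x) \<otimes> c) s (pt k \<phi> x) = G (x(k := s))))"
    using stream_map_contract_cell[OF cube_cone_cell[OF \<phi> thr_vertex cc]] la d
    by (intro exI[of _ "min e d"] conjI exI[of _ "\<lambda>q. pt (Suc k) (cube_cone k \<phi> ?J ?c) ((expand k 0 q)(k := q k))"]) auto
qed

lemma pt_const_cell:
  "\<phi> \<in> cells (nerve M) k \<Longrightarrow> (\<And>u v. (u, v) \<in> vertex_pairs k \<Longrightarrow> \<phi> (u, v) = \<one>) \<Longrightarrow> x \<in> icube k \<Longrightarrow> pt k \<phi> x = star"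
proof (induction k arbitrary: \<phi> x)
  case 0
  then show ?case using cell_0_eq by (simp add: star_eq icube_0)
next
  case (Suc k)
  define \<psi> where "\<psi> = (\<lambda>z\<in>vertex_pairs k. \<one>)"
  have \<psi>: "\<psi> \<in> cells (nerve M) k"
    by (rule nerve_cellI) (auto simp: \<psi>_def vertex_pairs_refl dest: vertex_pairs_trans)
  note ba = box_arrow.codegeneracy[of k k, simplified]
  have "act (nerve M) (Suc k) k (restrict (omit_at k) (vertices (Suc k))) \<psi> = \<phi>"
  proof
    fix z :: "(nat \<Rightarrow> bool) \<times> (nat \<Rightarrow> bool)"
    obtain u v where z: "z = (u, v)" by (cases z)
    show "act (nerve M) (Suc k) k (restrict (omit_at k) (vertices (Suc k))) \<psi> z = \<phi> z"
    proof (cases "z \<in> vertex_pairs (Suc k)")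
      case True
      then show ?thesis using box_arrow_vertices(2)[OF ba, of u v] Suc.prems(2) by (simp add: z act_nerve \<psi>_def)
    qed (simp add: act_nerve_undef nerve_undef[OF Suc.prems(1)])
  qed
  then have "pt (Suc k) \<phi> x = pt k \<psi> (restrict (omit_at k) (icube (Suc k)) x)"
    using pt_glue[OF ba \<psi> Suc.prems(3)] by simp
  also have "\<dots> = star"
    using box_arrow_icube[OF ba Suc.prems(3)] by (intro Suc.IH[OF \<psi>]) (simp_all add: \<psi>_def)
  finally show ?case .
qed

text \<open>The initial face of the cone is \<open>\<phi>\<close> restricted below the rounded
  vertex, and the stretched point has vanishing coordinates outside it. So the label
  \<open>l\<close> is irrelevant at time 0.\<close>

lemma contract_0:
  assumes "C \<in> points X" and l: "l \<in> carrier M"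
  shows "contract l 0 C = shrink_to 0 C"
proof -
  obtain k \<phi> x where C: "C = pt k \<phi> x" and \<phi>: "\<phi> \<in> cells (nerve M) k" and x: "x \<in> icube k" using X_cases[OF assms(1)] .
  let ?e = "thr k (1 / 2) x" and ?y = "expand k 0 x"
  have y: "?y \<in> icube k" using expand_icube[OF x] by simp
  have cn: "cube_cone k \<phi> ?e l \<in> cells (nerve M) (Suc k)" using cube_cone_cell[OF \<phi> thr_vertex l] .
  note ba = box_arrow.coface[OF order_refl[of k], of False]
  have ins: "insert_at k b u = u(k := b)" if "\<And>i. k \<le> i \<Longrightarrow> u i = undefined" for u :: "nat \<Rightarrow> bool" and b
  proof
    fix j
    show "insert_at k b u j = (u(k := b)) j"
      using that[of j] that[of "j - 1"] by (cases "j < k"; cases "j = k") (auto simp: insert_at_def)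
  qed
  define S where "S = {i. i < k \<and> \<not> ?e i}"
  define A where "A = setc k S (\<lambda>_. False)"
  have ba': "box_arrow k k (restrict A (vertices k)) (restrict (setc k S (\<lambda>_. of_bool False)) (icube k))"
    unfolding A_def by (rule box_arrow_setc) (simp add: S_def)
  have A: "A u = vmeet k u ?e" for u by (auto simp: A_def setc_def S_def vmeet_def fun_eq_iff)
  have Ay: "restrict (setc k S (\<lambda>_. of_bool False)) (icube k) ?y = ?y"
    using y by (auto simp: setc_def S_def fun_eq_iff expand_def max_def dest: icubeD[OF x])
  have "act (nerve M) k (Suc k) (restrict (insert_at k False) (vertices k)) (cube_cone k \<phi> ?e l) =
      act (nerve M) k k (restrict A (vertices k)) \<phi>"
  proof
    fix z :: "(nat \<Rightarrow> bool) \<times> (nat \<Rightarrow> bool)"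
    obtain v w where z: "z = (v, w)" by (cases z)
    show "act (nerve M) k (Suc k) (restrict (insert_at k False) (vertices k)) (cube_cone k \<phi> ?e l) z =
      act (nerve M) k k (restrict A (vertices k)) \<phi> z"
    proof (cases "(v, w) \<in> vertex_pairs k")
      case True
      note vw = vertex_pairsD(1,2)[OF True]
      have iv: "insert_at k False v = v(k := False)" "insert_at k False w = w(k := False)"
        by (rule ins, rule vertices_undef[OF vw(1)], assumption, rule ins, rule vertices_undef[OF vw(2)], assumption)
      have p: "(v(k := False), w(k := False)) \<in> vertex_pairs (Suc k)"
        using box_arrow_vertices(2)[OF ba True] vw iv by simp
      have m: "vmeet k (u(k := False)) ?e = vmeet k u ?e" for u by (auto simp: vmeet_def fun_eq_iff)
      show ?thesis using True vw iv p by (simp add: z act_nerve cube_cone_apply A m)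
    qed (simp add: z act_nerve_undef)
  qed
  then have "pt (Suc k) (cube_cone k \<phi> ?e l) (restrict (insert_at k (of_bool False)) (icube k) ?y) = pt k \<phi> ?y"
    using pt_glue[OF ba cn y] pt_glue[OF ba' \<phi> y] Ay by simp
  moreover have "restrict (insert_at k (of_bool False)) (icube k) ?y = ?y(k := 0)"
    using y icube_undef[OF y] by (auto simp: insert_at_def fun_eq_iff)
  ultimately show ?thesis using contract_pt[OF \<phi> x l, of 0] shrink_to_pt[OF \<phi> x, of 0] C by simp
qed

lemma contract_1:
  assumes "C \<in> points X" and l: "l \<in> carrier M"
  shows "contract l 1 C = star"
proof -
  obtain k \<phi> x where C: "C = pt k \<phi> x" and \<phi>: "\<phi> \<in> cells (nerve M) k" and x: "x \<in> icube k" using X_cases[OF assms(1)] .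
  let ?e = "thr k (1 / 2) x" and ?y = "expand k 0 x"
  have y: "?y \<in> icube k" using expand_icube[OF x] by simp
  have cn: "cube_cone k \<phi> ?e l \<in> cells (nerve M) (Suc k)" using cube_cone_cell[OF \<phi> thr_vertex l] .
  note ba = box_arrow.coface[OF order_refl[of k], of True]
  have "act (nerve M) k (Suc k) (restrict (insert_at k True) (vertices k)) (cube_cone k \<phi> ?e l) (v, w) = \<one>"
    if vw: "(v, w) \<in> vertex_pairs k" for v w
    using vw vertex_pairsD(1,2)[OF vw] box_arrow_vertices(2)[OF ba vw] by (simp add: act_nerve cube_cone_apply insert_at_def)
  then have "pt k (act (nerve M) k (Suc k) (restrict (insert_at k True) (vertices k)) (cube_cone k \<phi> ?e l)) ?y = star"
    using pt_const_cell[OF act_cells[OF ba cn] _ y] by blast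
  moreover have "restrict (insert_at k (of_bool True)) (icube k) ?y = ?y(k := 1)"
    using y icube_undef[OF y] by (auto simp: insert_at_def fun_eq_iff)
  ultimately show ?thesis using contract_pt[OF \<phi> x l, of 1] pt_glue[OF ba cn y] C by simp
qed

lemma shrink_to_star: "0 \<le> u \<Longrightarrow> u \<le> 1 \<Longrightarrow> shrink_to u star = star"
  using shrink_to_pt[OF nerve_vertex_cell undefined_icube_0] expand_icube[OF undefined_icube_0, of u]
  by (simp add: star_eq icube_0)

lemma shrink_to_1: "C \<in> points X \<Longrightarrow> shrink_to 1 C = C"
  by (erule X_cases) (simp add: shrink_to_pt expand_1)

lemma contract_star_one:
  assumes s: "0 \<le> s" "s \<le> 1"
  shows "contract \<one> s star = star"
proof -
  let ?u = "\<lambda>_::nat. undefined :: real"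
  let ?c = "cube_cone 0 (nerve_vertex M) (thr 0 (1 / 2) ?u) \<one>"
  have c: "?c \<in> cells (nerve M) (Suc 0)" by (rule cube_cone_cell[OF nerve_vertex_cell]) simp_all
  have "contract \<one> s star = pt (Suc 0) ?c ((expand 0 0 ?u)(0 := s))"
    unfolding star_eq using contract_pt[OF nerve_vertex_cell undefined_icube_0 _ s] by simp
  also have "\<dots> = star"
  proof (rule pt_const_cell[OF c])
    show "(expand 0 0 ?u)(0 := s) \<in> icube (Suc 0)" using expand_icube[OF undefined_icube_0] icube_upd s by simp
    have n1: "nerve_vertex M (u, v) = \<one>" if "u \<in> vertices 0" "v \<in> vertices 0" for u v
      using that nerve_refl[OF nerve_vertex_cell] by (simp add: vertices_0)
    fix u v assume "(u, v) \<in> vertex_pairs (Suc 0)"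
    then show "?c (u, v) = \<one>"
      by (simp add: cube_cone_apply n1)
  qed
  finally show ?thesis .
qed

end

subsection \<open>Concatenation of loops\<close>

lemma ctop_boundary: "1 \<le> n \<Longrightarrow> ctop n \<in> boundary n"
  by (auto simp: boundary_def ctop_def intro: exI[of _ 0] intro!: icube_restrict)

lemma restrict_icube: "p \<in> icube n \<Longrightarrow> restrict p {..<n} = p"
  by (auto simp: fun_eq_iff icube_undef)

lemma cube_homotopy_rel:
  assumes X: "stream X" and b: "b \<in> points X" and K: "stream_map (dcube (Suc n)) X K"
    and bd: "\<And>p t. p \<in> boundary n \<Longrightarrow> 0 \<le> t \<Longrightarrow> t \<le> 1 \<Longrightarrow> K (p(n := t)) = b"
    and k0: "\<And>p. p \<in> icube n \<Longrightarrow> K (p(n := 0)) = k0 p" and k1: "\<And>p. p \<in> icube n \<Longrightarrow> K (p(n := 1)) = k1 p"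
  shows "(of_cube n b k0, of_cube n b k1) \<in> dihomotopy_rel n X b"
proof -
  have loop: "of_cube n b (\<lambda>p. K (p(n := t))) \<in> loops n X b" if t: "0 \<le> t" "t \<le> 1" for t
  proof (rule of_cube_loops[OF X b])
    have "stream_map (dcube n) X (\<lambda>p. K (p(n := t)))"
      by (rule stream_map_dcube_compose'[OF X K]) (use t in \<open>auto simp: cle_def near_def less_Suc_eq intro: icube_upd\<close>)
    then show "cube_loop n X b (\<lambda>p. K (p(n := t)))" unfolding cube_loop_def using bd t by simp
  qed
  have "(of_cube n b (\<lambda>p. K (p(n := 0))), of_cube n b (\<lambda>p. K (p(n := 1)))) \<in> dihomotopy_rel n X b"
    by (rule dihomotopic_imp_rel) (rule loop loop dihomotopic_of_cube[OF X b K bd]; simp)+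
  moreover have "of_cube n b (\<lambda>p. K (p(n := 0))) = of_cube n b k0" by (rule of_cube_cong) (use k0 bd in auto)
  moreover have "of_cube n b (\<lambda>p. K (p(n := 1))) = of_cube n b k1" by (rule of_cube_cong) (use k1 bd in auto)
  ultimately show ?thesis by simp
qed

definition concat :: "((nat \<Rightarrow> real) \<Rightarrow> 'a) \<Rightarrow> ((nat \<Rightarrow> real) \<Rightarrow> 'a) \<Rightarrow> (nat \<Rightarrow> real) \<Rightarrow> 'a" where
  "concat f g p = (if p 0 \<le> 1 / 2 then f (p(0 := 2 * p 0)) else g (p(0 := 2 * p 0 - 1)))"

lemma icube_double:
  assumes "p \<in> icube n" "1 \<le> n"
  shows "p 0 \<le> 1 / 2 \<Longrightarrow> p(0 := 2 * p 0) \<in> icube n" "1 / 2 \<le> p 0 \<Longrightarrow> p(0 := 2 * p 0 - 1) \<in> icube n"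
    "p(0 := 1) \<in> icube n" "p(0 := 0) \<in> icube n"
  using assms icubeD[OF assms(1), of 0] by (auto intro!: icube_upd_inner)

lemma near_double:
  assumes "near n (r / 2) p q" "0 < r"
  shows "near n r (p(0 := 2 * p 0)) (q(0 := 2 * q 0))" "near n r (p(0 := 2 * p 0 - 1)) (q(0 := 2 * q 0 - 1))"
    "near n r (p(0 := c)) (q(0 := c))"
proof -
  have *: "\<bar>q i - p i\<bar> < r / 2" if "i < n" for i using assms(1) that unfolding near_def by blast
  then have d: "q i < p i + r / 2" "p i < q i + r / 2" if "i < n" for i using *[OF that] by linarith+
  have d': "\<bar>q i - p i\<bar> < r" if "i < n" for i using *[OF that] assms(2) by linarith
  show "near n r (p(0 := 2 * p 0)) (q(0 := 2 * q 0))" "near n r (p(0 := 2 * p 0 - 1)) (q(0 := 2 * q 0 - 1))"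
    "near n r (p(0 := c)) (q(0 := c))"
    unfolding near_def using d d' assms(2) by (auto simp: abs_less_iff) (smt (verit) d field_sum_of_halves)+
qed

lemma cle_double:
  assumes "cle n p q"
  shows "cle n (p(0 := 2 * p 0)) (q(0 := 2 * q 0))" "cle n (p(0 := 2 * p 0 - 1)) (q(0 := 2 * q 0 - 1))"
  using assms by (auto simp: cle_def)

lemma concat_boundary:
  assumes f: "cube_loop n X b f" and g: "cube_loop n X b g" and n: "1 \<le> n" and p: "p \<in> boundary n"
  shows "concat f g p = b"
proof -
  have pi: "p \<in> icube n" using p boundary_subset by blast
  obtain i where i: "i < n" "p i = 0 \<or> p i = 1" using p by (auto simp: boundary_def)
  show ?thesis
  proof (cases "p 0 \<le> 1 / 2")
    case True
    have "p(0 := 2 * p 0) \<in> boundary n"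
      unfolding boundary_def using i True icube_double(1)[OF pi n True] by (auto intro!: exI[of _ i])
    then show ?thesis using True f by (simp add: concat_def cube_loop_def)
  next
    case False
    then have "p(0 := 2 * p 0 - 1) \<in> boundary n"
      unfolding boundary_def using i icube_double(2)[OF pi n] by (auto intro!: exI[of _ i])
    then show ?thesis using False g by (simp add: concat_def cube_loop_def)
  qed
qed

lemma cube_loop_concat:
  assumes X: "stream X" and f: "cube_loop n X b f" and g: "cube_loop n X b g" and n: "1 \<le> n"
  shows "cube_loop n X b (concat f g)"
  unfolding cube_loop_def
proof (intro conjI ballI)
  show "concat f g p = b" if "p \<in> boundary n" for p using concat_boundary[OF f g n that] .
  have sf: "stream_map (dcube n) X f" and sg: "stream_map (dcube n) X g" using f g by (auto simp: cube_loop_def)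
  have fb: "f (p(0 := 1)) = b" "g (p(0 := 0)) = b" if "p \<in> icube n" for p
  proof -
    have "p(0 := 1) \<in> boundary n" "p(0 := 0) \<in> boundary n"
      using icube_double(3,4)[OF that n] n unfolding boundary_def by (auto intro!: exI[of _ 0])
    then show "f (p(0 := 1)) = b" "g (p(0 := 0)) = b" using f g by (simp_all add: cube_loop_def)
  qed
  have lf: "\<exists>r>0. \<forall>x\<in>icube n. \<forall>y\<in>icube n. near n r x0 x \<and> near n r x0 y \<and> cle n x y \<longrightarrow> (h x, h y) \<in> circ X U"
    if "stream_map (dcube n) X h" "x0 \<in> icube n" "openin (topo X) U" "h x0 \<in> U" for h x0 U
    using that(1)[unfolded stream_map_dcube_iff[OF X]] that(2-4) by blast
  show "stream_map (dcube n) X (concat f g)"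
    unfolding stream_map_dcube_iff[OF X]
  proof (intro conjI ballI allI impI)
    have "f x \<in> points X" "g x \<in> points X" if "x \<in> icube n" for x
      using sf sg that by (auto simp: stream_map_def continuous_map_def)
    then show "concat f g \<in> icube n \<rightarrow> points X"
      using icube_double[OF _ n] by (auto simp: concat_def)
    fix x0 U assume x0: "x0 \<in> icube n" and U: "openin (topo X) U \<and> concat f g x0 \<in> U"
    have U1: "openin (topo X) U" using U by blast
    show "\<exists>r>0. \<forall>x\<in>icube n. \<forall>y\<in>icube n. near n r x0 x \<and> near n r x0 y \<and> cle n x y \<longrightarrow>
        (concat f g x, concat f g y) \<in> circ X U"
    proof (cases "x0 0 \<le> 1 / 2")
      case le: True
      then have "f (x0(0 := 2 * x0 0)) \<in> U" using U by (simp add: concat_def)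
      then obtain r1 where r1: "0 < r1" "\<And>x y. x \<in> icube n \<Longrightarrow> y \<in> icube n \<Longrightarrow> near n r1 (x0(0 := 2 * x0 0)) x \<Longrightarrow>
          near n r1 (x0(0 := 2 * x0 0)) y \<Longrightarrow> cle n x y \<Longrightarrow> (f x, f y) \<in> circ X U"
        using lf[OF sf icube_double(1)[OF x0 n le] U1] by blast
      have low: "(concat f g x, concat f g y) \<in> circ X U"
        if "x \<in> icube n" "y \<in> icube n" "near n (r1 / 2) x0 x" "near n (r1 / 2) x0 y" "cle n x y" "x 0 \<le> 1 / 2" "y 0 \<le> 1 / 2" for x y
        using r1(2)[OF icube_double(1)[OF that(1) n that(6)] icube_double(1)[OF that(2) n that(7)]
            near_double(1)[OF that(3) r1(1)] near_double(1)[OF that(4) r1(1)] cle_double(1)[OF that(5)]] that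
        by (simp add: concat_def)
      show ?thesis
      proof (cases "x0 0 = 1 / 2")
        case False
        define r where "r = min (r1 / 2) (1 / 2 - x0 0)"
        have r: "0 < r" "r \<le> r1 / 2" "r \<le> 1 / 2 - x0 0"
          unfolding r_def using r1(1) le False by - (simp, rule min.cobounded1, rule min.cobounded2)
        have "x 0 \<le> 1 / 2" if "near n r x0 x" for x
        proof -
          have "\<bar>x 0 - x0 0\<bar> < r" using that n by (simp add: near_def)
          then show ?thesis using r(3) by linarith
        qed
        then show ?thesis using low near_mono[OF _ r(2)] r(1) by blast
      next
        case half: True
        have x01: "x0(0 := 2 * x0 0) = x0(0 := 1)" unfolding half by simp
        note r1' = r1(2)[unfolded x01]
        have "b \<in> U" using fb(1)[OF x0] U half by (simp add: concat_def)
        then have "g (x0(0 := 0)) \<in> U" using fb(2)[OF x0] by simp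
        then obtain r2 where r2: "0 < r2" "\<And>x y. x \<in> icube n \<Longrightarrow> y \<in> icube n \<Longrightarrow> near n r2 (x0(0 := 0)) x \<Longrightarrow>
            near n r2 (x0(0 := 0)) y \<Longrightarrow> cle n x y \<Longrightarrow> (g x, g y) \<in> circ X U"
          using lf[OF sg icube_double(4)[OF x0 n] U1] by blast
        \<comment> \<open>In the middle both formulas are active. Each doubles the first coordinate,
          hence the halves.\<close>
        define r where "r = min (r1 / 2) (r2 / 2)"
        have r: "0 < r" "r \<le> r1 / 2" "r \<le> r2 / 2"
          unfolding r_def using r1(1) r2(1) by - (simp, rule min.cobounded1, rule min.cobounded2)
        have x02: "x0(0 := 2 * x0 0 - 1) = x0(0 := 0)" unfolding half by simp
        have "(concat f g x, concat f g y) \<in> circ X U"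
          if x: "x \<in> icube n" and y: "y \<in> icube n" and nr: "near n r x0 x" "near n r x0 y" and xy: "cle n x y" for x y
        proof -
          note n1 = near_mono[OF nr(1) r(2)] near_mono[OF nr(2) r(2)]
          note n2 = near_mono[OF nr(1) r(3)] near_mono[OF nr(2) r(3)]
          consider "x 0 \<le> 1 / 2" "y 0 \<le> 1 / 2" | "1 / 2 < x 0" "1 / 2 < y 0" | "x 0 \<le> 1 / 2" "1 / 2 < y 0"
            using xy n by (force simp: cle_def)
          then show ?thesis
          proof cases
            case 1
            then show ?thesis using low[OF x y n1 xy] by simp
          next
            case 2
            have "(g (x(0 := 2 * x 0 - 1)), g (y(0 := 2 * y 0 - 1))) \<in> circ X U"
              using near_double(2)[OF n2(1) r2(1)] near_double(2)[OF n2(2) r2(1)] 2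
              by (intro r2(2) icube_double(2)[OF x n] icube_double(2)[OF y n] cle_double(2)[OF xy]) (simp_all add: x02)
            then show ?thesis using 2 by (simp add: concat_def)
          next
            case 3
            \<comment> \<open>A relation across the middle passes through the end of
              \<open>f\<close> and the beginning of \<open>g\<close>, both of which are
              \<open>b\<close>.\<close>
            have "(f (x(0 := 2 * x 0)), f (x(0 := 1))) \<in> circ X U"
            proof (rule r1')
              show "near n r1 (x0(0 := 1)) (x(0 := 2 * x 0))"
                using near_double(1)[OF n1(1) r1(1)] unfolding x01 .
              show "cle n (x(0 := 2 * x 0)) (x(0 := 1))" using 3 by (simp add: cle_def)
            qed (use icube_double[OF x n] 3 near_double(3)[OF n1(1) r1(1)] in auto)
            moreover have "(g (y(0 := 0)), g (y(0 := 2 * y 0 - 1))) \<in> circ X U"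
            proof (rule r2(2))
              show "near n r2 (x0(0 := 0)) (y(0 := 2 * y 0 - 1))"
                using near_double(2)[OF n2(2) r2(1)] unfolding x02 .
              show "cle n (y(0 := 0)) (y(0 := 2 * y 0 - 1))" using 3 by (simp add: cle_def)
            qed (use icube_double[OF y n] 3 near_double(3)[OF n2(2) r2(1)] in auto)
            ultimately show ?thesis
              using fb(1)[OF x] fb(2)[OF y] 3 circ_trans[OF X U1] by (auto simp: concat_def dest: transD)
          qed
        qed
        then show ?thesis using r(1) by blast
      qed
    next
      case gt: False
      then have "g (x0(0 := 2 * x0 0 - 1)) \<in> U" using U by (simp add: concat_def)
      then obtain r1 where r1: "0 < r1" "\<And>x y. x \<in> icube n \<Longrightarrow> y \<in> icube n \<Longrightarrow> near n r1 (x0(0 := 2 * x0 0 - 1)) x \<Longrightarrow>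
          near n r1 (x0(0 := 2 * x0 0 - 1)) y \<Longrightarrow> cle n x y \<Longrightarrow> (g x, g y) \<in> circ X U"
        using lf[OF sg icube_double(2)[OF x0 n] U1] gt by force
      define r where "r = min (r1 / 2) (x0 0 - 1 / 2)"
      have r: "0 < r" "r \<le> r1 / 2" "r \<le> x0 0 - 1 / 2"
          unfolding r_def using r1(1) gt by - (simp, rule min.cobounded1, rule min.cobounded2)
      have hi: "1 / 2 < x 0" if "near n r x0 x" for x
      proof -
        have "\<bar>x 0 - x0 0\<bar> < r" using that n by (simp add: near_def)
        then show ?thesis using r(3) by linarith
      qed
      have "(concat f g x, concat f g y) \<in> circ X U"
        if x: "x \<in> icube n" and y: "y \<in> icube n" and nr: "near n r x0 x" "near n r x0 y" and xy: "cle n x y" for x y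
      proof -
        have "(g (x(0 := 2 * x 0 - 1)), g (y(0 := 2 * y 0 - 1))) \<in> circ X U"
          using near_double(2)[OF near_mono[OF nr(1) r(2)] r1(1)] near_double(2)[OF near_mono[OF nr(2) r(2)] r1(1)]
            hi[OF nr(1)] hi[OF nr(2)]
          by (intro r1(2) icube_double(2)[OF x n] icube_double(2)[OF y n] cle_double(2)[OF xy]) simp_all
        then show ?thesis using hi[OF nr(1)] hi[OF nr(2)] by (simp add: concat_def)
      qed
      then show ?thesis using r(1) by blast
    qed
  qed
qed

lemma loop_mult_to_sphere:
  assumes f: "f \<in> loops n X b" and g: "g \<in> loops n X b" and n: "1 \<le> n" and p: "p \<in> icube n"
  shows "loop_mult n f g (to_sphere n p) = concat (\<lambda>p. f (to_sphere n p)) (\<lambda>p. g (to_sphere n p)) p"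
proof (cases "p \<in> boundary n")
  case True
  then have "to_sphere n p = sphere_infty n" using to_sphere_eq_infty_iff[OF p] by simp
  moreover have "f (sphere_infty n) = b" using f by (simp add: loops_def)
  ultimately show ?thesis
    using concat_boundary[OF loops_cube(1)[OF f] loops_cube(1)[OF g] n True] by (simp add: loop_mult_def)
next
  case False
  then have "to_sphere n p \<noteq> sphere_infty n" using to_sphere_eq_infty_iff[OF p] by simp
  then show ?thesis
    using p some_to_sphere[OF p False] by (simp add: loop_mult_def concat_def Let_def)
qed

lemma loop_mult_eq_of_cube:
  assumes f: "f \<in> loops n X b" and g: "g \<in> loops n X b" and n: "1 \<le> n"
  shows "loop_mult n f g = of_cube n b (concat (\<lambda>p. f (to_sphere n p)) (\<lambda>p. g (to_sphere n p)))"
proof (rule of_cube_eqI[symmetric])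
  show "loop_mult n f g \<in> extensional (points (dsphere n))" by (simp add: loop_mult_def)
  show "loop_mult n f g (sphere_infty n) = b" using f by (simp add: loop_mult_def loops_def)
qed (rule loop_mult_to_sphere[OF f g n])

lemma loop_mult_loops:
  assumes X: "stream X" and b: "b \<in> points X" and f: "f \<in> loops n X b" and g: "g \<in> loops n X b" and n: "1 \<le> n"
  shows "loop_mult n f g \<in> loops n X b"
  unfolding loop_mult_eq_of_cube[OF f g n]
  using cube_loop_concat[OF X loops_cube(1)[OF f] loops_cube(1)[OF g] n] by (rule of_cube_loops[OF X b])

lemma const_loop:
  assumes X: "stream X" and b: "b \<in> points X"
  shows "(\<lambda>s\<in>points (dsphere n). b) = of_cube n b (\<lambda>_. b)" "cube_loop n X b (\<lambda>_. b)"
    "(\<lambda>s\<in>points (dsphere n). b) \<in> loops n X b"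
proof -
  show 1: "(\<lambda>s\<in>points (dsphere n). b) = of_cube n b (\<lambda>_. b)"
    by (rule of_cube_eqI[symmetric]) simp_all
  show 2: "cube_loop n X b (\<lambda>_. b)"
    unfolding cube_loop_def using stream_map_const[OF stream_dcube X b] by simp
  show "(\<lambda>s\<in>points (dsphere n). b) \<in> loops n X b"
    unfolding 1 by (rule of_cube_loops[OF X b 2])
qed

text \<open>Once every loop is related to the constant one there is a single class, and the product
  formed over all representatives can only be that class.\<close>

lemma tau_trivial:
  assumes X: "stream X" and b: "b \<in> points X"
    and triv: "\<And>k. cube_loop n X b k \<Longrightarrow> (of_cube n b k, of_cube n b (\<lambda>_. b)) \<in> dihomotopy_rel n X b"
  shows "carrier (tau n X b) = {\<one>\<^bsub>tau n X b\<^esub>}" "1 \<le> n \<Longrightarrow> monoid (tau n X b)"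
proof -
  define D c where "D = dihomotopy_rel n X b" and "c = (\<lambda>s\<in>points (dsphere n). b)"
  have E: "equiv (loops n X b) D" unfolding D_def by (rule equiv_dihomotopy_rel)
  have c: "c \<in> loops n X b" unfolding c_def by (rule const_loop(3)[OF X b])
  have cl: "D `` {f} = D `` {c}" if f: "f \<in> loops n X b" for f
    using triv[OF loops_cube(1)[OF f]] unfolding loops_cube(2)[OF f] const_loop(1)[OF X b, symmetric]
      D_def[symmetric] c_def[symmetric] by (rule equiv_class_eq[OF E])
  have "loops n X b // D = {D `` {c}}"
  proof (intro equalityI subsetI)
    show "a \<in> {D `` {c}}" if "a \<in> loops n X b // D" for a
      using that by (rule quotientE) (simp add: cl)
    show "a \<in> loops n X b // D" if "a \<in> {D `` {c}}" for a
      using that quotientI[OF c, of D] by simp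
  qed
  then show car: "carrier (tau n X b) = {\<one>\<^bsub>tau n X b\<^esub>}" by (simp add: tau_def D_def c_def)
  show "monoid (tau n X b)" if n: "1 \<le> n"
  proof -
    have one: "\<one>\<^bsub>tau n X b\<^esub> = D `` {c}" by (simp add: tau_def D_def c_def)
    have lm: "D `` {loop_mult n f g} = D `` {c}" if "f \<in> D `` {c}" "g \<in> D `` {c}" for f g
      using that E loop_mult_loops[OF X b _ _ n] by (intro cl) (auto simp: equiv_def)
    have "c \<in> D `` {c}" using equiv_class_self[OF E c] .
    then have "(\<Union>f\<in>D `` {c}. \<Union>g\<in>D `` {c}. D `` {loop_mult n f g}) = D `` {c}" using lm by (simp cong: SUP_cong) blast
    then have "\<one>\<^bsub>tau n X b\<^esub> \<otimes>\<^bsub>tau n X b\<^esub> \<one>\<^bsub>tau n X b\<^esub> = \<one>\<^bsub>tau n X b\<^esub>"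
      unfolding one by (simp add: tau_def D_def)
    then show ?thesis by (intro monoidI) (auto simp: car)
  qed
qed

subsection \<open>Loops in the realization of a nerve\<close>

declare One_nat_def [simp del]

lemma interval_point_nth [simp]: "interval_point t 0 = t"
  by (simp add: interval_point_def)

lemma icube_1: "p \<in> icube 1 \<longleftrightarrow> (\<exists>t. 0 \<le> t \<and> t \<le> 1 \<and> p = interval_point t)"
proof
  assume p: "p \<in> icube 1"
  have "p = interval_point (p 0)"
    using icube_undef[OF p] by (auto simp: interval_point_def fun_eq_iff)
  then show "\<exists>t. 0 \<le> t \<and> t \<le> 1 \<and> p = interval_point t" using icubeD[OF p, of 0] by auto
qed (auto simp: interval_point_def intro: icube_restrict)

lemma interval_point_icube [simp]: "0 \<le> t \<Longrightarrow> t \<le> 1 \<Longrightarrow> interval_point t \<in> icube 1"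
  by (auto simp: icube_1)

lemma ctop_1: "ctop 1 = interval_point 1"
  by (simp add: ctop_def interval_point_def)

lemma boundary_1: "boundary 1 = {interval_point 0, interval_point 1}"
proof -
  have "interval_point t \<in> icube 1" if "t = 0 \<or> t = 1" for t using that by auto
  then show ?thesis by (auto simp: boundary_def icube_1 less_one)
qed

context nerve_space
begin

section \<open>Restriction and uniqueness of lifts\<close>

lemma lift_stepsE:
  assumes "lift_steps n f L"
  obtains d where "0 < d" "\<And>p q. p \<in> icube n \<Longrightarrow> q \<in> icube n \<Longrightarrow> cle n p q \<Longrightarrow> near n d p q \<Longrightarrow>
     \<exists>a e s. level a e \<and> (\<forall>z\<in>cbetween n p q. f z \<in> regular a e) \<and> chain (regular a e) (f p) s (f q) \<and>
        L p = s (1 / 2) \<otimes> L q"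
  using assms unfolding lift_steps_def by meson

lemma lift_steps_compose:
  assumes L: "lift_steps n f L" and \<alpha>: "\<alpha> \<in> icube m \<rightarrow> icube n"
    and mono: "\<And>x y. x \<in> icube m \<Longrightarrow> y \<in> icube m \<Longrightarrow> cle m x y \<Longrightarrow> cle n (\<alpha> x) (\<alpha> y)"
    and near: "\<And>x y r. x \<in> icube m \<Longrightarrow> y \<in> icube m \<Longrightarrow> 0 < r \<Longrightarrow> near m r x y \<Longrightarrow> near n r (\<alpha> x) (\<alpha> y)"
  shows "lift_steps m (\<lambda>x. f (\<alpha> x)) (\<lambda>x. L (\<alpha> x))"
proof -
  obtain d where d: "0 < d" "\<And>p q. p \<in> icube n \<Longrightarrow> q \<in> icube n \<Longrightarrow> cle n p q \<Longrightarrow> near n d p q \<Longrightarrow>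
     \<exists>a e s. level a e \<and> (\<forall>z\<in>cbetween n p q. f z \<in> regular a e) \<and> chain (regular a e) (f p) s (f q) \<and>
        L p = s (1 / 2) \<otimes> L q" by (rule lift_stepsE[OF L]) blast
  show ?thesis
    unfolding lift_steps_def
  proof (rule exI[of _ d], intro conjI ballI impI d(1))
    fix p q assume p: "p \<in> icube m" and q: "q \<in> icube m" and pq: "cle m p q \<and> near m d p q"
    have "\<alpha> p \<in> icube n" "\<alpha> q \<in> icube n" using \<alpha> p q by auto
    moreover have "cle n (\<alpha> p) (\<alpha> q)" "near n d (\<alpha> p) (\<alpha> q)" using mono near p q pq d(1) by auto
    ultimately obtain a e s where *: "level a e" "\<forall>z\<in>cbetween n (\<alpha> p) (\<alpha> q). f z \<in> regular a e"
      "chain (regular a e) (f (\<alpha> p)) s (f (\<alpha> q))" "L (\<alpha> p) = s (1 / 2) \<otimes> L (\<alpha> q)" using d(2) by blast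
    have "\<alpha> z \<in> cbetween n (\<alpha> p) (\<alpha> q)" if "z \<in> cbetween m p q" for z
      using that \<alpha> mono p q by (auto simp: cbetween_def)
    then show "\<exists>a e s. level a e \<and> (\<forall>z\<in>cbetween m p q. f (\<alpha> z) \<in> regular a e) \<and>
        chain (regular a e) (f (\<alpha> p)) s (f (\<alpha> q)) \<and> L (\<alpha> p) = s (1 / 2) \<otimes> L (\<alpha> q)"
      using * by meson
  qed
qed

lemma lift_steps_cong:
  assumes L: "lift_steps n f L" and eq: "\<And>p. p \<in> icube n \<Longrightarrow> f p = g p"
  shows "lift_steps n g L"
proof -
  have "z \<in> icube n" if "z \<in> cbetween n p q" for z p q using that by (simp add: cbetween_def)
  then show ?thesis using L eq unfolding lift_steps_def by (simp cong: ball_cong)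
qed

text \<open>The chains from \<open>star\<close> to \<open>star\<close> need not be constant. They
  are trivial at \<open>a\<close> by regularity, and hence at \<open>1 / 2\<close>, since transport
  between thresholds at \<open>star\<close> is the identity.\<close>

lemma lift_steps_star:
  assumes L: "lift_steps n f L" and cl: "\<And>p. p \<in> icube n \<Longrightarrow> L p \<in> carrier M"
    and star: "\<And>p. p \<in> icube n \<Longrightarrow> f p = star" and p: "p \<in> icube n"
  shows "L p = L (ctop n)"
proof -
  obtain d where d: "0 < d" "\<And>p q. p \<in> icube n \<Longrightarrow> q \<in> icube n \<Longrightarrow> cle n p q \<Longrightarrow> near n d p q \<Longrightarrow>
     \<exists>a e s. level a e \<and> (\<forall>z\<in>cbetween n p q. f z \<in> regular a e) \<and> chain (regular a e) (f p) s (f q) \<and>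
        L p = s (1 / 2) \<otimes> L q" by (rule lift_stepsE[OF L]) blast
  show ?thesis
  proof (rule advance_induct[OF d(1) p])
    fix p assume p: "p \<in> icube n" and IH: "L (advance n d p) = L (ctop n)"
    note ap = advance_props[OF p d(1)]
    obtain a e s where *: "level a e" "chain (regular a e) (f p) s (f (advance n d p))"
      "L p = s (1 / 2) \<otimes> L (advance n d p)" using d(2)[OF p ap] by blast
    note la = levelD[OF *(1)]
    have c: "chain (regular a e) star s star" using *(2) star[OF p] star[OF ap(1)] by simp
    have "s (1 / 2) = \<one>"
      using chain_transport[OF c regular_subset, of a "1 / 2"] la chain_regular[OF c *(1)] chain_closed[OF c, of "1 / 2"]
      by (simp add: transport_star)
    then show "L p = L (ctop n)" using *(3) IH cl[of "ctop n"] by simp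
  qed simp
qed

lemma lift_steps_star_path:
  assumes L: "lift_steps n f L" and cl: "\<And>p. p \<in> icube n \<Longrightarrow> L p \<in> carrier M"
    and \<alpha>: "\<alpha> \<in> icube 1 \<rightarrow> icube n"
    and mono: "\<And>x y. x \<in> icube 1 \<Longrightarrow> y \<in> icube 1 \<Longrightarrow> cle 1 x y \<Longrightarrow> cle n (\<alpha> x) (\<alpha> y)"
    and near: "\<And>x y r. x \<in> icube 1 \<Longrightarrow> y \<in> icube 1 \<Longrightarrow> 0 < r \<Longrightarrow> near 1 r x y \<Longrightarrow> near n r (\<alpha> x) (\<alpha> y)"
    and star: "\<And>p. p \<in> icube 1 \<Longrightarrow> f (\<alpha> p) = star"
  shows "L (\<alpha> (interval_point 0)) = L (\<alpha> (interval_point 1))"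
proof -
  have "L (\<alpha> (interval_point 0)) = L (\<alpha> (ctop 1))"
    by (rule lift_steps_star[OF lift_steps_compose[OF L \<alpha> mono near] _ star])
       (use cl \<alpha> in auto)
  then show ?thesis by (simp only: ctop_1)
qed

text \<open>On a step short enough for both, a chain occurring for \<open>L'\<close> is admissible
  for \<open>L\<close>, so both values acquire the same left factor. Advancing to the final corner
  leaves the end value of \<open>L'\<close> as a right factor.\<close>

lemma lift_of_map:
  assumes f: "stream_map (dcube n) X f" and ftop: "f (ctop n) = star"
  obtains L where "is_lift n f L" "\<And>p. p \<in> icube n \<Longrightarrow> L p \<in> carrier M"
    "\<And>p0. p0 \<in> icube n \<Longrightarrow> \<exists>a e c r. level a e \<and> c \<in> carrier M \<and> 0 < r \<and>
      (\<forall>p\<in>icube n. near n r p0 p \<longrightarrow> f p \<in> regular a e \<and> L p = transport (1 / 2) a (f p) \<otimes> c)"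
    "\<And>L' p. lift_steps n f L' \<Longrightarrow> (\<And>p. p \<in> icube n \<Longrightarrow> L' p \<in> carrier M) \<Longrightarrow> p \<in> icube n \<Longrightarrow> L' p = L p \<otimes> L' (ctop n)"
proof (rule lift_exists[OF f ftop])
  fix L assume L: "is_lift n f L" and cl: "\<And>p. p \<in> icube n \<Longrightarrow> L p \<in> carrier M"
    and loc: "\<And>p0. p0 \<in> icube n \<Longrightarrow> \<exists>a e c r. level a e \<and> c \<in> carrier M \<and> 0 < r \<and>
      (\<forall>p\<in>icube n. near n r p0 p \<longrightarrow> f p \<in> regular a e \<and> L p = transport (1 / 2) a (f p) \<otimes> c)"
    and st: "\<exists>d>0. \<forall>p\<in>icube n. \<forall>q\<in>icube n. cle n p q \<longrightarrow> near n d p q \<longrightarrow> (\<forall>a e s. level a e \<longrightarrow>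
      (\<forall>z\<in>cbetween n p q. f z \<in> regular a e) \<longrightarrow> chain (regular a e) (f p) s (f q) \<longrightarrow> L p = s (1 / 2) \<otimes> L q)"
  obtain d where d: "0 < d" "\<And>p q a e s. p \<in> icube n \<Longrightarrow> q \<in> icube n \<Longrightarrow> cle n p q \<Longrightarrow> near n d p q \<Longrightarrow> level a e \<Longrightarrow>
      (\<forall>z\<in>cbetween n p q. f z \<in> regular a e) \<Longrightarrow> chain (regular a e) (f p) s (f q) \<Longrightarrow> L p = s (1 / 2) \<otimes> L q"
    using st by meson
  have "L' p = L p \<otimes> L' (ctop n)" if L': "lift_steps n f L'" and cl': "\<And>p. p \<in> icube n \<Longrightarrow> L' p \<in> carrier M" and p: "p \<in> icube n" for L' p
  proof -
    obtain d' where d': "0 < d'" "\<And>p q. p \<in> icube n \<Longrightarrow> q \<in> icube n \<Longrightarrow> cle n p q \<Longrightarrow> near n d' p q \<Longrightarrow>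
      \<exists>a e s. level a e \<and> (\<forall>z\<in>cbetween n p q. f z \<in> regular a e) \<and> chain (regular a e) (f p) s (f q) \<and>
        L' p = s (1 / 2) \<otimes> L' q" by (rule lift_stepsE[OF L']) blast
    define m where "m = min d d'"
    have m: "0 < m" "m \<le> d" "m \<le> d'" using d(1) d'(1) by (simp_all add: m_def)
    show ?thesis
    proof (rule advance_induct[OF m(1) p])
      show "L' (ctop n) = L (ctop n) \<otimes> L' (ctop n)" using L cl' by (simp add: is_lift_def)
      fix p assume p: "p \<in> icube n" and IH: "L' (advance n m p) = L (advance n m p) \<otimes> L' (ctop n)"
      note ap = advance_props[OF p m(1)]
      obtain a e s where *: "level a e" "\<forall>z\<in>cbetween n p (advance n m p). f z \<in> regular a e"
        "chain (regular a e) (f p) s (f (advance n m p))" "L' p = s (1 / 2) \<otimes> L' (advance n m p)"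
        using d'(2)[OF p ap(1,2) near_mono[OF ap(3) m(3)]] by blast
      have "L p = s (1 / 2) \<otimes> L (advance n m p)"
        by (rule d(2)[OF p ap(1,2) near_mono[OF ap(3) m(2)] *(1,2,3)])
      then show "L' p = L p \<otimes> L' (ctop n)"
        using *(4) IH cl[OF ap(1)] cl'[of "ctop n"] chain_closed[OF *(3)] by (simp add: m_assoc)
    qed
  qed
  from that[OF L cl loc this] show thesis .
qed

text \<open>Motion inside one cell is a chain of a single step, whose label at \<open>1 / 2\<close>
  is the edge between the rounded vertices.\<close>

lemma lift_of_cell:
  assumes \<phi>: "\<phi> \<in> cells (nerve M) k" and top: "pt k \<phi> (ctop k) = star"
  shows "is_lift k (pt k \<phi>) (\<lambda>p. \<phi> (thr k (1 / 2) p, thr k (1 / 2) (ctop k)))"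
proof -
  obtain d where d: "meshed (pt k \<phi>) k d" using exists_meshed[OF stream_map_pt[OF \<phi>] top] .
  have le: "cle k p (ctop k)" if "p \<in> icube k" for p using icubeD[OF that] by (auto simp: cle_def ctop_def)
  have "\<exists>a e s. level a e \<and> (\<forall>z\<in>cbetween k p q. pt k \<phi> z \<in> regular a e) \<and>
      chain (regular a e) (pt k \<phi> p) s (pt k \<phi> q) \<and>
      \<phi> (thr k (1 / 2) p, thr k (1 / 2) (ctop k)) = s (1 / 2) \<otimes> \<phi> (thr k (1 / 2) q, thr k (1 / 2) (ctop k))"
    if p: "p \<in> icube k" and q: "q \<in> icube k" and pq: "cle k p q" "near k d p q" for p q
  proof -
    obtain a e where ae: "level a e" "\<And>z. z \<in> cbetween k p q \<Longrightarrow> pt k \<phi> z \<in> regular a e"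
      by (rule meshed_between[OF stream_map_pt[OF \<phi>] top d p q pq]) blast
    have "pt k \<phi> q \<in> regular a e" using ae(2) cbetween_ends[OF p q pq(1)] by blast
    then have "chain (regular a e) (pt k \<phi> p) (\<lambda>b. \<phi> (thr k b p, thr k b q) \<otimes> \<one>) (pt k \<phi> q)"
      using chain.step[OF \<phi> p q pq(1) ae(2) chain.nil] by simp
    moreover have "\<phi> (thr k (1 / 2) p, thr k (1 / 2) (ctop k)) =
        (\<phi> (thr k (1 / 2) p, thr k (1 / 2) q) \<otimes> \<one>) \<otimes> \<phi> (thr k (1 / 2) q, thr k (1 / 2) (ctop k))"
      using nerve_comp[OF \<phi> thr_mono[OF pq(1)] thr_mono[OF le[OF q]]] nerve_closed[OF \<phi> thr_mono[OF pq(1)]] by simp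
    ultimately show ?thesis using ae
      by (intro exI[of _ a] exI[of _ e] exI[of _ "\<lambda>b. \<phi> (thr k b p, thr k b q) \<otimes> \<one>"]) auto
  qed
  moreover have "0 < d" by (rule meshed_pos[OF stream_map_pt[OF \<phi>] top d])
  ultimately have "lift_steps k (pt k \<phi>) (\<lambda>p. \<phi> (thr k (1 / 2) p, thr k (1 / 2) (ctop k)))"
    unfolding lift_steps_def by meson
  then show ?thesis using nerve_refl[OF \<phi>] by (simp add: is_lift_def)
qed

definition holonomy where
  "holonomy f = (SOME L. is_lift 1 f L \<and> (\<forall>p\<in>icube 1. L p \<in> carrier M)) (interval_point 0)"

text \<open>For lifts not normalized at the end, the end value splits off on the right; this is the
  form needed for the first half of a concatenation.\<close>

lemma holonomy_eq:
  assumes f: "stream_map (dcube 1) X f" and ftop: "f (ctop 1) = star"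
    and L: "lift_steps 1 f L" and cl: "\<And>p. p \<in> icube 1 \<Longrightarrow> L p \<in> carrier M"
  shows "L (interval_point 0) = holonomy f \<otimes> L (ctop 1)"
proof -
  obtain K where K: "is_lift 1 f K" "\<And>p. p \<in> icube 1 \<Longrightarrow> K p \<in> carrier M"
    and uniq: "\<And>L' p. lift_steps 1 f L' \<Longrightarrow> (\<And>p. p \<in> icube 1 \<Longrightarrow> L' p \<in> carrier M) \<Longrightarrow> p \<in> icube 1 \<Longrightarrow> L' p = K p \<otimes> L' (ctop 1)"
    using lift_of_map[OF f ftop] by metis
  define S where "S = (SOME L. is_lift 1 f L \<and> (\<forall>p\<in>icube 1. L p \<in> carrier M))"
  have S: "is_lift 1 f S \<and> (\<forall>p\<in>icube 1. S p \<in> carrier M)"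
    unfolding S_def by (rule someI[of _ K]) (use K in blast)
  have i0: "interval_point 0 \<in> icube 1" by (rule interval_point_icube) simp_all
  have "S (interval_point 0) = K (interval_point 0)"
    using uniq[of S, OF _ _ i0] S K(2)[OF i0] by (simp add: is_lift_def)
  then show ?thesis using uniq[OF L cl i0] by (simp add: holonomy_def S_def)
qed

lemma holonomy_lift:
  assumes f: "stream_map (dcube 1) X f" "f (ctop 1) = star"
    and L: "is_lift 1 f L" and cl: "\<And>p. p \<in> icube 1 \<Longrightarrow> L p \<in> carrier M"
  shows "holonomy f = L (interval_point 0)" "holonomy f \<in> carrier M"
proof -
  have i0: "interval_point 0 \<in> icube 1" by (rule interval_point_icube) simp_all
  obtain K where K: "is_lift 1 f K" "\<And>p. p \<in> icube 1 \<Longrightarrow> K p \<in> carrier M" using lift_of_map[OF f] by metis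
  have "\<exists>K. is_lift 1 f K \<and> (\<forall>p\<in>icube 1. K p \<in> carrier M)" using K by blast
  from someI_ex[OF this] show 1: "holonomy f \<in> carrier M" unfolding holonomy_def using i0 by blast
  show "holonomy f = L (interval_point 0)"
    using holonomy_eq[OF f, of L, OF _ cl] L 1 by (simp add: is_lift_def)
qed

lemma holonomy_cong:
  assumes "\<And>p. p \<in> icube 1 \<Longrightarrow> f p = g p"
  shows "holonomy f = holonomy g"
proof -
  have "is_lift 1 f L \<longleftrightarrow> is_lift 1 g L" for L
    unfolding is_lift_def using lift_steps_cong[of 1 f L g] lift_steps_cong[of 1 g L f] assms by metis
  then show ?thesis by (simp add: holonomy_def)
qed

lemma cube_loop_map:
  assumes "cube_loop n X star f"
  shows "stream_map (dcube n) X f" "p \<in> boundary n \<Longrightarrow> f p = star" "1 \<le> n \<Longrightarrow> f (ctop n) = star"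
  using assms ctop_boundary by (auto simp: cube_loop_def)

text \<open>The track of \<open>star\<close> under the contraction. With this choice one side of the
  contraction square of a loop is literally the edge labelled by its holonomy.\<close>

definition edge where
  "edge l p = contract l (p 0) star"

lemma edge_eq:
  assumes l: "l \<in> carrier M"
  obtains c where "c \<in> cells (nerve M) 1" "\<And>p. p \<in> icube 1 \<Longrightarrow> edge l p = pt 1 c p"
    "c (thr 1 (1 / 2) (interval_point 0), thr 1 (1 / 2) (ctop 1)) = l"
proof -
  let ?u = "\<lambda>_::nat. undefined :: real"
  define c where "c = cube_cone 0 (nerve_vertex M) (thr 0 (1 / 2) ?u) l"
  have c: "c \<in> cells (nerve M) 1"
    using cube_cone_cell[OF nerve_vertex_cell thr_vertex l] by (simp add: c_def One_nat_def)
  moreover have "edge l p = pt 1 c p" if "p \<in> icube 1" for p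
  proof -
    obtain t where t: "0 \<le> t" "t \<le> 1" "p = interval_point t" using \<open>p \<in> icube 1\<close> by (auto simp: icube_1)
    have "edge l p = pt (Suc 0) c ((expand 0 0 ?u)(0 := t))"
      unfolding edge_def star_eq c_def using contract_pt[OF nerve_vertex_cell undefined_icube_0 l t(1,2)] t(3) by simp
    moreover have "(expand 0 0 ?u)(0 := t) = p" by (auto simp: expand_def t(3) interval_point_def fun_eq_iff)
    ultimately show ?thesis by (simp add: One_nat_def)
  qed
  moreover have "c (thr 1 (1 / 2) (interval_point 0), thr 1 (1 / 2) (ctop 1)) = l"
  proof -
    have p: "(thr 1 (1 / 2) (interval_point 0), thr 1 (1 / 2) (ctop 1)) \<in> vertex_pairs (Suc 0)"
      using thr_mono[of 1 "interval_point 0" "ctop 1" "1 / 2"] by (simp add: One_nat_def cle_def ctop_def)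
    have v: "vmeet 0 v e = e" if "e \<in> vertices 0" for v e using that by (auto simp: vertices_0 vmeet_def fun_eq_iff)
    have "thr 1 (1 / 2) (ctop 1) 0" "\<not> thr 1 (1 / 2) (interval_point 0) 0" by (simp_all add: ctop_def)
    then show ?thesis
      unfolding c_def cube_cone_apply[OF p] using l nerve_refl[OF nerve_vertex_cell] by (simp add: v)
  qed
  ultimately show thesis by (rule that)
qed

lemma edge_loop:
  assumes l: "l \<in> carrier M"
  shows "cube_loop 1 X star (edge l)" "holonomy (edge l) = l"
proof -
  obtain c where c: "c \<in> cells (nerve M) 1" "\<And>p. p \<in> icube 1 \<Longrightarrow> edge l p = pt 1 c p"
    "c (thr 1 (1 / 2) (interval_point 0), thr 1 (1 / 2) (ctop 1)) = l" by (rule edge_eq[OF l]) blast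
  have ends: "edge l (interval_point 0) = star" "edge l (interval_point 1) = star"
    using l by (simp_all add: edge_def contract_0 contract_1 shrink_to_star)
  have "stream_map (dcube 1) X (edge l)"
    by (rule stream_map_cong[OF stream_map_pt[OF c(1)]]) (use c(2) in \<open>simp_all add: stream_dcube\<close>)
  then show "cube_loop 1 X star (edge l)" using ends by (simp add: cube_loop_def boundary_1)
  have top: "pt 1 c (ctop 1) = star" using c(2)[of "ctop 1"] ends by (simp add: ctop_1)
  have le: "cle 1 p (ctop 1)" if "p \<in> icube 1" for p using icubeD[OF that] by (auto simp: cle_def ctop_def)
  have "holonomy (edge l) = holonomy (pt 1 c)" by (rule holonomy_cong) (rule c(2))
  also have "\<dots> = l"
    using holonomy_lift(1)[OF stream_map_pt[OF c(1)] top lift_of_cell[OF c(1) top]] nerve_closed[OF c(1) thr_mono[OF le]] c(3)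
    by simp
  finally show "holonomy (edge l) = l" .
qed

text \<open>A lift of the whole square is constant along the two sides that are sent to
  \<open>star\<close>. One side normalizes the restrictions to both faces, and the other equates
  their initial values.\<close>

lemma holonomy_homotopy:
  assumes K: "stream_map (dcube 2) X K"
    and bd: "\<And>p t. p \<in> boundary 1 \<Longrightarrow> 0 \<le> t \<Longrightarrow> t \<le> 1 \<Longrightarrow> K (p(1 := t)) = star"
  shows "holonomy (\<lambda>p. K (p(1 := 0))) = holonomy (\<lambda>p. K (p(1 := 1)))"
proof -
  have up: "p(1 := t) \<in> icube 2" if "p \<in> icube 1" "0 \<le> t" "t \<le> 1" for p t
    using icube_upd[OF that] by (simp add: numeral_2_eq_2 One_nat_def)
  have c2: "ctop 2 = (interval_point 1)(1 := 1)"
    by (auto simp: ctop_def interval_point_def fun_eq_iff)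
  have top: "K (ctop 2) = star" unfolding c2 by (rule bd) (auto simp: boundary_1)
  obtain L where L: "is_lift 2 K L" and cl: "\<And>p. p \<in> icube 2 \<Longrightarrow> L p \<in> carrier M" using lift_of_map[OF K top] by metis
  have Ls: "lift_steps 2 K L" "L (ctop 2) = \<one>" using L by (simp_all add: is_lift_def)
  have two: "i < 2 \<longleftrightarrow> i = 0 \<or> i = 1" for i :: nat by auto
  have side: "L ((interval_point s)(1 := 0)) = L ((interval_point s)(1 := 1))" if s: "s = 0 \<or> s = 1" for s
  proof -
    have ip: "interval_point s \<in> boundary 1" using s by (auto simp: boundary_1)
    have "L ((interval_point s)(1 := interval_point 0 0)) = L ((interval_point s)(1 := interval_point 1 0))"
      by (rule lift_steps_star_path[OF Ls(1) cl, where \<alpha> = "\<lambda>q. (interval_point s)(1 := q 0)"])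
         (use up[OF subsetD[OF boundary_subset ip]] bd[OF ip] icubeD[where n = 1 and i = 0] in
          \<open>auto simp: cle_def near_def two\<close>)
    then show ?thesis by simp
  qed
  have face: "holonomy (\<lambda>p. K (p(1 := t))) = L ((interval_point 0)(1 := t))" if t: "t = 0 \<or> t = 1" for t
  proof (rule holonomy_lift(1))
    show "stream_map (dcube 1) X (\<lambda>p. K (p(1 := t)))"
      by (rule stream_map_dcube_compose'[OF stream_X K]) (use t up in \<open>auto simp: cle_def near_def two\<close>)
    show "K ((ctop 1)(1 := t)) = star" using t by (intro bd) (auto simp: ctop_1 boundary_1)
    have "lift_steps 1 (\<lambda>p. K (p(1 := t))) (\<lambda>p. L (p(1 := t)))"
      by (rule lift_steps_compose[OF Ls(1)]) (use t up in \<open>auto simp: cle_def near_def two\<close>)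
    moreover have "L ((ctop 1)(1 := t)) = \<one>"
      using side[of 1] Ls(2) t unfolding c2 by (auto simp: ctop_1)
    ultimately show "is_lift 1 (\<lambda>p. K (p(1 := t))) (\<lambda>p. L (p(1 := t)))" by (simp add: is_lift_def)
    show "L (p(1 := t)) \<in> carrier M" if "p \<in> icube 1" for p using cl up that t by auto
  qed
  show ?thesis using face[of 0] face[of 1] side[of 0] by simp
qed

text \<open>The lift of the concatenation restricts to a normalized lift over the second half and to
  a lift ending in the holonomy of \<open>g\<close> over the first, whence the order of the
  factors.\<close>

lemma holonomy_concat:
  assumes f: "cube_loop 1 X star f" and g: "cube_loop 1 X star g"
  shows "holonomy (concat f g) = holonomy f \<otimes> holonomy g"
proof -
  let ?k = "concat f g"
  note k = cube_loop_concat[OF stream_X f g order_refl]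
  note fm = cube_loop_map[OF f] and gm = cube_loop_map[OF g] and km = cube_loop_map[OF k]
  obtain L where L: "is_lift 1 ?k L" and cl: "\<And>p. p \<in> icube 1 \<Longrightarrow> L p \<in> carrier M"
    using lift_of_map[OF km(1) km(3)] by (metis order_refl)
  have Ls: "lift_steps 1 ?k L" "L (ctop 1) = \<one>" using L by (simp_all add: is_lift_def)
  let ?a = "\<lambda>p::nat \<Rightarrow> real. interval_point (1 / 2 + p 0 / 2)" and ?b = "\<lambda>p::nat \<Rightarrow> real. interval_point (p 0 / 2)"
  have a: "?a p \<in> icube 1" and b: "?b p \<in> icube 1" if "p \<in> icube 1" for p using icubeD[OF that, of 0] by auto
  have ka: "?k (?a p) = g p" and kb: "?k (?b p) = f p" if "p \<in> icube 1" for p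
  proof -
    obtain t where t: "0 \<le> t" "t \<le> 1" "p = interval_point t" using \<open>p \<in> icube 1\<close> by (auto simp: icube_1)
    have u: "(interval_point s)(0 := r) = interval_point r" for r s by (auto simp: interval_point_def fun_eq_iff)
    show "?k (?b p) = f p" using t by (simp add: concat_def u)
    show "?k (?a p) = g p"
    proof (cases "t = 0")
      case True
      have "f (interval_point 1) = star" "g (interval_point 0) = star" using fm(2) gm(2) by (simp_all add: boundary_1)
      then show ?thesis using True t by (simp add: concat_def u)
    next
      case False
      then have "\<not> 1 / 2 + t / 2 \<le> 1 / 2" using t by simp
      moreover have "2 * (1 / 2 + t / 2) - 1 = t" by simp
      ultimately show ?thesis using t by (simp only: concat_def u interval_point_nth if_False)
    qed
  qed
  have "lift_steps 1 (\<lambda>p. ?k (?a p)) (\<lambda>p. L (?a p))"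
    by (rule lift_steps_compose[OF Ls(1)]) (use a in \<open>auto simp: cle_def near_def\<close>)
  then have La: "lift_steps 1 g (\<lambda>p. L (?a p))" by (rule lift_steps_cong) (rule ka)
  have "lift_steps 1 (\<lambda>p. ?k (?b p)) (\<lambda>p. L (?b p))"
    by (rule lift_steps_compose[OF Ls(1)]) (use b in \<open>auto simp: cle_def near_def\<close>)
  then have Lb: "lift_steps 1 f (\<lambda>p. L (?b p))" by (rule lift_steps_cong) (rule kb)
  have "L (?a (ctop 1)) = \<one>" using Ls(2) by (simp add: ctop_1)
  then have "is_lift 1 g (\<lambda>p. L (?a p))" using La by (simp add: is_lift_def)
  then have hg: "holonomy g = L (interval_point (1 / 2))"
    using holonomy_lift(1)[OF gm(1) gm(3)] a cl by (metis (no_types, lifting) interval_point_nth order_refl add_0_right div_0)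
  have "L (?b (interval_point 0)) = holonomy f \<otimes> L (?b (ctop 1))"
    by (rule holonomy_eq[OF fm(1) fm(3) Lb]) (use cl b in auto)
  then have "L (interval_point 0) = holonomy f \<otimes> holonomy g" using hg by (simp add: ctop_1)
  then show ?thesis using holonomy_lift(1)[OF km(1) km(3) L cl] by simp
qed

lemma holonomy_const: "holonomy (\<lambda>_. star) = \<one>"
proof -
  have "holonomy (\<lambda>_. star) = holonomy (edge \<one>)"
    using icubeD[of _ 1 0] by (intro holonomy_cong) (simp add: edge_def contract_star_one)
  then show ?thesis using edge_loop(2)[of \<one>] by simp
qed

end

subsection \<open>Contraction of directed cubes\<close>

context nerve_space
begin

lemma shrink_homotopic:
  assumes f: "cube_loop n X star f"
  shows "(of_cube n star (\<lambda>p. shrink_to 0 (f p)), of_cube n star f) \<in> dihomotopy_rel n X star"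
proof (rule cube_homotopy_rel[OF stream_X star_in_X])
  note fm = cube_loop_map[OF f]
  let ?K = "\<lambda>q. shrink_to (q n) (f (restrict q {..<n}))"
  have fX: "f p \<in> points X" if "p \<in> icube n" for p using fm(1) that by (auto simp: stream_map_def continuous_map_def)
  show "stream_map (dcube (Suc n)) X ?K"
  proof (rule stream_map_homotopy[OF fm(1)])
    fix p0 assume "p0 \<in> icube n"
    then show "\<exists>N \<Theta> r. local_homotopy N \<Theta> \<and> f p0 \<in> N \<and> 0 < r \<and>
      (\<forall>p\<in>icube n. near n r p0 p \<longrightarrow> (\<forall>s. 0 \<le> s \<and> s \<le> 1 \<longrightarrow>
         shrink_to ((p(n := s)) n) (f (restrict (p(n := s)) {..<n})) = \<Theta> (f p) s))"
      using local_homotopy_shrink fX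
      by (intro exI[of _ "points X"] exI[of _ "\<lambda>C s. shrink_to s C"] exI[of _ 1]) (simp add: restrict_icube)
  qed
  show "shrink_to ((p(n := t)) n) (f (restrict (p(n := t)) {..<n})) = star" if "p \<in> boundary n" "0 \<le> t" "t \<le> 1" for p t
    using that fm(2) subsetD[OF boundary_subset that(1)] by (simp add: restrict_icube shrink_to_star)
  show "shrink_to ((p(n := 0)) n) (f (restrict (p(n := 0)) {..<n})) = shrink_to 0 (f p)"
    "shrink_to ((p(n := 1)) n) (f (restrict (p(n := 1)) {..<n})) = f p" if "p \<in> icube n" for p
    using that fX by (simp_all add: restrict_icube shrink_to_1)
qed

text \<open>The discontinuous label \<open>L\<close> is admissible because near each point it has
  the form required by \<open>local_homotopy_contract\<close>.\<close>

lemma contraction_map: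
  assumes f: "stream_map (dcube n) X f" and ftop: "f (ctop n) = star"
  obtains L K where "is_lift n f L" "\<And>p. p \<in> icube n \<Longrightarrow> L p \<in> carrier M" "stream_map (dcube (Suc n)) X K"
    "\<And>p s. p \<in> icube n \<Longrightarrow> K (p(n := s)) = contract (L p) s (f p)"
proof (rule lift_of_map[OF f ftop])
  fix L assume L: "is_lift n f L" and cl: "\<And>p. p \<in> icube n \<Longrightarrow> L p \<in> carrier M"
    and loc: "\<And>p0. p0 \<in> icube n \<Longrightarrow> \<exists>a e c r. level a e \<and> c \<in> carrier M \<and> 0 < r \<and>
      (\<forall>p\<in>icube n. near n r p0 p \<longrightarrow> f p \<in> regular a e \<and> L p = transport (1 / 2) a (f p) \<otimes> c)"
  define K where "K q = contract (L (restrict q {..<n})) (q n) (f (restrict q {..<n}))" for q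
  have Kv: "K (p(n := s)) = contract (L p) s (f p)" if "p \<in> icube n" for p s
    using that by (simp add: K_def restrict_icube)
  have "stream_map (dcube (Suc n)) X K"
  proof (rule stream_map_homotopy[OF f])
    fix p0 assume p0: "p0 \<in> icube n"
    obtain a e c r where *: "level a e" "c \<in> carrier M" "0 < r"
      "\<forall>p\<in>icube n. near n r p0 p \<longrightarrow> f p \<in> regular a e \<and> L p = transport (1 / 2) a (f p) \<otimes> c"
      using loc[OF p0] by meson
    have "f p0 \<in> regular a e" using *(3,4) p0 by simp
    moreover have "\<forall>p\<in>icube n. near n r p0 p \<longrightarrow> (\<forall>s. 0 \<le> s \<and> s \<le> 1 \<longrightarrow>
        K (p(n := s)) = contract (transport (1 / 2) a (f p) \<otimes> c) s (f p))"
      using *(4) Kv by simp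
    ultimately show "\<exists>N \<Theta> r. local_homotopy N \<Theta> \<and> f p0 \<in> N \<and> 0 < r \<and>
      (\<forall>p\<in>icube n. near n r p0 p \<longrightarrow> (\<forall>s. 0 \<le> s \<and> s \<le> 1 \<longrightarrow> K (p(n := s)) = \<Theta> (f p) s))"
      using local_homotopy_contract[OF *(1,2)] *(3)
      by (intro exI[of _ "regular a e"] exI[of _ "\<lambda>C s. contract (transport (1 / 2) a C \<otimes> c) s C"] exI[of _ r] conjI)
  qed
  from that[OF L cl this Kv] show thesis .
qed

text \<open>From a boundary point with a coordinate 1 the other coordinates are raised to the final
  corner inside the boundary, where \<open>f\<close> is constant. With a coordinate 0 that
  coordinate is held while the others rise, reaching the previous case.\<close>

lemma boundary_lift:
  assumes f: "cube_loop n X star f" and n: "2 \<le> n"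
    and L: "is_lift n f L" and cl: "\<And>p. p \<in> icube n \<Longrightarrow> L p \<in> carrier M" and p: "p \<in> boundary n"
  shows "L p = \<one>"
proof -
  have Ls: "lift_steps n f L" "L (ctop n) = \<one>" using L by (simp_all add: is_lift_def)
  have up: "L p = \<one>" if p: "p \<in> icube n" and i: "i < n" "p i = 1" for p i
  proof -
    define \<alpha> where "\<alpha> q = (\<lambda>j\<in>{..<n}. max (p j) (q 0))" for q :: "nat \<Rightarrow> real"
    have \<alpha>: "\<alpha> q \<in> boundary n" if q: "q \<in> icube 1" for q
    proof -
      have "\<alpha> q \<in> icube n" unfolding \<alpha>_def using icubeD[OF p] icubeD[OF q, of 0] by (intro icube_restrict) (simp add: max_def)
      moreover have "\<alpha> q i = 1" using i icubeD[OF q, of 0] by (simp add: \<alpha>_def)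
      ultimately show ?thesis using i by (auto simp: boundary_def)
    qed
    have "L (\<alpha> (interval_point 0)) = L (\<alpha> (interval_point 1))"
    proof (rule lift_steps_star_path[OF Ls(1) cl])
      show "\<alpha> \<in> icube 1 \<rightarrow> icube n" using \<alpha> boundary_subset by blast
      show "f (\<alpha> q) = star" if "q \<in> icube 1" for q using cube_loop_map(2)[OF f \<alpha>[OF that]] .
    qed (auto simp: cle_def near_def \<alpha>_def max_def)
    moreover have "\<alpha> (interval_point 0) = p"
      using icubeD[OF p] icube_undef[OF p] by (auto simp: \<alpha>_def fun_eq_iff)
    moreover have "\<alpha> (interval_point 1) = ctop n"
      using icubeD[OF p] by (auto simp: \<alpha>_def ctop_def fun_eq_iff)
    ultimately show ?thesis using Ls(2) by simp
  qed
  have pi: "p \<in> icube n" using p boundary_subset by blast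
  obtain i where i: "i < n" "p i = 0 \<or> p i = 1" using p by (auto simp: boundary_def)
  show ?thesis
  proof (cases "p i = 1")
    case False
    then have pi0: "p i = 0" using i by simp
    define \<alpha> where "\<alpha> q = (\<lambda>j\<in>{..<n}. if j = i then 0 else max (p j) (q 0))" for q :: "nat \<Rightarrow> real"
    have \<alpha>i: "\<alpha> q \<in> icube n" if q: "q \<in> icube 1" for q
      unfolding \<alpha>_def using icubeD[OF pi] icubeD[OF q, of 0] by (intro icube_restrict) (simp add: max_def)
    have \<alpha>: "\<alpha> q \<in> boundary n" if q: "q \<in> icube 1" for q
      using \<alpha>i[OF q] i by (auto simp: boundary_def \<alpha>_def)
    have "L (\<alpha> (interval_point 0)) = L (\<alpha> (interval_point 1))"
    proof (rule lift_steps_star_path[OF Ls(1) cl])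
      show "\<alpha> \<in> icube 1 \<rightarrow> icube n" using \<alpha>i by blast
      show "f (\<alpha> q) = star" if "q \<in> icube 1" for q using cube_loop_map(2)[OF f \<alpha>[OF that]] .
    qed (auto simp: cle_def near_def \<alpha>_def max_def)
    moreover have "\<alpha> (interval_point 0) = p"
      using icubeD[OF pi] icube_undef[OF pi] pi0 by (auto simp: \<alpha>_def fun_eq_iff)
    moreover have "L (\<alpha> (interval_point 1)) = \<one>"
    proof (rule up)
      show "\<alpha> (interval_point 1) \<in> icube n" by (rule \<alpha>i) simp
      \<comment> \<open>Some coordinate other than \<open>i\<close>; it exists because
        \<open>2 \<le> n\<close>.\<close>
      let ?j = "if i = 0 then 1 else 0 :: nat"
      show "?j < n" using n by simp
      show "\<alpha> (interval_point 1) ?j = 1" using n icubeD[OF pi, of ?j] by (auto simp: \<alpha>_def)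
    qed
    ultimately show ?thesis by simp
  qed (use up pi i in blast)
qed

lemma higher_trivial:
  assumes f: "cube_loop n X star f" and n: "2 \<le> n"
  shows "(of_cube n star f, of_cube n star (\<lambda>_. star)) \<in> dihomotopy_rel n X star"
proof -
  have n1: "1 \<le> n" using n by simp
  note fm = cube_loop_map[OF f]
  obtain L K where L: "is_lift n f L" and cl: "\<And>p. p \<in> icube n \<Longrightarrow> L p \<in> carrier M"
    and K: "stream_map (dcube (Suc n)) X K" and Kv: "\<And>p s. p \<in> icube n \<Longrightarrow> K (p(n := s)) = contract (L p) s (f p)"
    using contraction_map[OF fm(1) fm(3)[OF n1]] by metis
  have fX: "f p \<in> points X" if "p \<in> icube n" for p using fm(1) that by (auto simp: stream_map_def continuous_map_def)
  have "(of_cube n star (\<lambda>p. shrink_to 0 (f p)), of_cube n star (\<lambda>_. star)) \<in> dihomotopy_rel n X star"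
  proof (rule cube_homotopy_rel[OF stream_X star_in_X K])
    show "K (p(n := t)) = star" if p: "p \<in> boundary n" and t: "0 \<le> t" "t \<le> 1" for p t
      using Kv[OF subsetD[OF boundary_subset p]] boundary_lift[OF f n L cl p] fm(2)[OF p] contract_star_one[OF t] by simp
  qed (use Kv fX cl in \<open>simp_all add: contract_0 contract_1\<close>)
  moreover note shrink_homotopic[OF f]
  moreover have "sym (dihomotopy_rel n X star)" "trans (dihomotopy_rel n X star)"
    using equiv_dihomotopy_rel[of n X star] by (auto simp: equiv_def)
  ultimately show ?thesis by (meson symD transD)
qed

text \<open>Fixing all coordinates at 1 is an arrow that fixes the corner and pulls every cell back
  to a cell of identities.\<close>

lemma pt_ctop: "\<phi> \<in> cells (nerve M) k \<Longrightarrow> pt k \<phi> (ctop k) = star"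
proof -
  assume \<phi>: "\<phi> \<in> cells (nerve M) k"
  note ba = box_arrow_setc[of "{..<k}" k "\<lambda>_. True", OF finite_lessThan]
  let ?f = "restrict (setc k {..<k} (\<lambda>_. True)) (vertices k)"
  have "pt k (act (nerve M) k k ?f \<phi>) (ctop k) = star"
  proof (rule pt_const_cell[OF act_cells[OF ba \<phi>] _ ctop_icube])
    fix u v assume uv: "(u, v) \<in> vertex_pairs k"
    have "?f u = ?f v" using vertex_pairsD(1,2)[OF uv] by (auto simp: setc_def fun_eq_iff)
    then show "act (nerve M) k k ?f \<phi> (u, v) = \<one>"
      using uv nerve_refl[OF \<phi>, of "?f v"] vertex_pairsD(2)[OF uv] by (simp add: act_nerve)
  qed
  moreover have "restrict (setc k {..<k} (\<lambda>i. of_bool True)) (icube k) (ctop k) = ctop k"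
    using ctop_icube[of k] by (auto simp: setc_def ctop_def fun_eq_iff)
  ultimately show "pt k \<phi> (ctop k) = star" using pt_glue[OF ba \<phi> ctop_icube] by simp
qed

lemma connected_trivial:
  assumes f: "cube_loop 0 X star f"
  shows "(of_cube 0 star f, of_cube 0 star (\<lambda>_. star)) \<in> dihomotopy_rel 0 X star"
proof -
  let ?u = "\<lambda>_::nat. undefined :: real"
  have "f ?u \<in> points X" using cube_loop_map(1)[OF f] by (auto simp: stream_map_def continuous_map_def icube_0)
  then obtain k \<phi> x where C: "f ?u = pt k \<phi> x" and \<phi>: "\<phi> \<in> cells (nerve M) k" and x: "x \<in> icube k" by (rule X_cases)
  define \<alpha> where "\<alpha> q = (\<lambda>i\<in>{..<k}. max (x i) (q 0))" for q :: "nat \<Rightarrow> real"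
  have "stream_map (dcube (Suc 0)) X (\<lambda>q. pt k \<phi> (\<alpha> q))"
  proof (rule stream_map_dcube_compose'[OF stream_X stream_map_pt[OF \<phi>]])
    show "\<alpha> \<in> icube (Suc 0) \<rightarrow> icube k"
      unfolding \<alpha>_def using icubeD[OF x] icubeD[of _ "Suc 0" 0] by (auto intro!: icube_restrict simp: max_def)
  qed (auto simp: cle_def near_def \<alpha>_def max_def)
  then show ?thesis
  proof (rule cube_homotopy_rel[OF stream_X star_in_X])
    have "\<alpha> (p(0 := 0)) = x" "\<alpha> (p(0 := 1)) = ctop k" for p
      using icubeD[OF x] icube_undef[OF x] by (auto simp: \<alpha>_def ctop_def fun_eq_iff)
    then show "pt k \<phi> (\<alpha> (p(0 := 0))) = f p" "pt k \<phi> (\<alpha> (p(0 := 1))) = star" if "p \<in> icube 0" for p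
      using that C pt_ctop[OF \<phi>] by (simp_all add: icube_0)
  qed (simp add: boundary_def)
qed

text \<open>In the contraction square the sides at time 0, time 1, start and end are the stretched
  loop, \<open>star\<close>, the edge of the holonomy, and \<open>star\<close>. Both the stretched
  loop and the edge deform upwards to the diagonal, so only the generated equivalence relates the
  two.\<close>

lemma homotopic_edge:
  assumes f: "cube_loop 1 X star f"
  shows "(of_cube 1 star f, of_cube 1 star (edge (holonomy f))) \<in> dihomotopy_rel 1 X star" "holonomy f \<in> carrier M"
proof -
  note fm = cube_loop_map(1)[OF f] cube_loop_map(2)[OF f] cube_loop_map(3)[OF f order_refl]
  obtain L K where L: "is_lift 1 f L" and cl: "\<And>p. p \<in> icube 1 \<Longrightarrow> L p \<in> carrier M"
    and K: "stream_map (dcube (Suc 1)) X K" and Kv: "\<And>p s. p \<in> icube 1 \<Longrightarrow> K (p(1 := s)) = contract (L p) s (f p)"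
    using contraction_map[OF fm(1) fm(3)] by metis
  show "holonomy f \<in> carrier M" by (rule holonomy_lift(2)[OF fm(1,3) L cl])
  have fX: "f p \<in> points X" if "p \<in> icube 1" for p using fm(1) that by (auto simp: stream_map_def continuous_map_def)
  have L0: "L (interval_point 0) = holonomy f" using holonomy_lift(1)[OF fm(1,3) L cl] by simp
  have L1: "L (interval_point 1) = \<one>" using L by (simp add: is_lift_def ctop_1)
  have f01: "f (interval_point 0) = star" "f (interval_point 1) = star" using fm(2) by (simp_all add: boundary_1)
  have two: "i < 2 \<longleftrightarrow> i = 0 \<or> i = 1" for i :: nat by auto
  define A where "A s t = (interval_point s)(1 := t)" for s t
  have A: "A s t \<in> icube (Suc 1)" if "0 \<le> s" "s \<le> 1" "0 \<le> t" "t \<le> 1" for s t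
    unfolding A_def using that by (intro icube_upd) simp_all
  have A_nth: "A s t 0 = s" "A s t 1 = t" for s t by (simp_all add: A_def)
  have KA: "K (A s t) = contract (L (interval_point s)) t (f (interval_point s))" if "0 \<le> s" "s \<le> 1" for s t
    unfolding A_def using that by (intro Kv) simp
  have K0: "K (A s 0) = shrink_to 0 (f (interval_point s))" and K1: "K (A s 1) = star" if "0 \<le> s" "s \<le> 1" for s
    using KA[OF that] that cl fX by (simp_all add: contract_0 contract_1)
  have q01: "0 \<le> q 0 \<and> q 0 \<le> 1 \<and> 0 \<le> q 1 \<and> q 1 \<le> 1" if "q \<in> icube (Suc 1)" for q
    using icubeD[OF that, of 0] icubeD[OF that, of 1] by auto
  have u: "(interval_point s)(1 := t) = A s t" for s t by (simp add: A_def)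
  have mn: "\<bar>min v w - min v' w'\<bar> < r" if "\<bar>v - v'\<bar> < r" "\<bar>w - w'\<bar> < r" for v w v' w' r :: real
    using that by (auto simp: min_def abs_less_iff)
  \<comment> \<open>The second coordinate bounds the time: at 0 this is the side at time 0, at 1 the
    diagonal.\<close>
  have m1: "stream_map (dcube (Suc 1)) X (\<lambda>q. K (A (q 0) (min (q 0) (q 1))))"
    by (rule stream_map_dcube_compose'[OF stream_X K])
       (use A q01 in \<open>auto simp: cle_def near_def two A_nth mn min_le_iff_disj\<close>)
  \<comment> \<open>Here the bound applies to the point of the loop: at 0 this is the initial side,
    at 1 the diagonal.\<close>
  have m2: "stream_map (dcube (Suc 1)) X (\<lambda>q. K (A (min (q 0) (q 1)) (q 0)))"
    by (rule stream_map_dcube_compose'[OF stream_X K])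
       (use A q01 in \<open>auto simp: cle_def near_def two A_nth mn min_le_iff_disj\<close>)
  have b: "p = interval_point 0 \<or> p = interval_point 1" if "p \<in> boundary 1" for p using that by (simp add: boundary_1)
  let ?diag = "\<lambda>p. K (A (p 0) (p 0))"
  have "(of_cube 1 star (\<lambda>p. shrink_to 0 (f p)), of_cube 1 star ?diag) \<in> dihomotopy_rel 1 X star"
  proof (rule cube_homotopy_rel[OF stream_X star_in_X m1])
    fix p and t :: real assume "p \<in> boundary 1" "0 \<le> t" "t \<le> 1"
    then show "K (A ((p(1 := t)) 0) (min ((p(1 := t)) 0) ((p(1 := t)) 1))) = star"
      using b[of p] K0[of 0] KA[of 1 t] L1 f01 by (auto simp: shrink_to_star contract_star_one)
  qed (auto simp: icube_1 K0)
  moreover have "(of_cube 1 star (edge (holonomy f)), of_cube 1 star ?diag) \<in> dihomotopy_rel 1 X star"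
  proof (rule cube_homotopy_rel[OF stream_X star_in_X m2])
    fix p and t :: real assume "p \<in> boundary 1" "0 \<le> t" "t \<le> 1"
    then show "K (A (min ((p(1 := t)) 0) ((p(1 := t)) 1)) ((p(1 := t)) 0)) = star"
      using b[of p] K0[of 0] K1[of t] f01 by (auto simp: shrink_to_star)
  qed (auto simp: icube_1 KA L0 f01 edge_def)
  moreover note shrink_homotopic[OF f]
  moreover have "sym (dihomotopy_rel 1 X star)" "trans (dihomotopy_rel 1 X star)"
    using equiv_dihomotopy_rel[of 1 X star] by (auto simp: equiv_def)
  ultimately show "(of_cube 1 star f, of_cube 1 star (edge (holonomy f))) \<in> dihomotopy_rel 1 X star" by (meson symD transD)
qed

section \<open>Holonomy as a complete invariant of homotopy classes\<close>

definition loop_holonomy where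
  "loop_holonomy f = holonomy (\<lambda>p. f (to_sphere 1 p))"

lemma loop_holonomy_of_cube: "cube_loop 1 X star k \<Longrightarrow> loop_holonomy (of_cube 1 star k) = holonomy k"
  unfolding loop_holonomy_def by (rule holonomy_cong) (simp add: of_cube_to_sphere cube_loop_def)

lemma loop_holonomy_closed: "f \<in> loops 1 X star \<Longrightarrow> loop_holonomy f \<in> carrier M"
  unfolding loop_holonomy_def by (rule homotopic_edge(2)[OF loops_cube(1)])

lemma loop_holonomy_iff:
  assumes f: "f \<in> loops 1 X star" and g: "g \<in> loops 1 X star"
  shows "(f, g) \<in> dihomotopy_rel 1 X star \<longleftrightarrow> loop_holonomy f = loop_holonomy g"
proof
  assume "(f, g) \<in> dihomotopy_rel 1 X star"
  then show "loop_holonomy f = loop_holonomy g"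
  proof (rule dihomotopy_rel_invariant[rotated])
    fix f g assume "dihomotopic 1 X star f g"
    then obtain K where K: "stream_map (dcube (Suc 1)) X K"
      "\<And>p. p \<in> icube 1 \<Longrightarrow> K (p(1 := 0)) = f (to_sphere 1 p)"
      "\<And>p. p \<in> icube 1 \<Longrightarrow> K (p(1 := 1)) = g (to_sphere 1 p)"
      "\<And>p t. p \<in> boundary 1 \<Longrightarrow> 0 \<le> t \<Longrightarrow> t \<le> 1 \<Longrightarrow> K (p(1 := t)) = star"
      by (rule dihomotopic_cube[OF stream_X]) blast
    have "holonomy (\<lambda>p. K (p(1 := 0))) = holonomy (\<lambda>p. K (p(1 := 1)))"
    proof (rule holonomy_homotopy)
      show "stream_map (dcube 2) X K" using K(1) by simp
    qed (rule K(4))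
    moreover have "holonomy (\<lambda>p. K (p(1 := 0))) = loop_holonomy f" "holonomy (\<lambda>p. K (p(1 := 1))) = loop_holonomy g"
      unfolding loop_holonomy_def by (rule holonomy_cong, erule K(2), rule holonomy_cong, erule K(3))
    ultimately show "loop_holonomy f = loop_holonomy g" by simp
  qed
next
  assume eq: "loop_holonomy f = loop_holonomy g"
  have 1: "(f, of_cube 1 star (edge (loop_holonomy f))) \<in> dihomotopy_rel 1 X star"
    "(g, of_cube 1 star (edge (loop_holonomy g))) \<in> dihomotopy_rel 1 X star"
    using homotopic_edge(1)[OF loops_cube(1)[OF f]] homotopic_edge(1)[OF loops_cube(1)[OF g]]
    by (simp_all add: loops_cube(2)[OF f] loops_cube(2)[OF g] loop_holonomy_def)
  have "sym (dihomotopy_rel 1 X star)" "trans (dihomotopy_rel 1 X star)"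
    using equiv_dihomotopy_rel[of 1 X star] by (auto simp: equiv_def)
  from transD[OF this(2) 1(1)[unfolded eq] symD[OF this(1) 1(2)]] show "(f, g) \<in> dihomotopy_rel 1 X star" .
qed

lemma loop_holonomy_mult:
  assumes f: "f \<in> loops 1 X star" and g: "g \<in> loops 1 X star"
  shows "loop_holonomy (loop_mult 1 f g) = loop_holonomy f \<otimes> loop_holonomy g"
proof -
  note fc = loops_cube(1)[OF f] and gc = loops_cube(1)[OF g]
  show ?thesis
    unfolding loop_mult_eq_of_cube[OF f g order_refl] loop_holonomy_of_cube[OF cube_loop_concat[OF stream_X fc gc order_refl]]
      loop_holonomy_def[of f] loop_holonomy_def[of g] by (rule holonomy_concat[OF fc gc])
qed

definition class_holonomy where
  "class_holonomy a = (THE m. \<exists>f\<in>a. loop_holonomy f = m)"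

lemma class_holonomy_eq: "f \<in> loops 1 X star \<Longrightarrow> class_holonomy (dihomotopy_rel 1 X star `` {f}) = loop_holonomy f"
proof -
  assume f: "f \<in> loops 1 X star"
  have g: "loop_holonomy g = loop_holonomy f" if "g \<in> dihomotopy_rel 1 X star `` {f}" for g
  proof -
    have "(f, g) \<in> dihomotopy_rel 1 X star" using that by blast
    moreover from this have "g \<in> loops 1 X star" using equiv_dihomotopy_rel[of 1 X star] by (auto simp: equiv_def)
    ultimately show ?thesis using loop_holonomy_iff[OF f] by simp
  qed
  moreover have "f \<in> dihomotopy_rel 1 X star `` {f}" by (rule equiv_class_self[OF equiv_dihomotopy_rel f])
  ultimately show ?thesis unfolding class_holonomy_def by (intro the_equality) blast+
qed

end

subsection \<open>Naturality\<close>

locale nerve_hom = M: nerve_space M + N: nerve_space N for M N :: "'a monoid" +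
  fixes h
  assumes hom: "h \<in> hom M N" and hom_one: "h \<one>\<^bsub>M\<^esub> = \<one>\<^bsub>N\<^esub>"
begin

lemma hom_closed: "x \<in> carrier M \<Longrightarrow> h x \<in> carrier N"
  and hom_mult: "x \<in> carrier M \<Longrightarrow> y \<in> carrier M \<Longrightarrow> h (x \<otimes>\<^bsub>M\<^esub> y) = h x \<otimes>\<^bsub>N\<^esub> h y"
  using hom by (auto simp: hom_def)

lemma nerve_map_apply: "(u, v) \<in> vertex_pairs k \<Longrightarrow> nerve_map h k \<phi> (u, v) = h (\<phi> (u, v))"
  by (simp add: nerve_map_def compose_def)

lemma nerve_map_cell:
  assumes \<phi>: "\<phi> \<in> cells (nerve M) k"
  shows "nerve_map h k \<phi> \<in> cells (nerve N) k"
proof (rule N.nerve_cellI)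
  fix u v w assume uv: "(u, v) \<in> vertex_pairs k" "(v, w) \<in> vertex_pairs k"
  show "nerve_map h k \<phi> (u, w) = nerve_map h k \<phi> (u, v) \<otimes>\<^bsub>N\<^esub> nerve_map h k \<phi> (v, w)"
    using uv vertex_pairs_trans[OF uv] M.nerve_closed[OF \<phi>] M.nerve_comp[OF \<phi> uv]
    by (simp add: nerve_map_apply hom_mult)
qed (use M.nerve_closed[OF \<phi>] M.nerve_refl[OF \<phi>] in
  \<open>auto simp: nerve_map_apply hom_closed hom_one vertex_pairs_refl nerve_map_def compose_def\<close>)

definition rmap where "rmap = realization_map (nerve M) (nerve N) (nerve_map h)"

text \<open>\<open>realization_map\<close> collects the classes of the images of all
  representatives; applying a homomorphism commutes with pulling back cells, so these classes
  coincide.\<close>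

lemma rmap_pt:
  assumes \<phi>: "\<phi> \<in> cells (nerve M) k" and x: "x \<in> icube k"
  shows "rmap (M.pt k \<phi> x) = N.pt k (nerve_map h k \<phi>) x"
proof -
  let ?Q = "\<lambda>((k, \<phi>), x). N.pt k (nerve_map h k \<phi>) x"
  have nat: "?Q ((m, act (nerve M) m n f \<psi>), y) = ?Q ((n, \<psi>), F y)"
    if ba: "box_arrow m n f F" and \<psi>: "\<psi> \<in> cells (nerve M) n" and y: "y \<in> icube m" for m n f F \<psi> y
  proof -
    have "nerve_map h m (act (nerve M) m n f \<psi>) = act (nerve N) m n f (nerve_map h n \<psi>)"
    proof
      fix z :: "(nat \<Rightarrow> bool) \<times> (nat \<Rightarrow> bool)"
      obtain u v where z: "z = (u, v)" by (cases z)
      show "nerve_map h m (act (nerve M) m n f \<psi>) z = act (nerve N) m n f (nerve_map h n \<psi>) z"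
      proof (cases "(u, v) \<in> vertex_pairs m")
        case True
        then show ?thesis
          using box_arrow_vertices(2)[OF ba True] by (simp add: z M.act_nerve N.act_nerve nerve_map_apply)
      qed (simp add: z N.act_nerve_undef nerve_map_def compose_def)
    qed
    then show ?thesis using N.pt_glue[OF ba nerve_map_cell[OF \<psi>] y] by simp
  qed
  have "ditop_equiv (cell_sum (nerve N)) (cell_glue (nerve N)) `` ((\<lambda>((n, c), x). ((n, nerve_map h n c), x)) ` M.pt k \<phi> x) =
      (\<Union>z\<in>M.pt k \<phi> x. ?Q z)"
    unfolding N.ditop_equiv_nerve N.pt_def by (auto simp: case_prod_beta)
  also have "\<dots> = ?Q ((k, \<phi>), x)"
  proof -
    have "?Q z = ?Q ((k, \<phi>), x)" if "z \<in> M.pt k \<phi> x" for z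
    proof -
      have "(((k, \<phi>), x), z) \<in> cell_equiv (nerve M)" using that by (simp add: M.pt_def)
      then have "?Q ((k, \<phi>), x) = ?Q z"
        by (rule cell_equiv_invariant[where Q = ?Q, OF _ cubical_set_nerve]) (rule nat)
      then show ?thesis by simp
    qed
    moreover have "((k, \<phi>), x) \<in> M.pt k \<phi> x"
      unfolding M.pt_def using assms by (intro equiv_class_self[OF M.equiv_nerve]) (simp add: points_cell_sum)
    ultimately show ?thesis by (intro equalityI) blast+
  qed
  finally show ?thesis using M.pt_in_X[OF \<phi> x] by (simp add: rmap_def realization_map_def)
qed

lemma rmap_star: "rmap M.star = N.star"
  using rmap_pt[OF M.nerve_vertex_cell M.undefined_icube_0] N.cell_0_eq[OF nerve_map_cell[OF M.nerve_vertex_cell]]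
  by (simp add: M.star_eq N.star_eq)

lemma stream_map_rmap: "stream_map M.X N.X rmap"
  unfolding M.X_eq
proof (rule stream_map_from_quotient[OF stream_cell_sum M.equiv_nerve N.stream_X])
  show "stream_map (cell_sum (nerve M)) N.X (\<lambda>z. rmap (cell_equiv (nerve M) `` {z}))"
    unfolding cell_sum_def
  proof (rule stream_map_from_sum)
    fix i assume i: "i \<in> Sigma UNIV (cells (nerve M))"
    obtain k \<phi> where k: "i = (k, \<phi>)" "\<phi> \<in> cells (nerve M) k" using i by auto
    have "stream_map (dcube k) N.X (\<lambda>x. rmap (M.pt k \<phi> x))"
      by (rule stream_map_cong[OF N.stream_map_pt[OF nerve_map_cell[OF k(2)]]]) (simp_all add: rmap_pt[OF k(2)] stream_dcube)
    then show "stream_map (case i of (n, c) \<Rightarrow> dcube n) N.X (\<lambda>x. rmap (cell_equiv (nerve M) `` {(i, x)}))"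
      by (simp add: k(1) M.pt_def)
  qed
qed

lemma rmap_regular:
  assumes l: "M.level a e" and C: "C \<in> M.regular a e"
  shows "N.level a e" "rmap C \<in> N.regular a e"
proof -
  show l': "N.level a e" using l by (simp add: M.level_def N.level_def)
  obtain k \<phi> x where k: "C = M.pt k \<phi> x" "\<phi> \<in> cells (nerve M) k" "x \<in> icube k"
    using M.X_cases M.regular_subset C by blast
  show "rmap C \<in> N.regular a e"
    using C unfolding k(1) rmap_pt[OF k(2,3)] M.pt_in_regular[OF l k(2,3)] N.pt_in_regular[OF l' nerve_map_cell[OF k(2)] k(3)]
    by (simp add: nerve_map_apply hom_one)
qed

lemma rmap_chain:
  assumes "M.chain U C \<mu> D" and UV: "\<And>C. C \<in> U \<Longrightarrow> rmap C \<in> V"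
  shows "N.chain V (rmap C) (\<lambda>b. h (\<mu> b)) (rmap D)"
  using assms(1)
proof (induction rule: M.chain.induct)
  case (nil C)
  then show ?case using N.chain.nil UV by (simp add: hom_one)
next
  case (step \<phi> k x y \<mu> D)
  have "N.pt k (nerve_map h k \<phi>) z \<in> V" if "z \<in> cbetween k x y" for z
    using UV[OF step.hyps(5)[OF that]] that by (simp add: rmap_pt[OF step.hyps(1)] cbetween_def)
  from N.chain.step[OF nerve_map_cell[OF step.hyps(1)] step.hyps(2-4) this step.IH[unfolded rmap_pt[OF step.hyps(1,3)]]]
  show ?case
    using M.nerve_closed[OF step.hyps(1) M.thr_mono[OF step.hyps(4)]] M.chain_closed[OF step.hyps(6)]
    by (simp add: rmap_pt[OF step.hyps(1,2)] hom_mult nerve_map_apply[OF M.thr_mono[OF step.hyps(4)]])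
qed

text \<open>A unital homomorphism preserves identities and products, so regular sets map into
  regular sets and chains to chains with image labels; the same step length works.\<close>

lemma rmap_lift:
  assumes L: "M.is_lift n f L" and cl: "\<And>p. p \<in> icube n \<Longrightarrow> L p \<in> carrier M"
  shows "N.is_lift n (\<lambda>p. rmap (f p)) (\<lambda>p. h (L p))"
proof -
  obtain d where d: "0 < d" "\<And>p q. p \<in> icube n \<Longrightarrow> q \<in> icube n \<Longrightarrow> cle n p q \<Longrightarrow> near n d p q \<Longrightarrow>
     \<exists>a e s. M.level a e \<and> (\<forall>z\<in>cbetween n p q. f z \<in> M.regular a e) \<and> M.chain (M.regular a e) (f p) s (f q) \<and>
        L p = s (1 / 2) \<otimes>\<^bsub>M\<^esub> L q" using L unfolding M.is_lift_def by (elim conjE) (rule M.lift_stepsE, assumption, blast)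
  have "N.lift_steps n (\<lambda>p. rmap (f p)) (\<lambda>p. h (L p))"
    unfolding N.lift_steps_def
  proof (rule exI[of _ d], intro conjI ballI impI d(1))
    fix p q assume p: "p \<in> icube n" and q: "q \<in> icube n" and pq: "cle n p q \<and> near n d p q"
    obtain a e s where *: "M.level a e" "\<forall>z\<in>cbetween n p q. f z \<in> M.regular a e"
      "M.chain (M.regular a e) (f p) s (f q)" "L p = s (1 / 2) \<otimes>\<^bsub>M\<^esub> L q" using d(2)[OF p q] pq by blast
    have "f p \<in> M.regular a e" using M.chain_ends[OF *(3)] by simp
    note l = rmap_regular(1)[OF *(1) this]
    have "h (L p) = h (s (1 / 2)) \<otimes>\<^bsub>N\<^esub> h (L q)"
      using *(4) M.chain_closed[OF *(3)] cl[OF q] by (simp add: hom_mult)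
    then show "\<exists>a e s. N.level a e \<and> (\<forall>z\<in>cbetween n p q. rmap (f z) \<in> N.regular a e) \<and>
        N.chain (N.regular a e) (rmap (f p)) s (rmap (f q)) \<and> h (L p) = s (1 / 2) \<otimes>\<^bsub>N\<^esub> h (L q)"
      using l rmap_regular(2)[OF *(1)] *(2) rmap_chain[OF *(3) rmap_regular(2)[OF *(1)]]
      by (intro exI[of _ a] exI[of _ e] exI[of _ "\<lambda>b. h (s b)"]) simp
  qed
  then show ?thesis using L by (simp add: N.is_lift_def M.is_lift_def hom_one)
qed

lemma rmap_holonomy:
  assumes f: "stream_map (dcube 1) M.X f" and ftop: "f (ctop 1) = M.star"
  shows "N.holonomy (\<lambda>p. rmap (f p)) = h (M.holonomy f)"
proof -
  obtain L where L: "M.is_lift 1 f L" "\<And>p. p \<in> icube 1 \<Longrightarrow> L p \<in> carrier M" using M.lift_of_map[OF f ftop] by metis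
  have top: "rmap (f (ctop 1)) = N.star" using ftop rmap_star by simp
  show ?thesis
    using N.holonomy_lift(1)[OF stream_map_compose[OF f stream_map_rmap] top rmap_lift[OF L] hom_closed[OF L(2)]]
      M.holonomy_lift(1)[OF f ftop L] by simp
qed

lemma rmap_loop:
  assumes f: "f \<in> loops 1 M.X M.star"
  shows "compose (points (dsphere 1)) rmap f \<in> loops 1 N.X N.star"
    "N.loop_holonomy (compose (points (dsphere 1)) rmap f) = h (M.loop_holonomy f)"
proof -
  have sf: "stream_map (dsphere 1) M.X f" "f (sphere_infty 1) = M.star" using f by (auto simp: loops_def)
  have "stream_map (dsphere 1) N.X (compose (points (dsphere 1)) rmap f)"
    by (rule stream_map_cong[OF stream_map_compose[OF sf(1) stream_map_rmap]]) (simp_all add: compose_def stream_dsphere)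
  then show "compose (points (dsphere 1)) rmap f \<in> loops 1 N.X N.star"
    using sf(2) by (simp add: loops_def compose_def rmap_star)
  have "N.loop_holonomy (compose (points (dsphere 1)) rmap f) = N.holonomy (\<lambda>p. rmap (f (to_sphere 1 p)))"
    unfolding N.loop_holonomy_def by (rule N.holonomy_cong) (simp add: compose_def)
  also have "\<dots> = h (M.loop_holonomy f)"
    unfolding M.loop_holonomy_def
    by (rule rmap_holonomy) (rule M.cube_loop_map(1)[OF loops_cube(1)[OF f]], rule M.cube_loop_map(3)[OF loops_cube(1)[OF f] order_refl])
  finally show "N.loop_holonomy (compose (points (dsphere 1)) rmap f) = h (M.loop_holonomy f)" .
qed

lemma class_holonomy_natural:
  assumes "a \<in> carrier (tau_nerve 1 M)"
  shows "N.class_holonomy (tau_nerve_map 1 M N h a) = h (M.class_holonomy a)"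
proof -
  define DM DN c where "DM = dihomotopy_rel 1 M.X M.star" and "DN = dihomotopy_rel 1 N.X N.star"
    and "c = compose (points (dsphere 1)) rmap"
  have EM: "equiv (loops 1 M.X M.star) DM" and EN: "equiv (loops 1 N.X N.star) DN"
    unfolding DM_def DN_def by (rule equiv_dihomotopy_rel)+
  obtain f where f: "f \<in> loops 1 M.X M.star" "a = DM `` {f}"
    using assms by (auto simp: tau_def DM_def elim: quotientE)
  note cf = rmap_loop[OF f(1), folded c_def]
  have g: "(c f, c g) \<in> DN" if "g \<in> a" for g
  proof -
    have fg: "(f, g) \<in> DM" using that f(2) by simp
    then have g: "g \<in> loops 1 M.X M.star" using EM by (auto simp: equiv_def)
    have "M.loop_holonomy f = M.loop_holonomy g" using fg M.loop_holonomy_iff[OF f(1) g] by (simp add: DM_def)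
    then show ?thesis
      using N.loop_holonomy_iff[OF cf(1)] rmap_loop[OF g, folded c_def] cf(2) by (simp add: DN_def)
  qed
  have "DN `` (c ` a) = DN `` {c f}"
  proof (intro equalityI subsetI)
    fix w assume "w \<in> DN `` (c ` a)"
    then obtain g where "g \<in> a" "(c g, w) \<in> DN" by blast
    then show "w \<in> DN `` {c f}" using g EN by (auto simp: equiv_def dest: transD)
  next
    fix w assume "w \<in> DN `` {c f}"
    moreover have "f \<in> a" using equiv_class_self[OF EM f(1)] f(2) by simp
    ultimately show "w \<in> DN `` (c ` a)" by blast
  qed
  then have "tau_nerve_map 1 M N h a = DN `` {c f}"
    using assms unfolding tau_map_def rmap_def[symmetric] c_def[symmetric] DN_def[symmetric] by simp
  then show ?thesis using N.class_holonomy_eq[OF cf(1)] M.class_holonomy_eq[OF f(1)] cf(2) f(2) by (simp add: DM_def DN_def)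
qed

end

context nerve_space
begin

text \<open>That multiplication is well defined on classes follows from completeness and
  multiplicativity of the holonomy, so homotopies need not be concatenated.\<close>

lemma tau_mult:
  assumes f: "f \<in> loops 1 X star" and g: "g \<in> loops 1 X star"
  defines "D \<equiv> dihomotopy_rel 1 X star"
  shows "D `` {f} \<otimes>\<^bsub>tau_nerve 1 M\<^esub> D `` {g} = D `` {loop_mult 1 f g}"
proof -
  have E: "equiv (loops 1 X star) D" unfolding D_def by (rule equiv_dihomotopy_rel)
  have cl: "D `` {loop_mult 1 f' g'} = D `` {loop_mult 1 f g}" if "f' \<in> D `` {f}" "g' \<in> D `` {g}" for f' g'
  proof -
    have l: "f' \<in> loops 1 X star" "g' \<in> loops 1 X star" using that E by (auto simp: equiv_def)
    have "loop_holonomy f = loop_holonomy f'" "loop_holonomy g = loop_holonomy g'"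
      using that loop_holonomy_iff[OF f l(1)] loop_holonomy_iff[OF g l(2)] by (auto simp: D_def)
    then have "(loop_mult 1 f' g', loop_mult 1 f g) \<in> D"
      using loop_holonomy_iff[OF loop_mult_loops[OF stream_X star_in_X l order_refl] loop_mult_loops[OF stream_X star_in_X f g order_refl]]
      by (simp add: loop_holonomy_mult f g l D_def)
    then show ?thesis by (rule equiv_class_eq[OF E])
  qed
  have fg: "f \<in> D `` {f}" "g \<in> D `` {g}" by (rule equiv_class_self[OF E f], rule equiv_class_self[OF E g])
  have "(\<Union>f'\<in>D `` {f}. \<Union>g'\<in>D `` {g}. D `` {loop_mult 1 f' g'}) = D `` {loop_mult 1 f g}"
  proof (intro equalityI subsetI)
    fix w assume "w \<in> (\<Union>f'\<in>D `` {f}. \<Union>g'\<in>D `` {g}. D `` {loop_mult 1 f' g'})"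
    then show "w \<in> D `` {loop_mult 1 f g}" by (elim UN_E) (simp only: cl)
  qed (intro UN_I[OF fg(1)] UN_I[OF fg(2)])
  then show ?thesis by (simp add: tau_def D_def)
qed

text \<open>Associativity and the unit laws are transferred from \<open>M\<close> through the
  injective multiplicative map, in place of reparametrization homotopies.\<close>

lemma tau_1:
  shows "monoid (tau_nerve 1 M)" "class_holonomy \<in> iso (tau_nerve 1 M) M"
proof -
  define D T where "D = dihomotopy_rel 1 X star" and "T = tau_nerve 1 M"
  let ?c = "\<lambda>s\<in>points (dsphere 1). star"
  note E = equiv_dihomotopy_rel[of 1 X star, folded D_def]
  note cc = const_loop[OF stream_X star_in_X, of 1]
  have car: "carrier T = loops 1 X star // D" and one: "\<one>\<^bsub>T\<^esub> = D `` {?c}" by (simp_all add: T_def tau_def D_def)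
  have el: "\<exists>f\<in>loops 1 X star. a = D `` {f} \<and> class_holonomy a = loop_holonomy f" if "a \<in> carrier T" for a
    using that class_holonomy_eq unfolding car by (auto simp: D_def elim!: quotientE)
  have inT: "D `` {f} \<in> carrier T" if "f \<in> loops 1 X star" for f unfolding car by (rule quotientI[OF that])
  have cl: "class_holonomy a \<in> carrier M" if "a \<in> carrier T" for a using el[OF that] loop_holonomy_closed by auto
  have inj: "a = b" if ab: "a \<in> carrier T" "b \<in> carrier T" and eq: "class_holonomy a = class_holonomy b" for a b
  proof -
    obtain f g where "f \<in> loops 1 X star" "a = D `` {f}" "class_holonomy a = loop_holonomy f"
      "g \<in> loops 1 X star" "b = D `` {g}" "class_holonomy b = loop_holonomy g" using el[OF ab(1)] el[OF ab(2)] by blast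
    then show ?thesis using loop_holonomy_iff[of f g] eq equiv_class_eq[OF E, of f g] by (simp add: D_def)
  qed
  have mult: "a \<otimes>\<^bsub>T\<^esub> b \<in> carrier T \<and> class_holonomy (a \<otimes>\<^bsub>T\<^esub> b) = class_holonomy a \<otimes> class_holonomy b"
    if ab: "a \<in> carrier T" "b \<in> carrier T" for a b
  proof -
    obtain f g where f: "f \<in> loops 1 X star" "a = D `` {f}" "class_holonomy a = loop_holonomy f"
      and g: "g \<in> loops 1 X star" "b = D `` {g}" "class_holonomy b = loop_holonomy g" using el[OF ab(1)] el[OF ab(2)] by blast
    note l = loop_mult_loops[OF stream_X star_in_X f(1) g(1) order_refl]
    have "a \<otimes>\<^bsub>T\<^esub> b = D `` {loop_mult 1 f g}" unfolding f(2) g(2) T_def D_def by (rule tau_mult[OF f(1) g(1)])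
    then show ?thesis
      using inT[OF l] class_holonomy_eq[OF l, folded D_def] loop_holonomy_mult[OF f(1) g(1)] f(3) g(3) by simp
  qed
  have "loop_holonomy ?c = holonomy (\<lambda>_. star)" unfolding loop_holonomy_def by (rule holonomy_cong) simp
  then have h1: "\<one>\<^bsub>T\<^esub> \<in> carrier T" "class_holonomy \<one>\<^bsub>T\<^esub> = \<one>"
    unfolding one using inT[OF cc(3)] class_holonomy_eq[OF cc(3), folded D_def] by (simp_all add: holonomy_const)
  have "monoid T"
  proof (rule monoidI)
    fix a b c assume abc: "a \<in> carrier T" "b \<in> carrier T" "c \<in> carrier T"
    show "a \<otimes>\<^bsub>T\<^esub> b \<otimes>\<^bsub>T\<^esub> c = a \<otimes>\<^bsub>T\<^esub> (b \<otimes>\<^bsub>T\<^esub> c)"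
      by (rule inj) (use abc mult cl in \<open>simp_all add: m_assoc\<close>)
  next
    fix a assume "a \<in> carrier T"
    then show "\<one>\<^bsub>T\<^esub> \<otimes>\<^bsub>T\<^esub> a = a" "a \<otimes>\<^bsub>T\<^esub> \<one>\<^bsub>T\<^esub> = a"
      using mult h1 cl by (simp_all add: inj)
  qed (use h1 mult in blast)+
  then show "monoid (tau_nerve 1 M)" by (simp add: T_def)
  have surj: "\<exists>a\<in>carrier T. class_holonomy a = l" if l: "l \<in> carrier M" for l
  proof
    note el = of_cube_loops[OF stream_X star_in_X edge_loop(1)[OF l]]
    show "D `` {of_cube 1 star (edge l)} \<in> carrier T" by (rule inT[OF el])
    show "class_holonomy (D `` {of_cube 1 star (edge l)}) = l"
      using class_holonomy_eq[OF el] loop_holonomy_of_cube[OF edge_loop(1)[OF l]] edge_loop(2)[OF l] by (simp add: D_def)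
  qed
  have "class_holonomy \<in> hom T M" using cl mult by (auto simp: hom_def)
  moreover have "bij_betw class_holonomy (carrier T) (carrier M)"
    unfolding bij_betw_def
  proof
    show "inj_on class_holonomy (carrier T)" using inj by (rule inj_onI)
    show "class_holonomy ` carrier T = carrier M" using cl surj by (intro equalityI subsetI) (force, fast)
  qed
  ultimately show "class_holonomy \<in> iso (tau_nerve 1 M) M" by (simp add: iso_def T_def)
qed

lemma tau_not_1:
  assumes "n \<noteq> 1"
  shows "carrier (tau_nerve n M) = {\<one>\<^bsub>tau_nerve n M\<^esub>}" "1 \<le> n \<Longrightarrow> monoid (tau_nerve n M)"
proof -
  have "(of_cube n star k, of_cube n star (\<lambda>_. star)) \<in> dihomotopy_rel n X star" if "cube_loop n X star k" for k
  proof (cases "n = 0")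
    case False
    then show ?thesis using assms by (intro higher_trivial[OF that]) simp
  qed (use connected_trivial that in blast)
  from tau_trivial[OF stream_X star_in_X this]
  show "carrier (tau_nerve n M) = {\<one>\<^bsub>tau_nerve n M\<^esub>}" "1 \<le> n \<Longrightarrow> monoid (tau_nerve n M)" by simp_all
qed

end

text \<open>The identification in dimension 1 is one family \<open>\<Phi>\<close> for all monoids on
  the type, natural for unital homomorphisms, rather than an unrelated isomorphism for each monoid.
  In the other dimensions the target has one element, so naturality is automatic.\<close>

theorem proposition4p24:
  shows "\<exists>\<Phi>.
    (\<forall>M :: 'a monoid. monoid M \<longrightarrow>
       (\<forall>n\<ge>1. monoid (tau_nerve n M)) \<and>
       (\<forall>n. if n = 1 then \<Phi> M \<in> iso (tau_nerve n M) M
            else carrier (tau_nerve n M) = {\<one>\<^bsub>tau_nerve n M\<^esub>})) \<and>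
    (\<forall>(M :: 'a monoid) (N :: 'a monoid) h.
       monoid M \<and> monoid N \<and> h \<in> hom M N \<and> h \<one>\<^bsub>M\<^esub> = \<one>\<^bsub>N\<^esub> \<longrightarrow>
       (\<forall>a \<in> carrier (tau_nerve 1 M). \<Phi> N (tau_nerve_map 1 M N h a) = h (\<Phi> M a)))"
proof (rule exI[of _ nerve_space.class_holonomy], intro conjI allI impI ballI)
  fix M :: "'a monoid" and n :: nat assume "monoid M"
  then interpret nerve_space M by (rule nerve_space.intro)
  show "monoid (tau_nerve n M)" if "1 \<le> n" using tau_1(1) tau_not_1(2)[OF _ that] by (cases "n = 1") simp_all
  show "if n = 1 then nerve_space.class_holonomy M \<in> iso (tau_nerve n M) M
      else carrier (tau_nerve n M) = {\<one>\<^bsub>tau_nerve n M\<^esub>}"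
    using tau_1(2) tau_not_1(1) by simp
next
  fix M N :: "'a monoid" and h a
  assume *: "monoid M \<and> monoid N \<and> h \<in> hom M N \<and> h \<one>\<^bsub>M\<^esub> = \<one>\<^bsub>N\<^esub>" and a: "a \<in> carrier (tau_nerve 1 M)"
  interpret nerve_hom M N h
    using * by (simp add: nerve_hom_def nerve_hom_axioms_def nerve_space_def)
  show "nerve_space.class_holonomy N (tau_nerve_map 1 M N h a) = h (nerve_space.class_holonomy M a)"
    by (rule class_holonomy_natural[OF a])
qed

end
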